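(* Let $\mathbb{Y}=(Y_t,\,t\in\mathbb{Z})$ be a strictly stationary stochastic process of random elements of $L^2=L^2([0,1])$ with $\mathbb{E}Y_t=0$, which is $L^2$-$m$-approximable and satisfies $\lim_{m\to\infty} m\sqrt{\mathbb{E}\|Y_t-Y_{t,m}\|^2}=0$. Let $w_n(\cdot)$, $n=1,2,\ldots$, be a sequence of data-tapering windows (as defined in the context), and let $X_1^*,\ldots,X_n^*$ be pseudo-observations generated from $\mathbf{Y}_n=\{Y_1,\ldots,Y_n\}$ by the tapered block bootstrap (TBB) with block size $b=b(n)$, where $b^{-1}+bn^{-1/2}=o(1)$ as $n\to\infty$. Put $\overline{Y}_n=n^{-1}\sum_{t=1}^nY_t$ and $\overline{X}_n^*=n^{-1}\sum_{t=1}^nX_t^*$. Then, as $n\to\infty$: (i) $d\big(\mathcal{L}(\sqrt{n}(\overline{X}_n^*-\mathbb{E}^*(\overline{X}_n^* ))\mid \mathbf{Y}_n),\ \mathcal{L}(\sqrt{n}\,\overline{Y}_n)\big)\to 0$ in probability, where $d$ is any metric metrizing weak convergence on $L^2$; (ii) $\big\|n\,\mathbb{E}^*\big[(\overline{X}_n^*-\mathbb{E}^*(\overline{X}_n^* ))\otimes(\overline{X}_n^*-\mathbb{E}^*(\overline{X}_n^* ))\big]-n\,\mathbb{E}\big[\overline{Y}_n\otimes\overline{Y}_n\big]\big\|_{HS}=o_P(1)$.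
   Context: $L^2=L^2([0,1])$ is the separable Hilbert space of square-integrable real-valued functions on $[0,1]$, with $\langle f,g\rangle=\int_0^1 f(\tau)g(\tau)\,d\tau$, $\|f\|^2=\langle f,f\rangle$, and tensor product $f\otimes g(\cdot)=\langle f,\cdot\rangle g$. $\|\cdot\|_{HS}$ is the Hilbert-Schmidt norm, $\|\Psi\|_{HS}^2=\sum_{i}\|\Psi(e_i)\|^2$ for an orthonormal basis $(e_i)$ of $L^2$. $\mathcal{L}(Z)$ denotes the law of the random element $Z$; $\mathcal{L}(\cdot\mid\mathbf{Y}_n)$ and $\mathbb{E}^*$ denote law and expectation conditional on $\mathbf{Y}_n$. $L^2$-$m$-approximability: a process $\{Y_t,t\in\mathbb{Z}\}$ of $L^2$-valued random elements is $L^2$-$m$-approximable if (1) $Y_t=f(\delta_t,\delta_{t-1},\delta_{t-2},\ldots)$ for a measurable function $f:(L^2)^\infty\to L^2$ and a sequence $\{\delta_t,t\in\mathbb{Z}\}$ of i.i.d. random elements of $L^2$; and (2) $\mathbb{E}\|Y_0\|^2<\infty$ and $\sum_{m\ge1}\sqrt{\mathbb{E}\|Y_t-Y_{t,m}\|^2}<\infty$, where $Y_{t,m}=f(\delta_t,\delta_{t-1},\ldots,\delta_{t-m+1},\delta^{(m)}_{t,t-m},\delta^{(m)}_{t,t-m-1},\ldots)$ and the $\delta^{(m)}_{t,k}$ are independent copies of $\delta_0$, independent of each other and of $\{\delta_s\}$. (By stationarity $\mathbb{E}\|Y_t-Y_{t,m}\|^2$ does not depend on $t$.) Data-tapering windows: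 $w_n(\tau)\in[0,1]$, $w_n(\tau)=0$ for $\tau\notin\{1,\ldots,n\}$, and $w_n(\tau)=w\big((\tau-0.5)/n\big)$ for $\tau\in\{1,\ldots,n\}$, where $w:\mathbb{R}\to[0,1]$ satisfies: $w(\tau)=0$ if $\tau\notin[0,1]$; $w(\tau)>0$ for all $\tau$ in a neighbourhood of $1/2$; $w$ is symmetric around $1/2$; $w$ is nondecreasing on $[0,1/2]$. Put $\|w_b\|_2^2=\sum_{i=1}^b w_b(i)^2$. TBB: for simplicity $n=kb$ with $k$ a positive integer, $1\le b<n$; $N=n-b+1$. Let $X_t=Y_t-\overline{Y}_n$, $t=1,\ldots,n$. For $t=1,\ldots,N$ let $\widetilde{B}_t=\big\{w_b(1)\tfrac{b^{1/2}}{\|w_b\|_2}X_t,\,w_b(2)\tfrac{b^{1/2}}{\|w_b\|_2}X_{t+1},\ldots,w_b(b)\tfrac{b^{1/2}}{\|w_b\|_2}X_{t+b-1}\big\}$. Let $I_1,\ldots,I_k$ be i.i.d. uniform on $\{1,\ldots,N\}$ (independent of the data). Let $B_i^*=\widetilde{B}_{I_i}$ and denote its elements, in order, by $X^*_{(i-1)b+1},\ldots,X^*_{ib}$, $i=1,\ldots,k$; joining the blocks in the order $B_1^*,\ldots,B_k^*$ gives $X_1^*,\ldots,X_n^*$. *)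

theory Defs
  imports "HOL-Probability.Probability"
begin

section \<open>The Hilbert space $L^2([0,1])$\<close>

text \<open>
  Elements of \<open>L2\<close> are classes of almost everywhere equal square-integrable functions. Only the
  values on \<open>[0,1]\<close> matter. Borel representatives suffice, since every Lebesgue measurable function
  agrees almost everywhere with a Borel measurable one.
\<close>

abbreviation unit_lborel :: "real measure" where
  "unit_lborel \<equiv> restrict_space lborel {0..1}"

definition sq_integrable :: "(real \<Rightarrow> real) \<Rightarrow> bool" where
  "sq_integrable f \<longleftrightarrow>
     f \<in> borel_measurable unit_lborel \<and> integrable unit_lborel (\<lambda>t. (f t)\<^sup>2)"

definition L2_rel :: "(real \<Rightarrow> real) \<Rightarrow> (real \<Rightarrow> real) \<Rightarrow> bool" where
  "L2_rel f g \<longleftrightarrow> sq_integrable f \<and> sq_integrable g \<and> (AE t in unit_lborel. f t = g t)"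

lemma prob_space_unit: "prob_space unit_lborel"
  by (rule prob_spaceI) (simp add: emeasure_restrict_space space_restrict_space)

lemma sq_integrable_mult:
  assumes "sq_integrable f" "sq_integrable g"
  shows "integrable unit_lborel (\<lambda>t. f t * g t)"
proof -
  have [measurable]: "f \<in> borel_measurable unit_lborel" "g \<in> borel_measurable unit_lborel"
    using assms by (auto simp: sq_integrable_def)
  have "integrable unit_lborel (\<lambda>t. (f t)\<^sup>2 + (g t)\<^sup>2)"
    using assms by (auto simp: sq_integrable_def)
  then show ?thesis
  proof (rule Bochner_Integration.integrable_bound)
    show "AE t in unit_lborel. norm (f t * g t) \<le> norm ((f t)\<^sup>2 + (g t)\<^sup>2)"
    proof (rule AE_I2)
      fix t
      have "2 * \<bar>f t\<bar> * \<bar>g t\<bar> \<le> \<bar>f t\<bar>\<^sup>2 + \<bar>g t\<bar>\<^sup>2" by (rule sum_squares_bound)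
      moreover have "0 \<le> \<bar>f t\<bar> * \<bar>g t\<bar>" by simp
      ultimately have "\<bar>f t\<bar> * \<bar>g t\<bar> \<le> \<bar>f t\<bar>\<^sup>2 + \<bar>g t\<bar>\<^sup>2" by linarith
      then show "norm (f t * g t) \<le> norm ((f t)\<^sup>2 + (g t)\<^sup>2)" by (simp add: abs_mult)
    qed
  qed measurable
qed

lemma sq_integrable_add:
  assumes "sq_integrable f" "sq_integrable g"
  shows "sq_integrable (\<lambda>t. f t + g t)"
proof -
  have [measurable]: "f \<in> borel_measurable unit_lborel" "g \<in> borel_measurable unit_lborel"
    using assms by (auto simp: sq_integrable_def)
  have "integrable unit_lborel (\<lambda>t. (f t)\<^sup>2 + (g t)\<^sup>2 + 2 * (f t * g t))"
    using sq_integrable_mult[OF assms] assms by (auto simp: sq_integrable_def)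
  then show ?thesis by (simp add: sq_integrable_def power2_sum mult.assoc)
qed

lemma sq_integrable_scale: "sq_integrable f \<Longrightarrow> sq_integrable (\<lambda>t. c * f t)"
  by (auto simp: sq_integrable_def power_mult_distrib)

lemma sq_integrable_zero: "sq_integrable (\<lambda>_. 0)"
  by (simp add: sq_integrable_def)

lemma sq_integrable_uminus: "sq_integrable f \<Longrightarrow> sq_integrable (\<lambda>t. - f t)"
  by (simp add: sq_integrable_def)

lemma sq_integrable_diff:
  "sq_integrable f \<Longrightarrow> sq_integrable g \<Longrightarrow> sq_integrable (\<lambda>t. f t - g t)"
  using sq_integrable_add[OF _ sq_integrable_uminus] by fastforce

quotient_type L2 = "real \<Rightarrow> real" / partial: L2_rel
proof (rule part_equivpI)
  show "\<exists>f. L2_rel f f"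
    using sq_integrable_zero by (auto simp: L2_rel_def)
  show "symp L2_rel"
    by (rule sympI) (auto simp: L2_rel_def)
  show "transp L2_rel"
    by (rule transpI) (auto simp: L2_rel_def elim: AE_mp)
qed

instantiation L2 :: real_vector
begin

lift_definition zero_L2 :: L2 is "\<lambda>_. 0"
  by (simp add: L2_rel_def sq_integrable_zero)

lift_definition plus_L2 :: "L2 \<Rightarrow> L2 \<Rightarrow> L2" is "\<lambda>f g t. f t + g t"
  unfolding L2_rel_def by (intro conjI sq_integrable_add) auto

lift_definition uminus_L2 :: "L2 \<Rightarrow> L2" is "\<lambda>f t. - f t"
  unfolding L2_rel_def by (intro conjI sq_integrable_uminus) auto

lift_definition minus_L2 :: "L2 \<Rightarrow> L2 \<Rightarrow> L2" is "\<lambda>f g t. f t - g t"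
  unfolding L2_rel_def by (intro conjI sq_integrable_diff) auto

lift_definition scaleR_L2 :: "real \<Rightarrow> L2 \<Rightarrow> L2" is "\<lambda>c f t. c * f t"
  unfolding L2_rel_def by (intro conjI sq_integrable_scale) auto

instance
  by standard
    (transfer; auto simp: L2_rel_def algebra_simps
      intro!: sq_integrable_add sq_integrable_scale sq_integrable_uminus sq_integrable_diff
        sq_integrable_zero)+

end

instantiation L2 :: real_inner
begin

lift_definition inner_L2 :: "L2 \<Rightarrow> L2 \<Rightarrow> real" is
  "\<lambda>f g. \<integral>t. f t * g t \<partial>unit_lborel"
proof -
  fix f f' g g' assume "L2_rel f f'" "L2_rel g g'"
  then show "(\<integral>t. f t * g t \<partial>unit_lborel) = (\<integral>t. f' t * g' t \<partial>unit_lborel)"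
    by (intro integral_cong_AE borel_measurable_times) (auto simp: L2_rel_def sq_integrable_def)
qed

definition norm_L2 :: "L2 \<Rightarrow> real" where "norm_L2 x = sqrt (inner x x)"

definition sgn_L2 :: "L2 \<Rightarrow> L2" where "sgn_L2 x = x /\<^sub>R norm x"

definition dist_L2 :: "L2 \<Rightarrow> L2 \<Rightarrow> real" where "dist_L2 x y = norm (x - y)"

definition uniformity_L2 :: "(L2 \<times> L2) filter" where
  "uniformity_L2 = (INF e\<in>{0<..}. principal {(x, y). dist x y < e})"

definition open_L2 :: "L2 set \<Rightarrow> bool" where
  "open_L2 S \<longleftrightarrow> (\<forall>x\<in>S. \<forall>\<^sub>F (x', y) in uniformity. x' = x \<longrightarrow> y \<in> S)"

instance
proof
  fix x y z :: L2 and r :: real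
  show "inner x y = inner y x"
    by transfer (simp add: mult.commute)
  show "inner (x + y) z = inner x z + inner y z"
    by transfer (simp add: L2_rel_def distrib_right sq_integrable_mult)
  show "inner (r *\<^sub>R x) y = r * inner x y"
    by transfer (simp add: mult.assoc)
  show "0 \<le> inner x x"
    by transfer simp
  show "inner x x = 0 \<longleftrightarrow> x = 0"
  proof transfer
    fix f assume "L2_rel f f"
    then have f: "sq_integrable f" by (simp add: L2_rel_def)
    have "(\<integral>t. f t * f t \<partial>unit_lborel) = 0 \<longleftrightarrow> (AE t in unit_lborel. f t * f t = 0)"
      by (rule integral_nonneg_eq_0_iff_AE) (auto simp: sq_integrable_mult[OF f f])
    then show "(\<integral>t. f t * f t \<partial>unit_lborel) = 0 \<longleftrightarrow> L2_rel f (\<lambda>_. 0)"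
      using f by (simp add: L2_rel_def sq_integrable_zero)
  qed
qed (simp_all add: norm_L2_def sgn_L2_def dist_L2_def uniformity_L2_def open_L2_def)

end

text \<open>
  Completeness and separability are needed for Bochner integrals of \<open>L2\<close>-valued random elements.
\<close>

lemma rep_L2: "sq_integrable (rep_L2 x)"
  using Quotient3_rep_reflp[OF Quotient3_L2, of x] by (simp add: L2_rel_def)

lemma abs_rep_L2 [simp]: "abs_L2 (rep_L2 x) = x"
  by (rule Quotient3_abs_rep[OF Quotient3_L2])

lemma measurable_rep_L2 [measurable]: "rep_L2 x \<in> borel_measurable unit_lborel"
  using rep_L2[of x] by (simp add: sq_integrable_def)

lemma dist_abs_L2:
  assumes "sq_integrable f" "sq_integrable g"
  shows "(dist (abs_L2 f) (abs_L2 g))\<^sup>2 = (\<integral>t. (f t - g t)\<^sup>2 \<partial>unit_lborel)"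
proof -
  have "L2_rel f f" "L2_rel g g" "L2_rel (\<lambda>t. f t - g t) (\<lambda>t. f t - g t)"
    using assms by (auto simp: L2_rel_def sq_integrable_diff)
  then show ?thesis
    by (simp add: dist_norm power2_norm_eq_inner minus_L2.abs_eq inner_L2.abs_eq)
      (simp add: power2_eq_square)
qed

lemma dist_L2_rep: "(dist x y)\<^sup>2 = (\<integral>t. (rep_L2 x t - rep_L2 y t)\<^sup>2 \<partial>unit_lborel)"
  using dist_abs_L2[OF rep_L2 rep_L2, of x y] by simp

lemma nn_integral_dist_L2:
  assumes "sq_integrable f" "sq_integrable g"
  shows "(\<integral>\<^sup>+t. ennreal ((f t - g t)\<^sup>2) \<partial>unit_lborel) = ennreal ((dist (abs_L2 f) (abs_L2 g))\<^sup>2)"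
  using sq_integrable_diff[OF assms] dist_abs_L2[OF assms]
  by (subst nn_integral_eq_integral) (auto simp: sq_integrable_def)

lemma integrable_L2: "sq_integrable f \<Longrightarrow> integrable unit_lborel f"
proof -
  interpret U: prob_space unit_lborel by (rule prob_space_unit)
  assume "sq_integrable f"
  moreover have "sq_integrable (\<lambda>_. 1)" by (simp add: sq_integrable_def)
  ultimately show ?thesis using sq_integrable_mult by fastforce
qed

lemma L1_le_dist_L2:
  assumes "dist x y < e"
  shows "(\<integral>t. norm (rep_L2 x t - rep_L2 y t) \<partial>unit_lborel) < e"
proof -
  interpret U: prob_space unit_lborel by (rule prob_space_unit)
  let ?h = "\<lambda>t. rep_L2 x t - rep_L2 y t"
  obtain d where d: "dist x y < d" "d < e" using assms dense by blast
  have "0 < d" using d(1) zero_le_dist[of x y] by linarith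
  have h: "sq_integrable ?h" by (intro sq_integrable_diff rep_L2)
  have "(\<integral>t. norm (?h t) \<partial>unit_lborel) \<le> (\<integral>t. ((?h t)\<^sup>2 / d + d) / 2 \<partial>unit_lborel)"
  proof (rule integral_mono)
    show "integrable unit_lborel (\<lambda>t. norm (?h t))"
      using integrable_L2[OF h] by simp
    show "integrable unit_lborel (\<lambda>t. ((?h t)\<^sup>2 / d + d) / 2)"
      using h by (auto simp: sq_integrable_def)
    show "norm (?h t) \<le> ((?h t)\<^sup>2 / d + d) / 2" for t
      using sum_squares_bound[of "\<bar>?h t\<bar>" d] \<open>0 < d\<close>
      by (simp add: field_simps power2_eq_square)
  qed
  also have "\<dots> = ((dist x y)\<^sup>2 / d + d) / 2"
    using h U.prob_space by (simp add: sq_integrable_def dist_L2_rep space_restrict_space)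
  also have "\<dots> \<le> d"
    using power_mono[OF less_imp_le[OF d(1)] zero_le_dist, of 2] \<open>0 < d\<close>
    by (simp add: field_simps power2_eq_square)
  finally show ?thesis using d(2) by linarith
qed

instance L2 :: banach
proof
  fix X :: "nat \<Rightarrow> L2" assume X: "Cauchy X"
  have L1_Cauchy: "\<exists>N. \<forall>i\<ge>N. \<forall>j\<ge>N.
      (\<integral>t. norm (rep_L2 (X i) t - rep_L2 (X j) t) \<partial>unit_lborel) < e" if "e > 0" for e
    using metric_CauchyD[OF X that] L1_le_dist_L2 by blast
  obtain r where r: "strict_mono r"
    and AE_Cauchy: "AE t in unit_lborel. Cauchy (\<lambda>i. rep_L2 (X (r i)) t)"
    using cauchy_L1_AE_cauchy_subseq[of unit_lborel "\<lambda>i. rep_L2 (X i)"]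
      integrable_L2[OF rep_L2] L1_Cauchy
    by blast
  define f where "f t = lim (\<lambda>i. rep_L2 (X (r i)) t)" for t
  have lim: "AE t in unit_lborel. (\<lambda>i. rep_L2 (X (r i)) t) \<longlonglongrightarrow> f t"
    using AE_Cauchy by eventually_elim (simp add: f_def Cauchy_convergent_iff convergent_LIMSEQ_iff)
  have [measurable]: "f \<in> borel_measurable unit_lborel"
    unfolding f_def by measurable
  have bound: "\<exists>N. \<forall>n\<ge>N. (\<integral>\<^sup>+t. ennreal ((f t - rep_L2 (X (r n)) t)\<^sup>2) \<partial>unit_lborel) \<le> ennreal (e\<^sup>2)"
    if "e > 0" for e
  proof -
    obtain N where N: "\<And>i j. i \<ge> N \<Longrightarrow> j \<ge> N \<Longrightarrow> dist (X i) (X j) < e"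
      using metric_CauchyD[OF X \<open>e > 0\<close>] by blast
    have "(\<integral>\<^sup>+t. ennreal ((f t - rep_L2 (X (r n)) t)\<^sup>2) \<partial>unit_lborel) \<le> ennreal (e\<^sup>2)"
      if "n \<ge> N" for n
    proof -
      have "(\<integral>\<^sup>+t. ennreal ((f t - rep_L2 (X (r n)) t)\<^sup>2) \<partial>unit_lborel)
          = (\<integral>\<^sup>+t. liminf (\<lambda>i. ennreal ((rep_L2 (X (r i)) t - rep_L2 (X (r n)) t)\<^sup>2)) \<partial>unit_lborel)"
      proof (rule nn_integral_cong_AE)
        show "AE t in unit_lborel. ennreal ((f t - rep_L2 (X (r n)) t)\<^sup>2)
          = liminf (\<lambda>i. ennreal ((rep_L2 (X (r i)) t - rep_L2 (X (r n)) t)\<^sup>2))"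
          using lim
        proof eventually_elim
          case (elim t)
          then have "(\<lambda>i. ennreal ((rep_L2 (X (r i)) t - rep_L2 (X (r n)) t)\<^sup>2))
            \<longlonglongrightarrow> ennreal ((f t - rep_L2 (X (r n)) t)\<^sup>2)"
            by (intro tendsto_intros)
          from lim_imp_Liminf[OF sequentially_bot this] show ?case by simp
        qed
      qed
      also have "\<dots> \<le> liminf (\<lambda>i. \<integral>\<^sup>+t. ennreal ((rep_L2 (X (r i)) t - rep_L2 (X (r n)) t)\<^sup>2) \<partial>unit_lborel)"
        by (rule nn_integral_liminf) measurable
      also have "\<dots> = liminf (\<lambda>i. ennreal ((dist (X (r i)) (X (r n)))\<^sup>2))"
        by (simp add: nn_integral_dist_L2 rep_L2)
      also have "\<dots> \<le> liminf (\<lambda>i. ennreal (e\<^sup>2))"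
      proof (rule Liminf_mono)
        have "dist (X (r i)) (X (r n)) < e" if "i \<ge> N" for i
          using N[of "r i" "r n"] seq_suble[OF r, of i] seq_suble[OF r, of n] that \<open>n \<ge> N\<close>
          by linarith
        then show "\<forall>\<^sub>F i in sequentially. ennreal ((dist (X (r i)) (X (r n)))\<^sup>2) \<le> ennreal (e\<^sup>2)"
          by (intro eventually_sequentiallyI[of N] ennreal_leI power_mono) (simp_all add: less_imp_le)
      qed
      finally show ?thesis by (simp add: Liminf_const)
    qed
    then show ?thesis by blast
  qed
  have sq_f: "sq_integrable f"
  proof -
    obtain n where n: "(\<integral>\<^sup>+t. ennreal ((f t - rep_L2 (X (r n)) t)\<^sup>2) \<partial>unit_lborel) \<le> ennreal (1\<^sup>2)"
      using bound[of 1] by auto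
    have "sq_integrable (\<lambda>t. f t - rep_L2 (X (r n)) t)"
      unfolding sq_integrable_def
    proof (intro conjI integrableI_bounded)
      show "(\<integral>\<^sup>+t. ennreal (norm ((f t - rep_L2 (X (r n)) t)\<^sup>2)) \<partial>unit_lborel) < \<infinity>"
        using n by (simp add: le_less_trans)
    qed measurable
    from sq_integrable_add[OF this rep_L2[of "X (r n)"]] show ?thesis by simp
  qed
  have "(X \<circ> r) \<longlonglongrightarrow> abs_L2 f"
  proof (rule metric_LIMSEQ_I)
    fix e :: real assume "e > 0"
    then obtain N where N: "\<And>n. n \<ge> N \<Longrightarrow>
      (\<integral>\<^sup>+t. ennreal ((f t - rep_L2 (X (r n)) t)\<^sup>2) \<partial>unit_lborel) \<le> ennreal ((e / 2)\<^sup>2)"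
      using bound[of "e / 2"] by auto
    have "dist ((X \<circ> r) n) (abs_L2 f) < e" if "n \<ge> N" for n
    proof -
      have "ennreal ((dist (abs_L2 f) (X (r n)))\<^sup>2) \<le> ennreal ((e / 2)\<^sup>2)"
        using N[OF that] nn_integral_dist_L2[OF sq_f rep_L2[of "X (r n)"]] by simp
      then have "(dist (abs_L2 f) (X (r n)))\<^sup>2 \<le> (e / 2)\<^sup>2" by (simp add: ennreal_le_iff)
      then have "dist (abs_L2 f) (X (r n)) \<le> e / 2"
        by (rule power2_le_imp_le) (use \<open>e > 0\<close> in simp)
      then show ?thesis using \<open>e > 0\<close> by (simp add: dist_commute)
    qed
    then show "\<exists>N. \<forall>n\<ge>N. dist ((X \<circ> r) n) (abs_L2 f) < e" by blast
  qed
  from Cauchy_converges_subseq[OF X r this] show "convergent X" by (rule convergentI)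
qed

lemma countable_rational_span:
  fixes B :: "'a::real_normed_vector set"
  assumes "countable B"
  shows "\<exists>T. countable T \<and> B \<subseteq> closure T \<and> 0 \<in> closure T \<and>
    (\<forall>x\<in>closure T. \<forall>y\<in>closure T. x + y \<in> closure T) \<and>
    (\<forall>c. \<forall>x\<in>closure T. c *\<^sub>R x \<in> closure T)"
proof -
  define s where "s xs = sum_list (map (\<lambda>(q, b). of_rat q *\<^sub>R b) xs)" for xs :: "(rat \<times> 'a) list"
  define T where "T = s ` lists (UNIV \<times> B)"
  have count: "countable T"
    unfolding T_def using assms by (intro countable_image countable_lists) auto
  have T_add: "x + y \<in> T" if "x \<in> T" "y \<in> T" for x y
  proof -
    obtain xs ys where "xs \<in> lists (UNIV \<times> B)" "ys \<in> lists (UNIV \<times> B)" "x = s xs" "y = s ys"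
      using \<open>x \<in> T\<close> \<open>y \<in> T\<close> by (auto simp: T_def)
    then show ?thesis
      by (auto simp: T_def s_def intro!: image_eqI[of _ _ "xs @ ys"])
  qed
  have s_scale: "s (map (\<lambda>(p, b). (q * p, b)) xs) = of_rat q *\<^sub>R s xs" for q xs
    by (induction xs) (auto simp: s_def of_rat_mult scaleR_add_right)
  have T_scale: "of_rat q *\<^sub>R x \<in> T" if "x \<in> T" for q x
  proof -
    obtain xs where "xs \<in> lists (UNIV \<times> B)" "x = s xs"
      using \<open>x \<in> T\<close> by (auto simp: T_def)
    then show ?thesis
      unfolding T_def by (intro image_eqI[of _ _ "map (\<lambda>(p, b). (q * p, b)) xs"]) (auto simp: s_scale)
  qed
  have B: "B \<subseteq> T"
  proof
    fix b assume "b \<in> B"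
    then show "b \<in> T" unfolding T_def
      by (intro image_eqI[of _ _ "[(1, b)]"]) (auto simp: s_def)
  qed
  have zero: "0 \<in> T" unfolding T_def by (intro image_eqI[of _ _ "[]"]) (auto simp: s_def)
  show ?thesis
  proof (intro exI[of _ T] conjI ballI allI count)
    show "B \<subseteq> closure T" using B closure_subset by blast
    show "0 \<in> closure T" using zero closure_subset by blast
    show "x + y \<in> closure T" if x: "x \<in> closure T" and y: "y \<in> closure T" for x y
    proof -
      from x obtain u where u: "(\<forall>n. u n \<in> T) \<and> u \<longlonglongrightarrow> x"
        unfolding closure_sequential ..
      from y obtain v where v: "(\<forall>n. v n \<in> T) \<and> v \<longlonglongrightarrow> y"
        unfolding closure_sequential ..
      show ?thesis
        unfolding closure_sequential
        by (rule exI[of _ "\<lambda>n. u n + v n"]) (use u v in \<open>simp add: T_add tendsto_add\<close>)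
    qed
    show "c *\<^sub>R x \<in> closure T" if x: "x \<in> closure T" for c x
    proof -
      from x obtain u where u: "(\<forall>n. u n \<in> T) \<and> u \<longlonglongrightarrow> x"
        unfolding closure_sequential ..
      have "c \<in> closure \<rat>" by (simp add: Rats_closure_real)
      then obtain q where q: "(\<forall>n. q n \<in> \<rat>) \<and> q \<longlonglongrightarrow> c"
        unfolding closure_sequential ..
      have "q n *\<^sub>R u n \<in> T" for n
      proof -
        have "q n \<in> \<rat>" using q by simp
        then obtain p where "q n = of_rat p" by (rule Rats_cases)
        then show ?thesis using u T_scale by simp
      qed
      then show ?thesis
        unfolding closure_sequential
        by (intro exI[of _ "\<lambda>n. q n *\<^sub>R u n"]) (use u q in \<open>simp add: tendsto_scaleR\<close>)
    qed
  qed
qed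


abbreviation L2_ind :: "real set \<Rightarrow> L2" where
  "L2_ind A \<equiv> abs_L2 (indicator A)"

lemma sq_integrable_indicator: "A \<in> sets borel \<Longrightarrow> sq_integrable (indicator A)"
proof -
  interpret U: prob_space unit_lborel by (rule prob_space_unit)
  assume [measurable]: "A \<in> sets borel"
  have [measurable]: "(indicator A :: real \<Rightarrow> real) \<in> borel_measurable unit_lborel"
    by (intro measurable_restrict_space1) simp
  have "(\<lambda>t. (indicator A t)\<^sup>2 :: real) = indicator A"
    by (auto simp: indicator_def)
  moreover have "integrable unit_lborel (indicator A :: real \<Rightarrow> real)"
    by (rule U.integrable_const_bound[of _ 1]) simp_all
  ultimately have "integrable unit_lborel (\<lambda>t. (indicator A t)\<^sup>2 :: real)" by simp
  then show ?thesis by (simp add: sq_integrable_def)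
qed

lemma dist_L2_ind:
  assumes "A \<in> sets borel" "B \<in> sets borel"
  shows "(dist (L2_ind A) (L2_ind B))\<^sup>2 = measure unit_lborel (sym_diff A B \<inter> {0..1})"
proof -
  have "(dist (L2_ind A) (L2_ind B))\<^sup>2 = (\<integral>t. (indicator A t - indicator B t)\<^sup>2 \<partial>unit_lborel)"
    by (rule dist_abs_L2) (simp_all add: sq_integrable_indicator assms)
  also have "\<dots> = (\<integral>t. indicator (sym_diff A B \<inter> {0..1}) t \<partial>unit_lborel)"
    by (rule Bochner_Integration.integral_cong) (auto simp: indicator_def space_restrict_space)
  also have "\<dots> = measure unit_lborel (sym_diff A B \<inter> {0..1})"
    using assms by (simp add: space_restrict_space Int_absorb2)
  finally show ?thesis .
qed

lemma add_abs_L2: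
  "sq_integrable f \<Longrightarrow> sq_integrable g \<Longrightarrow> abs_L2 (\<lambda>t. f t + g t) = abs_L2 f + abs_L2 g"
  by (rule sym, rule plus_L2.abs_eq) (auto simp: L2_rel_def)

lemma diff_abs_L2:
  "sq_integrable f \<Longrightarrow> sq_integrable g \<Longrightarrow> abs_L2 (\<lambda>t. f t - g t) = abs_L2 f - abs_L2 g"
  by (rule sym, rule minus_L2.abs_eq) (auto simp: L2_rel_def)

lemma scale_abs_L2: "sq_integrable f \<Longrightarrow> abs_L2 (\<lambda>t. c * f t) = c *\<^sub>R abs_L2 f"
  by (rule sym, rule scaleR_L2.abs_eq) (auto simp: L2_rel_def)

lemma zero_abs_L2: "abs_L2 (\<lambda>_. 0) = 0"
  by (simp add: zero_L2_def)

lemma tendsto_abs_L2: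
  assumes f: "sq_integrable f" and s: "\<And>i. sq_integrable (s i)"
    and lim: "\<And>t. t \<in> {0..1} \<Longrightarrow> (\<lambda>i. s i t) \<longlonglongrightarrow> f t"
    and bound: "\<And>i t. t \<in> {0..1} \<Longrightarrow> \<bar>s i t\<bar> \<le> 2 * \<bar>f t\<bar>"
  shows "(\<lambda>i. abs_L2 (s i)) \<longlonglongrightarrow> abs_L2 f"
proof -
  have [measurable]: "f \<in> borel_measurable unit_lborel" "\<And>i. s i \<in> borel_measurable unit_lborel"
    using f s by (auto simp: sq_integrable_def)
  have "(\<lambda>i. \<integral>t. (s i t - f t)\<^sup>2 \<partial>unit_lborel) \<longlonglongrightarrow> (\<integral>t. 0 \<partial>unit_lborel)"
  proof (rule integral_dominated_convergence[where w="\<lambda>t. 9 * (f t)\<^sup>2"])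
    show "integrable unit_lborel (\<lambda>t. 9 * (f t)\<^sup>2)"
      using f by (simp add: sq_integrable_def)
    show "AE t in unit_lborel. (\<lambda>i. (s i t - f t)\<^sup>2) \<longlonglongrightarrow> 0"
    proof (rule AE_I2)
      fix t assume "t \<in> space unit_lborel"
      then have "(\<lambda>i. s i t) \<longlonglongrightarrow> f t" by (intro lim) (simp add: space_restrict_space)
      from tendsto_power[OF tendsto_diff[OF this tendsto_const[of "f t"]], of 2]
      show "(\<lambda>i. (s i t - f t)\<^sup>2) \<longlonglongrightarrow> 0" by simp
    qed
    show "AE t in unit_lborel. norm ((s i t - f t)\<^sup>2) \<le> 9 * (f t)\<^sup>2" for i
    proof (rule AE_I2)
      fix t assume "t \<in> space unit_lborel"
      then have "\<bar>s i t\<bar> \<le> 2 * \<bar>f t\<bar>" by (intro bound) (simp add: space_restrict_space)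
      then have "\<bar>s i t - f t\<bar> \<le> 3 * \<bar>f t\<bar>" by linarith
      from power_mono[OF this, of 2] show "norm ((s i t - f t)\<^sup>2) \<le> 9 * (f t)\<^sup>2"
        by (simp add: power_mult_distrib)
    qed
  qed measurable
  then have "(\<lambda>i. (dist (abs_L2 (s i)) (abs_L2 f))\<^sup>2) \<longlonglongrightarrow> 0"
    by (simp add: dist_abs_L2 f s)
  from tendsto_real_sqrt[OF this] show ?thesis
    by (simp add: tendsto_dist_iff[of "\<lambda>i. abs_L2 (s i)"])
qed

lemma L2_ind_in_closed_subspace:
  assumes closed: "closed V" and zero: "0 \<in> V"
    and add: "\<And>x y. x \<in> V \<Longrightarrow> y \<in> V \<Longrightarrow> x + y \<in> V"
    and scale: "\<And>c x. x \<in> V \<Longrightarrow> c *\<^sub>R x \<in> V"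
    and gen: "\<And>q. q \<in> \<rat> \<Longrightarrow> L2_ind {..q} \<in> V"
    and A: "A \<in> sets borel"
  shows "L2_ind A \<in> V"
proof -
  have diff: "x - y \<in> V" if "x \<in> V" "y \<in> V" for x y
    using add[OF that(1) scale[OF that(2), of "-1"]] by simp
  have Iic: "L2_ind {..a} \<in> V" for a
  proof -
    have "a \<in> closure \<rat>" using Rats_closure_real by blast
    then obtain q where q: "\<And>n. q n \<in> \<rat>" "q \<longlonglongrightarrow> a"
      unfolding closure_sequential by metis
    have le: "(dist (L2_ind {..q n}) (L2_ind {..a}))\<^sup>2 \<le> \<bar>q n - a\<bar>" for n
    proof -
      have "measure unit_lborel (sym_diff {..q n} {..a} \<inter> {0..1})
          = measure lborel (sym_diff {..q n} {..a} \<inter> {0..1})"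
        by (rule measure_restrict_space) auto
      also have "\<dots> \<le> measure lborel {min (q n) a..max (q n) a}"
        by (intro measure_mono_fmeasurable) (auto simp: fmeasurable_def)
      also have "\<dots> = \<bar>q n - a\<bar>" by (simp add: min_def max_def)
      finally show ?thesis by (simp add: dist_L2_ind)
    qed
    have "(\<lambda>n. \<bar>q n - a\<bar>) \<longlonglongrightarrow> 0"
      using q(2) by (simp add: LIM_zero tendsto_rabs_zero)
    then have "(\<lambda>n. (dist (L2_ind {..q n}) (L2_ind {..a}))\<^sup>2) \<longlonglongrightarrow> 0"
      by (rule Lim_null_comparison[rotated]) (use le in auto)
    from tendsto_real_sqrt[OF this] have "(\<lambda>n. L2_ind {..q n}) \<longlonglongrightarrow> L2_ind {..a}"
      by (simp add: tendsto_dist_iff[of "\<lambda>n. L2_ind {..q n}"])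
    then show ?thesis by (rule closed_sequentially[OF closed gen[OF q(1)]])
  qed
  have univ: "L2_ind UNIV \<in> V"
  proof -
    have "(dist (L2_ind UNIV) (L2_ind {..1}))\<^sup>2 = 0"
    proof -
      have *: "sym_diff UNIV {..1::real} \<inter> {0..1} = {}" by auto
      show ?thesis by (subst dist_L2_ind, simp, simp, simp only: * measure_empty)
    qed
    then show ?thesis using Iic[of 1] by simp
  qed
  let ?G = "range (\<lambda>a::real. {..a})"
  have "Int_stable ?G" by (auto simp: Int_stable_def)
  moreover have "?G \<subseteq> Pow UNIV" by simp
  moreover have "A \<in> sigma_sets UNIV ?G" using A by (simp add: borel_eq_atMost)
  ultimately show ?thesis
  proof (induction rule: sigma_sets_induct_disjoint)
    case (basic A)
    then show ?case using Iic by auto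
  next
    case empty
    show ?case using zero by (simp add: zero_abs_L2 indicator_def[abs_def])
  next
    case (compl A)
    then have A: "A \<in> sets borel" by (simp add: borel_eq_atMost)
    have "indicator (UNIV - A) = (\<lambda>t. indicator UNIV t - indicator A t :: real)"
      by (auto simp: indicator_def)
    then have "L2_ind (UNIV - A) = L2_ind UNIV - L2_ind A"
      using diff_abs_L2[OF sq_integrable_indicator[of UNIV] sq_integrable_indicator[OF A]] by simp
    then show ?case using diff[OF univ compl(2)] by simp
  next
    case (union S)
    then have S: "\<And>i. S i \<in> sets borel" by (auto simp: borel_eq_atMost)
    then have UN: "(\<Union>i<n. S i) \<in> sets borel" for n by auto
    have fin: "L2_ind (\<Union>i<n. S i) \<in> V" for n
    proof (induction n)
      case 0
      show ?case using zero by (simp add: zero_abs_L2 indicator_def[abs_def])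
    next
      case (Suc n)
      have "S i \<inter> S n = {}" if "i < n" for i
        using disjoint_family_onD[OF union(1), of i n] that by simp
      then have "indicator (\<Union>i<Suc n. S i) t = (indicator (\<Union>i<n. S i) t + indicator (S n) t :: real)"
        for t by (fastforce simp: indicator_def less_Suc_eq)
      then have "indicator (\<Union>i<Suc n. S i) = (\<lambda>t. indicator (\<Union>i<n. S i) t + indicator (S n) t :: real)"
        by (rule ext)
      then have "L2_ind (\<Union>i<Suc n. S i) = L2_ind (\<Union>i<n. S i) + L2_ind (S n)"
        using add_abs_L2[OF sq_integrable_indicator[OF UN[of n]] sq_integrable_indicator[OF S[of n]]]
        by simp
      then show ?case using add[OF Suc union(3)] by simp
    qed
    have "(\<lambda>n. L2_ind (\<Union>i<n. S i)) \<longlonglongrightarrow> L2_ind (\<Union>i. S i)"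
    proof (rule tendsto_abs_L2)
      show "(\<lambda>n. indicator (\<Union>i<n. S i) t :: real) \<longlonglongrightarrow> indicator (\<Union>i. S i) t" for t
        by (rule LIMSEQ_indicator_UN)
    qed (use S UN in \<open>auto intro!: sq_integrable_indicator simp: indicator_def\<close>)
    then show ?case by (rule closed_sequentially[OF closed fin])
  qed
qed

lemma L2_in_closed_subspace:
  assumes closed: "closed V" and zero: "0 \<in> V"
    and add: "\<And>x y. x \<in> V \<Longrightarrow> y \<in> V \<Longrightarrow> x + y \<in> V"
    and scale: "\<And>c x. x \<in> V \<Longrightarrow> c *\<^sub>R x \<in> V"
    and gen: "\<And>q. q \<in> \<rat> \<Longrightarrow> L2_ind {..q} \<in> V"
  shows "x \<in> V"
proof -
  let ?f = "rep_L2 x"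
  obtain s where s: "\<And>i. simple_function unit_lborel (s i)"
    "\<And>t. t \<in> space unit_lborel \<Longrightarrow> (\<lambda>i. s i t) \<longlonglongrightarrow> ?f t"
    "\<And>i t. t \<in> space unit_lborel \<Longrightarrow> dist (s i t) 0 \<le> 2 * dist (?f t) 0"
    using borel_measurable_implies_sequence_metric[OF measurable_rep_L2[of x], of 0] by metis
  have sp: "space unit_lborel = {0..1}" by (simp add: space_restrict_space)
  have simple: "sq_integrable g \<and> abs_L2 g \<in> V" if g: "simple_function unit_lborel g" for g
  proof -
    let ?R = "g ` {0..1}"
    let ?A = "\<lambda>y. g -` {y} \<inter> {0..1}"
    have fin: "finite ?R" using g by (simp add: simple_function_def sp)
    have A: "?A y \<in> sets borel" for y
    proof -
      have "g -` {y} \<inter> space unit_lborel \<in> sets unit_lborel"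
        by (rule simple_functionD[OF g])
      then show ?thesis by (auto simp: sp sets_restrict_space)
    qed
    have sum: "sq_integrable (\<lambda>t. \<Sum>y\<in>F. y * indicator (?A y) t) \<and>
        abs_L2 (\<lambda>t. \<Sum>y\<in>F. y * indicator (?A y) t) \<in> V" if "finite F" for F
      using that
    proof (induction F)
      case empty
      show ?case using zero by (simp add: zero_abs_L2 sq_integrable_zero)
    next
      case (insert y F)
      have i: "sq_integrable (indicator (?A y))" by (rule sq_integrable_indicator[OF A])
      have "L2_ind (?A y) \<in> V" by (rule L2_ind_in_closed_subspace[OF assms A])
      then have y_in: "abs_L2 (\<lambda>t. y * indicator (?A y) t) \<in> V"
        by (simp only: scale_abs_L2[OF i] scale)
      note y = sq_integrable_scale[OF i, of y]
      have F: "sq_integrable (\<lambda>t. \<Sum>y\<in>F. y * indicator (?A y) t)"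
        "abs_L2 (\<lambda>t. \<Sum>y\<in>F. y * indicator (?A y) t) \<in> V"
        using insert.IH by blast+
      show ?case
        unfolding sum.insert[OF insert.hyps] add_abs_L2[OF y F(1)]
        by (intro conjI sq_integrable_add[OF y F(1)] add[OF y_in F(2)])
    qed
    have eq: "g t = (\<Sum>y\<in>?R. y * indicator (?A y) t)" if "t \<in> {0..1}" for t
    proof -
      have "(\<Sum>y\<in>?R. y * indicator (?A y) t) = (\<Sum>y\<in>?R. if y = g t then y else 0)"
        using that by (intro sum.cong) (auto simp: indicator_def)
      then show ?thesis using that fin by simp
    qed
    have meas: "g \<in> borel_measurable unit_lborel"
      by (rule borel_measurable_simple_function[OF g])
    have "integrable unit_lborel (\<lambda>t. (g t)\<^sup>2) \<longleftrightarrow>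
        integrable unit_lborel (\<lambda>t. (\<Sum>y\<in>?R. y * indicator (?A y) t)\<^sup>2)"
    proof (rule Bochner_Integration.integrable_cong[OF refl])
      show "(g t)\<^sup>2 = (\<Sum>y\<in>?R. y * indicator (?A y) t)\<^sup>2" if "t \<in> space unit_lborel" for t
        by (rule arg_cong[where f="\<lambda>z. z\<^sup>2"], rule eq) (use that sp in simp)
    qed
    then have sq: "sq_integrable g"
      using sum[OF fin] meas unfolding sq_integrable_def by blast
    have "AE t in unit_lborel. g t = (\<Sum>y\<in>?R. y * indicator (?A y) t)"
      by (rule AE_I2, rule eq) (simp only: sp)
    then have "L2_rel g (\<lambda>t. \<Sum>y\<in>?R. y * indicator (?A y) t)"
      using sq sum[OF fin] unfolding L2_rel_def by blast
    then have "abs_L2 g = abs_L2 (\<lambda>t. \<Sum>y\<in>?R. y * indicator (?A y) t)"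
      by (rule Quotient3_rel_abs[OF Quotient3_L2])
    then show ?thesis using sq sum[OF fin] by metis
  qed
  have lim: "(\<lambda>i. abs_L2 (s i)) \<longlonglongrightarrow> abs_L2 ?f"
  proof (rule tendsto_abs_L2)
    show "sq_integrable (s i)" for i using simple[OF s(1)] by blast
    show "(\<lambda>i. s i t) \<longlonglongrightarrow> ?f t" if "t \<in> {0..1}" for t
      by (rule s(2)) (use that sp in simp)
    show "\<bar>s i t\<bar> \<le> 2 * \<bar>?f t\<bar>" if "t \<in> {0..1}" for i t
      using s(3)[of t i] that sp by (simp add: dist_real_def)
  qed (rule rep_L2)
  have "abs_L2 (s i) \<in> V" for i using simple[OF s(1)] by blast
  from closed_sequentially[OF closed this lim] have "abs_L2 ?f \<in> V" .
  then show ?thesis by simp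
qed

instance L2 :: second_countable_topology
proof
  have "countable ((\<lambda>q. L2_ind {..q}) ` \<rat>)" by (intro countable_image countable_rat)
  from countable_rational_span[OF this]
  obtain T where TV: "countable T \<and> (\<lambda>q. L2_ind {..q}) ` \<rat> \<subseteq> closure T \<and> 0 \<in> closure T \<and>
      (\<forall>x\<in>closure T. \<forall>y\<in>closure T. x + y \<in> closure T) \<and>
      (\<forall>c. \<forall>x\<in>closure T. c *\<^sub>R x \<in> closure T)" ..
  note T = TV[THEN conjunct1] and V = TV[THEN conjunct2, THEN conjunct1]
    TV[THEN conjunct2, THEN conjunct2, THEN conjunct1]
    TV[THEN conjunct2, THEN conjunct2, THEN conjunct2, THEN conjunct1]
    TV[THEN conjunct2, THEN conjunct2, THEN conjunct2, THEN conjunct2]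
  have dense: "x \<in> closure T" for x :: L2
  proof (rule L2_in_closed_subspace[OF closed_closure V(2)])
    show "x + y \<in> closure T" if "x \<in> closure T" "y \<in> closure T" for x y
      using V(3) that by blast
    show "c *\<^sub>R x \<in> closure T" if "x \<in> closure T" for c x
      using V(4) that by blast
    show "L2_ind {..q} \<in> closure T" if "q \<in> \<rat>" for q
      using V(1) that by blast
  qed
  define B where "B = (\<lambda>(x, q). ball x q) ` (T \<times> \<rat>)"
  have count: "countable B" unfolding B_def using T by (intro countable_image countable_SIGMA countable_rat)
  have basis: "topological_basis B"
  proof (rule topological_basisI)
    show "open O'" if "O' \<in> B" for O' using that by (auto simp: B_def)
    fix O' and x :: L2 assume "open O'" "x \<in> O'"
    then obtain e where e: "e > 0" "ball x e \<subseteq> O'" by (auto simp: open_contains_ball)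
    obtain q where q: "q \<in> \<rat>" "0 < q" "q < e / 2"
      using Rats_dense_in_real[of 0 "e / 2"] \<open>e > 0\<close> by auto
    obtain y where y: "y \<in> T" "dist y x < q"
      using dense[of x] q(2) unfolding closure_approachable by blast
    have "ball y q \<subseteq> O'"
    proof
      fix z assume "z \<in> ball y q"
      then have "dist x z < e" using y(2) q(3) dist_triangle2[of x z y]
        by (simp add: dist_commute)
      then show "z \<in> O'" using e(2) by auto
    qed
    moreover have "x \<in> ball y q" using y(2) by simp
    moreover have "ball y q \<in> B"
      unfolding B_def by (rule image_eqI[of _ _ "(y, q)"]) (use y(1) q(1) in simp_all)
    ultimately show "\<exists>B'\<in>B. x \<in> B' \<and> B' \<subseteq> O'" by (intro bexI[of _ "ball y q"] conjI)
  qed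
  show "\<exists>B::L2 set set. countable B \<and> open = generate_topology B"
    by (rule exI[of _ B], rule conjI[OF count topological_basis_imp_subbasis[OF basis]])
qed

instance L2 :: polish_space ..


section \<open>Operators on $L^2$\<close>

definition tensor :: "L2 \<Rightarrow> L2 \<Rightarrow> L2 \<Rightarrow> L2" where
  "tensor f g = (\<lambda>h. inner f h *\<^sub>R g)"

text \<open>
  The expectation of a random operator is taken pointwise (in the strong sense). For
  \<open>tensor X X\<close> with \<open>X\<close> square-integrable this is the Bochner expectation in the space of
  Hilbert-Schmidt operators, because evaluation at \<open>h\<close> is a bounded linear map on that space.
\<close>

definition op_expectation :: "'w measure \<Rightarrow> ('w \<Rightarrow> L2 \<Rightarrow> L2) \<Rightarrow> L2 \<Rightarrow> L2" where
  "op_expectation M \<Psi> = (\<lambda>h. \<integral>\<omega>. \<Psi> \<omega> h \<partial>M)"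

definition orthonormal_basis :: "(nat \<Rightarrow> L2) \<Rightarrow> bool" where
  "orthonormal_basis e \<longleftrightarrow>
     (\<forall>i j. inner (e i) (e j) = (if i = j then 1 else 0)) \<and> closure (span (range e)) = UNIV"

text \<open>
  Meaningful for Hilbert-Schmidt operators, where the series converges and does not depend on the
  orthonormal basis \<open>e\<close>. Covariance operators of square-integrable laws are of this kind.
\<close>

definition hs_norm :: "(nat \<Rightarrow> L2) \<Rightarrow> (L2 \<Rightarrow> L2) \<Rightarrow> real" where
  "hs_norm e \<Psi> = sqrt (\<Sum>i. (norm (\<Psi> (e i)))\<^sup>2)"

section \<open>Convergence of laws and convergence in probability\<close>

definition weak_conv_L2 :: "(nat \<Rightarrow> L2 measure) \<Rightarrow> L2 measure \<Rightarrow> bool" where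
  "weak_conv_L2 \<mu> \<nu> \<longleftrightarrow>
     (\<forall>g :: L2 \<Rightarrow> real. continuous_on UNIV g \<and> bounded (range g) \<longrightarrow>
        (\<lambda>n. \<integral>x. g x \<partial>\<mu> n) \<longlonglongrightarrow> (\<integral>x. g x \<partial>\<nu>))"

definition metrizes_weak_convergence :: "(L2 measure \<Rightarrow> L2 measure \<Rightarrow> real) \<Rightarrow> bool" where
  "metrizes_weak_convergence d \<longleftrightarrow>
     Metric_space (space (prob_algebra borel)) d \<and>
     (\<forall>\<mu> \<nu>. (\<forall>n. \<mu> n \<in> space (prob_algebra borel)) \<and> \<nu> \<in> space (prob_algebra borel) \<longrightarrow>
        (weak_conv_L2 \<mu> \<nu> \<longleftrightarrow> (\<lambda>n. d (\<mu> n) \<nu>) \<longlonglongrightarrow> 0))"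

text \<open>
  \<open>measure\<close> is 0 on non-measurable sets, so the exceedance events are covered by measurable ones
  (outer probability). For measurable \<open>X j\<close> this is convergence to 0 in probability as usual.
\<close>

definition tendsto_0_in_prob :: "'w measure \<Rightarrow> (nat \<Rightarrow> 'w \<Rightarrow> real) \<Rightarrow> bool" where
  "tendsto_0_in_prob M X \<longleftrightarrow>
     (\<forall>\<epsilon>>0. \<exists>A. (\<forall>j. A j \<in> sets M \<and> {\<omega> \<in> space M. \<bar>X j \<omega>\<bar> > \<epsilon>} \<subseteq> A j) \<and>
        (\<lambda>j. measure M (A j)) \<longlonglongrightarrow> 0)"

text \<open>\<open>K\<close> is a version of the regular conditional law of \<open>Z\<close> given the sub-\<open>\<sigma>\<close>-algebra \<open>F\<close>.\<close>

definition is_cond_law ::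
  "'w measure \<Rightarrow> 'w measure \<Rightarrow> ('w \<Rightarrow> L2) \<Rightarrow> ('w \<Rightarrow> L2 measure) \<Rightarrow> bool" where
  "is_cond_law M F Z K \<longleftrightarrow>
     K \<in> measurable F (prob_algebra borel) \<and>
     (\<forall>A \<in> sets borel. AE \<omega> in M.
        measure (K \<omega>) A = real_cond_exp M F (indicator (Z -` A \<inter> space M)) \<omega>)"

text \<open>
  With \<open>K \<omega>\<close> the conditional law of \<open>Z\<close>, \<open>law_mean (K \<omega>)\<close> is the conditional expectation of \<open>Z\<close>, and
  more generally integrals of \<open>\<phi>\<close> with respect to \<open>K \<omega>\<close> are conditional expectations of \<open>\<phi> Z\<close>.
\<close>

definition law_mean :: "L2 measure \<Rightarrow> L2" where
  "law_mean \<mu> = (\<integral>x. x \<partial>\<mu>)"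

section \<open>Stationarity and $L^2$-$m$-approximability\<close>

definition strictly_stationary :: "'w measure \<Rightarrow> (int \<Rightarrow> 'w \<Rightarrow> L2) \<Rightarrow> bool" where
  "strictly_stationary M Y \<longleftrightarrow>
     (\<forall>J h. finite J \<longrightarrow>
        distr M (\<Pi>\<^sub>M t\<in>J. borel) (\<lambda>\<omega>. \<lambda>t\<in>J. Y (t + h) \<omega>) =
        distr M (\<Pi>\<^sub>M t\<in>J. borel) (\<lambda>\<omega>. \<lambda>t\<in>J. Y t \<omega>))"

text \<open>
  \<open>\<delta>' m t k\<close> is the copy $\delta^{(m)}_{t,k}$, used for \<open>m \<ge> 1\<close> and \<open>k \<le> t - m\<close>. The family
  consisting of all \<open>\<delta> s\<close> (left summand) and all copies (right summand) is independent, and every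
  member has the law of \<open>\<delta> 0\<close>.
\<close>

definition iid_with_copies ::
  "'w measure \<Rightarrow> (int \<Rightarrow> 'w \<Rightarrow> L2) \<Rightarrow> (nat \<Rightarrow> int \<Rightarrow> int \<Rightarrow> 'w \<Rightarrow> L2) \<Rightarrow> bool" where
  "iid_with_copies M \<delta> \<delta>' \<longleftrightarrow>
     (let copies = {(m, t, k). 1 \<le> m \<and> k \<le> t - int m};
          fam = case_sum \<delta> (\<lambda>(m, t, k). \<delta>' m t k)
      in prob_space.indep_vars M (\<lambda>_. borel) fam (UNIV <+> copies) \<and>
         (\<forall>i \<in> UNIV <+> copies. distr M borel (fam i) = distr M borel (\<delta> 0)))"

definition coupled ::
  "((nat \<Rightarrow> L2) \<Rightarrow> L2) \<Rightarrow> (int \<Rightarrow> 'w \<Rightarrow> L2) \<Rightarrow> (nat \<Rightarrow> int \<Rightarrow> int \<Rightarrow> 'w \<Rightarrow> L2) \<Rightarrow>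
   int \<Rightarrow> nat \<Rightarrow> 'w \<Rightarrow> L2" where
  "coupled f \<delta> \<delta>' t m \<omega> =
     f (\<lambda>j. if j < m then \<delta> (t - int j) \<omega> else \<delta>' m t (t - int j) \<omega>)"

definition approx_error ::
  "'w measure \<Rightarrow> (int \<Rightarrow> 'w \<Rightarrow> L2) \<Rightarrow> ((nat \<Rightarrow> L2) \<Rightarrow> L2) \<Rightarrow> (int \<Rightarrow> 'w \<Rightarrow> L2) \<Rightarrow>
   (nat \<Rightarrow> int \<Rightarrow> int \<Rightarrow> 'w \<Rightarrow> L2) \<Rightarrow> int \<Rightarrow> nat \<Rightarrow> real" where
  "approx_error M Y f \<delta> \<delta>' t m =
     sqrt (\<integral>\<omega>. (norm (Y t \<omega> - coupled f \<delta> \<delta>' t m \<omega>))\<^sup>2 \<partial>M)"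

text \<open>
  The representation \<open>f\<close>, \<open>\<delta>\<close> and the copies \<open>\<delta>'\<close> are parameters, so that a rate condition on
  \<open>approx_error\<close> can refer to them. The sum starts at \<open>m = 1\<close>.
\<close>

definition L2_m_approximable ::
  "'w measure \<Rightarrow> (int \<Rightarrow> 'w \<Rightarrow> L2) \<Rightarrow> ((nat \<Rightarrow> L2) \<Rightarrow> L2) \<Rightarrow> (int \<Rightarrow> 'w \<Rightarrow> L2) \<Rightarrow>
   (nat \<Rightarrow> int \<Rightarrow> int \<Rightarrow> 'w \<Rightarrow> L2) \<Rightarrow> bool" where
  "L2_m_approximable M Y f \<delta> \<delta>' \<longleftrightarrow>
     f \<in> borel_measurable (\<Pi>\<^sub>M j\<in>UNIV. borel) \<and>
     iid_with_copies M \<delta> \<delta>' \<and>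
     (\<forall>t. AE \<omega> in M. Y t \<omega> = f (\<lambda>j. \<delta> (t - int j) \<omega>)) \<and>
     integrable M (\<lambda>\<omega>. (norm (Y 0 \<omega>))\<^sup>2) \<and>
     (\<forall>t. summable (\<lambda>m. approx_error M Y f \<delta> \<delta>' t (Suc m)))"

section \<open>The tapered block bootstrap\<close>

definition tapering_window :: "(real \<Rightarrow> real) \<Rightarrow> bool" where
  "tapering_window w \<longleftrightarrow>
     (\<forall>\<tau>. 0 \<le> w \<tau> \<and> w \<tau> \<le> 1) \<and>
     (\<forall>\<tau>. \<tau> \<notin> {0..1} \<longrightarrow> w \<tau> = 0) \<and>
     (\<forall>\<^sub>F \<tau> in nhds (1/2). w \<tau> > 0) \<and>
     (\<forall>x. w (1/2 + x) = w (1/2 - x)) \<and>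
     mono_on {0..1/2} w"

definition taper :: "(real \<Rightarrow> real) \<Rightarrow> nat \<Rightarrow> nat \<Rightarrow> real" where
  "taper w n \<tau> = (if \<tau> \<in> {1..n} then w ((real \<tau> - 1/2) / real n) else 0)"

definition taper_norm :: "(real \<Rightarrow> real) \<Rightarrow> nat \<Rightarrow> real" where
  "taper_norm w b = sqrt (\<Sum>i=1..b. (taper w b i)\<^sup>2)"

definition sample_mean :: "nat \<Rightarrow> (nat \<Rightarrow> L2) \<Rightarrow> L2" where
  "sample_mean n x = (1 / real n) *\<^sub>R (\<Sum>t=1..n. x t)"

definition sample :: "(int \<Rightarrow> 'w \<Rightarrow> L2) \<Rightarrow> nat \<Rightarrow> 'w \<Rightarrow> nat \<Rightarrow> L2" where
  "sample Y n \<omega> = (\<lambda>t\<in>{1..n}. Y (int t) \<omega>)"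

definition data_algebra :: "'w measure \<Rightarrow> (int \<Rightarrow> 'w \<Rightarrow> L2) \<Rightarrow> nat \<Rightarrow> 'w measure" where
  "data_algebra M Y n = vimage_algebra (space M) (sample Y n) (\<Pi>\<^sub>M t\<in>{1..n}. borel)"

definition Y_mean :: "(int \<Rightarrow> 'w \<Rightarrow> L2) \<Rightarrow> nat \<Rightarrow> 'w \<Rightarrow> L2" where
  "Y_mean Y n \<omega> = sample_mean n (sample Y n \<omega>)"

text \<open>The \<open>i\<close>-th element of the block starting at \<open>t\<close>; \<open>X\<close> is the centred sample.\<close>

definition tbb_block :: "(real \<Rightarrow> real) \<Rightarrow> nat \<Rightarrow> (nat \<Rightarrow> L2) \<Rightarrow> nat \<Rightarrow> nat \<Rightarrow> L2" where
  "tbb_block w b X t i = (taper w b i * (sqrt (real b) / taper_norm w b)) *\<^sub>R X (t + i - 1)"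

text \<open>
  Position \<open>s = (i - 1) * b + r\<close> with \<open>1 \<le> r \<le> b\<close> holds the \<open>r\<close>-th element of the block starting
  at \<open>J i\<close>. Here \<open>y\<close> is the observed sample and \<open>J\<close> are the drawn starting points.
\<close>

definition tbb_sample ::
  "(real \<Rightarrow> real) \<Rightarrow> nat \<Rightarrow> nat \<Rightarrow> (nat \<Rightarrow> L2) \<Rightarrow> (nat \<Rightarrow> nat) \<Rightarrow> nat \<Rightarrow> L2" where
  "tbb_sample w n b y J s =
     tbb_block w b (\<lambda>t. y t - sample_mean n y) (J ((s - 1) div b + 1)) ((s - 1) mod b + 1)"

definition tbb_mean ::
  "(real \<Rightarrow> real) \<Rightarrow> nat \<Rightarrow> nat \<Rightarrow> (int \<Rightarrow> 'w \<Rightarrow> L2) \<Rightarrow> (nat \<Rightarrow> 'w \<Rightarrow> nat) \<Rightarrow> 'w \<Rightarrow> L2" where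
  "tbb_mean w n b Y I \<omega> = sample_mean n (tbb_sample w n b (sample Y n \<omega>) (\<lambda>i. I i \<omega>))"

definition tbb_indices ::
  "'w measure \<Rightarrow> (int \<Rightarrow> 'w \<Rightarrow> L2) \<Rightarrow> nat \<Rightarrow> nat \<Rightarrow> nat \<Rightarrow> (nat \<Rightarrow> 'w \<Rightarrow> nat) \<Rightarrow> bool" where
  "tbb_indices M Y n b k I \<longleftrightarrow>
     prob_space.indep_vars M (\<lambda>_. count_space UNIV) I {1..k} \<and>
     (\<forall>i\<in>{1..k}. distr M (count_space UNIV) (I i) = measure_pmf (pmf_of_set {1..n - b + 1})) \<and>
     prob_space.indep_set M
       (sets (data_algebra M Y n))
       (sets (vimage_algebra (space M) (\<lambda>\<omega>. \<lambda>i\<in>{1..k}. I i \<omega>) (\<Pi>\<^sub>M i\<in>{1..k}. count_space UNIV)))"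

end

theory Submission
  imports Defs
begin

text \<open>
  Laws on \<open>L2\<close> are tested against countably many functions: the products \<open>inner x (e i) * inner x (e l)\<close>
  and \<open>(norm x)\<^sup>2\<close>, which give tightness and the covariance operator, and \<open>cos\<close> and \<open>sin\<close> of
  \<open>inner h x\<close> for rational combinations \<open>h\<close> of the basis. Convergence of all these integrals implies
  both weak convergence and Hilbert-Schmidt convergence of the covariance operators. By countability,
  \<open>L\<^sup>1\<close>-convergence of the integrals for a random law yields convergence in probability of any
  functional that is continuous along such sequences.

  Thus it suffices to show that the test integrals of the law of the normalised mean and (in
  \<open>L\<^sup>1\<close>) of the bootstrap law have the same limits, those of a Gaussian law whose covariance is the
  long-run covariance. The coupled variables, truncated and centred, approximate the process by a
  bounded \<open>m\<close>-dependent one, uniformly over weighted sums with normalised weights. For the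
  approximation, the normalised mean is treated by Bernstein blocks, and the bootstrap mean is a sum
  of \<open>k\<close> conditionally independent block sums, each bounded by a constant times \<open>sqrt b\<close>, whose
  empirical variance over the overlapping blocks concentrates since \<open>b\<^sup>2/n\<close> tends to 0. Tapers only
  enter through their squared increments, which tend to 0 in sum. The centring by the sample mean
  cancels when the conditional mean is subtracted.
\<close>

section \<open>Fourier coordinates\<close>

text \<open>Second moments take the place of compactness arguments for laws: convergence of
  \<open>(norm x)\<^sup>2\<close> and of squared coordinates already controls the mass outside a
  finite-dimensional box, and inside the box trigonometric polynomials are dense. The limit law has
  to exist as a Borel law on \<open>L2\<close> before anything can converge to it; a Cholesky factor
  of the long-run covariance, applied to independent normals, supplies its coordinates. The
  bandwidth condition is met in two places: a summand of the bootstrap mean has order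
  \<open>sqrt b / sqrt k\<close>, and the mean of \<open>N\<close> squared block sums, each
  dependent on about \<open>b\<close> neighbours and with second moment of order \<open>b\<close>,
  has variance of order \<open>b * b / N\<close>. Since \<open>n = k * b\<close>, both are governed
  by \<open>b\<^sup>2 / n\<close>. The rate on the coupling error pays for short lags: the first
  \<open>m\<close> lags of the difference between process and approximant contribute about
  \<open>m\<close> times the squared coupling error. The passage to convergence in probability
  argues with deterministic sequences of laws, so measurability of the distance between random laws
  never arises.\<close>

locale L2_basis =
  fixes e :: "nat \<Rightarrow> L2"
  assumes onb: "orthonormal_basis e"
begin

lemma inner_basis: "inner (e i) (e j) = (if i = j then 1 else 0)"
  using onb by (simp add: orthonormal_basis_def)

definition proj :: "nat \<Rightarrow> L2 \<Rightarrow> L2" where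
  "proj r x = (\<Sum>i<r. inner x (e i) *\<^sub>R e i)"

lemma inner_proj: "inner (proj r x) (e i) = (if i < r then inner x (e i) else 0)"
  by (simp add: proj_def inner_sum_left inner_basis if_distrib sum.delta cong: if_cong)

lemma bounded_linear_proj: "bounded_linear (proj r)"
  unfolding proj_def [abs_def]
  by (intro bounded_linear_sum bounded_linear_scaleR_left[THEN bounded_linear_compose]
      bounded_linear_inner_left)

lemma inner_proj_left: "inner (proj r x) y = (\<Sum>i<r. inner x (e i) * inner y (e i))"
  unfolding proj_def inner_sum_left by (simp add: inner_commute[of y])

lemma proj_selfadjoint: "inner (proj r x) y = inner x (proj r y)"
  unfolding proj_def inner_sum_left inner_sum_right by (simp add: inner_commute[of y] mult.commute)

lemma norm_proj: "(norm (proj r x))\<^sup>2 = (\<Sum>i<r. (inner x (e i))\<^sup>2)"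
proof -
  have "(norm (proj r x))\<^sup>2 = (\<Sum>i<r. inner x (e i) * inner (proj r x) (e i))"
    unfolding power2_norm_eq_inner by (rule inner_proj_left)
  then show ?thesis by (simp add: inner_proj power2_eq_square)
qed

lemma norm_diff_proj: "(norm (x - proj r x))\<^sup>2 = (norm x)\<^sup>2 - (\<Sum>i<r. (inner x (e i))\<^sup>2)"
proof -
  have "(norm (x - proj r x))\<^sup>2 = (norm x)\<^sup>2 - 2 * inner (proj r x) x + (norm (proj r x))\<^sup>2"
    unfolding power2_norm_eq_inner by (simp add: inner_diff_left inner_diff_right inner_commute)
  then show ?thesis unfolding norm_proj inner_proj_left by (simp add: power2_eq_square)
qed

text \<open>An element of the span involves finitely many basis vectors; the induction adds one
  vector and takes the larger of two thresholds.\<close>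

lemma proj_span: "y \<in> span (range e) \<Longrightarrow> \<exists>r0. \<forall>r\<ge>r0. proj r y = y"
proof (induction rule: span_induct_alt)
  case base
  then show ?case by (simp add: proj_def)
next
  case (step c x y)
  obtain i where i: "x = e i" using step by auto
  obtain r0 where r0: "\<And>r. r \<ge> r0 \<Longrightarrow> proj r y = y" using step by auto
  have "proj r (c *\<^sub>R x + y) = c *\<^sub>R x + y" if "r \<ge> max r0 (Suc i)" for r
  proof -
    have "proj r x = x"
      using that unfolding proj_def i
      by (subst sum.cong[OF refl, where h="\<lambda>j. if j = i then e i else 0"]) (auto simp: inner_basis)
    moreover have "proj r (c *\<^sub>R x + y) = c *\<^sub>R proj r x + proj r y"
      using bounded_linear_proj[of r] by (simp add: linear_simps)
    ultimately show ?thesis using r0 that by simp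
  qed
  then show ?case by blast
qed

lemma proj_tendsto: "(\<lambda>r. proj r x) \<longlonglongrightarrow> x"
proof (rule metric_LIMSEQ_I)
  fix \<epsilon> :: real assume "\<epsilon> > 0"
  have "x \<in> closure (span (range e))" using onb by (simp add: orthonormal_basis_def)
  then obtain y where y: "y \<in> span (range e)" "dist y x < \<epsilon> / 2"
    using \<open>\<epsilon> > 0\<close> unfolding closure_approachable by (meson half_gt_zero)
  obtain r0 where r0: "\<And>r. r \<ge> r0 \<Longrightarrow> proj r y = y" using proj_span[OF y(1)] by auto
  have "dist (proj r x) x < \<epsilon>" if "r \<ge> r0" for r
  proof -
    \<comment> \<open>Bessel's inequality: projections are contractions, so replacing
      \<open>x\<close> by the nearby \<open>y\<close>, which large projections fix, costs at most
      twice the distance.\<close>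
    have "(norm (proj r (x - y)))\<^sup>2 \<le> (norm (x - y))\<^sup>2"
      using norm_diff_proj[of "x - y" r] norm_proj[of r "x - y"] zero_le_power2[of "norm (x - y - proj r (x - y))"]
      by linarith
    then have 1: "norm (proj r (x - y)) \<le> norm (x - y)" by simp
    have "proj r x - x = proj r (x - y) - (x - y)"
      using bounded_linear_proj[of r] r0[OF that] by (simp add: linear_simps)
    then have "norm (proj r x - x) \<le> norm (proj r (x - y)) + norm (x - y)"
      using norm_triangle_ineq4[of "proj r (x - y)" "x - y"] by (metis (no_types))
    then show ?thesis using 1 y(2) by (simp add: dist_norm norm_minus_commute)
  qed
  then show "\<exists>r0. \<forall>r\<ge>r0. dist (proj r x) x < \<epsilon>" by blast
qed

lemma parseval: "(\<lambda>i. (inner x (e i))\<^sup>2) sums (norm x)\<^sup>2"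
  unfolding sums_def norm_proj[symmetric] by (intro tendsto_intros proj_tendsto)

text \<open>Rational coefficients keep the family of test functions countable, as \<open>tests_transfer\<close> requires.\<close>

definition rat_span :: "L2 set" where
  "rat_span = range (\<lambda>xs :: (rat \<times> nat) list. sum_list (map (\<lambda>(q, i). of_rat q *\<^sub>R e i) xs))"

lemma countable_rat_span: "countable rat_span"
  unfolding rat_span_def by simp

lemma rat_span_add: "x \<in> rat_span \<Longrightarrow> y \<in> rat_span \<Longrightarrow> x + y \<in> rat_span"
proof -
  assume "x \<in> rat_span" "y \<in> rat_span"
  then obtain xs ys where "x = sum_list (map (\<lambda>(q, i). of_rat q *\<^sub>R e i) xs)"
    "y = sum_list (map (\<lambda>(q, i). of_rat q *\<^sub>R e i) ys)" by (auto simp: rat_span_def)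
  then show ?thesis unfolding rat_span_def by (intro image_eqI[of _ _ "xs @ ys"]) auto
qed

lemma rat_span_uminus: "x \<in> rat_span \<Longrightarrow> - x \<in> rat_span"
proof -
  assume "x \<in> rat_span"
  then obtain xs where xs: "x = sum_list (map (\<lambda>(q, i). of_rat q *\<^sub>R e i) xs)" by (auto simp: rat_span_def)
  have "- sum_list (map (\<lambda>(q, i). of_rat q *\<^sub>R e i) xs)
      = sum_list (map (\<lambda>(q, i). of_rat q *\<^sub>R e i) (map (\<lambda>(q, i). (- q, i)) xs))" for xs :: "(rat \<times> nat) list"
    by (induction xs) (auto simp: of_rat_minus)
  then show ?thesis unfolding rat_span_def xs by blast
qed

lemma rat_span_diff: "x \<in> rat_span \<Longrightarrow> y \<in> rat_span \<Longrightarrow> x - y \<in> rat_span"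
  using rat_span_add[OF _ rat_span_uminus] by fastforce

lemma zero_in_rat_span: "0 \<in> rat_span"
  unfolding rat_span_def by (rule image_eqI[of _ _ "[]"]) auto

text \<open>These vectors are the frequencies of the sines in \<open>trig_approx\<close>;
  rationality is the reason why the box size there is a natural number.\<close>

lemma basis_in_rat_span: "(1 / real n) *\<^sub>R e i \<in> rat_span"
  unfolding rat_span_def by (rule image_eqI[of _ _ "[(1 / of_nat n, i)]"]) (auto simp: of_rat_divide)

text \<open>Turns \<open>inner h x\<close> into a finite combination of coordinates, the form in
  which the characteristic function of the Gaussian law is known.\<close>

lemma rat_span_finite_expansion: "h \<in> rat_span \<Longrightarrow> \<exists>r. proj r h = h"
proof -
  assume "h \<in> rat_span"
  moreover have "sum_list (map (\<lambda>(q, i). of_rat q *\<^sub>R e i) xs) \<in> span (range e)" for xs :: "(rat \<times> nat) list"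
  proof (induction xs)
    case (Cons a xs)
    have "of_rat (fst a) *\<^sub>R e (snd a) \<in> span (range e)" by (intro span_scale span_base) auto
    from span_add[OF this Cons] show ?case by (simp add: case_prod_beta)
  qed (simp add: span_zero)
  ultimately show ?thesis using proj_span unfolding rat_span_def by blast
qed

inductive_set tests :: "(L2 \<Rightarrow> real) set" where
  cos: "h \<in> rat_span \<Longrightarrow> (\<lambda>x. cos (inner h x)) \<in> tests"
| sin: "h \<in> rat_span \<Longrightarrow> (\<lambda>x. sin (inner h x)) \<in> tests"
| prod: "(\<lambda>x. inner x (e i) * inner x (e l)) \<in> tests"
| sq_norm: "(\<lambda>x. (norm x)\<^sup>2) \<in> tests"

lemma countable_tests: "countable tests"
proof -
  have "tests \<subseteq> (\<lambda>h x. cos (inner h x)) ` rat_span \<union> (\<lambda>h x. sin (inner h x)) ` rat_span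
      \<union> range (\<lambda>(i, l) x. inner x (e i) * inner x (e l)) \<union> {\<lambda>x. (norm x)\<^sup>2}"
    by (auto elim!: tests.cases)
  then show ?thesis
    by (rule countable_subset) (intro countable_Un countable_image countable_rat_span; simp)
qed

lemma continuous_tests: "F \<in> tests \<Longrightarrow> continuous_on UNIV F"
  by (induction rule: tests.induct) (auto intro!: continuous_intros)

lemma borel_tests: "F \<in> tests \<Longrightarrow> F \<in> borel_measurable borel"
  by (intro borel_measurable_continuous_onI continuous_tests)

text \<open>Quadratic growth makes every test integrable under a law with finite second
  moment.\<close>

lemma tests_bound: "F \<in> tests \<Longrightarrow> \<bar>F x\<bar> \<le> 1 + (norm x)\<^sup>2"
proof (induction rule: tests.induct)
  case (cos h)
  show ?case using abs_cos_le_one[of "inner h x"] zero_le_power2[of "norm x"] by linarith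
next
  case (sin h)
  show ?case using abs_sin_le_one[of "inner h x"] zero_le_power2[of "norm x"] by linarith
next
  case (prod i l)
  have "\<bar>inner x (e i)\<bar> \<le> norm x" for i
    using Cauchy_Schwarz_ineq2[of x "e i"] inner_basis[of i i] by (simp add: norm_eq_sqrt_inner)
  then have "\<bar>inner x (e i)\<bar> * \<bar>inner x (e l)\<bar> \<le> norm x * norm x" by (intro mult_mono) auto
  then show ?case by (simp add: abs_mult power2_eq_square)
qed simp

end

section \<open>Laws with finite second moment\<close>

definition good_law :: "L2 measure \<Rightarrow> bool" where
  "good_law \<mu> \<longleftrightarrow> prob_space \<mu> \<and> sets \<mu> = sets borel \<and> integrable \<mu> (\<lambda>x. (norm x)\<^sup>2)"

lemma good_lawD:
  assumes "good_law \<mu>"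
  shows "prob_space \<mu>" "sets \<mu> = sets borel" "integrable \<mu> (\<lambda>x. (norm x)\<^sup>2)" "space \<mu> = UNIV"
    "\<mu> \<in> space (prob_algebra borel)"
  using assms sets_eq_imp_space_eq[of \<mu> borel] by (auto simp: good_law_def space_prob_algebra)

lemma good_law_borel: "good_law \<mu> \<Longrightarrow> f \<in> borel_measurable borel \<Longrightarrow> f \<in> borel_measurable \<mu>"
  using good_lawD(2) measurable_cong_sets by blast

lemma good_law_integrable_bounded:
  fixes f :: "L2 \<Rightarrow> real"
  assumes "good_law \<mu>" "f \<in> borel_measurable borel" "\<And>x. \<bar>f x\<bar> \<le> C * (1 + (norm x)\<^sup>2)"
  shows "integrable \<mu> f"
proof (rule Bochner_Integration.integrable_bound)
  interpret prob_space \<mu> using assms(1) by (rule good_lawD)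
  show "integrable \<mu> (\<lambda>x. C * (1 + (norm x)\<^sup>2))" using good_lawD(3)[OF assms(1)] by simp
  show "AE x in \<mu>. norm (f x) \<le> norm (C * (1 + (norm x)\<^sup>2))"
    by (intro AE_I2) (use assms(3) order_trans[OF _ abs_ge_self] in auto)
qed (rule good_law_borel[OF assms(1,2)])

context L2_basis begin

lemma integrable_tests: "good_law \<mu> \<Longrightarrow> F \<in> tests \<Longrightarrow> integrable \<mu> F"
  by (rule good_law_integrable_bounded[where C=1]) (use borel_tests tests_bound in auto)

definition conv_tests :: "(nat \<Rightarrow> L2 measure) \<Rightarrow> L2 measure \<Rightarrow> bool" where
  "conv_tests \<mu> N \<longleftrightarrow> good_law N \<and> (\<forall>m. good_law (\<mu> m)) \<and>
     (\<forall>F\<in>tests. (\<lambda>m. \<integral>x. F x \<partial>\<mu> m) \<longlonglongrightarrow> (\<integral>x. F x \<partial>N))"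

section \<open>A criterion for weak convergence\<close>

inductive_set trig :: "(L2 \<Rightarrow> real) set" where
  cos: "h \<in> rat_span \<Longrightarrow> (\<lambda>x. cos (inner h x)) \<in> trig"
| sin: "h \<in> rat_span \<Longrightarrow> (\<lambda>x. sin (inner h x)) \<in> trig"
| add: "f \<in> trig \<Longrightarrow> g \<in> trig \<Longrightarrow> (\<lambda>x. f x + g x) \<in> trig"
| scale: "f \<in> trig \<Longrightarrow> (\<lambda>x. c * f x) \<in> trig"

text \<open>The product-to-sum formulas produce the frequencies \<open>h + h'\<close> and
  \<open>h - h'\<close>, which stay in \<open>rat_span\<close>. Hence the linear span of cosines and
  sines is an algebra, as Stone-Weierstrass demands.\<close>

lemma trig_mult:
  assumes "f \<in> trig" "g \<in> trig"
  shows "(\<lambda>x. f x * g x) \<in> trig"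
proof -
  have half: "(\<lambda>x. a * (f x + c * g x)) \<in> trig" if "f \<in> trig" "g \<in> trig" for a c f g
    using that by (intro trig.scale trig.add)
  have cos_g: "(\<lambda>x. cos (inner h x) * g x) \<in> trig" if "h \<in> rat_span" for h
    using assms(2)
  proof induction
    case (cos h')
    have "(\<lambda>x. 1/2 * (cos (inner (h - h') x) + 1 * cos (inner (h + h') x))) \<in> trig"
      by (intro half trig.cos rat_span_add rat_span_diff that cos)
    then show ?case by (simp add: cos_times_cos inner_diff_left inner_add_left)
  next
    case (sin h')
    have "(\<lambda>x. 1/2 * (sin (inner (h + h') x) + (-1) * sin (inner (h - h') x))) \<in> trig"
      by (intro half trig.sin rat_span_add rat_span_diff that sin)
    then show ?case by (simp add: cos_times_sin inner_diff_left inner_add_left)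
  next
    case (add f g) then show ?case by (simp add: distrib_left trig.add)
  next
    case (scale f c) then show ?case using trig.scale[of _ c] by (simp add: mult.left_commute)
  qed
  have sin_g: "(\<lambda>x. sin (inner h x) * g x) \<in> trig" if "h \<in> rat_span" for h
    using assms(2)
  proof induction
    case (cos h')
    have "(\<lambda>x. 1/2 * (sin (inner (h + h') x) + 1 * sin (inner (h - h') x))) \<in> trig"
      by (intro half trig.sin rat_span_add rat_span_diff that cos)
    then show ?case by (simp add: sin_times_cos inner_diff_left inner_add_left)
  next
    case (sin h')
    have "(\<lambda>x. 1/2 * (cos (inner (h - h') x) + (-1) * cos (inner (h + h') x))) \<in> trig"
      by (intro half trig.cos rat_span_add rat_span_diff that sin)
    then show ?case by (simp add: sin_times_sin inner_diff_left inner_add_left)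
  next
    case (add f g) then show ?case by (simp add: distrib_left trig.add)
  next
    case (scale f c) then show ?case using trig.scale[of _ c] by (simp add: mult.left_commute)
  qed
  from assms(1) show ?thesis
  proof induction
    case (add f g') then show ?case by (simp add: distrib_right trig.add)
  next
    case (scale f c) then show ?case using trig.scale[of _ c] by (simp add: mult.assoc)
  qed (use cos_g sin_g in auto)
qed

lemma trig_const: "(\<lambda>x. c) \<in> trig"
  using trig.scale[OF trig.cos[OF zero_in_rat_span], of c] by simp

lemma continuous_trig: "f \<in> trig \<Longrightarrow> continuous_on UNIV f"
  by (induction rule: trig.induct) (auto intro!: continuous_intros)

lemma trig_bounded: "f \<in> trig \<Longrightarrow> \<exists>B. \<forall>x. \<bar>f x\<bar> \<le> B"
proof (induction rule: trig.induct)
  case (add f g)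
  then obtain A B where "\<forall>x. \<bar>f x\<bar> \<le> A" "\<forall>x. \<bar>g x\<bar> \<le> B" by blast
  then have "\<bar>f x + g x\<bar> \<le> A + B" for x using abs_triangle_ineq[of "f x" "g x"] by (metis add_mono order_trans)
  then show ?case by blast
next
  case (scale f c)
  then obtain A where "\<forall>x. \<bar>f x\<bar> \<le> A" by blast
  then have "\<bar>c * f x\<bar> \<le> \<bar>c\<bar> * A" for x by (simp add: abs_mult mult_left_mono)
  then show ?case by blast
qed (use abs_cos_le_one abs_sin_le_one in blast)+

lemma integrable_trig: "good_law \<mu> \<Longrightarrow> f \<in> trig \<Longrightarrow> integrable \<mu> f"
proof -
  assume \<mu>: "good_law \<mu>" and f: "f \<in> trig"
  interpret prob_space \<mu> using \<mu> by (rule good_lawD)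
  obtain B where "\<And>x. \<bar>f x\<bar> \<le> B" using trig_bounded[OF f] by blast
  then show ?thesis
    by (intro integrable_const_bound[of _ B] good_law_borel[OF \<mu>] borel_measurable_continuous_onI continuous_trig f) auto
qed

lemma conv_trig:
  assumes c: "conv_tests \<mu> N" and f: "f \<in> trig"
  shows "(\<lambda>m. \<integral>x. f x \<partial>\<mu> m) \<longlonglongrightarrow> (\<integral>x. f x \<partial>N)"
  using f
proof induction
  case (cos h) then show ?case using c tests.cos unfolding conv_tests_def by blast
next
  case (sin h) then show ?case using c tests.sin unfolding conv_tests_def by blast
next
  case (add f g)
  then show ?case using c by (simp add: conv_tests_def integrable_trig tendsto_add)
next
  case (scale f k)
  then show ?case using c by (simp add: conv_tests_def integrable_trig tendsto_mult)
qed

section \<open>Approximation by trigonometric polynomials on folded coordinates\<close>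

primrec cube :: "nat \<Rightarrow> L2 set" where
  "cube 0 = {0}"
| "cube (Suc r) = {x + y |x y. x \<in> cube r \<and> y \<in> (\<lambda>s. s *\<^sub>R e r) ` {-1..1}}"

text \<open>The recursion of \<open>cube\<close> through sums of sets is made for this induction:
  sums of compact sets are compact. The description by coordinates is recovered in
  \<open>cube_eq\<close>.\<close>

lemma compact_cube: "compact (cube r)"
proof (induction r)
  case (Suc r)
  have "compact ((\<lambda>s. s *\<^sub>R e r) ` {-1..1})"
    by (intro compact_continuous_image continuous_intros compact_Icc)
  from compact_sums[OF Suc this] show ?case by simp
qed simp

lemma cube_eq: "cube r = {(\<Sum>i<r. s i *\<^sub>R e i) |s. \<forall>i<r. s i \<in> {-1..1}}"
proof (induction r)
  case (Suc r)
  show ?case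
  proof (intro set_eqI iffI)
    fix x assume "x \<in> cube (Suc r)"
    then obtain u t where u: "u \<in> cube r" "t \<in> {-1..1}" "x = u + t *\<^sub>R e r" by auto
    then obtain s where s: "u = (\<Sum>i<r. s i *\<^sub>R e i)" "\<forall>i<r. s i \<in> {-1..1}" unfolding Suc by blast
    have "x = (\<Sum>i<Suc r. (s(r := t)) i *\<^sub>R e i)" using u s by simp
    moreover have "\<forall>i<Suc r. (s(r := t)) i \<in> {-1..1}" using u s by (simp add: less_Suc_eq)
    ultimately show "x \<in> {(\<Sum>i<Suc r. s i *\<^sub>R e i) |s. \<forall>i<Suc r. s i \<in> {-1..1}}" by blast
  next
    fix x assume "x \<in> {(\<Sum>i<Suc r. s i *\<^sub>R e i) |s. \<forall>i<Suc r. s i \<in> {-1..1}}"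
    then obtain s where s: "x = (\<Sum>i<Suc r. s i *\<^sub>R e i)" "\<forall>i<Suc r. s i \<in> {-1..1}" by blast
    then have "(\<Sum>i<r. s i *\<^sub>R e i) \<in> cube r" unfolding Suc by (auto intro!: exI[of _ s])
    moreover have "s r *\<^sub>R e r \<in> (\<lambda>s. s *\<^sub>R e r) ` {-1..1}" using s(2) by blast
    ultimately show "x \<in> cube (Suc r)" unfolding s(1) cube.simps sum.lessThan_Suc by blast
  qed
qed simp

lemma inner_basis_sum: "inner (\<Sum>i<r. s i *\<^sub>R e i) (e l) = (if l < r then s l else 0)"
  by (simp add: inner_sum_left inner_basis if_distrib sum.delta cong: if_cong)

text \<open>The function \<open>T * arcsin (sin (s / T))\<close> is a triangle wave: it equals
  \<open>s\<close> as long as \<open>\<bar>s / T\<bar> \<le> pi / 2\<close>, is bounded, and depends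
  on \<open>s\<close> only through a sine. It plays the part of a coordinate truncation while
  remaining within reach of trigonometric polynomials.\<close>

definition fold_coords :: "real \<Rightarrow> nat \<Rightarrow> L2 \<Rightarrow> L2" where
  "fold_coords T r x = (\<Sum>i<r. (T * arcsin (sin (inner x (e i) / T))) *\<^sub>R e i)"

text \<open>
  \<open>g (fold_coords T r x)\<close> is a continuous function of finitely many sines, so Stone-Weierstrass
  approximates it uniformly on the whole space.
\<close>

lemma trig_approx:
  assumes g: "continuous_on UNIV g" and T: "0 < T" and "\<epsilon> > 0"
  shows "\<exists>f\<in>trig. \<forall>x. \<bar>g (fold_coords (real T) r x) - f x\<bar> < \<epsilon>"
proof -
  define \<sigma> where "\<sigma> x = (\<Sum>i<r. sin (inner x (e i) / real T) *\<^sub>R e i)" for x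
  define G where "G x = g (\<Sum>i<r. (real T * arcsin (inner x (e i))) *\<^sub>R e i)" for x
  \<comment> \<open>Stone-Weierstrass runs over functions on the cube; the second conjunct records
    that pulling such a function back along \<open>\<sigma>\<close> gives a trigonometric polynomial
    on the whole space.\<close>
  define P where "P f \<longleftrightarrow> continuous_on (cube r) f \<and> (\<lambda>x. f (\<sigma> x)) \<in> trig" for f :: "L2 \<Rightarrow> real"
  have coord: "inner x (e i) \<in> {-1..1}" if "x \<in> cube r" for x i
  proof -
    obtain s where "x = (\<Sum>i<r. s i *\<^sub>R e i)" "\<forall>i<r. s i \<in> {-1..1}" using \<open>x \<in> cube r\<close> unfolding cube_eq by blast
    then show ?thesis by (simp add: inner_basis_sum)
  qed
  have "\<exists>f. P f \<and> (\<forall>x\<in>cube r. \<bar>G x - f x\<bar> < \<epsilon>)"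
  proof (rule Stone_Weierstrass_HOL[OF compact_cube])
    show "continuous_on (cube r) G"
      unfolding G_def
      by (rule continuous_on_compose2[OF g], intro continuous_intros ballI) (use coord in \<open>auto simp: abs_le_iff\<close>)
    show "\<exists>f. P f \<and> f x \<noteq> f y" if xy: "x \<in> cube r \<and> y \<in> cube r \<and> x \<noteq> y" for x y
    proof -
      obtain s t where st: "x = (\<Sum>i<r. s i *\<^sub>R e i)" "y = (\<Sum>i<r. t i *\<^sub>R e i)"
        using xy unfolding cube_eq by blast
      have "\<exists>i<r. s i \<noteq> t i"
      proof (rule ccontr)
        assume "\<not> ?thesis"
        then have "x = y" unfolding st by (intro sum.cong) auto
        then show False using that by simp
      qed
      then obtain i where i: "i < r" "s i \<noteq> t i" by blast
      \<comment> \<open>Coordinate functions separate the points of the cube, and each pulls back to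
        a single sine.\<close>
      have "(\<lambda>x. inner (\<sigma> x) (e i)) = (\<lambda>x. sin (inner ((1 / real T) *\<^sub>R e i) x))"
        unfolding \<sigma>_def inner_basis_sum using i by (auto simp: inner_commute)
      then have "P (\<lambda>x. inner x (e i))"
        unfolding P_def using trig.sin[OF basis_in_rat_span[of T i]] by (auto intro!: continuous_intros)
      moreover have "inner x (e i) \<noteq> inner y (e i)" using i by (simp add: st inner_basis_sum)
      ultimately show ?thesis by blast
    qed
  qed (auto simp: P_def trig_const \<open>\<epsilon> > 0\<close> intro!: continuous_intros trig.add trig_mult)
  then obtain f where f: "P f" "\<And>x. x \<in> cube r \<Longrightarrow> \<bar>G x - f x\<bar> < \<epsilon>" by blast
  have "\<sigma> x \<in> cube r" for x
    unfolding cube_eq \<sigma>_def by (intro CollectI exI[of _ "\<lambda>i. sin (inner x (e i) / real T)"]) auto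
  moreover have "G (\<sigma> x) = g (fold_coords (real T) r x)" for x
    unfolding G_def fold_coords_def \<sigma>_def
    by (rule arg_cong[of _ _ g], rule sum.cong) (simp_all add: inner_basis_sum)
  ultimately have "\<bar>g (fold_coords (real T) r x) - f (\<sigma> x)\<bar> < \<epsilon>" for x using f(2)[of "\<sigma> x"] by simp
  then show ?thesis using f(1) unfolding P_def by (intro bexI[of _ "\<lambda>x. f (\<sigma> x)"]) auto
qed

text \<open>If the first \<open>r\<close> coordinates are at most \<open>T\<close>, folding
  coincides with the projection, and the Lipschitz error in the tail is split by
  \<open>z \<le> \<eta> + z\<^sup>2 / \<eta>\<close>. Otherwise one squared coordinate exceeds
  \<open>T\<^sup>2\<close>, so the trivial error \<open>2 * B\<close> is absorbed by the last term.
  The bound is linear in second moments, which the tests control.\<close>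

lemma fold_coords_error:
  assumes lip: "\<And>x y. \<bar>g x - g y\<bar> \<le> L * norm (x - y)" and B: "\<And>x. \<bar>g x\<bar> \<le> B"
    and T: "T > 0" and \<eta>: "\<eta> > 0"
  shows "\<bar>g x - g (fold_coords T r x)\<bar> \<le> \<eta> + L\<^sup>2 / \<eta> * ((norm x)\<^sup>2 - (\<Sum>i<r. (inner x (e i))\<^sup>2))
     + 2 * B / T\<^sup>2 * (\<Sum>i<r. (inner x (e i))\<^sup>2)"
proof -
  let ?S = "\<Sum>i<r. (inner x (e i))\<^sup>2"
  have B0: "0 \<le> B" using B[of 0] by linarith
  have S0: "0 \<le> ?S" by (intro sum_nonneg) simp
  have d: "(norm (x - proj r x))\<^sup>2 = (norm x)\<^sup>2 - ?S" by (rule norm_diff_proj)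
  show ?thesis
  proof (cases "\<forall>i<r. \<bar>inner x (e i)\<bar> \<le> T")
    case True
    have "T * arcsin (sin (inner x (e i) / T)) = inner x (e i)" if "i < r" for i
    proof -
      have "\<bar>inner x (e i) / T\<bar> \<le> 1" using True that T by (simp add: divide_le_eq_1_pos)
      then have "arcsin (sin (inner x (e i) / T)) = inner x (e i) / T"
        using pi_gt3 by (intro arcsin_sin) linarith+
      then show ?thesis using T by simp
    qed
    then have eq: "fold_coords T r x = proj r x" by (simp add: fold_coords_def proj_def)
    have "L * norm (x - proj r x) \<le> \<eta> + L\<^sup>2 / \<eta> * (norm (x - proj r x))\<^sup>2"
    proof -
      define z where "z = L * norm (x - proj r x)"
      have "2 * (z * \<eta>) \<le> z\<^sup>2 + \<eta>\<^sup>2" using sum_squares_bound[of z \<eta>] by simp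
      moreover have "0 \<le> z\<^sup>2" "0 \<le> \<eta>\<^sup>2" by simp_all
      ultimately have "z * \<eta> \<le> \<eta>\<^sup>2 + z\<^sup>2" by linarith
      then have "z \<le> \<eta> + z\<^sup>2 / \<eta>" using \<eta> by (simp add: field_simps power2_eq_square)
      then show ?thesis by (simp add: z_def power_mult_distrib)
    qed
    moreover have "0 \<le> 2 * B / T\<^sup>2 * ?S" using B0 S0 by simp
    ultimately show ?thesis using lip[of x "proj r x"] unfolding eq d by linarith
  next
    case False
    then obtain i where i: "i < r" "\<bar>inner x (e i)\<bar> > T" by auto
    have "T\<^sup>2 \<le> (inner x (e i))\<^sup>2" using i(2) T by (metis abs_le_square_iff abs_of_pos less_imp_le)
    also have "\<dots> \<le> ?S" by (rule member_le_sum) (use i in auto)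
    finally have "2 * B * 1 \<le> 2 * B * (?S / T\<^sup>2)" using B0 T by (intro mult_left_mono) auto
    moreover have "\<bar>g x - g (fold_coords T r x)\<bar> \<le> 2 * B"
      using B[of x] B[of "fold_coords T r x"] by linarith
    moreover have "0 \<le> L\<^sup>2 / \<eta> * ((norm x)\<^sup>2 - ?S)" using \<eta> unfolding d[symmetric] by simp
    ultimately show ?thesis using \<eta> by simp
  qed
qed

end

context L2_basis begin

lemma conv_poly_tests:
  assumes c: "conv_tests \<mu> N"
  shows "(\<lambda>m. \<integral>x. a + b * (norm x)\<^sup>2 + k * (\<Sum>i<r. (inner x (e i))\<^sup>2) \<partial>\<mu> m)
     \<longlonglongrightarrow> (\<integral>x. a + b * (norm x)\<^sup>2 + k * (\<Sum>i<r. (inner x (e i))\<^sup>2) \<partial>N)"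
proof -
  have eq: "(\<integral>x. a + b * (norm x)\<^sup>2 + k * (\<Sum>i<r. (inner x (e i))\<^sup>2) \<partial>\<mu>)
      = a + b * (\<integral>x. (norm x)\<^sup>2 \<partial>\<mu>) + k * (\<Sum>i<r. \<integral>x. inner x (e i) * inner x (e i) \<partial>\<mu>)"
    if "good_law \<mu>" for \<mu>
  proof -
    interpret prob_space \<mu> using that by (rule good_lawD)
    show ?thesis
      using integrable_tests[OF that tests.prod] good_lawD(3)[OF that]
      by (simp add: power2_eq_square prob_space)
  qed
  show ?thesis
    using c tests.prod tests.sq_norm
    by (simp add: conv_tests_def eq) (intro tendsto_intros; simp)
qed

text \<open>Dominated convergence: Parseval gives the pointwise limit and Bessel's inequality the
  majorant.\<close>

lemma tail_moment_tendsto: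
  assumes N: "good_law N"
  shows "(\<lambda>r. \<integral>x. (norm x)\<^sup>2 - (\<Sum>i<r. (inner x (e i))\<^sup>2) \<partial>N) \<longlonglongrightarrow> 0"
proof -
  have "(\<lambda>r. \<integral>x. (norm x)\<^sup>2 - (\<Sum>i<r. (inner x (e i))\<^sup>2) \<partial>N) \<longlonglongrightarrow> (\<integral>x. 0 \<partial>N)"
  proof (rule integral_dominated_convergence[where w="\<lambda>x. (norm x)\<^sup>2"])
    show "AE x in N. (\<lambda>r. (norm x)\<^sup>2 - (\<Sum>i<r. (inner x (e i))\<^sup>2)) \<longlonglongrightarrow> 0"
    proof (rule AE_I2)
      fix x
      show "(\<lambda>r. (norm x)\<^sup>2 - (\<Sum>i<r. (inner x (e i))\<^sup>2)) \<longlonglongrightarrow> 0"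
        using tendsto_diff[OF tendsto_const parseval[unfolded sums_def], of "(norm x)\<^sup>2" x] by simp
    qed
    show "AE x in N. norm ((norm x)\<^sup>2 - (\<Sum>i<r. (inner x (e i))\<^sup>2)) \<le> (norm x)\<^sup>2" for r
    proof (rule AE_I2)
      fix x
      have "0 \<le> (\<Sum>i<r. (inner x (e i))\<^sup>2)" by (intro sum_nonneg) simp
      then show "norm ((norm x)\<^sup>2 - (\<Sum>i<r. (inner x (e i))\<^sup>2)) \<le> (norm x)\<^sup>2"
        using norm_diff_proj[of x r] zero_le_power2[of "norm (x - proj r x)"] unfolding real_norm_def by argo
    qed
  qed (auto intro!: good_law_borel[OF N] good_lawD(3)[OF N])
  then show ?thesis by simp
qed

text \<open>The parameters \<open>r\<close> and \<open>T\<close> are chosen from the limit law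
  \<open>N\<close> alone. The majorant \<open>R\<close> of the folding error is a combination of
  tests and a constant, so its integral under \<open>\<mu> m\<close> is eventually as small as under
  \<open>N\<close>; this replaces a tightness argument.\<close>

lemma conv_tests_lipschitz:
  assumes c: "conv_tests \<mu> N"
    and lip: "\<And>x y. \<bar>g x - g y\<bar> \<le> L * norm (x - y)" and B: "\<And>x. \<bar>g x\<bar> \<le> B"
  shows "(\<lambda>m. \<integral>x. g x \<partial>\<mu> m) \<longlonglongrightarrow> (\<integral>x. g x \<partial>N)"
proof (rule metric_LIMSEQ_I)
  fix \<epsilon> :: real assume "\<epsilon> > 0"
  \<comment> \<open>In the end \<open>9 * \<eta>\<close> is spent: exchanging \<open>g\<close> for
    \<open>f\<close> costs less than \<open>4 * \<eta>\<close> under each of \<open>\<mu> m\<close>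
    and \<open>N\<close>, and the integrals of \<open>f\<close> differ by less than
    \<open>\<eta>\<close>.\<close>
  define \<eta> where "\<eta> = \<epsilon> / 12"
  have \<eta>: "\<eta> > 0" using \<open>\<epsilon> > 0\<close> by (simp add: \<eta>_def)
  have N: "good_law N" and \<mu>: "\<And>m. good_law (\<mu> m)" using c by (auto simp: conv_tests_def)
  have L0: "0 \<le> L"
    using lip[of "e 0" 0] order_trans[OF abs_ge_zero] inner_basis[of 0 0]
    by (fastforce simp: norm_eq_sqrt_inner)
  have contg: "continuous_on UNIV g"
    by (rule lipschitz_on_continuous_on[of L], rule lipschitz_onI) (use lip L0 in \<open>auto simp: dist_norm\<close>)
  let ?S = "\<lambda>r x. \<Sum>i<r. (inner x (e i))\<^sup>2"
  have int_S: "integrable N (?S r)" for r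
    using integrable_tests[OF N tests.prod] by (simp add: power2_eq_square)
  have "(\<lambda>r. L\<^sup>2 / \<eta> * (\<integral>x. (norm x)\<^sup>2 - ?S r x \<partial>N)) \<longlonglongrightarrow> L\<^sup>2 / \<eta> * 0"
    by (intro tendsto_intros tail_moment_tendsto N)
  then have "\<forall>\<^sub>F r in sequentially. L\<^sup>2 / \<eta> * (\<integral>x. (norm x)\<^sup>2 - ?S r x \<partial>N) < \<eta>"
    by (rule order_tendstoD) (use \<eta> in simp)
  then obtain r where r: "L\<^sup>2 / \<eta> * (\<integral>x. (norm x)\<^sup>2 - ?S r x \<partial>N) < \<eta>"
    by (auto simp: eventually_sequentially)
  have "(\<lambda>T. 2 * B * (1 / real T)\<^sup>2 * (\<integral>x. ?S r x \<partial>N)) \<longlonglongrightarrow> 2 * B * 0\<^sup>2 * (\<integral>x. ?S r x \<partial>N)"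
    by (intro tendsto_intros lim_1_over_n)
  then have "\<forall>\<^sub>F T in sequentially. 2 * B * (1 / real T)\<^sup>2 * (\<integral>x. ?S r x \<partial>N) < \<eta>"
    by (rule order_tendstoD) (use \<eta> in simp)
  then have "\<forall>\<^sub>F T in sequentially. 2 * B * (1 / real T)\<^sup>2 * (\<integral>x. ?S r x \<partial>N) < \<eta> \<and> T > 0"
    using eventually_gt_at_top[of 0] by eventually_elim simp
  then obtain T where T: "2 * B / (real T)\<^sup>2 * (\<integral>x. ?S r x \<partial>N) < \<eta>" "T > 0"
    by (auto simp: eventually_sequentially power_divide)
  \<comment> \<open>The bound of \<open>fold_coords_error\<close>, regrouped by
    \<open>(norm x)\<^sup>2\<close> and the partial sum of squares to fit
    \<open>conv_poly_tests\<close>.\<close>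
  define R where "R x = \<eta> + L\<^sup>2 / \<eta> * (norm x)\<^sup>2 + (2 * B / (real T)\<^sup>2 - L\<^sup>2 / \<eta>) * ?S r x" for x
  have R: "\<bar>g x - g (fold_coords T r x)\<bar> \<le> R x" for x
    using fold_coords_error[OF lip B _ \<eta>, of T x r] T(2) by (simp add: R_def algebra_simps)
  have int_R: "integrable \<mu> R" if "good_law \<mu>" for \<mu>
  proof -
    interpret prob_space \<mu> using that by (rule good_lawD)
    show ?thesis unfolding R_def
      using integrable_tests[OF that tests.prod] good_lawD(3)[OF that] by (simp add: power2_eq_square)
  qed
  have RN: "(\<integral>x. R x \<partial>N) < 3 * \<eta>"
  proof -
    interpret prob_space N using N by (rule good_lawD)
    have "(\<integral>x. R x \<partial>N) = \<eta> + L\<^sup>2 / \<eta> * (\<integral>x. (norm x)\<^sup>2 - ?S r x \<partial>N) + 2 * B / (real T)\<^sup>2 * (\<integral>x. ?S r x \<partial>N)"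
      unfolding R_def using int_S good_lawD(3)[OF N] by (simp add: prob_space algebra_simps del: Bochner_Integration.integral_sum)
    then show ?thesis using r T by simp
  qed
  obtain f where f: "f \<in> trig" "\<And>x. \<bar>g (fold_coords (real T) r x) - f x\<bar> < \<eta>"
    using trig_approx[OF contg T(2) \<eta>] by blast
  have close: "\<bar>(\<integral>x. g x \<partial>\<mu>) - (\<integral>x. f x \<partial>\<mu>)\<bar> \<le> (\<integral>x. R x \<partial>\<mu>) + \<eta>" if good: "good_law \<mu>" for \<mu>
  proof -
    interpret prob_space \<mu> using good by (rule good_lawD)
    have ig: "integrable \<mu> g"
      by (rule integrable_const_bound[of _ B]) (use B in \<open>auto intro!: good_law_borel[OF good] borel_measurable_continuous_onI contg\<close>)
    note if' = integrable_trig[OF good f(1)]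
    have "\<bar>(\<integral>x. g x \<partial>\<mu>) - (\<integral>x. f x \<partial>\<mu>)\<bar> = \<bar>\<integral>x. g x - f x \<partial>\<mu>\<bar>" using ig if' by simp
    also have "\<dots> \<le> (\<integral>x. \<bar>g x - f x\<bar> \<partial>\<mu>)" by (rule integral_abs_bound)
    also have "\<dots> \<le> (\<integral>x. R x + \<eta> \<partial>\<mu>)"
    proof (rule integral_mono)
      show "\<bar>g x - f x\<bar> \<le> R x + \<eta>" for x using R[of x] f(2)[of x] by linarith
    qed (use ig if' int_R[OF good] in simp_all)
    finally show ?thesis using int_R[OF good] by (simp add: prob_space)
  qed
  have "(\<lambda>m. \<integral>x. R x \<partial>\<mu> m) \<longlonglongrightarrow> (\<integral>x. R x \<partial>N)"
    unfolding R_def by (rule conv_poly_tests[OF c])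
  then have 1: "\<forall>\<^sub>F m in sequentially. (\<integral>x. R x \<partial>\<mu> m) < 3 * \<eta>" by (rule order_tendstoD) (rule RN)
  have 2: "\<forall>\<^sub>F m in sequentially. dist (\<integral>x. f x \<partial>\<mu> m) (\<integral>x. f x \<partial>N) < \<eta>"
    using tendstoD[OF conv_trig[OF c f(1)] \<eta>] .
  have "\<forall>\<^sub>F m in sequentially. dist (\<integral>x. g x \<partial>\<mu> m) (\<integral>x. g x \<partial>N) < \<epsilon>"
    using 1 2
  proof eventually_elim
    case (elim m)
    then show ?case using close[OF \<mu>[of m]] close[OF N] RN unfolding dist_real_def \<eta>_def by argo
  qed
  then show "\<exists>m0. \<forall>m\<ge>m0. dist (\<integral>x. g x \<partial>\<mu> m) (\<integral>x. g x \<partial>N) < \<epsilon>"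
    by (simp add: eventually_sequentially)
qed

text \<open>Continuous functions are increasing limits of their Lipschitz minorants (infimal convolutions).\<close>

lemma conv_tests_lower:
  fixes g :: "L2 \<Rightarrow> real"
  assumes c: "conv_tests \<mu> N"
    and cont: "continuous_on UNIV g" and B: "\<And>x. \<bar>g x\<bar> \<le> B" and "\<epsilon> > 0"
  shows "\<forall>\<^sub>F m in sequentially. (\<integral>x. g x \<partial>\<mu> m) > (\<integral>x. g x \<partial>N) - \<epsilon>"
proof -
  have N: "good_law N" and \<mu>: "\<And>m. good_law (\<mu> m)" using c by (auto simp: conv_tests_def)
  define G where "G k x = (INF y. g y + real k * norm (x - y))" for k and x :: L2
  have lb: "- B \<le> g y + real k * norm (x - y)" for k x y
  proof -
    have "- B \<le> g y" using B[of y] by linarith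
    moreover have "0 \<le> real k * norm (x - y)" by simp
    ultimately show ?thesis by linarith
  qed
  have bdd: "bdd_below (range (\<lambda>y. g y + real k * norm (x - y)))" for k x
    using lb by (intro bdd_belowI[of _ "- B"]) auto
  have le: "G k x \<le> g y + real k * norm (x - y)" for k x y
    unfolding G_def using bdd by (rule cINF_lower) simp
  have ge: "G k x \<ge> z" if "\<And>y. z \<le> g y + real k * norm (x - y)" for k x z
    unfolding G_def using that by (intro cINF_greatest) auto
  have Gg: "G k x \<le> g x" for k x using le[of k x x] by simp
  have GB: "\<bar>G k x\<bar> \<le> B" for k x
    using Gg[of k x] ge[OF lb, of k x] B[of x] by linarith
  have Glip: "\<bar>G k x - G k y\<bar> \<le> real k * norm (x - y)" for k x y
  proof -
    have one: "G k x - real k * norm (x - y) \<le> G k y" for x y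
    proof (rule ge)
      fix z
      have "real k * norm (x - z) \<le> real k * (norm (x - y) + norm (y - z))"
        using norm_triangle_ineq[of "x - y" "y - z"] by (intro mult_left_mono) auto
      then show "G k x - real k * norm (x - y) \<le> g z + real k * norm (y - z)"
        using le[of k x z] by (simp add: distrib_left)
    qed
    show ?thesis using one[of x y] one[of y x] by (simp add: norm_minus_commute)
  qed
  have Gcont: "continuous_on UNIV (G k)" for k
    by (rule lipschitz_on_continuous_on[of "real k"], rule lipschitz_onI) (use Glip in \<open>auto simp: dist_norm\<close>)
  have lim: "(\<lambda>k. G k x) \<longlonglongrightarrow> g x" for x
  proof (rule metric_LIMSEQ_I)
    fix \<eta> :: real assume "\<eta> > 0"
    then have "\<eta> / 2 > 0" by simp
    then obtain \<delta> where \<delta>: "\<delta> > 0" "\<And>y. dist y x < \<delta> \<Longrightarrow> dist (g y) (g x) < \<eta> / 2"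
      using cont unfolding continuous_on_iff by blast
    \<comment> \<open>Beyond distance \<open>\<delta>\<close> the penalty
      \<open>k * \<delta>\<close> outweighs the largest possible oscillation \<open>2 * B\<close>,
      so only nearby points can lower the infimum.\<close>
    obtain k0 :: nat where k0: "2 * B / \<delta> \<le> real k0" using real_arch_simple by blast
    have "dist (G k x) (g x) < \<eta>" if "k \<ge> k0" for k
    proof -
      have "g x - \<eta> / 2 \<le> G k x"
      proof (rule ge)
        fix y
        show "g x - \<eta> / 2 \<le> g y + real k * norm (x - y)"
        proof (cases "dist y x < \<delta>")
          case True
          then have "g x - \<eta> / 2 \<le> g y" using \<delta>(2)[of y] unfolding dist_real_def by argo
          moreover have "0 \<le> real k * norm (x - y)" by simp
          ultimately show ?thesis by linarith
        next
          case False
          have "2 * B \<le> real k0 * \<delta>" using k0 \<delta>(1) by (simp add: divide_le_eq)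
          also have "\<dots> \<le> real k * norm (x - y)"
            using that False \<delta>(1) by (intro mult_mono) (auto simp: dist_norm norm_minus_commute)
          finally have "2 * B \<le> real k * norm (x - y)" .
          then show ?thesis using B[of x] B[of y] \<open>\<eta> > 0\<close> by argo
        qed
      qed
      then show ?thesis using Gg[of k x] \<open>\<eta> > 0\<close> unfolding dist_real_def by argo
    qed
    then show "\<exists>k0. \<forall>k\<ge>k0. dist (G k x) (g x) < \<eta>" by blast
  qed
  have int: "integrable \<nu> f" if good: "good_law \<nu>" and f: "continuous_on UNIV f" "\<And>x. \<bar>f x\<bar> \<le> B" for \<nu> f
  proof -
    interpret prob_space \<nu> using good by (rule good_lawD)
    show ?thesis
      by (rule integrable_const_bound[of _ B]) (use f in \<open>auto intro!: good_law_borel[OF good] borel_measurable_continuous_onI\<close>)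
  qed
  interpret N: prob_space N using N by (rule good_lawD)
  have "(\<lambda>k. \<integral>x. G k x \<partial>N) \<longlonglongrightarrow> (\<integral>x. g x \<partial>N)"
  proof (rule integral_dominated_convergence[where w="\<lambda>_. B"])
    show "AE x in N. (\<lambda>k. G k x) \<longlonglongrightarrow> g x" using lim by simp
    show "AE x in N. norm (G k x) \<le> B" for k using GB by simp
  qed (auto intro!: good_law_borel[OF N] borel_measurable_continuous_onI cont Gcont)
  then have "\<forall>\<^sub>F k in sequentially. (\<integral>x. G k x \<partial>N) > (\<integral>x. g x \<partial>N) - \<epsilon>"
    by (rule order_tendstoD) (use \<open>\<epsilon> > 0\<close> in simp)
  then obtain k where k: "(\<integral>x. G k x \<partial>N) > (\<integral>x. g x \<partial>N) - \<epsilon>" by (auto simp: eventually_sequentially)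
  have "(\<lambda>m. \<integral>x. G k x \<partial>\<mu> m) \<longlonglongrightarrow> (\<integral>x. G k x \<partial>N)"
    by (rule conv_tests_lipschitz[OF c Glip GB])
  then have "\<forall>\<^sub>F m in sequentially. (\<integral>x. G k x \<partial>\<mu> m) > (\<integral>x. g x \<partial>N) - \<epsilon>"
    by (rule order_tendstoD) (rule k)
  then show ?thesis
  proof eventually_elim
    case (elim m)
    have "(\<integral>x. G k x \<partial>\<mu> m) \<le> (\<integral>x. g x \<partial>\<mu> m)"
      by (intro integral_mono int[OF \<mu>] cont Gcont GB B Gg)
    then show ?case using elim by simp
  qed
qed

text \<open>The one-sided bound for \<open>g\<close> and for \<open>- g\<close> gives both halves of
  the limit.\<close>

theorem conv_tests_imp_weak_conv:
  assumes c: "conv_tests \<mu> N"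
  shows "weak_conv_L2 \<mu> N"
  unfolding weak_conv_L2_def
proof (intro allI impI)
  fix g :: "L2 \<Rightarrow> real" assume "continuous_on UNIV g \<and> bounded (range g)"
  then obtain B where g: "continuous_on UNIV g" and B: "\<And>x. \<bar>g x\<bar> \<le> B"
    unfolding bounded_iff by auto
  show "(\<lambda>m. \<integral>x. g x \<partial>\<mu> m) \<longlonglongrightarrow> (\<integral>x. g x \<partial>N)"
  proof (rule order_tendstoI)
    fix a assume "a < (\<integral>x. g x \<partial>N)"
    then show "\<forall>\<^sub>F m in sequentially. a < (\<integral>x. g x \<partial>\<mu> m)"
      using conv_tests_lower[OF c g B, of "(\<integral>x. g x \<partial>N) - a"] by simp
  next
    fix a assume a: "(\<integral>x. g x \<partial>N) < a"
    have "continuous_on UNIV (\<lambda>x. - g x)" "\<And>x. \<bar>- g x\<bar> \<le> B" using g B by (auto intro!: continuous_intros)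
    from conv_tests_lower[OF c this, of "a - (\<integral>x. g x \<partial>N)"] a
    show "\<forall>\<^sub>F m in sequentially. (\<integral>x. g x \<partial>\<mu> m) < a" by simp
  qed
qed

section \<open>From test functions to convergence in probability\<close>

text \<open>If closeness to \<open>N\<close> on finitely many tests never forced \<open>G\<close> to
  be small, one could pick for every \<open>m\<close> an index \<open>r m \<ge> m\<close> and a law
  within \<open>1 / (m + 1)\<close> of \<open>N\<close> on the tests up to number \<open>m\<close>
  with \<open>G\<close> still large. These laws converge on all tests, contradicting the hypothesis
  on \<open>G\<close>; the free reindexing \<open>r\<close> is there for this. Large values of
  \<open>G\<close> therefore lie in finitely many measurable events about test integrals, and
  Markov's inequality bounds those.\<close>

lemma tests_transfer:
  fixes G :: "nat \<Rightarrow> L2 measure \<Rightarrow> real"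
  assumes M: "prob_space M"
    and N: "good_law N" and L: "\<And>j \<omega>. good_law (L j \<omega>)"
    and meas: "\<And>F j. F \<in> tests \<Longrightarrow> integrable M (\<lambda>\<omega>. \<integral>x. F x \<partial>L j \<omega>)"
    and conv: "\<And>F. F \<in> tests \<Longrightarrow> (\<lambda>j. \<integral>\<omega>. \<bar>(\<integral>x. F x \<partial>L j \<omega>) - (\<integral>x. F x \<partial>N)\<bar> \<partial>M) \<longlonglongrightarrow> 0"
    and G: "\<And>r \<mu>. filterlim r at_top sequentially \<Longrightarrow> conv_tests \<mu> N \<Longrightarrow> (\<lambda>m. G (r m) (\<mu> m)) \<longlonglongrightarrow> 0"
  shows "tendsto_0_in_prob M (\<lambda>j \<omega>. G j (L j \<omega>))"
  unfolding tendsto_0_in_prob_def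
proof (intro allI impI)
  fix \<epsilon> :: real assume "\<epsilon> > 0"
  interpret M: prob_space M by (rule M)
  define F where "F = from_nat_into tests"
  have ne: "tests \<noteq> {}" using tests.sq_norm by blast
  have F: "F i \<in> tests" for i unfolding F_def by (rule from_nat_into[OF ne])
  define near where "near m \<mu> \<longleftrightarrow> (\<forall>i\<le>m. \<bar>(\<integral>x. F i x \<partial>\<mu>) - (\<integral>x. F i x \<partial>N)\<bar> \<le> 1 / real (Suc m))"
    for m :: nat and \<mu>
  have "\<exists>m. \<forall>j\<ge>m. \<forall>\<mu>. good_law \<mu> \<longrightarrow> near m \<mu> \<longrightarrow> \<bar>G j \<mu>\<bar> \<le> \<epsilon>"
  proof (rule ccontr)
    assume "\<not> ?thesis"
    then have "\<forall>m. \<exists>j \<mu>. m \<le> j \<and> good_law \<mu> \<and> near m \<mu> \<and> \<bar>G j \<mu>\<bar> > \<epsilon>" by (auto simp: not_le)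
    then obtain r \<mu> where r: "\<And>m. m \<le> r m" and \<mu>: "\<And>m. good_law (\<mu> m)" "\<And>m. near m (\<mu> m)"
      and big: "\<And>m. \<bar>G (r m) (\<mu> m)\<bar> > \<epsilon>" by metis
    have "conv_tests \<mu> N"
      unfolding conv_tests_def
    proof (intro conjI allI ballI N \<mu>(1))
      fix f assume "f \<in> tests"
      then obtain i where i: "f = F i"
        unfolding F_def using from_nat_into_surj[OF countable_tests] by metis
      have "(\<lambda>m. (\<integral>x. f x \<partial>\<mu> m) - (\<integral>x. f x \<partial>N)) \<longlonglongrightarrow> 0"
      proof (rule Lim_null_comparison)
        show "\<forall>\<^sub>F m in sequentially. norm ((\<integral>x. f x \<partial>\<mu> m) - (\<integral>x. f x \<partial>N)) \<le> 1 / real (Suc m)"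
          using \<mu>(2) unfolding near_def i by (intro eventually_sequentiallyI[of i]) simp
      qed (rule LIMSEQ_Suc, rule lim_1_over_n)
      then show "(\<lambda>m. \<integral>x. f x \<partial>\<mu> m) \<longlonglongrightarrow> (\<integral>x. f x \<partial>N)" by (rule LIM_zero_cancel)
    qed
    moreover have "filterlim r at_top sequentially"
      by (rule filterlim_at_top_mono[OF filterlim_ident]) (simp add: r)
    ultimately have "(\<lambda>m. G (r m) (\<mu> m)) \<longlonglongrightarrow> 0" using G by blast
    from tendstoD[OF this \<open>\<epsilon> > 0\<close>] obtain m where "\<bar>G (r m) (\<mu> m)\<bar> < \<epsilon>"
      by (auto simp: eventually_sequentially)
    then show False using big[of m] by simp
  qed
  then obtain m where m: "\<And>j \<mu>. m \<le> j \<Longrightarrow> good_law \<mu> \<Longrightarrow> near m \<mu> \<Longrightarrow> \<bar>G j \<mu>\<bar> \<le> \<epsilon>" by blast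
  define D where "D i j \<omega> = \<bar>(\<integral>x. F i x \<partial>L j \<omega>) - (\<integral>x. F i x \<partial>N)\<bar>" for i j \<omega>
  have D_int: "integrable M (D i j)" for i j unfolding D_def using meas[OF F] by simp
  have D_meas [measurable]: "D i j \<in> borel_measurable M" for i j using D_int by (rule borel_measurable_integrable)
  define A where "A j = (if m \<le> j then \<Union>i\<in>{..m}. {\<omega> \<in> space M. D i j \<omega> \<ge> 1 / real (Suc m)} else space M)" for j
  show "\<exists>A. (\<forall>j. A j \<in> sets M \<and> {\<omega> \<in> space M. \<bar>G j (L j \<omega>)\<bar> > \<epsilon>} \<subseteq> A j) \<and> (\<lambda>j. measure M (A j)) \<longlonglongrightarrow> 0"
  proof (intro exI[of _ A] conjI allI)
    show "A j \<in> sets M" for j unfolding A_def by auto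
    show "{\<omega> \<in> space M. \<bar>G j (L j \<omega>)\<bar> > \<epsilon>} \<subseteq> A j" for j
    proof (cases "m \<le> j")
      case True
      show ?thesis
      proof
        fix \<omega> assume \<omega>: "\<omega> \<in> {\<omega> \<in> space M. \<bar>G j (L j \<omega>)\<bar> > \<epsilon>}"
        then have "\<not> near m (L j \<omega>)" using m[OF True L] by fastforce
        then show "\<omega> \<in> A j" using True \<omega> unfolding near_def A_def D_def by (auto simp: not_le intro: less_imp_le)
      qed
    qed (simp add: A_def)
    have bound: "measure M (A j) \<le> (\<Sum>i\<le>m. real (Suc m) * (\<integral>\<omega>. D i j \<omega> \<partial>M))" if "m \<le> j" for j
    proof -
      have "measure M (A j) \<le> (\<Sum>i\<le>m. measure M {\<omega> \<in> space M. D i j \<omega> \<ge> 1 / real (Suc m)})"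
        unfolding A_def using that by (auto intro!: measure_UNION_le)
      also have "\<dots> \<le> (\<Sum>i\<le>m. real (Suc m) * (\<integral>\<omega>. D i j \<omega> \<partial>M))"
      proof (rule sum_mono)
        fix i
        show "measure M {\<omega> \<in> space M. D i j \<omega> \<ge> 1 / real (Suc m)} \<le> real (Suc m) * (\<integral>\<omega>. D i j \<omega> \<partial>M)"
          using integral_Markov_inequality_measure[OF D_int[of i j], of "space M" "1 / real (Suc m)"]
          by (auto simp: D_def mult.commute)
      qed
      finally show ?thesis .
    qed
    show "(\<lambda>j. measure M (A j)) \<longlonglongrightarrow> 0"
    proof (rule Lim_null_comparison)
      show "\<forall>\<^sub>F j in sequentially. norm (measure M (A j)) \<le> (\<Sum>i\<le>m. real (Suc m) * (\<integral>\<omega>. D i j \<omega> \<partial>M))"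
        by (rule eventually_sequentiallyI[of m]) (use bound in auto)
      have "(\<lambda>j. \<Sum>i\<le>m. real (Suc m) * (\<integral>\<omega>. D i j \<omega> \<partial>M)) \<longlonglongrightarrow> (\<Sum>i\<le>m. real (Suc m) * 0)"
        unfolding D_def by (intro tendsto_intros conv F)
      then show "(\<lambda>j. \<Sum>i\<le>m. real (Suc m) * (\<integral>\<omega>. D i j \<omega> \<partial>M)) \<longlonglongrightarrow> 0" by simp
    qed
  qed
qed

end

section \<open>Square-integrable random elements\<close>

definition sq_int :: "'w measure \<Rightarrow> ('w \<Rightarrow> 'b::{real_inner, banach, second_countable_topology}) \<Rightarrow> bool" where
  "sq_int M X \<longleftrightarrow> X \<in> borel_measurable M \<and> integrable M (\<lambda>\<omega>. (norm (X \<omega>))\<^sup>2)"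

definition rms :: "'w measure \<Rightarrow> ('w \<Rightarrow> 'b::{real_inner, banach, second_countable_topology}) \<Rightarrow> real" where
  "rms M X = sqrt (\<integral>\<omega>. (norm (X \<omega>))\<^sup>2 \<partial>M)"

lemma sq_intD:
  assumes "sq_int M X"
  shows "X \<in> borel_measurable M" "integrable M (\<lambda>\<omega>. (norm (X \<omega>))\<^sup>2)"
  using assms by (auto simp: sq_int_def)

lemma rms_nonneg [simp]: "0 \<le> rms M X"
  by (simp add: rms_def)

lemma rms_power2: "(rms M X)\<^sup>2 = (\<integral>\<omega>. (norm (X \<omega>))\<^sup>2 \<partial>M)"
  by (simp add: rms_def)

lemma integrable_norm_mult:
  assumes "sq_int M X" "sq_int M Y"
  shows "integrable M (\<lambda>\<omega>. norm (X \<omega>) * norm (Y \<omega>))"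
proof (rule Bochner_Integration.integrable_bound)
  show "integrable M (\<lambda>\<omega>. (norm (X \<omega>))\<^sup>2 + (norm (Y \<omega>))\<^sup>2)" using assms by (simp add: sq_int_def)
  have [measurable]: "X \<in> borel_measurable M" "Y \<in> borel_measurable M" using assms by (auto simp: sq_int_def)
  show "(\<lambda>\<omega>. norm (X \<omega>) * norm (Y \<omega>)) \<in> borel_measurable M" by measurable
  show "AE \<omega> in M. norm (norm (X \<omega>) * norm (Y \<omega>)) \<le> norm ((norm (X \<omega>))\<^sup>2 + (norm (Y \<omega>))\<^sup>2)"
  proof (rule AE_I2)
    fix \<omega>
    have "2 * norm (X \<omega>) * norm (Y \<omega>) \<le> (norm (X \<omega>))\<^sup>2 + (norm (Y \<omega>))\<^sup>2" by (rule sum_squares_bound)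
    moreover have "0 \<le> norm (X \<omega>) * norm (Y \<omega>)" by simp
    ultimately have "norm (X \<omega>) * norm (Y \<omega>) \<le> (norm (X \<omega>))\<^sup>2 + (norm (Y \<omega>))\<^sup>2" by linarith
    then show "norm (norm (X \<omega>) * norm (Y \<omega>)) \<le> norm ((norm (X \<omega>))\<^sup>2 + (norm (Y \<omega>))\<^sup>2)"
      by simp
  qed
qed

text \<open>Cauchy-Schwarz from the quadratic polynomial \<open>quad\<close> in \<open>t\<close>:
  evaluated at its minimiser \<open>?B / ?C\<close> it gives the inequality, and if
  \<open>?C\<close> vanishes, an affine function bounded below has slope zero.\<close>

lemma integral_norm_mult_le:
  assumes X: "sq_int M X" and Y: "sq_int M Y"
  shows "(\<integral>\<omega>. norm (X \<omega>) * norm (Y \<omega>) \<partial>M) \<le> rms M X * rms M Y"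
proof -
  let ?A = "\<integral>\<omega>. (norm (X \<omega>))\<^sup>2 \<partial>M" and ?B = "\<integral>\<omega>. norm (X \<omega>) * norm (Y \<omega>) \<partial>M"
    and ?C = "\<integral>\<omega>. (norm (Y \<omega>))\<^sup>2 \<partial>M"
  note int = sq_intD(2)[OF X] sq_intD(2)[OF Y] integrable_norm_mult[OF X Y]
  have quad: "0 \<le> ?A - 2 * t * ?B + t\<^sup>2 * ?C" for t
  proof -
    have "0 \<le> (\<integral>\<omega>. (norm (X \<omega>) - t * norm (Y \<omega>))\<^sup>2 \<partial>M)" by simp
    also have "\<dots> = (\<integral>\<omega>. (norm (X \<omega>))\<^sup>2 - 2 * t * (norm (X \<omega>) * norm (Y \<omega>)) + t\<^sup>2 * (norm (Y \<omega>))\<^sup>2 \<partial>M)"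
      by (rule Bochner_Integration.integral_cong) (simp_all add: power2_diff power_mult_distrib)
    also have "\<dots> = ?A - 2 * t * ?B + t\<^sup>2 * ?C" using int by simp
    finally show ?thesis .
  qed
  have "?B\<^sup>2 \<le> ?A * ?C"
  proof (cases "?C = 0")
    case True
    have "?B = 0"
    proof (rule ccontr)
      assume "?B \<noteq> 0"
      \<comment> \<open>At this \<open>t\<close> the polynomial would equal
        \<open>-1\<close>.\<close>
      then show False using quad[of "(?A + 1) / (2 * ?B)"] True by (simp add: field_simps)
    qed
    then show ?thesis using True by simp
  next
    case False
    moreover have "0 \<le> ?C" by simp
    ultimately have "0 < ?C" by linarith
    have "?A - 2 * (?B / ?C) * ?B + (?B / ?C)\<^sup>2 * ?C = ?A - ?B\<^sup>2 / ?C"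
      using \<open>0 < ?C\<close> by (simp add: field_simps power2_eq_square)
    then have "?B\<^sup>2 / ?C \<le> ?A" using quad[of "?B / ?C"] by simp
    then show ?thesis using \<open>0 < ?C\<close> by (simp add: field_simps)
  qed
  then have "?B \<le> sqrt (?A * ?C)" by (intro real_le_rsqrt) simp
  then show ?thesis by (simp add: rms_def real_sqrt_mult)
qed

lemma integrable_inner_sq_int:
  assumes "sq_int M X" "sq_int M Y"
  shows "integrable M (\<lambda>\<omega>. inner (X \<omega>) (Y \<omega>))"
proof (rule Bochner_Integration.integrable_bound[OF integrable_norm_mult[OF assms]])
  show "(\<lambda>\<omega>. inner (X \<omega>) (Y \<omega>)) \<in> borel_measurable M"
    using sq_intD(1)[OF assms(1)] sq_intD(1)[OF assms(2)] by measurable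
qed (simp add: Cauchy_Schwarz_ineq2)

lemma integral_abs_inner_le:
  assumes "sq_int M X" "sq_int M Y"
  shows "(\<integral>\<omega>. \<bar>inner (X \<omega>) (Y \<omega>)\<bar> \<partial>M) \<le> rms M X * rms M Y"
proof -
  have "(\<integral>\<omega>. \<bar>inner (X \<omega>) (Y \<omega>)\<bar> \<partial>M) \<le> (\<integral>\<omega>. norm (X \<omega>) * norm (Y \<omega>) \<partial>M)"
    by (intro integral_mono integrable_norm_mult integrable_abs integrable_inner_sq_int assms Cauchy_Schwarz_ineq2)
  then show ?thesis using integral_norm_mult_le[OF assms] by linarith
qed

lemma abs_integral_inner_le:
  assumes "sq_int M X" "sq_int M Y"
  shows "\<bar>\<integral>\<omega>. inner (X \<omega>) (Y \<omega>) \<partial>M\<bar> \<le> rms M X * rms M Y"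
  using integral_abs_bound[of M "\<lambda>\<omega>. inner (X \<omega>) (Y \<omega>)"] integral_abs_inner_le[OF assms] by linarith

lemma sq_int_scaleR: "sq_int M X \<Longrightarrow> sq_int M (\<lambda>\<omega>. c *\<^sub>R X \<omega>)"
  by (auto simp: sq_int_def power_mult_distrib)

lemma sq_int_zero [simp]: "sq_int M (\<lambda>\<omega>. 0)"
  by (simp add: sq_int_def)

lemma sq_int_add:
  assumes "sq_int M X" "sq_int M Y"
  shows "sq_int M (\<lambda>\<omega>. X \<omega> + Y \<omega>)"
proof -
  have "(norm (X \<omega> + Y \<omega>))\<^sup>2 = (norm (X \<omega>))\<^sup>2 + 2 * inner (X \<omega>) (Y \<omega>) + (norm (Y \<omega>))\<^sup>2" for \<omega>
    unfolding power2_norm_eq_inner by (simp add: inner_add_left inner_add_right inner_commute)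
  then show ?thesis using assms integrable_inner_sq_int[OF assms]
    by (auto simp: sq_int_def intro: borel_measurable_add)
qed

lemma sq_int_diff: "sq_int M X \<Longrightarrow> sq_int M Y \<Longrightarrow> sq_int M (\<lambda>\<omega>. X \<omega> - Y \<omega>)"
  using sq_int_add[OF _ sq_int_scaleR[of M Y "-1"]] by fastforce

lemma sq_int_sum: "(\<And>i. i \<in> A \<Longrightarrow> sq_int M (X i)) \<Longrightarrow> sq_int M (\<lambda>\<omega>. \<Sum>i\<in>A. X i \<omega>)"
  by (induction A rule: infinite_finite_induct) (auto intro: sq_int_add)

lemma sq_int_bounded_linear:
  assumes R: "bounded_linear R" and X: "sq_int M X"
  shows "sq_int M (\<lambda>\<omega>. R (X \<omega>))"
proof -
  obtain K where K: "\<And>x. norm (R x) \<le> norm x * K" "K > 0" using bounded_linear.pos_bounded[OF R] by blast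
  have [measurable]: "R \<in> borel_measurable borel"
    by (intro borel_measurable_continuous_onI linear_continuous_on R)
  have [measurable]: "X \<in> borel_measurable M" using X by (rule sq_intD)
  have "integrable M (\<lambda>\<omega>. (norm (R (X \<omega>)))\<^sup>2)"
  proof (rule Bochner_Integration.integrable_bound)
    show "integrable M (\<lambda>\<omega>. K\<^sup>2 * (norm (X \<omega>))\<^sup>2)" using sq_intD(2)[OF X] by simp
    show "AE \<omega> in M. norm ((norm (R (X \<omega>)))\<^sup>2) \<le> norm (K\<^sup>2 * (norm (X \<omega>))\<^sup>2)"
      using power_mono[OF K(1) norm_ge_zero, of _ 2] by (intro AE_I2) (simp add: power_mult_distrib mult.commute)
  qed measurable
  then show ?thesis by (simp add: sq_int_def)
qed

lemma rms_add: "sq_int M X \<Longrightarrow> sq_int M Y \<Longrightarrow> rms M (\<lambda>\<omega>. X \<omega> + Y \<omega>) \<le> rms M X + rms M Y"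
proof -
  assume X: "sq_int M X" and Y: "sq_int M Y"
  have eq: "(norm (X \<omega> + Y \<omega>))\<^sup>2 = (norm (X \<omega>))\<^sup>2 + 2 * inner (X \<omega>) (Y \<omega>) + (norm (Y \<omega>))\<^sup>2" for \<omega>
    unfolding power2_norm_eq_inner by (simp add: inner_add_left inner_add_right inner_commute)
  have "(rms M (\<lambda>\<omega>. X \<omega> + Y \<omega>))\<^sup>2 = (rms M X)\<^sup>2 + 2 * (\<integral>\<omega>. inner (X \<omega>) (Y \<omega>) \<partial>M) + (rms M Y)\<^sup>2"
    unfolding rms_power2 eq using sq_intD[OF X] sq_intD[OF Y] integrable_inner_sq_int[OF X Y] by simp
  also have "\<dots> \<le> (rms M X + rms M Y)\<^sup>2"
    using abs_integral_inner_le[OF X Y] by (simp add: power2_sum)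
  finally show ?thesis by (rule power2_le_imp_le) simp
qed

lemma rms_scaleR: "rms M (\<lambda>\<omega>. c *\<^sub>R X \<omega>) = \<bar>c\<bar> * rms M X"
  by (simp add: rms_def power_mult_distrib real_sqrt_mult)

lemma rms_minus: "rms M (\<lambda>\<omega>. - X \<omega>) = rms M X"
  by (simp add: rms_def)

lemma rms_diff: "sq_int M X \<Longrightarrow> sq_int M Y \<Longrightarrow> rms M (\<lambda>\<omega>. X \<omega> - Y \<omega>) \<le> rms M X + rms M Y"
  using rms_add[of M X "\<lambda>\<omega>. - Y \<omega>"] sq_int_scaleR[of M Y "-1"] by (simp add: rms_minus)

lemma (in prob_space) sq_int_const [simp]: "sq_int M (\<lambda>\<omega>. c)"
  by (simp add: sq_int_def)

lemma (in prob_space) rms_const: "rms M (\<lambda>\<omega>. c) = norm c"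
  by (simp add: rms_def prob_space)

lemma (in prob_space) integrable_sq_int: "sq_int M X \<Longrightarrow> integrable M X"
proof -
  assume X: "sq_int M X"
  show ?thesis
  proof (rule Bochner_Integration.integrable_bound)
    show "integrable M (\<lambda>\<omega>. norm (X \<omega>) * norm (1::real))"
      by (rule integrable_norm_mult[OF X]) simp
  qed (use sq_intD(1)[OF X] in auto)
qed

lemma (in prob_space) integral_norm_le_rms: "sq_int M X \<Longrightarrow> (\<integral>\<omega>. norm (X \<omega>) \<partial>M) \<le> rms M X"
  using integral_norm_mult_le[of M X "\<lambda>_. 1::real"] by (simp add: rms_const)

lemma (in prob_space) norm_integral_le_rms: "sq_int M X \<Longrightarrow> norm (\<integral>\<omega>. X \<omega> \<partial>M) \<le> rms M X"
  using integral_norm_bound[of M X] integral_norm_le_rms[of X] by linarith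

lemma (in prob_space) sq_int_bounded:
  assumes "X \<in> borel_measurable M" "\<And>\<omega>. norm (X \<omega>) \<le> T"
  shows "sq_int M X" "rms M X \<le> T"
proof -
  have le: "(norm (X \<omega>))\<^sup>2 \<le> T\<^sup>2" for \<omega> using assms(2)[of \<omega>] by (intro power_mono) auto
  have "integrable M (\<lambda>\<omega>. (norm (X \<omega>))\<^sup>2)"
    by (rule integrable_const_bound[of _ "T\<^sup>2"]) (use assms le in auto)
  then show sq: "sq_int M X" using assms by (simp add: sq_int_def)
  have "0 \<le> T" using assms(2) norm_ge_zero order_trans by blast
  have "(rms M X)\<^sup>2 \<le> (\<integral>\<omega>. T\<^sup>2 \<partial>M)"
    unfolding rms_power2 by (rule integral_mono) (use sq_intD[OF sq] le in auto)
  then show "rms M X \<le> T" using \<open>0 \<le> T\<close> by (simp add: prob_space)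
qed

lemma (in prob_space) variance_le:
  assumes "sq_int M X"
  shows "(rms M (\<lambda>\<omega>. X \<omega> - (\<integral>\<omega>. X \<omega> \<partial>M)))\<^sup>2 = (rms M X)\<^sup>2 - (norm (\<integral>\<omega>. X \<omega> \<partial>M))\<^sup>2"
proof -
  let ?m = "\<integral>\<omega>. X \<omega> \<partial>M"
  have "(norm (X \<omega> - ?m))\<^sup>2 = (norm (X \<omega>))\<^sup>2 - 2 * inner ?m (X \<omega>) + (norm ?m)\<^sup>2" for \<omega>
    unfolding power2_norm_eq_inner by (simp add: inner_diff_left inner_diff_right inner_commute)
  then show ?thesis
    unfolding rms_power2 using integrable_sq_int[OF assms] sq_intD[OF assms]
    by (simp add: prob_space power2_norm_eq_inner)
qed

section \<open>Hilbert-Schmidt convergence of covariance operators\<close>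

text \<open>Dominated convergence for series whose majorant \<open>g m\<close> moves with
  \<open>m\<close>. Convergence of the total masses forces the tails of \<open>g m\<close> to
  approach the tail of \<open>G\<close>, which is small beyond a fixed index.\<close>

lemma suminf_tendsto_0_dominated:
  fixes f g :: "nat \<Rightarrow> nat \<Rightarrow> real"
  assumes le: "\<And>m i. \<bar>f m i\<bar> \<le> g m i" and f: "\<And>i. (\<lambda>m. f m i) \<longlonglongrightarrow> 0"
    and g: "\<And>i. (\<lambda>m. g m i) \<longlonglongrightarrow> G i" and sg: "\<And>m. summable (g m)" and sG: "summable G"
    and lim: "(\<lambda>m. \<Sum>i. g m i) \<longlonglongrightarrow> (\<Sum>i. G i)"
  shows "(\<lambda>m. \<Sum>i. f m i) \<longlonglongrightarrow> 0"
proof (rule metric_LIMSEQ_I)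
  fix \<epsilon> :: real assume "\<epsilon> > 0"
  have "(\<lambda>r. \<Sum>i<r. G i) \<longlonglongrightarrow> (\<Sum>i. G i)" using summable_LIMSEQ[OF sG] .
  then have "\<forall>\<^sub>F r in sequentially. (\<Sum>i. G i) - \<epsilon> < (\<Sum>i<r. G i)"
    by (rule order_tendstoD) (use \<open>\<epsilon> > 0\<close> in simp)
  then obtain r where r: "(\<Sum>i. G i) - \<epsilon> < (\<Sum>i<r. G i)" by (auto simp: eventually_sequentially)
  have "(\<lambda>m. (\<Sum>i<r. \<bar>f m i\<bar>) + ((\<Sum>i. g m i) - (\<Sum>i<r. g m i))) \<longlonglongrightarrow> (\<Sum>i<r. \<bar>0\<bar>) + ((\<Sum>i. G i) - (\<Sum>i<r. G i))"
    by (intro tendsto_intros f g lim)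
  then have "\<forall>\<^sub>F m in sequentially. (\<Sum>i<r. \<bar>f m i\<bar>) + ((\<Sum>i. g m i) - (\<Sum>i<r. g m i)) < \<epsilon>"
    by (rule order_tendstoD) (use r in simp)
  then obtain m0 where m0: "\<And>m. m \<ge> m0 \<Longrightarrow> (\<Sum>i<r. \<bar>f m i\<bar>) + ((\<Sum>i. g m i) - (\<Sum>i<r. g m i)) < \<epsilon>"
    by (auto simp: eventually_sequentially)
  have "dist (\<Sum>i. f m i) 0 < \<epsilon>" if "m \<ge> m0" for m
  proof -
    have sf: "summable (\<lambda>i. \<bar>f m i\<bar>)" by (rule summable_comparison_test'[OF sg[of m]]) (use le in auto)
    have "\<bar>\<Sum>i. f m i\<bar> \<le> (\<Sum>i. \<bar>f m i\<bar>)" by (rule summable_rabs[OF sf])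
    also have "\<dots> = (\<Sum>i. \<bar>f m (i + r)\<bar>) + (\<Sum>i<r. \<bar>f m i\<bar>)" by (rule suminf_split_initial_segment[OF sf])
    also have "(\<Sum>i. \<bar>f m (i + r)\<bar>) \<le> (\<Sum>i. g m (i + r))"
      using sf sg le by (intro suminf_le) (auto simp: summable_iff_shift[of "\<lambda>i. \<bar>f m i\<bar>"] summable_iff_shift[of "g m"])
    also have "(\<Sum>i. g m (i + r)) = (\<Sum>i. g m i) - (\<Sum>i<r. g m i)"
      by (rule suminf_minus_initial_segment[OF sg])
    finally show ?thesis using m0[OF that] by (simp add: dist_real_def)
  qed
  then show "\<exists>m0. \<forall>m\<ge>m0. dist (\<Sum>i. f m i) 0 < \<epsilon>" by blast
qed

lemma good_law_sq_int: "good_law \<mu> \<Longrightarrow> sq_int \<mu> (\<lambda>x. x)"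
  by (simp add: sq_int_def good_lawD good_law_borel)

context L2_basis begin

definition second_moment :: "L2 measure \<Rightarrow> nat \<Rightarrow> nat \<Rightarrow> real" where
  "second_moment \<mu> i l = (\<integral>x. inner x (e i) * inner x (e l) \<partial>\<mu>)"

definition total_moment :: "L2 measure \<Rightarrow> real" where
  "total_moment \<mu> = (\<integral>x. (norm x)\<^sup>2 \<partial>\<mu>)"

lemma sq_int_coordinate: "good_law \<mu> \<Longrightarrow> sq_int \<mu> (\<lambda>x. inner x (e i))"
  using sq_int_bounded_linear[OF bounded_linear_inner_left good_law_sq_int] .

lemma second_moment_le:
  assumes "good_law \<mu>"
  shows "(second_moment \<mu> i l)\<^sup>2 \<le> second_moment \<mu> i i * second_moment \<mu> l l"
proof -
  have "\<bar>second_moment \<mu> i l\<bar> \<le> rms \<mu> (\<lambda>x. inner x (e i)) * rms \<mu> (\<lambda>x. inner x (e l))"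
    unfolding second_moment_def
    using abs_integral_inner_le[OF sq_int_coordinate sq_int_coordinate, OF assms assms, of i l] by simp
  then have "\<bar>second_moment \<mu> i l\<bar>\<^sup>2 \<le> (rms \<mu> (\<lambda>x. inner x (e i)) * rms \<mu> (\<lambda>x. inner x (e l)))\<^sup>2"
    by (intro power_mono) auto
  then show ?thesis unfolding power_mult_distrib rms_power2 by (simp add: second_moment_def power2_eq_square)
qed

lemma second_moment_sums:
  assumes "good_law \<mu>"
  shows "(\<lambda>i. second_moment \<mu> i i) sums total_moment \<mu>"
proof -
  have "(\<lambda>r. (\<integral>x. (norm x)\<^sup>2 \<partial>\<mu>) - (\<Sum>i<r. second_moment \<mu> i i)) \<longlonglongrightarrow> 0"
    using tail_moment_tendsto[OF assms] integrable_tests[OF assms tests.prod] good_lawD(3)[OF assms]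
    by (simp add: second_moment_def power2_eq_square)
  from tendsto_diff[OF tendsto_const[of "\<integral>x. (norm x)\<^sup>2 \<partial>\<mu>"] this]
  show ?thesis by (simp add: sums_def total_moment_def)
qed

lemma inner_op_expectation:
  assumes "good_law \<mu>"
  shows "inner (op_expectation \<mu> (\<lambda>x. tensor x x) (e i)) (e l) = second_moment \<mu> i l"
proof -
  have "integrable \<mu> (\<lambda>x. inner x (e i) *\<^sub>R x)"
  proof (rule Bochner_Integration.integrable_bound[OF integrable_norm_mult[OF sq_int_coordinate[OF assms, of i] good_law_sq_int[OF assms]]])
    have [measurable]: "(\<lambda>x. x) \<in> borel_measurable \<mu>" by (rule good_law_borel[OF assms]) simp
    show "(\<lambda>x. inner x (e i) *\<^sub>R x) \<in> borel_measurable \<mu>" by measurable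
  qed simp
  then show ?thesis
    unfolding op_expectation_def tensor_def second_moment_def by (subst integral_inner_left[symmetric]) auto
qed

lemma norm_op_expectation:
  assumes \<mu>: "good_law \<mu>" and \<nu>: "good_law \<nu>"
  defines "D \<equiv> \<lambda>h. op_expectation \<mu> (\<lambda>x. tensor x x) h - op_expectation \<nu> (\<lambda>x. tensor x x) h"
  shows "(\<lambda>l. (second_moment \<mu> i l - second_moment \<nu> i l)\<^sup>2) sums (norm (D (e i)))\<^sup>2"
  using parseval[of "D (e i)"] unfolding D_def by (simp add: inner_diff_left inner_op_expectation \<mu> \<nu>)

text \<open>The squared Hilbert-Schmidt distance is the double sum of squared differences of matrix
  entries. Entries converge by the product tests; Cauchy-Schwarz dominates them by products of
  diagonal entries, whose sums are products of traces, and the traces converge by the test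
  \<open>(norm x)\<^sup>2\<close>. Dominated convergence is applied within a row and again over the
  rows.\<close>

theorem hs_norm_tendsto:
  assumes \<mu>: "conv_tests \<mu> N" and \<nu>: "conv_tests \<nu> N"
  shows "(\<lambda>m. hs_norm e (\<lambda>h. op_expectation (\<mu> m) (\<lambda>x. tensor x x) h - op_expectation (\<nu> m) (\<lambda>x. tensor x x) h)) \<longlonglongrightarrow> 0"
proof -
  note good = \<mu>[unfolded conv_tests_def, THEN conjunct1] \<mu>[unfolded conv_tests_def, THEN conjunct2, THEN conjunct1, rule_format]
    \<nu>[unfolded conv_tests_def, THEN conjunct2, THEN conjunct1, rule_format]
  let ?s = second_moment and ?t = total_moment
  have s_lim: "(\<lambda>m. ?s (\<mu> m) i l) \<longlonglongrightarrow> ?s N i l" "(\<lambda>m. ?s (\<nu> m) i l) \<longlonglongrightarrow> ?s N i l" for i l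
    using \<mu> \<nu> tests.prod unfolding conv_tests_def second_moment_def by blast+
  have t_lim: "(\<lambda>m. ?t (\<mu> m)) \<longlonglongrightarrow> ?t N" "(\<lambda>m. ?t (\<nu> m)) \<longlonglongrightarrow> ?t N"
    using \<mu> \<nu> tests.sq_norm unfolding conv_tests_def total_moment_def by blast+
  define D where "D m h = op_expectation (\<mu> m) (\<lambda>x. tensor x x) h - op_expectation (\<nu> m) (\<lambda>x. tensor x x) h" for m h
  define a where "a m i l = (?s (\<mu> m) i l - ?s (\<nu> m) i l)\<^sup>2" for m i l
  define b where "b m i l = 2 * ?s (\<mu> m) i i * ?s (\<mu> m) l l + 2 * ?s (\<nu> m) i i * ?s (\<nu> m) l l" for m i l
  define c where "c m i = 2 * ?s (\<mu> m) i i * ?t (\<mu> m) + 2 * ?s (\<nu> m) i i * ?t (\<nu> m)" for m i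
  have D_sums: "a m i sums (norm (D m (e i)))\<^sup>2" for m i
    unfolding a_def D_def by (rule norm_op_expectation) (rule good)+
  have ab: "\<bar>a m i l\<bar> \<le> b m i l" for m i l
  proof -
    have "a m i l \<le> 2 * (?s (\<mu> m) i l)\<^sup>2 + 2 * (?s (\<nu> m) i l)\<^sup>2"
      unfolding a_def using zero_le_power2[of "?s (\<mu> m) i l + ?s (\<nu> m) i l"] by (simp add: power2_sum power2_diff)
    also have "\<dots> \<le> b m i l"
      unfolding b_def using second_moment_le[OF good(2), of m i l] second_moment_le[OF good(3), of m i l] by linarith
    finally show ?thesis by (simp add: a_def)
  qed
  have b_sums: "b m i sums c m i" for m i
    unfolding b_def c_def by (intro sums_add sums_mult second_moment_sums good)
  have col: "(\<lambda>m. (norm (D m (e i)))\<^sup>2) \<longlonglongrightarrow> 0" for i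
  proof -
    have N4: "(\<lambda>l. 2 * ?s N i i * ?s N l l + 2 * ?s N i i * ?s N l l) sums (2 * ?s N i i * ?t N + 2 * ?s N i i * ?t N)"
      by (intro sums_add sums_mult second_moment_sums good)
    have "(\<lambda>m. \<Sum>l. a m i l) \<longlonglongrightarrow> 0"
    proof (rule suminf_tendsto_0_dominated[where g="\<lambda>m. b m i"])
      show "\<bar>a m i l\<bar> \<le> b m i l" for m l by (rule ab)
      show "(\<lambda>m. a m i l) \<longlonglongrightarrow> 0" for l
        unfolding a_def using tendsto_power[OF tendsto_diff[OF s_lim(1) s_lim(2)], of i l i l 2] by simp
      show "(\<lambda>m. b m i l) \<longlonglongrightarrow> 2 * ?s N i i * ?s N l l + 2 * ?s N i i * ?s N l l" for l
        unfolding b_def by (intro tendsto_intros s_lim)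
      show "summable (b m i)" for m using b_sums by (rule sums_summable)
      show "summable (\<lambda>l. 2 * ?s N i i * ?s N l l + 2 * ?s N i i * ?s N l l)" using N4 by (rule sums_summable)
      show "(\<lambda>m. \<Sum>l. b m i l) \<longlonglongrightarrow> (\<Sum>l. 2 * ?s N i i * ?s N l l + 2 * ?s N i i * ?s N l l)"
        unfolding sums_unique[OF b_sums, symmetric] sums_unique[OF N4, symmetric] c_def
        by (intro tendsto_intros s_lim t_lim)
    qed
    then show ?thesis by (simp add: sums_unique[OF D_sums, symmetric])
  qed
  have c_sums: "(\<lambda>i. c m i) sums (2 * (?t (\<mu> m) * ?t (\<mu> m)) + 2 * (?t (\<nu> m) * ?t (\<nu> m)))" for m
    unfolding c_def mult.assoc by (intro sums_add sums_mult sums_mult2 second_moment_sums good)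
  have N4: "(\<lambda>i. 2 * (?s N i i * ?t N) + 2 * (?s N i i * ?t N)) sums (2 * (?t N * ?t N) + 2 * (?t N * ?t N))"
    by (intro sums_add sums_mult sums_mult2 second_moment_sums good)
  have "(\<lambda>m. \<Sum>i. (norm (D m (e i)))\<^sup>2) \<longlonglongrightarrow> 0"
  proof (rule suminf_tendsto_0_dominated[where g=c])
    show "\<bar>(norm (D m (e i)))\<^sup>2\<bar> \<le> c m i" for m i
      using sums_le[OF _ D_sums[of m i] b_sums[of m i]] ab[of m i] by (simp add: abs_le_iff)
    show "(\<lambda>m. (norm (D m (e i)))\<^sup>2) \<longlonglongrightarrow> 0" for i by (rule col)
    show "(\<lambda>m. c m i) \<longlonglongrightarrow> 2 * (?s N i i * ?t N) + 2 * (?s N i i * ?t N)" for i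
      unfolding c_def mult.assoc by (intro tendsto_intros s_lim t_lim)
    show "summable (c m)" for m using c_sums by (rule sums_summable)
    show "summable (\<lambda>i. 2 * (?s N i i * ?t N) + 2 * (?s N i i * ?t N))" using N4 by (rule sums_summable)
    show "(\<lambda>m. \<Sum>i. c m i) \<longlonglongrightarrow> (\<Sum>i. 2 * (?s N i i * ?t N) + 2 * (?s N i i * ?t N))"
      unfolding sums_unique[OF c_sums, symmetric] sums_unique[OF N4, symmetric]
      by (intro tendsto_intros t_lim)
  qed
  from tendsto_real_sqrt[OF this] show ?thesis unfolding hs_norm_def D_def by simp
qed

end

section \<open>Independence and second moments\<close>

lemma (in prob_space) indep_vars_pair:
  assumes "indep_vars M' X I" "i \<in> I" "j \<in> I" "i \<noteq> j"
  shows "indep_var (M' i) (X i) (M' j) (X j)"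
proof -
  have "indep_var (M' i) ((\<lambda>f. f i) \<circ> (\<lambda>\<omega>. restrict (\<lambda>i. X i \<omega>) {i})) (M' j) ((\<lambda>f. f j) \<circ> (\<lambda>\<omega>. restrict (\<lambda>i. X i \<omega>) {j}))"
    by (rule indep_var_compose[OF indep_var_restrict[OF assms(1)]]) (use assms in auto)
  then show ?thesis by (simp add: comp_def)
qed

text \<open>Fubini on the product of the two marginal laws: integrating one variable at a time pulls
  the means out of the inner product.\<close>

lemma (in prob_space) indep_integral_inner:
  fixes X Z :: "'a \<Rightarrow> 'b::{real_inner, banach, second_countable_topology}"
  assumes indep: "indep_var borel X borel Z" and X: "sq_int M X" and Z: "sq_int M Z"
  shows "(\<integral>\<omega>. inner (X \<omega>) (Z \<omega>) \<partial>M) = inner (\<integral>\<omega>. X \<omega> \<partial>M) (\<integral>\<omega>. Z \<omega> \<partial>M)"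
proof -
  have [measurable]: "X \<in> borel_measurable M" "Z \<in> borel_measurable M" using X Z by (auto simp: sq_int_def)
  let ?P = "distr M borel X" and ?Q = "distr M borel Z" and ?f = "\<lambda>(x :: 'b, z :: 'b). inner x z"
  interpret P: prob_space ?P by (rule prob_space_distr) simp
  interpret Q: prob_space ?Q by (rule prob_space_distr) simp
  interpret PQ: pair_prob_space ?P ?Q ..
  have joint: "distr M (borel \<Otimes>\<^sub>M borel) (\<lambda>\<omega>. (X \<omega>, Z \<omega>)) = ?P \<Otimes>\<^sub>M ?Q"
    using indep by (simp add: indep_var_distribution_eq)
  have f [measurable]: "?f \<in> borel_measurable (borel \<Otimes>\<^sub>M borel)"
    unfolding split_beta' by (intro borel_measurable_inner measurable_fst measurable_snd)
  have "integrable (distr M (borel \<Otimes>\<^sub>M borel) (\<lambda>\<omega>. (X \<omega>, Z \<omega>))) ?f"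
    using integrable_inner_sq_int[OF X Z] by (subst integrable_distr_eq) auto
  then have int: "integrable (?P \<Otimes>\<^sub>M ?Q) ?f" unfolding joint .
  have intZ: "integrable ?Q (\<lambda>z. z)" and intX: "integrable ?P (\<lambda>x. x)"
    using integrable_sq_int[OF Z] integrable_sq_int[OF X] by (auto simp: integrable_distr_eq)
  have "(\<integral>\<omega>. inner (X \<omega>) (Z \<omega>) \<partial>M) = integral\<^sup>L (distr M (borel \<Otimes>\<^sub>M borel) (\<lambda>\<omega>. (X \<omega>, Z \<omega>))) ?f"
    by (subst integral_distr) auto
  also have "\<dots> = (\<integral>x. (\<integral>z. inner x z \<partial>?Q) \<partial>?P)"
    unfolding joint using PQ.integral_fst'[OF int] by simp
  also have "\<dots> = (\<integral>x. inner x (\<integral>z. z \<partial>?Q) \<partial>?P)" using intZ by simp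
  also have "\<dots> = inner (\<integral>x. x \<partial>?P) (\<integral>z. z \<partial>?Q)" using intX by simp
  also have "\<dots> = inner (\<integral>\<omega>. X \<omega> \<partial>M) (\<integral>\<omega>. Z \<omega> \<partial>M)" by (simp add: integral_distr)
  finally show ?thesis .
qed

lemma borel_measurable_bounded_linear: "bounded_linear R \<Longrightarrow> R \<in> borel_measurable borel"
  by (intro borel_measurable_continuous_onI linear_continuous_on)

text \<open>Mixed terms vanish by independence and zero means. The operator \<open>R\<close> lets
  the same statement serve for squared norms and for squared linear functionals.\<close>

lemma (in prob_space) indep_sum_second_moment:
  fixes X :: "'i \<Rightarrow> 'a \<Rightarrow> 'b::{real_inner, banach, second_countable_topology}"
  assumes R: "bounded_linear R" and indep: "indep_vars (\<lambda>_. borel) X A" and "finite A"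
    and sq: "\<And>i. i \<in> A \<Longrightarrow> sq_int M (X i)" and mean: "\<And>i. i \<in> A \<Longrightarrow> (\<integral>\<omega>. X i \<omega> \<partial>M) = 0"
  shows "(\<integral>\<omega>. inner (R (\<Sum>i\<in>A. X i \<omega>)) (\<Sum>i\<in>A. X i \<omega>) \<partial>M) = (\<Sum>i\<in>A. \<integral>\<omega>. inner (R (X i \<omega>)) (X i \<omega>) \<partial>M)"
proof -
  have int: "integrable M (\<lambda>\<omega>. inner (R (X i \<omega>)) (X j \<omega>))" if "i \<in> A" "j \<in> A" for i j
    by (intro integrable_inner_sq_int sq_int_bounded_linear[OF R] sq that)
  have zero: "(\<integral>\<omega>. inner (R (X i \<omega>)) (X j \<omega>) \<partial>M) = 0" if ij: "i \<in> A" "j \<in> A" "i \<noteq> j" for i j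
  proof -
    have "indep_var borel (R \<circ> X i) borel (id \<circ> X j)"
      using indep_vars_pair[OF indep ij] by (rule indep_var_compose) (auto intro: borel_measurable_bounded_linear[OF R])
    then have "indep_var borel (\<lambda>\<omega>. R (X i \<omega>)) borel (X j)" by (simp add: comp_def)
    from indep_integral_inner[OF this] show ?thesis
      using ij by (simp add: sq_int_bounded_linear[OF R] sq mean)
  qed
  have "(\<integral>\<omega>. inner (R (\<Sum>i\<in>A. X i \<omega>)) (\<Sum>i\<in>A. X i \<omega>) \<partial>M)
      = (\<integral>\<omega>. (\<Sum>i\<in>A. \<Sum>j\<in>A. inner (R (X i \<omega>)) (X j \<omega>)) \<partial>M)"
    unfolding linear_sum[OF bounded_linear.linear[OF R]] inner_sum_left unfolding inner_sum_right ..
  also have "\<dots> = (\<Sum>i\<in>A. \<Sum>j\<in>A. \<integral>\<omega>. inner (R (X i \<omega>)) (X j \<omega>) \<partial>M)"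
    using int by (simp add: Bochner_Integration.integrable_sum)
  also have "\<dots> = (\<Sum>i\<in>A. \<Sum>j\<in>A. if j = i then (\<integral>\<omega>. inner (R (X i \<omega>)) (X i \<omega>) \<partial>M) else 0)"
    by (intro sum.cong refl) (auto simp: zero)
  also have "\<dots> = (\<Sum>i\<in>A. \<integral>\<omega>. inner (R (X i \<omega>)) (X i \<omega>) \<partial>M)" using \<open>finite A\<close> by simp
  finally show ?thesis .
qed

section \<open>Gaussian approximation for sums of small independent variables\<close>

lemma exp_minus_quadratic_bound:
  fixes y :: real
  assumes "0 \<le> y"
  shows "\<bar>exp (- y) - (1 - y)\<bar> \<le> y\<^sup>2 / 2"
proof -
  have "1 - y \<le> exp (- y)" using exp_ge_add_one_self[of "- y"] by simp
  moreover have "exp (- y) \<le> 1 - y + y\<^sup>2 / 2"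
  proof -
    have pos: "0 < 1 + y + y\<^sup>2 / 2" using assms by (simp add: add_pos_nonneg)
    have "exp (- y) = 1 / exp y" by (simp add: exp_minus inverse_eq_divide)
    also have "\<dots> \<le> 1 / (1 + y + y\<^sup>2 / 2)"
      using exp_lower_Taylor_quadratic[OF assms] pos by (intro divide_left_mono) auto
    also have "\<dots> \<le> 1 - y + y\<^sup>2 / 2"
    proof -
      \<comment> \<open>The two quadratics multiply to \<open>1\<close> plus a fourth power, so each
        bounds the reciprocal of the other from above.\<close>
      have "(1 - y + y\<^sup>2 / 2) * (1 + y + y\<^sup>2 / 2) = 1 + (y\<^sup>2)\<^sup>2 / 4"
        by (simp add: field_simps power2_eq_square)
      moreover have "0 \<le> (y\<^sup>2)\<^sup>2" by (rule zero_le_power2)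
      ultimately have "1 \<le> (1 - y + y\<^sup>2 / 2) * (1 + y + y\<^sup>2 / 2)" by linarith
      then show ?thesis using pos by (simp add: divide_le_eq)
    qed
    finally show ?thesis .
  qed
  ultimately show ?thesis by (simp add: abs_le_iff)
qed

text \<open>Lindeberg's replacement with explicit constants. The Taylor remainder of each
  characteristic function is at most \<open>\<beta> / 6\<close> times the variance because the third
  moment is at most \<open>\<beta>\<close> times the second; the remainder of the exponential is at
  most \<open>\<beta>\<^sup>2 / 8\<close> times the variance because the variance is at most
  \<open>\<beta>\<^sup>2\<close>. Factors of modulus at most one let the errors add up over the
  product.\<close>

lemma (in prob_space) char_sum_indep_bounded:
  fixes \<zeta> :: "'i \<Rightarrow> 'a \<Rightarrow> real"
  assumes "finite A" and indep: "indep_vars (\<lambda>_. borel) \<zeta> A"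
    and bound: "\<And>i \<omega>. i \<in> A \<Longrightarrow> \<bar>\<zeta> i \<omega>\<bar> \<le> \<beta>" and mean: "\<And>i. i \<in> A \<Longrightarrow> expectation (\<zeta> i) = 0"
  defines "s2 \<equiv> \<Sum>i\<in>A. expectation (\<lambda>\<omega>. (\<zeta> i \<omega>)\<^sup>2)"
  shows "cmod ((CLINT \<omega>|M. iexp (\<Sum>i\<in>A. \<zeta> i \<omega>)) - complex_of_real (exp (- s2 / 2))) \<le> (\<beta> / 6 + \<beta>\<^sup>2 / 8) * s2"
proof -
  have rv [measurable]: "\<zeta> i \<in> borel_measurable M" if "i \<in> A" for i
    using indep that by (auto simp: indep_vars_def2)
  have le: "\<bar>(\<zeta> i \<omega>)\<^sup>2\<bar> \<le> \<beta>\<^sup>2" if "i \<in> A" for i \<omega>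
    using power_mono[OF bound[OF that, of \<omega>] abs_ge_zero, of 2] by simp
  have int: "integrable M (\<zeta> i)" "integrable M (\<lambda>\<omega>. (\<zeta> i \<omega>)\<^sup>2)" if "i \<in> A" for i
    by (rule integrable_const_bound[of _ \<beta>], use bound that in auto)
       (rule integrable_const_bound[of _ "\<beta>\<^sup>2"], use le that in auto)
  define \<sigma> where "\<sigma> i = expectation (\<lambda>\<omega>. (\<zeta> i \<omega>)\<^sup>2)" for i
  have \<sigma>0: "0 \<le> \<sigma> i" for i unfolding \<sigma>_def by simp
  define \<phi> where "\<phi> i = char (distr M borel (\<zeta> i)) 1" for i
  have one: "cmod (\<phi> i - complex_of_real (exp (- \<sigma> i / 2))) \<le> (\<beta> / 6 + \<beta>\<^sup>2 / 8) * \<sigma> i" if i: "i \<in> A" for i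
  proof -
    note [measurable] = rv[OF i]
    have "\<sigma> i \<le> expectation (\<lambda>_. \<beta>\<^sup>2)"
      unfolding \<sigma>_def using le[OF i] int[OF i] by (intro integral_mono) (auto simp: abs_le_iff)
    then have \<sigma>\<beta>: "\<sigma> i \<le> \<beta>\<^sup>2" by (simp add: prob_space)
    have "cmod (\<phi> i - (1 - 1\<^sup>2 * \<sigma> i / 2)) \<le> (1\<^sup>2 / 6) * expectation (\<lambda>x. min (6 * (\<zeta> i x)\<^sup>2) (\<bar>1\<bar> * \<bar>\<zeta> i x\<bar>^3))"
      unfolding \<phi>_def using int[OF i] mean[OF i] by (intro char_approx3') (auto simp: \<sigma>_def)
    also have "\<dots> \<le> (1\<^sup>2 / 6) * expectation (\<lambda>x. \<beta> * (\<zeta> i x)\<^sup>2)"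
    proof (intro mult_left_mono integral_mono)
      show "integrable M (\<lambda>x. min (6 * (\<zeta> i x)\<^sup>2) (\<bar>1\<bar> * \<bar>\<zeta> i x\<bar>^3))"
        by (rule Bochner_Integration.integrable_bound[of _ "\<lambda>x. 6 * (\<zeta> i x)\<^sup>2"]) (use int[OF i] in \<open>auto simp: min_def\<close>)
      show "min (6 * (\<zeta> i x)\<^sup>2) (\<bar>1\<bar> * \<bar>\<zeta> i x\<bar>^3) \<le> \<beta> * (\<zeta> i x)\<^sup>2" for x
      proof -
        have "\<bar>\<zeta> i x\<bar> * \<bar>\<zeta> i x\<bar>\<^sup>2 \<le> \<beta> * \<bar>\<zeta> i x\<bar>\<^sup>2" using bound[OF i, of x] by (rule mult_right_mono) simp
        then show ?thesis by (simp add: power3_eq_cube power2_eq_square min.coboundedI2)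
      qed
    qed (use int[OF i] in auto)
    also have "\<dots> = \<beta> / 6 * \<sigma> i" by (simp add: \<sigma>_def)
    finally have 1: "cmod (\<phi> i - complex_of_real (1 - \<sigma> i / 2)) \<le> \<beta> / 6 * \<sigma> i" by simp
    have "\<bar>exp (- (\<sigma> i / 2)) - (1 - \<sigma> i / 2)\<bar> \<le> (\<sigma> i / 2)\<^sup>2 / 2"
      using \<sigma>0[of i] by (intro exp_minus_quadratic_bound) simp
    also have "\<dots> = \<sigma> i / 8 * \<sigma> i" by (simp add: power2_eq_square)
    also have "\<dots> \<le> \<beta>\<^sup>2 / 8 * \<sigma> i" using \<sigma>\<beta> \<sigma>0[of i] by (intro mult_right_mono) auto
    finally have "\<bar>exp (- (\<sigma> i / 2)) - (1 - \<sigma> i / 2)\<bar> \<le> \<beta>\<^sup>2 / 8 * \<sigma> i" .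
    then have 2: "cmod (complex_of_real (1 - \<sigma> i / 2) - complex_of_real (exp (- \<sigma> i / 2))) \<le> \<beta>\<^sup>2 / 8 * \<sigma> i"
      unfolding of_real_diff[symmetric] norm_of_real by (simp add: abs_minus_commute)
    show ?thesis using norm_triangle_le[OF add_mono[OF 1 2]] by (simp add: distrib_right)
  qed
  have "(CLINT \<omega>|M. iexp (\<Sum>i\<in>A. \<zeta> i \<omega>)) = char (distr M borel (\<lambda>\<omega>. \<Sum>i\<in>A. \<zeta> i \<omega>)) 1"
    unfolding char_def by (subst integral_distr) auto
  also have "\<dots> = (\<Prod>i\<in>A. \<phi> i)" unfolding \<phi>_def by (rule char_distr_sum[OF indep])
  finally have L: "(CLINT \<omega>|M. iexp (\<Sum>i\<in>A. \<zeta> i \<omega>)) = (\<Prod>i\<in>A. \<phi> i)" .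
  have Rr: "complex_of_real (exp (- s2 / 2)) = (\<Prod>i\<in>A. complex_of_real (exp (- \<sigma> i / 2)))"
    unfolding s2_def \<sigma>_def[symmetric] using \<open>finite A\<close>
    by (simp add: exp_sum[symmetric] sum_divide_distrib sum_negf flip: of_real_prod)
  have "cmod ((\<Prod>i\<in>A. \<phi> i) - (\<Prod>i\<in>A. complex_of_real (exp (- \<sigma> i / 2)))) \<le> (\<Sum>i\<in>A. cmod (\<phi> i - complex_of_real (exp (- \<sigma> i / 2))))"
  proof (rule norm_prod_diff)
    fix i assume i: "i \<in> A"
    interpret D: real_distribution "distr M borel (\<zeta> i)" using rv[OF i] by simp
    show "cmod (\<phi> i) \<le> 1" unfolding \<phi>_def by (rule D.cmod_char_le_1)
    show "cmod (complex_of_real (exp (- \<sigma> i / 2))) \<le> 1" using \<sigma>0[of i] by simp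
  qed
  also have "\<dots> \<le> (\<Sum>i\<in>A. (\<beta> / 6 + \<beta>\<^sup>2 / 8) * \<sigma> i)" by (intro sum_mono one)
  also have "\<dots> = (\<beta> / 6 + \<beta>\<^sup>2 / 8) * s2" by (simp add: s2_def \<sigma>_def sum_distrib_left)
  finally show ?thesis unfolding L Rr .
qed

section \<open>Gaussian laws with prescribed covariance\<close>

definition quad_form :: "nat \<Rightarrow> (nat \<Rightarrow> real) \<Rightarrow> (nat \<Rightarrow> nat \<Rightarrow> real) \<Rightarrow> real" where
  "quad_form r a c = (\<Sum>i<r. \<Sum>l<r. a i * a l * c i l)"

definition psd :: "(nat \<Rightarrow> nat \<Rightarrow> real) \<Rightarrow> bool" where
  "psd c \<longleftrightarrow> (\<forall>i l. c i l = c l i) \<and> (\<forall>r a. 0 \<le> quad_form r a c)"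

text \<open>One step of the Cholesky algorithm; division by a vanishing pivot gives 0, which is the right value.\<close>

definition schur :: "nat \<Rightarrow> (nat \<Rightarrow> nat \<Rightarrow> real) \<Rightarrow> nat \<Rightarrow> nat \<Rightarrow> real" where
  "schur j c = (\<lambda>i m. c i m - c i j * c j m / c j j)"

lemma quad_form_extend:
  assumes "r \<le> r'"
  shows "quad_form r a c = quad_form r' (\<lambda>i. if i < r then a i else 0) c"
proof -
  have "quad_form r' (\<lambda>i. if i < r then a i else 0) c = (\<Sum>i<r'. \<Sum>l<r'. if i < r then (if l < r then a i * a l * c i l else 0) else 0)"
    unfolding quad_form_def by (intro sum.cong refl) auto
  also have "\<dots> = (\<Sum>i<r'. if i < r then (\<Sum>l<r'. if l < r then a i * a l * c i l else 0) else 0)"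
    by (intro sum.cong refl) auto
  also have "\<dots> = (\<Sum>i\<in>{..<r'} \<inter> {..<r}. \<Sum>l\<in>{..<r'} \<inter> {..<r}. a i * a l * c i l)"
    by (simp add: sum.inter_restrict)
  also have "{..<r'} \<inter> {..<r} = {..<r}" using assms by auto
  finally show ?thesis by (simp add: quad_form_def)
qed

text \<open>Changing one coefficient makes the form a quadratic polynomial in \<open>t\<close>; its
  nonnegativity is the source of the facts about pivots.\<close>

lemma quad_form_shift:
  assumes sym: "\<And>i l. c i l = c l i" and "j < r"
  shows "quad_form r (\<lambda>i. a i + (if i = j then t else 0)) c
    = quad_form r a c + 2 * t * (\<Sum>i<r. a i * c i j) + t\<^sup>2 * c j j"
proof -
  have "quad_form r (\<lambda>i. a i + (if i = j then t else 0)) c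
      = (\<Sum>i<r. \<Sum>l<r. a i * a l * c i l + (if l = j then a i * t * c i j else 0)
          + (if i = j then t * a l * c j l + (if l = j then t * t * c j j else 0) else 0))"
    unfolding quad_form_def by (intro sum.cong refl) (auto simp: algebra_simps)
  also have "\<dots> = quad_form r a c + (\<Sum>i<r. a i * t * c i j) + (\<Sum>l<r. t * a l * c j l) + t * t * c j j"
    unfolding quad_form_def using \<open>j < r\<close>
    by (simp add: sum.distrib if_distrib[where f="\<lambda>x. sum x _"] sum.delta
        sum.swap[of "\<lambda>i l. if i = j then _ i l else _"] cong: if_cong)
  also have "(\<Sum>i<r. a i * t * c i j) = t * (\<Sum>i<r. a i * c i j)" by (simp add: sum_distrib_left mult_ac)
  also have "(\<Sum>l<r. t * a l * c j l) = t * (\<Sum>i<r. a i * c i j)"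
    by (simp add: sum_distrib_left mult_ac sym[of j])
  finally show ?thesis by (simp add: power2_eq_square)
qed

text \<open>With a zero on the diagonal the form is affine in the coefficient of \<open>j\<close>,
  so a nonzero entry in that column would make it negative somewhere.\<close>

lemma psd_zero_pivot:
  assumes "psd c" "c j j = 0"
  shows "c i j = 0"
proof (rule ccontr)
  assume "c i j \<noteq> 0"
  then have "i \<noteq> j" using assms by auto
  let ?r = "Suc (max i j)" and ?a = "\<lambda>l. if l = i then 1 else 0 :: real"
  have sym: "\<And>i l. c i l = c l i" using assms by (simp add: psd_def)
  have q: "quad_form ?r ?a c = c i i"
    unfolding quad_form_def
    by (subst sum.cong[OF refl, where h="\<lambda>i'. if i' = i then c i i else 0"])
       (auto simp: if_distrib[where f="\<lambda>x. x * _"] cong: if_cong)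
  have s: "(\<Sum>l<?r. ?a l * c l j) = c i j" by (simp add: if_distrib[where f="\<lambda>x. x * _"] cong: if_cong)
  \<comment> \<open>Chosen so that the form takes the value \<open>-1\<close>.\<close>
  define t where "t = - (c i i + 1) / (2 * c i j)"
  have "0 \<le> quad_form ?r (\<lambda>l. ?a l + (if l = j then t else 0)) c" using assms by (simp add: psd_def)
  also have "\<dots> = c i i + 2 * t * c i j" by (subst quad_form_shift[OF sym]) (use assms(2) q s in auto)
  also have "\<dots> = - 1" using \<open>c i j \<noteq> 0\<close> by (simp add: t_def field_simps)
  finally show False by simp
qed

text \<open>Completing the square: the form of the Schur complement at \<open>a\<close> is the
  original form with the coefficient of \<open>j\<close> moved to its minimiser. With a zero pivot,
  the convention for division makes both the correction and the move vanish.\<close>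

lemma psd_schur:
  assumes c: "psd c"
  shows "psd (schur j c)"
  unfolding psd_def
proof (intro conjI allI)
  have sym: "\<And>i l. c i l = c l i" using c by (simp add: psd_def)
  show "schur j c i l = schur j c l i" for i l by (simp add: schur_def sym[of i l] sym[of i j] sym[of l j])
  fix r :: nat and a :: "nat \<Rightarrow> real"
  \<comment> \<open>The index \<open>j\<close> has to lie in the range of the form so that its
    coefficient can be moved, even when \<open>r \<le> j\<close>.\<close>
  define r' where "r' = max r (Suc j)"
  define a' where "a' = (\<lambda>i. if i < r then a i else 0)"
  define s where "s = (\<Sum>i<r'. a' i * c i j)"
  have "quad_form r' a' (schur j c) = quad_form r' a' c - s * s / c j j"
  proof -
    have "quad_form r' a' (schur j c) = (\<Sum>i<r'. \<Sum>l<r'. a' i * a' l * c i l - (a' i * c i j) * (a' l * c l j) / c j j)"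
      unfolding quad_form_def schur_def
    proof (intro sum.cong refl)
      fix i l
      show "a' i * a' l * (c i l - c i j * c j l / c j j) = a' i * a' l * c i l - (a' i * c i j) * (a' l * c l j) / c j j"
        by (simp add: sym[of j l] algebra_simps)
    qed
    also have "\<dots> = quad_form r' a' c - s * s / c j j"
      unfolding quad_form_def s_def sum_product
      by (simp add: sum_subtractf sum_divide_distrib)
    finally show ?thesis .
  qed
  also have "\<dots> = quad_form r' (\<lambda>i. a' i + (if i = j then - s / c j j else 0)) c"
  proof (cases "c j j = 0")
    case True
    then show ?thesis by (simp cong: if_cong)
  next
    case False
    then show ?thesis
      by (subst quad_form_shift[OF sym])
         (auto simp: r'_def s_def[symmetric, unfolded r'_def] field_simps power2_eq_square)
  qed
  also have "0 \<le> \<dots>" using c by (simp add: psd_def)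
  finally show "0 \<le> quad_form r a (schur j c)"
    using quad_form_extend[of r r' a "schur j c"] by (simp add: a'_def r'_def)
qed

primrec schur_iter :: "(nat \<Rightarrow> nat \<Rightarrow> real) \<Rightarrow> nat \<Rightarrow> nat \<Rightarrow> nat \<Rightarrow> real" where
  "schur_iter c 0 = c"
| "schur_iter c (Suc j) = schur j (schur_iter c j)"

lemma psd_schur_iter: "psd c \<Longrightarrow> psd (schur_iter c j)"
  by (induction j) (simp_all add: psd_schur)

text \<open>Each step clears row \<open>j\<close>, by cancellation for a nonzero pivot and by
  \<open>psd_zero_pivot\<close> otherwise, and leaves cleared rows at zero.\<close>

lemma schur_iter_zero: "psd c \<Longrightarrow> i < j \<Longrightarrow> schur_iter c j i m = 0"
proof (induction j arbitrary: i m)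
  case (Suc j)
  let ?C = "schur_iter c j"
  have p: "psd ?C" using Suc by (simp add: psd_schur_iter)
  have sym: "?C i l = ?C l i" for i l using p by (simp add: psd_def)
  show ?case
  proof (cases "i = j")
    case True
    show ?thesis
    proof (cases "?C j j = 0")
      case True
      from psd_zero_pivot[OF p this, of m] show ?thesis using \<open>i = j\<close> by (simp add: schur_def sym[of j m])
    qed (simp add: schur_def \<open>i = j\<close>)
  next
    case False
    then have "i < j" using Suc.prems by simp
    from Suc.IH[OF Suc.prems(1) this] show ?thesis by (simp add: schur_def)
  qed
qed simp

text \<open>Every step subtracts the rank-one matrix formed by one column of the factor, so the sums
  telescope; the remainder is zero in the rows already cleared.\<close>

lemma psd_cholesky:
  assumes c: "psd c"
  shows "\<exists>l :: nat \<Rightarrow> nat \<Rightarrow> real. (\<forall>i j. i < j \<longrightarrow> l i j = 0) \<and>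
    (\<forall>i m J. i < J \<longrightarrow> c i m = (\<Sum>j<J. l i j * l m j))"
proof -
  define l where "l i j = schur_iter c j i j / sqrt (schur_iter c j j j)" for i j
  have tele: "c i m = (\<Sum>j<J. l i j * l m j) + schur_iter c J i m" for i m J
  proof (induction J)
    case (Suc J)
    let ?C = "schur_iter c J"
    have p: "psd ?C" by (rule psd_schur_iter[OF c])
    have sym: "?C i l = ?C l i" for i l using p by (simp add: psd_def)
    have "0 \<le> quad_form (Suc J) (\<lambda>i. if i = J then 1 else 0) ?C" using p by (simp add: psd_def)
    also have "\<dots> = ?C J J"
      unfolding quad_form_def
      by (subst sum.cong[OF refl, where h="\<lambda>i'. if i' = J then ?C J J else 0"])
         (auto simp: if_distrib[where f="\<lambda>x. x * _"] cong: if_cong)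
    finally have "l i J * l m J = ?C i J * ?C J m / ?C J J"
      by (simp add: l_def sym[of m J])
    then show ?case using Suc by (simp add: schur_def)
  qed simp
  have 1: "l i j = 0" if "i < j" for i j unfolding l_def schur_iter_zero[OF c that] by simp
  have 2: "c i m = (\<Sum>j<J. l i j * l m j)" if "i < J" for i m J
    using tele[of i m J] unfolding schur_iter_zero[OF c that, of m] by (simp only: add_0_right)
  show ?thesis
  proof (intro exI[of _ l] conjI allI impI)
    show "i < j \<Longrightarrow> l i j = 0" for i j by (rule 1)
    show "i < J \<Longrightarrow> c i m = (\<Sum>j<J. l i j * l m j)" for i m J by (rule 2)
  qed
qed

context L2_basis begin

text \<open>Riesz-Fischer: by Pythagoras the partial sums are Cauchy exactly when those of the
  squares are.\<close>

lemma orthogonal_series: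
  assumes "summable (\<lambda>i. (g i)\<^sup>2)"
  shows "summable (\<lambda>i. g i *\<^sub>R e i)" "inner (\<Sum>i. g i *\<^sub>R e i) (e k) = g k"
proof -
  have pyth: "(norm (\<Sum>i=m..<n. g i *\<^sub>R e i))\<^sup>2 = (\<Sum>i=m..<n. (g i)\<^sup>2)" for m n
  proof -
    have "inner (\<Sum>i=m..<n. g i *\<^sub>R e i) (\<Sum>i=m..<n. g i *\<^sub>R e i) = (\<Sum>i=m..<n. \<Sum>j=m..<n. if j = i then (g i)\<^sup>2 else 0)"
      unfolding inner_sum_left inner_sum_right by (intro sum.cong refl) (auto simp: inner_basis power2_eq_square)
    then show ?thesis by (simp add: power2_norm_eq_inner)
  qed
  show s: "summable (\<lambda>i. g i *\<^sub>R e i)"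
    unfolding summable_Cauchy
  proof (intro allI impI)
    fix \<epsilon> :: real assume "\<epsilon> > 0"
    then have "\<epsilon>\<^sup>2 > 0" by simp
    then obtain m0 where m0: "\<And>m n. m \<ge> m0 \<Longrightarrow> norm (\<Sum>i=m..<n. (g i)\<^sup>2) < \<epsilon>\<^sup>2"
      using assms unfolding summable_Cauchy by blast
    have "norm (\<Sum>i=m..<n. g i *\<^sub>R e i) < \<epsilon>" if "m \<ge> m0" for m n
    proof (rule power2_less_imp_less)
      show "(norm (\<Sum>i=m..<n. g i *\<^sub>R e i))\<^sup>2 < \<epsilon>\<^sup>2"
        unfolding pyth using m0[OF that, of n] abs_ge_self[of "\<Sum>i=m..<n. (g i)\<^sup>2"] unfolding real_norm_def by linarith
    qed (use \<open>\<epsilon> > 0\<close> in simp)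
    then show "\<exists>N. \<forall>m\<ge>N. \<forall>n. norm (\<Sum>i=m..<n. g i *\<^sub>R e i) < \<epsilon>" by blast
  qed
  have "(\<lambda>i. inner (g i *\<^sub>R e i) (e k)) sums inner (\<Sum>i. g i *\<^sub>R e i) (e k)"
    by (rule bounded_linear.sums[OF bounded_linear_inner_left summable_sums[OF s]])
  moreover have "(\<lambda>i. inner (g i *\<^sub>R e i) (e k)) = (\<lambda>i. if i = k then g k else 0)"
    by (auto simp: inner_basis)
  ultimately have "(\<lambda>i. if i = k then g k else 0) sums inner (\<Sum>i. g i *\<^sub>R e i) (e k)" by simp
  from sums_unique2[OF this sums_single[of k "\<lambda>_. g k"]]
  show "inner (\<Sum>i. g i *\<^sub>R e i) (e k) = g k" .
qed

text \<open>The coordinates are the rows of the Cholesky factor applied to a sequence of independent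
  standard normals; triangularity makes each a finite sum. A summable diagonal gives the squared
  coordinates a finite expected sum, so almost surely they are the Fourier coefficients of an
  element of \<open>L2\<close>.\<close>

theorem gaussian_law_exists:
  assumes c: "psd c" and sum: "summable (\<lambda>i. c i i)"
  obtains N where "good_law N" "\<And>i m. second_moment N i m = c i m"
    "\<And>r a. (CLINT x|N. iexp (\<Sum>i<r. a i * inner x (e i))) = complex_of_real (exp (- quad_form r a c / 2))"
proof -
  obtain l :: "nat \<Rightarrow> nat \<Rightarrow> real" where l: "(\<forall>i j. i < j \<longrightarrow> l i j = 0) \<and>
    (\<forall>i m J. i < J \<longrightarrow> c i m = (\<Sum>j<J. l i j * l m j))"
    using psd_cholesky[OF c] ..
  then have l0: "\<And>i j. i < j \<Longrightarrow> l i j = 0" and lc: "\<And>i m J. i < J \<Longrightarrow> c i m = (\<Sum>j<J. l i j * l m j)"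
    by blast+
  let ?S = "std_normal_distribution"
  define P where "P = PiM (UNIV :: nat set) (\<lambda>_. ?S)"
  interpret S: real_distribution ?S by (rule real_dist_normal_dist)
  interpret P: prob_space P unfolding P_def by (rule prob_space_PiM) (rule S.prob_space_axioms)
  have sets_P: "sets P = sets (PiM UNIV (\<lambda>_. borel))" unfolding P_def by (rule sets_PiM_cong) simp_all
  have meas [measurable]: "(\<lambda>\<omega>. \<omega> j) \<in> borel_measurable P" for j
    unfolding measurable_cong_sets[OF sets_P refl] by measurable
  have comp: "distr P borel (\<lambda>\<omega>. \<omega> j) = ?S" for j
  proof -
    have "distr P borel (\<lambda>\<omega>. \<omega> j) = distr P ?S (\<lambda>\<omega>. \<omega> j)" by (rule distr_cong) auto
    also have "\<dots> = ?S" unfolding P_def by (rule distr_PiM_component) (auto intro: S.prob_space_axioms)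
    finally show ?thesis .
  qed
  have indep: "P.indep_vars (\<lambda>_. borel) (\<lambda>j \<omega>. \<omega> j) UNIV"
  proof (subst P.indep_vars_iff_distr_eq_PiM')
    have "distr P (PiM UNIV (\<lambda>_. borel)) (\<lambda>\<omega>. \<lambda>i\<in>UNIV. \<omega> i) = distr P P (\<lambda>\<omega>. \<omega>)"
      by (rule distr_cong) (auto simp: sets_P)
    also have "\<dots> = PiM UNIV (\<lambda>j. distr P borel (\<lambda>\<omega>. \<omega> j))" unfolding comp by (simp add: P_def[symmetric] distr_id)
    finally show "distr P (PiM UNIV (\<lambda>_. borel)) (\<lambda>\<omega>. \<lambda>i\<in>UNIV. \<omega> i) = PiM UNIV (\<lambda>j. distr P borel (\<lambda>\<omega>. \<omega> j))" .
  qed simp_all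
  have int: "integral\<^sup>L P (\<lambda>\<omega>. f (\<omega> j)) = integral\<^sup>L ?S f" if "f \<in> borel_measurable borel"
    for f :: "real \<Rightarrow> 'z::{banach, second_countable_topology}" and j
    using integral_distr[OF meas that, of j] by (simp add: comp)
  have sq: "sq_int P (\<lambda>\<omega>. \<omega> j)" for j
  proof -
    have "integrable (distr P borel (\<lambda>\<omega>. \<omega> j)) (\<lambda>x. x\<^sup>2)"
      unfolding comp by (rule integrable_std_normal_distribution_moment)
    then show ?thesis by (simp add: integrable_distr_eq sq_int_def)
  qed
  have mean: "(\<integral>\<omega>. \<omega> j \<partial>P) = 0" for j
    using int[of "\<lambda>x. x" j] integral_std_normal_distribution_moment_odd[of 1] by simp
  have var: "(\<integral>\<omega>. (\<omega> j)\<^sup>2 \<partial>P) = 1" for j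
    using int[of "\<lambda>x. x\<^sup>2" j] std_normal_distribution_even_moments(1)[of 1] by (simp add: fact_numeral)
  define G where "G w J \<omega> = (\<Sum>j<J. w j * \<omega> j)" for w :: "nat \<Rightarrow> real" and J :: nat and \<omega>
  have sqG: "sq_int P (G w J)" for w J
    unfolding G_def by (intro sq_int_sum) (use sq_int_scaleR[OF sq] in simp)
  have indepG: "P.indep_vars (\<lambda>_. borel) (\<lambda>j \<omega>. w j * \<omega> j) A" for w A
    using P.indep_vars_compose2[OF P.indep_vars_subset[OF indep subset_UNIV], of A "\<lambda>j x. w j * x" "\<lambda>_. borel"] by simp
  have G2: "(\<integral>\<omega>. (G w J \<omega>)\<^sup>2 \<partial>P) = (\<Sum>j<J. (w j)\<^sup>2)" for w J
  proof -
    have "(\<integral>\<omega>. inner (G w J \<omega>) (G w J \<omega>) \<partial>P) = (\<Sum>j<J. \<integral>\<omega>. inner (w j * \<omega> j) (w j * \<omega> j) \<partial>P)"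
      unfolding G_def
      by (rule P.indep_sum_second_moment[where R="\<lambda>x. x", OF bounded_linear_ident indepG])
         (use sq_int_scaleR[OF sq] mean in auto)
    also have "\<dots> = (\<Sum>j<J. (w j)\<^sup>2)"
    proof (rule sum.cong[OF refl])
      fix j
      have "(\<integral>\<omega>. inner (w j * \<omega> j) (w j * \<omega> j) \<partial>P) = (\<integral>\<omega>. (w j)\<^sup>2 * (\<omega> j)\<^sup>2 \<partial>P)"
        by (rule Bochner_Integration.integral_cong) (simp_all add: power2_eq_square)
      then show "(\<integral>\<omega>. inner (w j * \<omega> j) (w j * \<omega> j) \<partial>P) = (w j)\<^sup>2" by (simp add: var)
    qed
    finally show ?thesis by (simp add: power2_eq_square)
  qed
  \<comment> \<open>Polarisation: covariances of linear combinations follow from the variances in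
    \<open>G2\<close>.\<close>
  have Guv: "(\<integral>\<omega>. G u J \<omega> * G v J \<omega> \<partial>P) = (\<Sum>j<J. u j * v j)" for u v J
  proof -
    have "(\<integral>\<omega>. G u J \<omega> * G v J \<omega> \<partial>P) = (\<integral>\<omega>. ((G (\<lambda>j. u j + v j) J \<omega>)\<^sup>2 - (G (\<lambda>j. u j - v j) J \<omega>)\<^sup>2) / 4 \<partial>P)"
      by (rule Bochner_Integration.integral_cong)
         (simp_all add: G_def sum.distrib sum_subtractf algebra_simps power2_eq_square)
    also have "\<dots> = ((\<Sum>j<J. (u j + v j)\<^sup>2) - (\<Sum>j<J. (u j - v j)\<^sup>2)) / 4"
      using sq_intD(2)[OF sqG] by (simp add: G2)
    also have "\<dots> = (\<Sum>j<J. u j * v j)"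
      unfolding sum_subtractf[symmetric] sum_divide_distrib
      by (rule sum.cong) (simp_all add: power2_sum power2_diff)
    finally show ?thesis .
  qed
  \<comment> \<open>Row \<open>i\<close> of the factor stops at column \<open>i\<close>, so longer
    sums give the same value; this provides a common length for two rows.\<close>
  define g where "g i = G (l i) (Suc i)" for i
  have g_eq: "g i \<omega> = G (l i) J \<omega>" if "i < J" for i J \<omega>
    unfolding g_def G_def using that l0 by (intro sum.mono_neutral_left) auto
  have meas_g [measurable]: "g i \<in> borel_measurable P" for i unfolding g_def using sqG by (rule sq_intD)
  have gg: "(\<integral>\<omega>. g i \<omega> * g m \<omega> \<partial>P) = c i m" for i m
    using Guv[of "l i" "Suc (max i m)" "l m"] lc[of i "Suc (max i m)" m] by (simp add: g_eq[of _ "Suc (max i m)"])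
  have AE_sum: "AE \<omega> in P. (\<Sum>i. ennreal ((g i \<omega>)\<^sup>2)) \<noteq> \<infinity>"
    and nn: "(\<integral>\<^sup>+\<omega>. (\<Sum>i. ennreal ((g i \<omega>)\<^sup>2)) \<partial>P) < \<infinity>"
  proof -
    have "(\<integral>\<^sup>+\<omega>. (\<Sum>i. ennreal ((g i \<omega>)\<^sup>2)) \<partial>P) = (\<Sum>i. \<integral>\<^sup>+\<omega>. ennreal ((g i \<omega>)\<^sup>2) \<partial>P)"
      by (rule nn_integral_suminf) measurable
    also have "\<dots> = (\<Sum>i. ennreal (c i i))"
    proof (rule arg_cong[where f=suminf], rule ext)
      fix i
      have "(\<integral>\<^sup>+\<omega>. ennreal ((g i \<omega>)\<^sup>2) \<partial>P) = ennreal (\<integral>\<omega>. (g i \<omega>)\<^sup>2 \<partial>P)"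
        using sq_intD(2)[OF sqG[of "l i" "Suc i"]] by (intro nn_integral_eq_integral) (auto simp: g_def)
      then show "(\<integral>\<^sup>+\<omega>. ennreal ((g i \<omega>)\<^sup>2) \<partial>P) = ennreal (c i i)" using gg[of i i] by (simp add: power2_eq_square)
    qed
    also have "\<dots> = ennreal (\<Sum>i. c i i)"
    proof (rule suminf_ennreal2[OF _ sum])
      show "0 \<le> c i i" for i unfolding gg[symmetric] by simp
    qed
    finally have eq: "(\<integral>\<^sup>+\<omega>. (\<Sum>i. ennreal ((g i \<omega>)\<^sup>2)) \<partial>P) = ennreal (\<Sum>i. c i i)" .
    then show "(\<integral>\<^sup>+\<omega>. (\<Sum>i. ennreal ((g i \<omega>)\<^sup>2)) \<partial>P) < \<infinity>" by simp
    show "AE \<omega> in P. (\<Sum>i. ennreal ((g i \<omega>)\<^sup>2)) \<noteq> \<infinity>"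
      by (rule nn_integral_PInf_AE) (use eq in auto)
  qed
  \<comment> \<open>\<open>lim\<close> is total and keeps \<open>X\<close> measurable; its value
    matters only on the almost sure event where the squared coordinates are summable.\<close>
  define X where "X \<omega> = lim (\<lambda>r. \<Sum>i<r. g i \<omega> *\<^sub>R e i)" for \<omega>
  have meas_X [measurable]: "X \<in> borel_measurable P"
    unfolding X_def by (rule borel_measurable_lim_metric) measurable
  have AE_X: "AE \<omega> in P. (\<forall>i. inner (X \<omega>) (e i) = g i \<omega>) \<and> ennreal ((norm (X \<omega>))\<^sup>2) = (\<Sum>i. ennreal ((g i \<omega>)\<^sup>2))"
    using AE_sum
  proof eventually_elim
    case (elim \<omega>)
    then have s: "summable (\<lambda>i. (g i \<omega>)\<^sup>2)" by (intro summable_suminf_not_top) auto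
    have "X \<omega> = (\<Sum>i. g i \<omega> *\<^sub>R e i)"
      unfolding X_def using summable_LIMSEQ[OF orthogonal_series(1)[OF s]] by (rule limI)
    then have in': "inner (X \<omega>) (e i) = g i \<omega>" for i using orthogonal_series(2)[OF s] by simp
    have "(\<Sum>i. ennreal ((g i \<omega>)\<^sup>2)) = ennreal (\<Sum>i. (g i \<omega>)\<^sup>2)" by (rule suminf_ennreal2[OF _ s]) simp
    also have "(\<Sum>i. (g i \<omega>)\<^sup>2) = (norm (X \<omega>))\<^sup>2" using sums_unique[OF parseval[of "X \<omega>"]] by (simp add: in')
    finally show ?case using in' by simp
  qed
  define N where "N = distr P borel X"
  have good: "good_law N"
    unfolding good_law_def
  proof (intro conjI)
    show "prob_space N" unfolding N_def by (rule P.prob_space_distr) simp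
    have "integrable P (\<lambda>\<omega>. (norm (X \<omega>))\<^sup>2)"
    proof (rule integrableI_bounded)
      have "(\<integral>\<^sup>+\<omega>. ennreal (norm ((norm (X \<omega>))\<^sup>2)) \<partial>P) = (\<integral>\<^sup>+\<omega>. (\<Sum>i. ennreal ((g i \<omega>)\<^sup>2)) \<partial>P)"
        by (rule nn_integral_cong_AE) (use AE_X in \<open>eventually_elim, simp\<close>)
      then show "(\<integral>\<^sup>+\<omega>. ennreal (norm ((norm (X \<omega>))\<^sup>2)) \<partial>P) < \<infinity>" using nn by simp
    qed measurable
    then show "integrable N (\<lambda>x. (norm x)\<^sup>2)" unfolding N_def by (subst integrable_distr_eq) auto
  qed (simp add: N_def)
  have moment: "second_moment N i m = c i m" for i m
  proof -
    have "second_moment N i m = (\<integral>\<omega>. inner (X \<omega>) (e i) * inner (X \<omega>) (e m) \<partial>P)"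
      unfolding second_moment_def N_def by (rule integral_distr) measurable
    also have "\<dots> = (\<integral>\<omega>. g i \<omega> * g m \<omega> \<partial>P)"
      by (rule integral_cong_AE) (use AE_X in \<open>simp, simp, eventually_elim, simp\<close>)
    finally show ?thesis using gg by simp
  qed
  have char: "(CLINT x|N. iexp (\<Sum>i<r. a i * inner x (e i))) = complex_of_real (exp (- quad_form r a c / 2))" for r a
  proof -
    \<comment> \<open>Exchanging the two sums writes a combination of coordinates in terms of the
      independent normals, whose characteristic functions multiply.\<close>
    define b where "b j = (\<Sum>i<r. a i * l i j)" for j
    have comb: "(\<Sum>i<r. a i * g i \<omega>) = (\<Sum>j<r. b j * \<omega> j)" for \<omega>
    proof -
      have "(\<Sum>i<r. a i * g i \<omega>) = (\<Sum>i<r. \<Sum>j<r. a i * l i j * \<omega> j)"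
        by (intro sum.cong refl) (simp add: g_eq[of _ r] G_def sum_distrib_left mult_ac)
      also have "\<dots> = (\<Sum>j<r. b j * \<omega> j)" unfolding b_def by (subst sum.swap) (simp add: sum_distrib_right)
      finally show ?thesis .
    qed
    have qf: "quad_form r a c = (\<Sum>j<r. (b j)\<^sup>2)"
    proof -
      have "quad_form r a c = (\<Sum>i<r. \<Sum>m<r. \<Sum>j<r. (a i * l i j) * (a m * l m j))"
        unfolding quad_form_def by (intro sum.cong refl) (simp add: lc[of _ r] sum_distrib_left mult_ac)
      also have "\<dots> = (\<Sum>i<r. \<Sum>j<r. \<Sum>m<r. (a i * l i j) * (a m * l m j))"
        by (intro sum.cong refl sum.swap)
      also have "\<dots> = (\<Sum>j<r. \<Sum>i<r. \<Sum>m<r. (a i * l i j) * (a m * l m j))"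
        by (rule sum.swap)
      also have "\<dots> = (\<Sum>j<r. (b j)\<^sup>2)" by (simp add: b_def power2_eq_square sum_product)
      finally show ?thesis .
    qed
    have "(CLINT x|N. iexp (\<Sum>i<r. a i * inner x (e i))) = (CLINT \<omega>|P. iexp (\<Sum>i<r. a i * inner (X \<omega>) (e i)))"
      unfolding N_def by (rule integral_distr) measurable
    also have "\<dots> = (CLINT \<omega>|P. iexp (\<Sum>j<r. b j * \<omega> j))"
      by (rule integral_cong_AE) (use AE_X in \<open>simp, simp, eventually_elim, simp only: comb\<close>)
    also have "\<dots> = char (distr P borel (\<lambda>\<omega>. \<Sum>j<r. b j * \<omega> j)) 1"
      unfolding char_def by (subst integral_distr) auto
    also have "\<dots> = (\<Prod>j<r. char (distr P borel (\<lambda>\<omega>. b j * \<omega> j)) 1)"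
      by (rule P.char_distr_sum[OF indepG])
    also have "\<dots> = (\<Prod>j<r. complex_of_real (exp (- (b j)\<^sup>2 / 2)))"
    proof (rule prod.cong[OF refl])
      fix j
      have "char (distr P borel (\<lambda>\<omega>. b j * \<omega> j)) 1 = (CLINT \<omega>|P. iexp (b j * \<omega> j))"
        unfolding char_def by (subst integral_distr) auto
      also have "\<dots> = char ?S (b j)" unfolding char_def by (rule int) simp
      finally show "char (distr P borel (\<lambda>\<omega>. b j * \<omega> j)) 1 = complex_of_real (exp (- (b j)\<^sup>2 / 2))"
        by (simp add: char_std_normal_distribution)
    qed
    also have "\<dots> = complex_of_real (exp (- quad_form r a c / 2))"
      unfolding qf by (simp add: exp_sum[symmetric] sum_divide_distrib sum_negf flip: of_real_prod)
    finally show ?thesis .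
  qed
  show ?thesis using that[OF good moment char] .
qed

end

section \<open>Weighted sums and tapers\<close>

text \<open>One of the two truncated differences is zero, so this is the distance between natural
  numbers.\<close>

definition gap :: "nat \<Rightarrow> nat \<Rightarrow> nat" where
  "gap s t = (s - t) + (t - s)"

lemma gap_commute: "gap s t = gap t s"
  by (simp add: gap_def)

text \<open>Each lag is attained at most once on either side of \<open>s\<close>.\<close>

lemma sum_gap_le:
  fixes g :: "nat \<Rightarrow> real"
  assumes g: "summable g" "\<And>h. 0 \<le> g h" and "finite A"
  shows "(\<Sum>t\<in>A. g (gap s t)) \<le> 2 * (\<Sum>h. g h)"
proof -
  have "(\<Sum>t\<in>A. g (gap s t)) = (\<Sum>t\<in>{t\<in>A. s \<le> t}. g (gap s t)) + (\<Sum>t\<in>{t\<in>A. \<not> s \<le> t}. g (gap s t))"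
    using \<open>finite A\<close> by (subst sum.union_disjoint[symmetric]) (auto intro: sum.cong)
  also have "(\<Sum>t\<in>{t\<in>A. s \<le> t}. g (gap s t)) = (\<Sum>h\<in>(\<lambda>t. t - s) ` {t\<in>A. s \<le> t}. g h)"
    by (subst sum.reindex) (auto simp: inj_on_def gap_def)
  also have "\<dots> \<le> (\<Sum>h. g h)" using g \<open>finite A\<close> by (intro sum_le_suminf) auto
  also have "(\<Sum>t\<in>{t\<in>A. \<not> s \<le> t}. g (gap s t)) = (\<Sum>h\<in>(\<lambda>t. s - t) ` {t\<in>A. \<not> s \<le> t}. g h)"
    by (subst sum.reindex) (auto simp: inj_on_def gap_def)
  also have "\<dots> \<le> (\<Sum>h. g h)" using g \<open>finite A\<close> by (intro sum_le_suminf) auto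
  finally show ?thesis by simp
qed

text \<open>Schur's test: the arithmetic-geometric inequality separates the two weights, and row
  sums are bounded by \<open>sum_gap_le\<close>.\<close>

lemma weighted_double_sum_le:
  fixes \<gamma> :: "nat \<Rightarrow> nat \<Rightarrow> real"
  assumes \<gamma>: "\<And>s t. s \<in> A \<Longrightarrow> t \<in> A \<Longrightarrow> \<bar>\<gamma> s t\<bar> \<le> g (gap s t)"
    and g: "summable g" "\<And>h. 0 \<le> g h" and "finite A"
  shows "\<bar>\<Sum>s\<in>A. \<Sum>t\<in>A. a s * a t * \<gamma> s t\<bar> \<le> 2 * (\<Sum>h. g h) * (\<Sum>s\<in>A. (a s)\<^sup>2)"
proof -
  have trm: "\<bar>a s * a t * \<gamma> s t\<bar> \<le> ((a s)\<^sup>2 * g (gap s t) + (a t)\<^sup>2 * g (gap s t)) / 2" if "s \<in> A" "t \<in> A" for s t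
  proof -
    have "\<bar>a s\<bar> * \<bar>a t\<bar> \<le> ((a s)\<^sup>2 + (a t)\<^sup>2) / 2" using sum_squares_bound[of "\<bar>a s\<bar>" "\<bar>a t\<bar>"] by simp
    then have "\<bar>a s\<bar> * \<bar>a t\<bar> * \<bar>\<gamma> s t\<bar> \<le> ((a s)\<^sup>2 + (a t)\<^sup>2) / 2 * g (gap s t)"
      using \<gamma>[OF that] by (intro mult_mono) auto
    then show ?thesis by (simp add: abs_mult distrib_right add_divide_distrib)
  qed
  have "\<bar>\<Sum>s\<in>A. \<Sum>t\<in>A. a s * a t * \<gamma> s t\<bar> \<le> (\<Sum>s\<in>A. \<Sum>t\<in>A. \<bar>a s * a t * \<gamma> s t\<bar>)"
    by (rule order_trans[OF sum_abs sum_mono[OF sum_abs]])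
  also have "\<dots> \<le> (\<Sum>s\<in>A. \<Sum>t\<in>A. ((a s)\<^sup>2 * g (gap s t) + (a t)\<^sup>2 * g (gap s t)) / 2)"
    by (intro sum_mono trm)
  also have "\<dots> = ((\<Sum>s\<in>A. \<Sum>t\<in>A. (a s)\<^sup>2 * g (gap s t)) + (\<Sum>s\<in>A. \<Sum>t\<in>A. (a t)\<^sup>2 * g (gap s t))) / 2"
    by (simp add: sum.distrib sum_divide_distrib[symmetric])
  also have "(\<Sum>s\<in>A. \<Sum>t\<in>A. (a t)\<^sup>2 * g (gap s t)) = (\<Sum>s\<in>A. \<Sum>t\<in>A. (a s)\<^sup>2 * g (gap s t))"
    by (subst sum.swap) (simp add: gap_commute)
  also have "((\<Sum>s\<in>A. \<Sum>t\<in>A. (a s)\<^sup>2 * g (gap s t)) + (\<Sum>s\<in>A. \<Sum>t\<in>A. (a s)\<^sup>2 * g (gap s t))) / 2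
      = (\<Sum>s\<in>A. (a s)\<^sup>2 * (\<Sum>t\<in>A. g (gap s t)))"
    unfolding sum_distrib_left by (simp only: add_divide_distrib field_sum_of_halves)
  also have "\<dots> \<le> (\<Sum>s\<in>A. (a s)\<^sup>2 * (2 * (\<Sum>h. g h)))"
    by (intro sum_mono mult_left_mono sum_gap_le g \<open>finite A\<close>) simp
  also have "\<dots> = 2 * (\<Sum>h. g h) * (\<Sum>s\<in>A. (a s)\<^sup>2)" by (simp add: sum_distrib_left mult_ac)
  finally show ?thesis .
qed

section \<open>Normalised weights and Toeplitz sums\<close>

definition norm_weights :: "nat \<Rightarrow> (nat \<Rightarrow> real) \<Rightarrow> bool" where
  "norm_weights b a \<longleftrightarrow> (\<forall>i. i \<notin> {1..b} \<longrightarrow> a i = 0) \<and> (\<Sum>i=1..b. (a i)\<^sup>2) = 1"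

text \<open>The range includes \<open>0\<close> and \<open>b\<close>, so the jumps from and to zero
  at both ends of the window count.\<close>

definition roughness :: "nat \<Rightarrow> (nat \<Rightarrow> real) \<Rightarrow> real" where
  "roughness b a = (\<Sum>i\<le>b. (a (Suc i) - a i)\<^sup>2)"

text \<open>A shift by \<open>h\<close> is a sum of \<open>h\<close> unit steps, and Cauchy-Schwarz
  gives one factor \<open>h\<close>; the sum over the steps gives the other.\<close>

lemma shift_le_roughness:
  assumes a: "norm_weights b a"
  shows "(\<Sum>i\<le>b. (a (i + h) - a i)\<^sup>2) \<le> (real h)\<^sup>2 * roughness b a"
proof -
  have z: "a i = 0" if "i > b" for i using a that by (simp add: norm_weights_def)
  have tele: "(a (i + h) - a i)\<^sup>2 \<le> real h * (\<Sum>k<h. (a (i + Suc k) - a (i + k))\<^sup>2)" for i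
  proof -
    have "a (i + h) - a i = (\<Sum>k<h. a (i + Suc k) - a (i + k))"
      using sum_lessThan_telescope[of "\<lambda>k. a (i + k)" h] by simp
    also have "(\<dots>)\<^sup>2 \<le> (\<Sum>k<h. 1\<^sup>2) * (\<Sum>k<h. (a (i + Suc k) - a (i + k))\<^sup>2)"
      using Cauchy_Schwarz_ineq_sum[of "\<lambda>_. 1" "\<lambda>k. a (i + Suc k) - a (i + k)" "{..<h}"] by simp
    finally show ?thesis by simp
  qed
  have step: "(\<Sum>i\<le>b. (a (i + Suc k) - a (i + k))\<^sup>2) \<le> roughness b a" for k
  proof -
    have "(\<Sum>i\<le>b. (a (i + Suc k) - a (i + k))\<^sup>2) = (\<Sum>i\<in>(\<lambda>i. i + k) ` {..b}. (a (Suc i) - a i)\<^sup>2)"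
      by (subst sum.reindex) (auto simp: inj_on_def)
    also have "\<dots> = (\<Sum>i\<in>(\<lambda>i. i + k) ` {..b} \<inter> {..b}. (a (Suc i) - a i)\<^sup>2)"
    proof (rule sum.mono_neutral_right)
      show "\<forall>i\<in>(\<lambda>i. i + k) ` {..b} - (\<lambda>i. i + k) ` {..b} \<inter> {..b}. (a (Suc i) - a i)\<^sup>2 = 0"
      proof
        fix i assume "i \<in> (\<lambda>i. i + k) ` {..b} - (\<lambda>i. i + k) ` {..b} \<inter> {..b}"
        then have "b < i" by auto
        then show "(a (Suc i) - a i)\<^sup>2 = 0" by (simp add: z)
      qed
    qed auto
    also have "\<dots> \<le> roughness b a" unfolding roughness_def by (intro sum_mono2) auto
    finally show ?thesis .
  qed
  have "(\<Sum>i\<le>b. (a (i + h) - a i)\<^sup>2) \<le> (\<Sum>i\<le>b. real h * (\<Sum>k<h. (a (i + Suc k) - a (i + k))\<^sup>2))"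
    by (intro sum_mono tele)
  also have "\<dots> = real h * (\<Sum>k<h. \<Sum>i\<le>b. (a (i + Suc k) - a (i + k))\<^sup>2)"
    by (simp only: sum_distrib_left[symmetric] sum.swap[of _ "{..<h}" "{..b}"])
  also have "\<dots> \<le> real h * (\<Sum>k<h. roughness b a)" by (intro mult_left_mono sum_mono step) auto
  finally show ?thesis by (simp add: power2_eq_square mult.assoc)
qed

text \<open>The term \<open>i = 0\<close> of the shifted increments, since \<open>a 0\<close> is
  zero.\<close>

lemma weight_le_roughness:
  assumes a: "norm_weights b a"
  shows "(a h)\<^sup>2 \<le> (real h)\<^sup>2 * roughness b a"
proof -
  have "(a (0 + h) - a 0)\<^sup>2 \<le> (\<Sum>i\<le>b. (a (i + h) - a i)\<^sup>2)" by (rule member_le_sum) auto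
  then show ?thesis using shift_le_roughness[OF a, of h] a by (simp add: norm_weights_def)
qed

definition autocorr :: "nat \<Rightarrow> (nat \<Rightarrow> real) \<Rightarrow> nat \<Rightarrow> real" where
  "autocorr b a h = (\<Sum>i=1..b. a i * a (i + h))"

text \<open>The identity \<open>key\<close> drives the proof:
  \<open>2 * (1 - autocorr b a h)\<close> is the sum of squared increments at lag \<open>h\<close>
  plus the mass of the initial weights that the shift pushes out. Both parts are small if the
  roughness is.\<close>

lemma autocorr_bounds:
  assumes a: "norm_weights b a"
  shows "\<bar>autocorr b a h\<bar> \<le> 1" "\<bar>autocorr b a h - 1\<bar> \<le> (real h)\<^sup>2 * (1 + real h) * roughness b a"
proof -
  have z: "a i = 0" if "i \<notin> {1..b}" for i using a that by (simp add: norm_weights_def)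
  have s: "(\<Sum>i=1..b. (a i)\<^sup>2) = 1" using a by (simp add: norm_weights_def)
  have s0: "(\<Sum>i\<le>b. (a i)\<^sup>2) = 1"
    unfolding s[symmetric] by (rule sum.mono_neutral_right) (auto simp: z)
  have shifted: "(\<Sum>i\<le>b. (a (i + h))\<^sup>2) = 1 - (\<Sum>i<h. (a i)\<^sup>2)"
  proof -
    have "(\<Sum>i\<le>b. (a (i + h))\<^sup>2) = (\<Sum>i\<in>{h..b + h}. (a i)\<^sup>2)"
      using sum.shift_bounds_cl_nat_ivl[of "\<lambda>i. (a i)\<^sup>2" 0 h b] by (simp add: atLeast0AtMost)
    moreover have "(\<Sum>i<h. (a i)\<^sup>2) + (\<Sum>i\<in>{h..b + h}. (a i)\<^sup>2) = (\<Sum>i\<le>b + h. (a i)\<^sup>2)"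
      by (subst sum.union_disjoint[symmetric]) (auto intro!: sum.cong)
    moreover have "(\<Sum>i\<le>b + h. (a i)\<^sup>2) = (\<Sum>i\<le>b. (a i)\<^sup>2)"
      by (rule sum.mono_neutral_right) (auto simp: z)
    ultimately show ?thesis using s0 by linarith
  qed
  have ac: "autocorr b a h = (\<Sum>i\<le>b. a i * a (i + h))"
    unfolding autocorr_def by (rule sum.mono_neutral_left) (auto simp: z)
  have "(\<Sum>i\<le>b. (a (i + h) - a i)\<^sup>2) = (\<Sum>i\<le>b. (a (i + h))\<^sup>2) + (\<Sum>i\<le>b. (a i)\<^sup>2) - 2 * autocorr b a h"
    unfolding ac sum_distrib_left sum.distrib[symmetric] sum_subtractf[symmetric]
    by (rule sum.cong) (simp_all add: power2_diff)
  then have key: "2 * (1 - autocorr b a h) = (\<Sum>i\<le>b. (a (i + h) - a i)\<^sup>2) + (\<Sum>i<h. (a i)\<^sup>2)"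
    unfolding shifted s0 by simp
  have nn: "0 \<le> (\<Sum>i\<le>b. (a (i + h) - a i)\<^sup>2)" "0 \<le> (\<Sum>i<h. (a i)\<^sup>2)" by (auto intro: sum_nonneg)
  have "(autocorr b a h)\<^sup>2 \<le> (\<Sum>i\<le>b. (a i)\<^sup>2) * (\<Sum>i\<le>b. (a (i + h))\<^sup>2)"
    unfolding ac by (rule Cauchy_Schwarz_ineq_sum)
  also have "\<dots> \<le> 1\<^sup>2" unfolding s0 shifted using nn(2) by simp
  finally show "\<bar>autocorr b a h\<bar> \<le> 1" using abs_le_square_iff[of "autocorr b a h" 1] by simp
  have r0: "0 \<le> roughness b a" unfolding roughness_def by (intro sum_nonneg) simp
  have "(\<Sum>i<h. (a i)\<^sup>2) \<le> (\<Sum>i<h. (real h)\<^sup>2 * roughness b a)"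
  proof (rule sum_mono)
    fix i assume "i \<in> {..<h}"
    then have "(real i)\<^sup>2 * roughness b a \<le> (real h)\<^sup>2 * roughness b a"
      using r0 by (intro mult_right_mono power_mono) auto
    then show "(a i)\<^sup>2 \<le> (real h)\<^sup>2 * roughness b a" using weight_le_roughness[OF a, of i] by linarith
  qed
  then have "2 * (1 - autocorr b a h) \<le> (real h)\<^sup>2 * (1 + real h) * roughness b a"
    using shift_le_roughness[OF a, of h] unfolding key by (simp add: algebra_simps)
  moreover have "0 \<le> 2 * (1 - autocorr b a h)" unfolding key using nn by linarith
  ultimately show "\<bar>autocorr b a h - 1\<bar> \<le> (real h)\<^sup>2 * (1 + real h) * roughness b a"
    by argo
qed

lemma double_sum_autocorr:
  assumes a: "norm_weights b a"
  shows "(\<Sum>s=1..b. \<Sum>t=1..b. a s * a t * \<gamma> (gap s t))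
    = \<gamma> 0 + 2 * (\<Sum>h=1..b. autocorr b a h * \<gamma> h)"
proof -
  have z: "a i = 0" if "i \<notin> {1..b}" for i using a that by (simp add: norm_weights_def)
  define U where "U = (\<Sum>s=1..b. \<Sum>t=1..b. if s < t then a s * a t * \<gamma> (gap s t) else 0)"
  have "(\<Sum>s=1..b. \<Sum>t=1..b. a s * a t * \<gamma> (gap s t))
      = (\<Sum>s=1..b. \<Sum>t=1..b. (if t = s then (a s)\<^sup>2 * \<gamma> 0 else 0)
          + (if s < t then a s * a t * \<gamma> (gap s t) else 0) + (if t < s then a s * a t * \<gamma> (gap s t) else 0))"
    by (intro sum.cong refl) (auto simp: gap_def power2_eq_square)
  also have "\<dots> = (\<Sum>s=1..b. (a s)\<^sup>2 * \<gamma> 0) + U + (\<Sum>s=1..b. \<Sum>t=1..b. if t < s then a s * a t * \<gamma> (gap s t) else 0)"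
    unfolding U_def by (simp add: sum.distrib)
  also have "(\<Sum>s=1..b. \<Sum>t=1..b. if t < s then a s * a t * \<gamma> (gap s t) else 0) = U"
    unfolding U_def by (subst sum.swap, intro sum.cong refl) (auto simp: gap_commute mult.commute)
  also have "(\<Sum>s=1..b. (a s)\<^sup>2 * \<gamma> 0) = \<gamma> 0"
    using a by (simp add: norm_weights_def sum_distrib_right[symmetric])
  also have "U = (\<Sum>s=1..b. \<Sum>h=1..b. a s * a (s + h) * \<gamma> h)"
    unfolding U_def
  proof (rule sum.cong[OF refl])
    fix s assume s: "s \<in> {1..b}"
    have "(\<Sum>t=1..b. if s < t then a s * a t * \<gamma> (gap s t) else 0) = (\<Sum>t\<in>{t\<in>{1..b}. s < t}. a s * a t * \<gamma> (t - s))"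
      by (subst sum.inter_filter) (auto intro!: sum.cong simp: gap_def)
    also have "\<dots> = (\<Sum>h\<in>(\<lambda>t. t - s) ` {t\<in>{1..b}. s < t}. a s * a (s + h) * \<gamma> h)"
      by (subst sum.reindex) (auto simp: inj_on_def)
    also have "\<dots> = (\<Sum>h=1..b. a s * a (s + h) * \<gamma> h)"
    proof (rule sum.mono_neutral_left)
      show "\<forall>h\<in>{1..b} - (\<lambda>t. t - s) ` {t \<in> {1..b}. s < t}. a s * a (s + h) * \<gamma> h = 0"
      proof
        fix h assume h: "h \<in> {1..b} - (\<lambda>t. t - s) ` {t \<in> {1..b}. s < t}"
        have "s + h \<notin> {1..b}"
        proof
          assume "s + h \<in> {1..b}"
          then have "h \<in> (\<lambda>t. t - s) ` {t \<in> {1..b}. s < t}" using h by (intro image_eqI[of _ _ "s + h"]) auto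
          then show False using h by simp
        qed
        then show "a s * a (s + h) * \<gamma> h = 0" by (simp add: z)
      qed
    qed auto
    finally show "(\<Sum>t=1..b. if s < t then a s * a t * \<gamma> (gap s t) else 0) = (\<Sum>h=1..b. a s * a (s + h) * \<gamma> h)" .
  qed
  also have "\<dots> = (\<Sum>h=1..b. autocorr b a h * \<gamma> h)"
    unfolding autocorr_def by (subst sum.swap) (simp add: sum_distrib_right)
  finally show ?thesis by simp
qed

text \<open>Vanishing roughness sends every autocorrelation to one, and autocorrelations are bounded
  by one, so dominated convergence over the lags applies. The limit does not depend on the weights;
  therefore tapered block sums and the plain mean share one covariance.\<close>

theorem toeplitz_tendsto:
  assumes a: "\<And>j. norm_weights (b j) (a j)" and rough: "(\<lambda>j. roughness (b j) (a j)) \<longlonglongrightarrow> 0"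
    and \<gamma>: "\<And>h. \<bar>\<gamma> h\<bar> \<le> g h" and g: "summable g"
  shows "(\<lambda>j. \<Sum>s=1..b j. \<Sum>t=1..b j. a j s * a j t * \<gamma> (gap s t)) \<longlonglongrightarrow> \<gamma> 0 + 2 * (\<Sum>h. \<gamma> (Suc h))"
proof -
  have g0: "0 \<le> g h" for h using \<gamma>[of h] by linarith
  have sg: "summable (\<lambda>h. g (Suc h))" using g by (simp add: summable_Suc_iff)
  have s\<gamma>: "summable (\<lambda>h. \<gamma> (Suc h))" by (rule summable_comparison_test'[OF sg]) (use \<gamma> in auto)
  have ac0: "autocorr (b j) (a j) h = 0" if "h > b j" for j h
    using a[of j] that by (simp add: autocorr_def norm_weights_def)
  have fin: "(\<Sum>h=1..b j. autocorr (b j) (a j) h * \<gamma> h) = (\<Sum>h. autocorr (b j) (a j) (Suc h) * \<gamma> (Suc h))" for j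
  proof -
    have "(\<Sum>h. autocorr (b j) (a j) (Suc h) * \<gamma> (Suc h)) = (\<Sum>h<b j. autocorr (b j) (a j) (Suc h) * \<gamma> (Suc h))"
      by (rule suminf_finite) (auto simp: ac0)
    also have "\<dots> = (\<Sum>h=1..b j. autocorr (b j) (a j) h * \<gamma> h)"
      by (rule sum.reindex_bij_witness[of _ "\<lambda>h. h - 1" Suc]) auto
    finally show ?thesis by simp
  qed
  have le: "\<bar>autocorr (b j) (a j) h * \<gamma> h\<bar> \<le> g h" for j h
    unfolding abs_mult using mult_mono[OF autocorr_bounds(1)[OF a, of j h] \<gamma>[of h]] g0[of h] by simp
  have sA: "summable (\<lambda>h. autocorr (b j) (a j) (Suc h) * \<gamma> (Suc h))" for j
    by (rule summable_comparison_test'[OF sg]) (use le in auto)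
  have "(\<lambda>j. \<Sum>h. autocorr (b j) (a j) (Suc h) * \<gamma> (Suc h) - \<gamma> (Suc h)) \<longlonglongrightarrow> 0"
  proof (rule suminf_tendsto_0_dominated[where g="\<lambda>_ h. 2 * g (Suc h)" and G="\<lambda>h. 2 * g (Suc h)"])
    show "\<bar>autocorr (b j) (a j) (Suc h) * \<gamma> (Suc h) - \<gamma> (Suc h)\<bar> \<le> 2 * g (Suc h)" for j h
      using le[of j "Suc h"] \<gamma>[of "Suc h"] by linarith
    show "(\<lambda>j. autocorr (b j) (a j) (Suc h) * \<gamma> (Suc h) - \<gamma> (Suc h)) \<longlonglongrightarrow> 0" for h
    proof -
      have "(\<lambda>j. autocorr (b j) (a j) (Suc h) - 1) \<longlonglongrightarrow> 0"
      proof (rule Lim_null_comparison)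
        show "\<forall>\<^sub>F j in sequentially. norm (autocorr (b j) (a j) (Suc h) - 1)
            \<le> (real (Suc h))\<^sup>2 * (1 + real (Suc h)) * roughness (b j) (a j)"
          using autocorr_bounds(2)[OF a] by (intro always_eventually allI) (simp only: real_norm_def)
        show "(\<lambda>j. (real (Suc h))\<^sup>2 * (1 + real (Suc h)) * roughness (b j) (a j)) \<longlonglongrightarrow> 0"
          using tendsto_mult_left[OF rough] by fastforce
      qed
      from tendsto_mult_right[OF this, of "\<gamma> (Suc h)"] show ?thesis by (simp add: left_diff_distrib)
    qed
  qed (use sg in \<open>auto intro: summable_mult\<close>)
  then have "(\<lambda>j. (\<Sum>h. autocorr (b j) (a j) (Suc h) * \<gamma> (Suc h)) - (\<Sum>h. \<gamma> (Suc h))) \<longlonglongrightarrow> 0"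
    by (simp add: suminf_diff sA s\<gamma>)
  then have "(\<lambda>j. \<Sum>h. autocorr (b j) (a j) (Suc h) * \<gamma> (Suc h)) \<longlonglongrightarrow> (\<Sum>h. \<gamma> (Suc h))" by (rule LIM_zero_cancel)
  then show ?thesis unfolding double_sum_autocorr[OF a] fin by (intro tendsto_intros)
qed

text \<open>The untapered mean as a special case; its roughness comes from the two end
  jumps.\<close>

lemma const_weights:
  assumes "0 < n"
  shows "norm_weights n (\<lambda>i. if i \<in> {1..n} then 1 / sqrt (real n) else 0)"
    "roughness n (\<lambda>i. if i \<in> {1..n} then 1 / sqrt (real n) else 0) = 2 / real n"
proof -
  show "norm_weights n (\<lambda>i. if i \<in> {1..n} then 1 / sqrt (real n) else 0)"
    using assms by (simp add: norm_weights_def power_divide)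
  have "roughness n (\<lambda>i. if i \<in> {1..n} then 1 / sqrt (real n) else 0)
      = (\<Sum>i\<le>n. (if i = 0 then 1 / real n else 0) + (if i = n then 1 / real n else 0))"
    unfolding roughness_def using assms by (intro sum.cong) (auto simp: power_divide)
  then show "roughness n (\<lambda>i. if i \<in> {1..n} then 1 / sqrt (real n) else 0) = 2 / real n"
    by (simp add: sum.distrib)
qed

section \<open>Tapers as slowly varying weights\<close>

lemma taper_bounds:
  assumes "tapering_window w"
  shows "0 \<le> taper w b i" "taper w b i \<le> 1"
  using assms by (auto simp: taper_def tapering_window_def)

text \<open>The sample point \<open>(i - 1/2) / b\<close> is at most \<open>1/2\<close> exactly when
  \<open>2 * i \<le> b + 1\<close>, so the last index on the rising side is
  \<open>(b + 1) div 2\<close>. The falling side is reduced to the rising one by the reflection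
  \<open>1 - x\<close>.\<close>

lemma taper_unimodal:
  assumes w: "tapering_window w" and "0 < b"
  shows "i < (b + 1) div 2 \<Longrightarrow> taper w b i \<le> taper w b (Suc i)"
    and "(b + 1) div 2 \<le> i \<Longrightarrow> taper w b (Suc i) \<le> taper w b i"
proof -
  have mono: "w x \<le> w y" if "0 \<le> x" "x \<le> y" "y \<le> 1/2" for x y
    using w that by (auto simp: tapering_window_def mono_on_def)
  have refl: "w (1 - x) = w x" for x
    using w unfolding tapering_window_def by (metis (no_types) add_diff_cancel_left' diff_add_cancel diff_diff_eq2 field_sum_of_halves)
  let ?x = "\<lambda>i. (real i - 1/2) / real b"
  show "taper w b i \<le> taper w b (Suc i)" if i: "i < (b + 1) div 2"
  proof (cases "i = 0")
    case True
    have "taper w b 0 = 0" by (simp add: taper_def)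
    then show ?thesis using taper_bounds(1)[OF w, of b 1] True by simp
  next
    case False
    have "2 * Suc i \<le> b + 1" using i by presburger
    then have "real (2 * i + 1) \<le> real b" by (simp only: of_nat_le_iff) simp
    then have "2 * real i + 1 \<le> real b" by simp
    then have "?x (Suc i) \<le> 1 / 2" using \<open>0 < b\<close> by (simp add: field_simps)
    moreover have "?x i \<le> ?x (Suc i)" using \<open>0 < b\<close> by (intro divide_right_mono) auto
    moreover have "0 \<le> ?x i" using False by simp
    ultimately have "w (?x i) \<le> w (?x (Suc i))" by (intro mono)
    moreover have "Suc i \<le> b" using i by linarith
    ultimately show ?thesis using False by (simp add: taper_def)
  qed
  show "taper w b (Suc i) \<le> taper w b i" if i: "(b + 1) div 2 \<le> i"
  proof (cases "Suc i \<le> b")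
    case True
    have "b \<le> 2 * i" using i by linarith
    then have "real b \<le> 2 * real i" by linarith
    then have 1: "1 - ?x (Suc i) \<le> ?x i" using \<open>0 < b\<close> by (simp add: field_simps)
    have 2: "1 - ?x (Suc i) \<le> 1 - ?x i" using \<open>0 < b\<close> by (simp add: divide_right_mono)
    have 3: "0 \<le> 1 - ?x (Suc i)" using True \<open>0 < b\<close> by (simp add: field_simps)
    have "w (?x (Suc i)) \<le> w (?x i)"
    proof (cases "?x i \<le> 1 / 2")
      case True
      from mono[OF 3 1 True] show ?thesis by (simp only: refl)
    next
      case False
      then have "1 - ?x i \<le> 1 / 2" by linarith
      from mono[OF 3 2 this] show ?thesis by (simp only: refl)
    qed
    moreover have "1 \<le> i" using i \<open>0 < b\<close> by linarith
    ultimately show ?thesis using True by (simp add: taper_def)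
  next
    case False
    then have "taper w b (Suc i) = 0" by (simp add: taper_def)
    then show ?thesis using taper_bounds(1)[OF w, of b i] by simp
  qed
qed

text \<open>Increments lie in \<open>[-1, 1]\<close>, so their squares are bounded by their absolute
  values; unimodality makes the total variation telescope to at most twice the peak.\<close>

lemma taper_roughness:
  assumes w: "tapering_window w" and "0 < b"
  shows "roughness b (taper w b) \<le> 2"
proof -
  let ?m = "(b + 1) div 2" and ?\<tau> = "taper w b"
  have le1: "(?\<tau> (Suc i) - ?\<tau> i)\<^sup>2 \<le> \<bar>?\<tau> (Suc i) - ?\<tau> i\<bar>" for i
  proof -
    have "\<bar>?\<tau> (Suc i) - ?\<tau> i\<bar> \<le> 1" using taper_bounds[OF w, of b i] taper_bounds[OF w, of b "Suc i"] by linarith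
    then have "\<bar>?\<tau> (Suc i) - ?\<tau> i\<bar> * \<bar>?\<tau> (Suc i) - ?\<tau> i\<bar> \<le> 1 * \<bar>?\<tau> (Suc i) - ?\<tau> i\<bar>" by (intro mult_right_mono) auto
    then show ?thesis by (simp add: power2_eq_square)
  qed
  have m: "?m \<le> Suc b" using \<open>0 < b\<close> by linarith
  have "roughness b ?\<tau> \<le> (\<Sum>i<Suc b. \<bar>?\<tau> (Suc i) - ?\<tau> i\<bar>)"
    unfolding roughness_def lessThan_Suc_atMost by (intro sum_mono le1)
  also have "\<dots> = (\<Sum>i<?m. \<bar>?\<tau> (Suc i) - ?\<tau> i\<bar>) + (\<Sum>i=?m..<Suc b. \<bar>?\<tau> (Suc i) - ?\<tau> i\<bar>)"
  proof -
    have "{..<Suc b} = {..<?m} \<union> {?m..<Suc b}" using m by auto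
    then show ?thesis by (simp only: sum.union_disjoint finite_lessThan finite_atLeastLessThan ivl_disj_int)
  qed
  also have "(\<Sum>i<?m. \<bar>?\<tau> (Suc i) - ?\<tau> i\<bar>) = (\<Sum>i<?m. ?\<tau> (Suc i) - ?\<tau> i)"
    using taper_unimodal(1)[OF assms] by (intro sum.cong) auto
  also have "\<dots> = ?\<tau> ?m - ?\<tau> 0" by (rule sum_lessThan_telescope)
  also have "(\<Sum>i=?m..<Suc b. \<bar>?\<tau> (Suc i) - ?\<tau> i\<bar>) = - (\<Sum>i=?m..<Suc b. ?\<tau> (Suc i) - ?\<tau> i)"
    using taper_unimodal(2)[OF assms] by (subst sum_negf[symmetric], intro sum.cong) auto
  also have "\<dots> = - (?\<tau> (Suc b) - ?\<tau> ?m)" by (subst sum_Suc_diff'[OF m]) simp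
  finally show ?thesis using taper_bounds[OF w, of b ?m] taper_bounds[OF w, of b 0] taper_bounds[OF w, of b "Suc b"] by linarith
qed

text \<open>By monotonicity the window is at least \<open>w (1/2 - \<delta>)\<close> from there up
  to \<open>1/2\<close>, and about \<open>\<delta> * b\<close> sample points fall into this
  interval. The subtracted \<open>1\<close> absorbs rounding and the case
  \<open>b = 0\<close>.\<close>

lemma taper_norm_lower:
  assumes w: "tapering_window w"
  shows "\<exists>c>0. \<forall>b. c * real b - 1 \<le> (taper_norm w b)\<^sup>2"
proof -
  have "\<forall>\<^sub>F \<tau> in nhds (1/2 :: real). w \<tau> > 0" using w by (simp add: tapering_window_def)
  then obtain d where d: "d > 0" "\<And>\<tau>. dist \<tau> (1/2) < d \<Longrightarrow> w \<tau> > 0" unfolding eventually_nhds_metric by blast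
  \<comment> \<open>Strictly below \<open>d\<close>, so that the left end still has positive window
    value, and at most \<open>1/2\<close>, so that it lies in the support interval.\<close>
  define \<delta> where "\<delta> = min (d / 2) (1 / 2)"
  have \<delta>: "0 < \<delta>" "\<delta> \<le> 1/2" "\<delta> < d" using d(1) by (auto simp: \<delta>_def)
  define v where "v = w (1/2 - \<delta>)"
  have v: "0 < v" "v \<le> 1" using d(2)[of "1/2 - \<delta>"] \<delta> w by (auto simp: v_def dist_real_def tapering_window_def)
  have mono: "w x \<le> w y" if "0 \<le> x" "x \<le> y" "y \<le> 1/2" for x y
    using w that by (auto simp: tapering_window_def mono_on_def)
  have "v\<^sup>2 * \<delta> * real b - 1 \<le> (taper_norm w b)\<^sup>2" for b
  proof (cases "b = 0")
    case False
    \<comment> \<open>\<open>p\<close> and \<open>q\<close> are the first and last index whose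
      sample point lies in \<open>[1/2 - \<delta>, 1/2]\<close>.\<close>
    define p where "p = nat \<lceil>real b * (1/2 - \<delta>) + 1/2\<rceil>"
    define q where "q = (b + 1) div 2"
    have nonneg: "0 \<le> real b * (1/2 - \<delta>)" using \<delta> by simp
    have p1: "real b * (1/2 - \<delta>) + 1/2 \<le> real p" "real p \<le> real b * (1/2 - \<delta>) + 3/2"
      unfolding p_def using nonneg by linarith+
    have p0: "1 \<le> p" using p1(1) nonneg by (cases p) auto
    have qb: "q \<le> b" using False by (simp add: q_def)
    have q1: "2 * q \<le> b + 1" "b \<le> 2 * q" unfolding q_def by linarith+
    have qr: "real b / 2 \<le> real q" using q1(2) by linarith
    have in_taper: "v\<^sup>2 \<le> (taper w b i)\<^sup>2" if i: "i \<in> {p..q}" for i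
    proof -
      let ?x = "(real i - 1/2) / real b"
      have "1/2 - \<delta> \<le> ?x" using i p1(1) False by (simp add: pos_le_divide_eq mult.commute)
      moreover have "?x \<le> 1/2"
      proof -
        have "2 * i \<le> b + 1" using i q1(1) by auto
        then have "2 * real i \<le> real b + 1" by linarith
        then show ?thesis using False by (simp add: pos_divide_le_eq)
      qed
      ultimately have "v \<le> w ?x" unfolding v_def using \<delta> by (intro mono) auto
      moreover have "i \<in> {1..b}" using i p0 qb by auto
      ultimately have "v \<le> taper w b i" by (simp add: taper_def)
      then show ?thesis using v by (intro power_mono) auto
    qed
    have "v\<^sup>2 * (real q + 1 - real p) \<le> (\<Sum>i\<in>{p..q}. v\<^sup>2)"
    proof (cases "p \<le> q + 1")
      case True
      then show ?thesis by (simp add: of_nat_diff algebra_simps)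
    next
      case False
      then have "v\<^sup>2 * (real q + 1 - real p) \<le> 0" by (intro mult_nonneg_nonpos) auto
      then show ?thesis using False by simp
    qed
    also have "\<dots> \<le> (\<Sum>i\<in>{p..q}. (taper w b i)\<^sup>2)" by (intro sum_mono in_taper)
    also have "\<dots> \<le> (\<Sum>i=1..b. (taper w b i)\<^sup>2)" by (intro sum_mono2) (use p0 qb in auto)
    also have "\<dots> = (taper_norm w b)\<^sup>2" unfolding taper_norm_def by (subst real_sqrt_pow2) (auto intro: sum_nonneg)
    finally have main: "v\<^sup>2 * (real q + 1 - real p) \<le> (taper_norm w b)\<^sup>2" .
    have "real b * \<delta> - 1/2 \<le> real q + 1 - real p" using qr p1(2) by (simp add: algebra_simps)
    then have "v\<^sup>2 * (real b * \<delta> - 1/2) \<le> v\<^sup>2 * (real q + 1 - real p)" by (intro mult_left_mono) auto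
    moreover have "v\<^sup>2 \<le> 1" using v by (simp add: power_le_one)
    ultimately show ?thesis using main by (simp add: algebra_simps)
  next
    case True
    then show ?thesis using order_trans[OF _ zero_le_power2, of "-1 :: real"] by simp
  qed
  then show ?thesis using v \<delta> by (intro exI[of _ "v\<^sup>2 * \<delta>"]) auto
qed

definition taper_weights :: "(real \<Rightarrow> real) \<Rightarrow> nat \<Rightarrow> nat \<Rightarrow> real" where
  "taper_weights w b i = taper w b i / taper_norm w b"

lemma taper_weights_norm:
  assumes "0 < taper_norm w b"
  shows "norm_weights b (taper_weights w b)"
proof -
  have "(\<Sum>i=1..b. (taper_weights w b i)\<^sup>2) = (\<Sum>i=1..b. (taper w b i)\<^sup>2) / (taper_norm w b)\<^sup>2"
    by (simp add: taper_weights_def power_divide sum_divide_distrib)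
  also have "(\<Sum>i=1..b. (taper w b i)\<^sup>2) = (taper_norm w b)\<^sup>2"
    unfolding taper_norm_def by (subst real_sqrt_pow2) (auto intro: sum_nonneg)
  finally show ?thesis using assms by (simp add: norm_weights_def taper_weights_def taper_def)
qed

text \<open>The roughness of the raw taper is bounded while its squared norm grows linearly in the
  block size.\<close>

lemma taper_weights_asymptotics:
  assumes w: "tapering_window w" and b: "filterlim b at_top sequentially"
  shows "\<forall>\<^sub>F j in sequentially. 0 < taper_norm w (b j)"
    "(\<lambda>j. roughness (b j) (taper_weights w (b j))) \<longlonglongrightarrow> 0"
proof -
  obtain c where c: "c > 0" "\<And>b. c * real b - 1 \<le> (taper_norm w b)\<^sup>2" using taper_norm_lower[OF w] by blast
  have "filterlim (\<lambda>j. real (b j)) at_top sequentially"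
    by (rule filterlim_compose[OF filterlim_real_sequentially b])
  then have "filterlim (\<lambda>j. c * real (b j)) at_top sequentially"
    by (rule filterlim_tendsto_pos_mult_at_top[OF tendsto_const c(1)])
  then have "filterlim (\<lambda>j. c * real (b j) + (- 1)) at_top sequentially"
    by (subst add.commute) (rule filterlim_tendsto_add_at_top[OF tendsto_const])
  then have lim: "filterlim (\<lambda>j. (taper_norm w (b j))\<^sup>2) at_top sequentially"
    by (rule filterlim_at_top_mono) (use c(2) in auto)
  have nn: "0 \<le> taper_norm w b" for b unfolding taper_norm_def by (simp add: sum_nonneg)
  have "\<forall>\<^sub>F j in sequentially. 0 < (taper_norm w (b j))\<^sup>2" using lim unfolding filterlim_at_top_dense by blast
  then show pos: "\<forall>\<^sub>F j in sequentially. 0 < taper_norm w (b j)"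
    by eventually_elim (use nn in \<open>simp add: less_le\<close>)
  show "(\<lambda>j. roughness (b j) (taper_weights w (b j))) \<longlonglongrightarrow> 0"
  proof (rule Lim_null_comparison)
    show "\<forall>\<^sub>F j in sequentially. norm (roughness (b j) (taper_weights w (b j))) \<le> 2 * inverse ((taper_norm w (b j))\<^sup>2)"
      using pos
    proof eventually_elim
      case (elim j)
      have "b j \<noteq> 0" using elim by (auto simp: taper_norm_def intro: ccontr)
      have "roughness (b j) (taper_weights w (b j)) = roughness (b j) (taper w (b j)) / (taper_norm w (b j))\<^sup>2"
        unfolding roughness_def taper_weights_def sum_divide_distrib
        by (simp add: diff_divide_distrib[symmetric] power_divide)
      moreover have "0 \<le> roughness (b j) (taper w (b j))" unfolding roughness_def by (intro sum_nonneg) simp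
      ultimately show ?case
        using taper_roughness[OF w, of "b j"] \<open>b j \<noteq> 0\<close> by (simp add: divide_inverse mult_right_mono)
    qed
    show "(\<lambda>j. 2 * inverse ((taper_norm w (b j))\<^sup>2)) \<longlonglongrightarrow> 0"
      using tendsto_mult_left[OF tendsto_inverse_0_at_top[OF lim], of 2] by simp
  qed
qed

section \<open>Functions of independent families\<close>

text \<open>The \<sigma>-algebra generated by a subfamily. As a measure space it lets measurability
  express which innovations a variable depends on.\<close>

definition (in prob_space) sig :: "('i \<Rightarrow> 'a \<Rightarrow> 'b::topological_space) \<Rightarrow> 'i set \<Rightarrow> 'a measure" where
  "sig fam G = vimage_algebra (space M) (\<lambda>\<omega>. \<lambda>i\<in>G. fam i \<omega>) (PiM G (\<lambda>_. borel))"

context prob_space begin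

lemma restrict_in_space: "(\<lambda>\<omega>. \<lambda>i\<in>G. fam i \<omega>) \<in> space M \<rightarrow> space (PiM G (\<lambda>_. borel))"
  by (auto simp: space_PiM)

lemma space_sig: "space (sig fam G) = space M"
  by (simp add: sig_def)

lemma sig_component: "i \<in> G \<Longrightarrow> fam i \<in> borel_measurable (sig fam G)"
proof -
  assume i: "i \<in> G"
  have "(\<lambda>\<omega>. (\<lambda>i\<in>G. fam i \<omega>) i) \<in> borel_measurable (sig fam G)"
    using measurable_compose[OF measurable_vimage_algebra1[OF restrict_in_space[of fam G]] measurable_component_singleton[OF i]]
    unfolding sig_def .
  then show ?thesis using i by simp
qed

lemma sig_mono:
  assumes "G \<subseteq> H" "X \<in> measurable (sig fam G) N"
  shows "X \<in> measurable (sig fam H) N"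
proof -
  have "(\<lambda>\<omega>. \<omega>) \<in> measurable (sig fam H) (sig fam G)"
    unfolding sig_def[of fam G]
    by (rule measurable_vimage_algebra2)
       (use assms(1) in \<open>auto simp: space_sig intro!: measurable_restrict sig_component\<close>)
  from measurable_compose[OF this assms(2)] show ?thesis .
qed

text \<open>Every event of \<open>X j\<close> is a preimage under the restricted family over
  \<open>K j\<close>, and restrictions to disjoint index sets are independent.\<close>

lemma indep_sig:
  fixes X :: "'j \<Rightarrow> 'a \<Rightarrow> 'c::topological_space"
  assumes indep: "indep_vars (\<lambda>_. borel) fam Idx"
    and K: "\<And>j. j \<in> J \<Longrightarrow> K j \<subseteq> Idx" "disjoint_family_on K J"
    and X: "\<And>j. j \<in> J \<Longrightarrow> X j \<in> measurable (sig fam (K j)) borel"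
  shows "indep_vars (\<lambda>_. borel) X J"
proof -
  let ?r = "\<lambda>j \<omega>. \<lambda>i\<in>K j. fam i \<omega>"
  have r: "indep_vars (\<lambda>j. PiM (K j) (\<lambda>_. borel)) ?r J" by (rule indep_vars_restrict[OF indep K])
  have sub: "X j -` A \<inter> space M \<in> {?r j -` B \<inter> space M |B. B \<in> sets (PiM (K j) (\<lambda>_. borel))}"
    if "j \<in> J" "A \<in> sets borel" for j A
  proof -
    have "X j -` A \<inter> space M \<in> sets (sig fam (K j))"
      using measurable_sets[OF X[OF that(1)] that(2)] by (simp add: space_sig)
    then show ?thesis unfolding sig_def sets_vimage_algebra2[OF restrict_in_space] .
  qed
  show ?thesis
    unfolding indep_vars_def2
  proof (intro conjI ballI)
    fix j assume j: "j \<in> J"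
    have rj: "?r j \<in> measurable M (PiM (K j) (\<lambda>_. borel))" using r j by (auto simp: indep_vars_def2)
    show "X j \<in> borel_measurable M"
    proof (rule measurableI)
      fix A :: "'c set" assume "A \<in> sets borel"
      from sub[OF j this] obtain B where "X j -` A \<inter> space M = ?r j -` B \<inter> space M" "B \<in> sets (PiM (K j) (\<lambda>_. borel))" by auto
      then show "X j -` A \<inter> space M \<in> sets M" using measurable_sets[OF rj] by simp
    qed simp
  next
    show "indep_sets (\<lambda>i. {X i -` A \<inter> space M |A. A \<in> sets borel}) J"
      by (rule indep_sets_mono_sets[OF conjunct2[OF r[unfolded indep_vars_def2]]]) (use sub in blast)
  qed
qed

lemma indep_sig_pair:
  assumes indep: "indep_vars (\<lambda>_. borel) fam Idx" and "A \<subseteq> Idx" "B \<subseteq> Idx" "A \<inter> B = {}"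
    and X: "X \<in> borel_measurable (sig fam A)" and Y: "Y \<in> borel_measurable (sig fam B)"
  shows "indep_var borel X borel Y"
proof -
  have "indep_vars (\<lambda>_. borel) (case_bool X Y) UNIV"
    by (rule indep_sig[OF indep, where K="case_bool A B"])
       (use assms in \<open>auto simp: disjoint_family_on_def split: bool.splits\<close>)
  from indep_vars_pair[OF this, of True False] show ?thesis by simp
qed

text \<open>Every injective selection of innovations has the same joint law, an infinite product.
  Stationarity and equality in law of the couplings reduce to this by varying
  \<open>\<phi>\<close>.\<close>

lemma iid_reindex:
  assumes indep: "indep_vars (\<lambda>_. borel) fam Idx" and id: "\<And>i. i \<in> Idx \<Longrightarrow> distr M borel (fam i) = \<mu>0"
    and \<phi>: "inj \<phi>" "range \<phi> \<subseteq> Idx"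
  shows "distr M (PiM UNIV (\<lambda>_. borel)) (\<lambda>\<omega> j. fam (\<phi> j) \<omega>) = PiM UNIV (\<lambda>_. \<mu>0)"
proof -
  have "indep_vars (\<lambda>_. borel) (\<lambda>j. fam (\<phi> j)) UNIV"
    by (rule indep_sig[OF indep, where K="\<lambda>j. {\<phi> j}"])
       (use \<phi> in \<open>auto simp: disjoint_family_on_def inj_def intro: sig_component\<close>)
  moreover have "fam (\<phi> j) \<in> borel_measurable M" for j
    using indep \<phi>(2) by (auto simp: indep_vars_def2)
  ultimately have "distr M (PiM UNIV (\<lambda>_. borel)) (\<lambda>\<omega>. \<lambda>j\<in>UNIV. fam (\<phi> j) \<omega>) = PiM UNIV (\<lambda>j. distr M borel (fam (\<phi> j)))"
    by (subst (asm) indep_vars_iff_distr_eq_PiM') auto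
  then show ?thesis using id \<phi>(2) by (simp add: image_subset_iff restrict_def)
qed

end

section \<open>Weakly dependent processes\<close>

text \<open>Independence is stated for weighted sums over groups of times at mutual distance at
  least \<open>m\<close>, the only form in which the blocking arguments use it.\<close>

definition m_dep :: "'a measure \<Rightarrow> (nat \<Rightarrow> 'a \<Rightarrow> L2) \<Rightarrow> nat \<Rightarrow> bool" where
  "m_dep M Z m \<longleftrightarrow> (\<forall>(J :: nat set) K a. (\<forall>i\<in>J. \<forall>j\<in>J. i \<noteq> j \<longrightarrow> (\<forall>s\<in>K i. \<forall>t\<in>K j. m \<le> gap s t)) \<longrightarrow>
     prob_space.indep_vars M (\<lambda>_. borel) (\<lambda>j \<omega>. \<Sum>t\<in>K j. a j t *\<^sub>R Z t \<omega>) J)"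

text \<open>The last clause bounds the error of every weighted sum by its squared weights, so a
  single approximant serves the normalised mean and all block sums.\<close>

definition approximant :: "'a measure \<Rightarrow> (nat \<Rightarrow> 'a \<Rightarrow> L2) \<Rightarrow> real \<Rightarrow> (nat \<Rightarrow> 'a \<Rightarrow> L2) \<Rightarrow> nat \<Rightarrow> real \<Rightarrow> bool" where
  "approximant M Y \<eta> Z m T \<longleftrightarrow>
     (\<forall>t. Z t \<in> borel_measurable M \<and> (\<forall>\<omega>. norm (Z t \<omega>) \<le> T) \<and> (\<integral>\<omega>. Z t \<omega> \<partial>M) = 0) \<and> m_dep M Z m \<and>
     (\<forall>A a. finite A \<longrightarrow> (\<integral>\<omega>. (norm (\<Sum>t\<in>A. a t *\<^sub>R (Y t \<omega> - Z t \<omega>)))\<^sup>2 \<partial>M) \<le> \<eta> * (\<Sum>t\<in>A. (a t)\<^sup>2))"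

text \<open>The bound \<open>cov\<close> keeps the factor
  \<open>rms M (\<lambda>\<omega>. R (Y 0 \<omega>))\<close>: for \<open>R\<close> the residual of a
  projection it tends to zero, which yields the trace formula \<open>trace_lrv\<close>.\<close>

locale weak_dep = prob_space M for M :: "'a measure" +
  fixes Y :: "nat \<Rightarrow> 'a \<Rightarrow> L2" and \<nu> :: "nat \<Rightarrow> real"
  assumes sq: "sq_int M (Y t)"
    and mean: "(\<integral>\<omega>. Y t \<omega> \<partial>M) = 0"
    and \<nu>: "summable \<nu>" "0 \<le> \<nu> h"
    and stat: "bounded_linear R \<Longrightarrow> s \<le> t \<Longrightarrow>
      (\<integral>\<omega>. inner (R (Y s \<omega>)) (Y t \<omega>) \<partial>M) = (\<integral>\<omega>. inner (R (Y 0 \<omega>)) (Y (t - s) \<omega>) \<partial>M)"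
    and cov: "bounded_linear R \<Longrightarrow> s \<le> t \<Longrightarrow>
      \<bar>\<integral>\<omega>. inner (R (Y s \<omega>)) (Y t \<omega>) \<partial>M\<bar> \<le> rms M (\<lambda>\<omega>. R (Y 0 \<omega>)) * \<nu> (t - s)"
    and approx: "\<eta> > 0 \<Longrightarrow> \<exists>Z m T. approximant M Y \<eta> Z m T"

lemma (in prob_space) weighted_sum_second_moment:
  fixes D :: "nat \<Rightarrow> 'a \<Rightarrow> L2"
  assumes D: "\<And>t. sq_int M (D t)" and R: "bounded_linear R"
  shows "(\<integral>\<omega>. inner (R (\<Sum>t\<in>A. a t *\<^sub>R D t \<omega>)) (\<Sum>t\<in>A. a t *\<^sub>R D t \<omega>) \<partial>M)
    = (\<Sum>s\<in>A. \<Sum>t\<in>A. a s * a t * (\<integral>\<omega>. inner (R (D s \<omega>)) (D t \<omega>) \<partial>M))"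
proof -
  have int: "integrable M (\<lambda>\<omega>. inner (R (D s \<omega>)) (D t \<omega>))" for s t
    by (intro integrable_inner_sq_int sq_int_bounded_linear[OF R] D)
  have "(\<integral>\<omega>. inner (R (\<Sum>t\<in>A. a t *\<^sub>R D t \<omega>)) (\<Sum>t\<in>A. a t *\<^sub>R D t \<omega>) \<partial>M)
      = (\<integral>\<omega>. (\<Sum>s\<in>A. \<Sum>t\<in>A. a s * a t * inner (R (D s \<omega>)) (D t \<omega>)) \<partial>M)"
    unfolding linear_sum[OF bounded_linear.linear[OF R]] linear_scale[OF bounded_linear.linear[OF R]] inner_sum_left
    unfolding inner_sum_right by (simp add: mult_ac)
  also have "\<dots> = (\<Sum>s\<in>A. \<Sum>t\<in>A. a s * a t * (\<integral>\<omega>. inner (R (D s \<omega>)) (D t \<omega>) \<partial>M))"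
    using int by (simp add: Bochner_Integration.integrable_sum)
  finally show ?thesis .
qed

definition truncate :: "real \<Rightarrow> L2 \<Rightarrow> L2" where
  "truncate T x = (if norm x \<le> T then x else 0)"

lemma borel_truncate [measurable]: "truncate T \<in> borel_measurable borel"
  unfolding truncate_def [abs_def] by measurable

lemma norm_truncate: "0 \<le> T \<Longrightarrow> norm (truncate T x) \<le> T"
  by (simp add: truncate_def)

lemma (in prob_space) truncation_error_tendsto:
  assumes X: "sq_int M X"
  shows "(\<lambda>T. rms M (\<lambda>\<omega>. X \<omega> - truncate (real T) (X \<omega>))) \<longlonglongrightarrow> 0"
proof -
  have [measurable]: "X \<in> borel_measurable M" using X by (rule sq_intD)
  have "(\<lambda>T. \<integral>\<omega>. (norm (X \<omega> - truncate (real T) (X \<omega>)))\<^sup>2 \<partial>M) \<longlonglongrightarrow> (\<integral>\<omega>. 0 \<partial>M)"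
  proof (rule integral_dominated_convergence[where w="\<lambda>\<omega>. (norm (X \<omega>))\<^sup>2"])
    show "AE \<omega> in M. (\<lambda>T. (norm (X \<omega> - truncate (real T) (X \<omega>)))\<^sup>2) \<longlonglongrightarrow> 0"
    proof (rule AE_I2)
      fix \<omega>
      obtain T0 :: nat where T0: "norm (X \<omega>) \<le> real T0" using real_arch_simple by blast
      have "(norm (X \<omega> - truncate (real T) (X \<omega>)))\<^sup>2 = 0" if "T \<ge> T0" for T
      proof -
        have "norm (X \<omega>) \<le> real T" using T0 that by linarith
        then show ?thesis by (simp add: truncate_def)
      qed
      then show "(\<lambda>T. (norm (X \<omega> - truncate (real T) (X \<omega>)))\<^sup>2) \<longlonglongrightarrow> 0"
        by (intro tendsto_eventually eventually_sequentiallyI[of T0])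
    qed
    show "AE \<omega> in M. norm ((norm (X \<omega> - truncate (real T) (X \<omega>)))\<^sup>2) \<le> (norm (X \<omega>))\<^sup>2" for T
      by (intro AE_I2) (simp add: truncate_def)
  qed (use sq_intD[OF X] in auto)
  from tendsto_real_sqrt[OF this] show ?thesis by (simp add: rms_def)
qed

section \<open>The shift representation and its couplings\<close>

locale shift_process = prob_space M for M :: "'a measure" +
  fixes f :: "(nat \<Rightarrow> L2) \<Rightarrow> L2" and \<delta> :: "int \<Rightarrow> 'a \<Rightarrow> L2" and \<delta>' :: "nat \<Rightarrow> int \<Rightarrow> int \<Rightarrow> 'a \<Rightarrow> L2"
  assumes f [measurable]: "f \<in> borel_measurable (PiM UNIV (\<lambda>_. borel))"
    and iid: "iid_with_copies M \<delta> \<delta>'"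
begin

definition fam :: "int + nat \<times> int \<times> int \<Rightarrow> 'a \<Rightarrow> L2" where
  "fam = case_sum \<delta> (\<lambda>(m, t, k). \<delta>' m t k)"

definition Idx :: "(int + nat \<times> int \<times> int) set" where
  "Idx = UNIV <+> {(m, t, k). 1 \<le> m \<and> k \<le> t - int m}"

lemma indep_fam: "indep_vars (\<lambda>_. borel) fam Idx"
  and id_fam: "i \<in> Idx \<Longrightarrow> distr M borel (fam i) = distr M borel (\<delta> 0)"
  using iid unfolding iid_with_copies_def Let_def fam_def[symmetric] Idx_def[symmetric] by blast+

definition X :: "int \<Rightarrow> 'a \<Rightarrow> L2" where
  "X t \<omega> = f (\<lambda>j. \<delta> (t - int j) \<omega>)"

abbreviation C :: "int \<Rightarrow> nat \<Rightarrow> 'a \<Rightarrow> L2" where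
  "C \<equiv> coupled f \<delta> \<delta>'"

text \<open>\<open>GX t\<close> and \<open>GC t m\<close> collect the innovations on which
  \<open>X t\<close> and the coupled variable depend. Copies carry the labels \<open>m\<close> and
  \<open>t\<close>, so they are never shared between different times.\<close>

definition GX :: "int \<Rightarrow> (int + nat \<times> int \<times> int) set" where
  "GX t = {Inl u |u. u \<le> t}"

definition GC :: "int \<Rightarrow> nat \<Rightarrow> (int + nat \<times> int \<times> int) set" where
  "GC t m = {Inl u |u. t - int m < u \<and> u \<le> t} \<union> {Inr (m, t, k) |k. k \<le> t - int m}"

lemma Inl_Idx: "Inl u \<in> Idx"
  by (simp add: Idx_def InlI)

lemma GX_sub: "GX t \<subseteq> Idx"
  by (auto simp: GX_def Idx_def)

lemma GC_sub: "1 \<le> m \<Longrightarrow> GC t m \<subseteq> Idx"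
  by (auto simp: GC_def Idx_def)

lemma sig_X: "X t \<in> borel_measurable (sig fam (GX t))"
proof -
  have "(\<lambda>\<omega>. fam (Inl (t - int j)) \<omega>) \<in> borel_measurable (sig fam (GX t))" for j
    using sig_component[of "Inl (t - int j)" "GX t" fam] by (simp add: GX_def)
  then have "(\<lambda>\<omega> j. \<delta> (t - int j) \<omega>) \<in> measurable (sig fam (GX t)) (PiM UNIV (\<lambda>_. borel))"
    by (intro measurable_abs_UNIV) (simp add: fam_def)
  from measurable_compose[OF this f] show ?thesis unfolding X_def .
qed

lemma sig_C: "C t m \<in> borel_measurable (sig fam (GC t m))"
proof -
  have "(\<lambda>\<omega>. fam (if j < m then Inl (t - int j) else Inr (m, t, t - int j)) \<omega>) \<in> borel_measurable (sig fam (GC t m))" for j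
    by (rule sig_component) (auto simp: GC_def)
  note comp = this
  have "(\<lambda>\<omega>. if j < m then \<delta> (t - int j) \<omega> else \<delta>' m t (t - int j) \<omega>) \<in> borel_measurable (sig fam (GC t m))" for j
    using comp[of j] by (cases "j < m") (simp_all add: fam_def)
  then have "(\<lambda>\<omega> j. if j < m then \<delta> (t - int j) \<omega> else \<delta>' m t (t - int j) \<omega>) \<in> measurable (sig fam (GC t m)) (PiM UNIV (\<lambda>_. borel))"
    by (intro measurable_abs_UNIV)
  from measurable_compose[OF this f] show ?thesis unfolding coupled_def[abs_def] .
qed

lemma sig_to_M:
  assumes "V \<in> borel_measurable (sig fam G)" "G \<subseteq> Idx"
  shows "V \<in> borel_measurable M"
  using indep_sig[OF indep_fam, of "{()}" "\<lambda>_. G" "\<lambda>_. V"] assms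
  by (auto simp: indep_vars_def2 disjoint_family_on_def)

lemma law_of_fam:
  assumes \<phi>: "inj \<phi>" "range \<phi> \<subseteq> Idx" and F: "F \<in> borel_measurable (PiM UNIV (\<lambda>_. borel))"
  shows "distr M borel (\<lambda>\<omega>. F (\<lambda>j. fam (\<phi> j) \<omega>)) = distr (PiM UNIV (\<lambda>_. distr M borel (\<delta> 0))) borel F"
proof -
  have meas: "(\<lambda>\<omega> j. fam (\<phi> j) \<omega>) \<in> measurable M (PiM UNIV (\<lambda>_. borel))"
    using indep_fam \<phi>(2) by (intro measurable_abs_UNIV) (auto simp: indep_vars_def2)
  have "distr M borel (\<lambda>\<omega>. F (\<lambda>j. fam (\<phi> j) \<omega>)) = distr (distr M (PiM UNIV (\<lambda>_. borel)) (\<lambda>\<omega> j. fam (\<phi> j) \<omega>)) borel F"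
    using distr_distr[OF F meas] by (simp add: comp_def)
  also have "distr M (PiM UNIV (\<lambda>_. borel)) (\<lambda>\<omega> j. fam (\<phi> j) \<omega>) = PiM UNIV (\<lambda>_. distr M borel (\<delta> 0))"
    by (rule iid_reindex[OF indep_fam id_fam \<phi>])
  finally show ?thesis .
qed

lemma law_X: "distr M borel (X t) = distr (PiM UNIV (\<lambda>_. distr M borel (\<delta> 0))) borel f"
  using law_of_fam[of "\<lambda>j. Inl (t - int j)" f] by (simp add: X_def[abs_def] fam_def inj_def Inl_Idx image_subset_iff)

lemma law_C: "1 \<le> m \<Longrightarrow> distr M borel (C t m) = distr M borel (X s)"
proof -
  assume m: "1 \<le> m"
  have "distr M borel (\<lambda>\<omega>. f (\<lambda>j. fam (if j < m then Inl (t - int j) else Inr (m, t, t - int j)) \<omega>))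
      = distr (PiM UNIV (\<lambda>_. distr M borel (\<delta> 0))) borel f"
    by (rule law_of_fam) (use m in \<open>auto simp: inj_def Idx_def split: if_splits\<close>)
  moreover have "C t m = (\<lambda>\<omega>. f (\<lambda>j. fam (if j < m then Inl (t - int j) else Inr (m, t, t - int j)) \<omega>))"
    unfolding coupled_def[abs_def] by (intro ext arg_cong[of _ _ f]) (auto simp: fam_def)
  ultimately show ?thesis by (simp add: law_X)
qed

text \<open>A joint statement, since \<open>X t\<close> and its coupling share recent innovations.
  Both are read off one sequence indexed by \<open>nat + nat\<close>: originals on the left, copies
  on the right.\<close>

lemma law_X_diff_C: "1 \<le> m \<Longrightarrow> distr M borel (\<lambda>\<omega>. X t \<omega> - C t m \<omega>) = distr M borel (\<lambda>\<omega>. X s \<omega> - C s m \<omega>)"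
proof -
  assume m: "1 \<le> m"
  define F where "F x = f (\<lambda>j. x (Inl j)) - f (\<lambda>j. if j < m then x (Inl j) else x (Inr (j - m)))" for x :: "nat + nat \<Rightarrow> L2"
  define \<phi> :: "int \<Rightarrow> nat + nat \<Rightarrow> int + nat \<times> int \<times> int" where
    "\<phi> t = case_sum (\<lambda>j. Inl (t - int j)) (\<lambda>j. Inr (m, t, t - int m - int j))" for t
  have "distr M borel (\<lambda>\<omega>. F (\<lambda>j. fam (\<phi> t j) \<omega>)) = distr (PiM UNIV (\<lambda>_. distr M borel (\<delta> 0))) borel F" for t
  proof (rule law_of_fam)
    show "inj (\<phi> t)" by (auto simp: inj_def \<phi>_def split: sum.splits)
    show "range (\<phi> t) \<subseteq> Idx" using m by (auto simp: \<phi>_def Idx_def split: sum.splits)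
    have "(\<lambda>x. if j < m then x (Inl j) else x (Inr (j - m))) \<in> borel_measurable (PiM UNIV (\<lambda>_ :: nat + nat. borel :: L2 measure))" for j
      by (cases "j < m") auto
    then show "F \<in> borel_measurable (PiM UNIV (\<lambda>_. borel))"
      unfolding F_def by (intro borel_measurable_diff measurable_compose[OF _ f] measurable_abs_UNIV) auto
  qed
  moreover have "F (\<lambda>j. fam (\<phi> t j) \<omega>) = X t \<omega> - C t m \<omega>" for t \<omega>
    unfolding F_def X_def coupled_def
    by (intro arg_cong2[where f="(-)"] arg_cong[of _ _ f] ext) (auto simp: \<phi>_def fam_def)
  ultimately show ?thesis by simp
qed

text \<open>The earlier variable is \<open>f\<close> applied to the sequence of innovations of the
  later one, with the first \<open>h\<close> entries dropped.\<close>

lemma law_pair: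
  assumes "s \<le> t"
  shows "distr M (borel \<Otimes>\<^sub>M borel) (\<lambda>\<omega>. (X s \<omega>, X t \<omega>)) = distr M (borel \<Otimes>\<^sub>M borel) (\<lambda>\<omega>. (X 0 \<omega>, X (t - s) \<omega>))"
proof -
  define h where "h = nat (t - s)"
  define F where "F x = (f (\<lambda>j. x (j + h)), f x)" for x
  have F: "F \<in> measurable (PiM UNIV (\<lambda>_. borel)) (borel \<Otimes>\<^sub>M borel)"
    unfolding F_def by (intro measurable_Pair measurable_compose[OF _ f] measurable_abs_UNIV f) auto
  have meas: "(\<lambda>\<omega> j. fam (Inl (t - int j)) \<omega>) \<in> measurable M (PiM UNIV (\<lambda>_. borel))" for t
    using indep_fam by (intro measurable_abs_UNIV) (auto simp: indep_vars_def2 Idx_def)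
  have law: "distr M (borel \<Otimes>\<^sub>M borel) (\<lambda>\<omega>. F (\<lambda>j. fam (Inl (t - int j)) \<omega>))
      = distr (PiM UNIV (\<lambda>_. distr M borel (\<delta> 0))) (borel \<Otimes>\<^sub>M borel) F" for t
    using distr_distr[OF F meas, of t] iid_reindex[OF indep_fam id_fam, of "\<lambda>j. Inl (t - int j)"]
    by (simp add: comp_def inj_def Inl_Idx image_subset_iff)
  have "F (\<lambda>j. fam (Inl (u - int j)) \<omega>) = (X (u - int h) \<omega>, X u \<omega>)" for u \<omega>
    unfolding F_def X_def fam_def by (simp add: algebra_simps)
  then show ?thesis using law[of t] law[of "t - s"] assms by (simp add: h_def)
qed

lemma sq_int_law_eq:
  fixes U V :: "'a \<Rightarrow> L2"
  assumes "distr M borel U = distr M borel V" "U \<in> borel_measurable M" "V \<in> borel_measurable M"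
  shows "sq_int M U \<longleftrightarrow> sq_int M V" "rms M U = rms M V" "(\<integral>\<omega>. U \<omega> \<partial>M) = (\<integral>\<omega>. V \<omega> \<partial>M)"
proof -
  have "integrable (distr M borel U) (\<lambda>x. (norm x)\<^sup>2) \<longleftrightarrow> integrable (distr M borel V) (\<lambda>x. (norm x)\<^sup>2)"
    using assms(1) by simp
  then show "sq_int M U \<longleftrightarrow> sq_int M V"
    using assms by (subst (asm) (1 2) integrable_distr_eq) (auto simp: sq_int_def)
  have "(\<integral>x. (norm x)\<^sup>2 \<partial>distr M borel V) = (\<integral>\<omega>. (norm (V \<omega>))\<^sup>2 \<partial>M)"
    by (rule integral_distr[OF assms(3)]) measurable
  moreover have "(\<integral>x. (norm x)\<^sup>2 \<partial>distr M borel U) = (\<integral>\<omega>. (norm (U \<omega>))\<^sup>2 \<partial>M)"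
    by (rule integral_distr[OF assms(2)]) measurable
  ultimately show "rms M U = rms M V" unfolding rms_def assms(1) by simp
  have "(\<integral>x. x \<partial>distr M borel V) = (\<integral>\<omega>. V \<omega> \<partial>M)" by (rule integral_distr[OF assms(3)]) simp
  moreover have "(\<integral>x. x \<partial>distr M borel U) = (\<integral>\<omega>. U \<omega> \<partial>M)" by (rule integral_distr[OF assms(2)]) simp
  ultimately show "(\<integral>\<omega>. U \<omega> \<partial>M) = (\<integral>\<omega>. V \<omega> \<partial>M)" unfolding assms(1) by simp
qed

end

context shift_process begin

definition err :: "nat \<Rightarrow> real" where
  "err m = rms M (\<lambda>\<omega>. X 0 \<omega> - C 0 m \<omega>)"

lemma meas_X [measurable]: "X t \<in> borel_measurable M"
  by (rule sig_to_M[OF sig_X GX_sub])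

lemma meas_C: "1 \<le> m \<Longrightarrow> C t m \<in> borel_measurable M"
  by (rule sig_to_M[OF sig_C GC_sub])

lemma law_X_eq: "distr M borel (X t) = distr M borel (X s)"
  by (simp add: law_X)

lemma rms_X_diff_C: "1 \<le> m \<Longrightarrow> rms M (\<lambda>\<omega>. X t \<omega> - C t m \<omega>) = err m"
  unfolding err_def by (rule sq_int_law_eq(2)[OF law_X_diff_C]) (auto intro!: borel_measurable_diff meas_C)

text \<open>The approximant \<open>Z\<close> is the coupled variable, truncated and recentred;
  \<open>D\<close> is the error, of root mean square at most \<open>d\<close>. Lags below
  \<open>m\<close> have covariance at most \<open>d\<^sup>2\<close>. At a lag
  \<open>h \<ge> m\<close>, \<open>Z t\<close> is independent of \<open>D s\<close> and drops out,
  and subtracting the independent centred \<open>C t h\<close> from \<open>X t\<close> leaves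
  \<open>d * err h\<close>. The covariances sum to at most \<open>m * d\<^sup>2 + d * E\<close>, and
  \<open>weighted_double_sum_le\<close> turns this into the bound for all weighted sums.\<close>

lemma approximant_exists:
  assumes sq0: "sq_int M (X 0)" and mean0: "(\<integral>\<omega>. X 0 \<omega> \<partial>M) = 0"
    and sum: "summable (\<lambda>m. err (Suc m))" and rate: "(\<lambda>m. real m * err m) \<longlonglongrightarrow> 0" and "\<eta> > 0"
  shows "\<exists>Z m T. approximant M (\<lambda>t. X (int t)) \<eta> Z m T"
proof -
  have sqX: "sq_int M (X t)" for t using sq_int_law_eq(1)[OF law_X_eq[of t 0]] sq0 by simp
  have meanX: "(\<integral>\<omega>. X t \<omega> \<partial>M) = 0" for t using sq_int_law_eq(3)[OF law_X_eq[of t 0]] mean0 by simp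
  have sqC: "sq_int M (C t m)" if "1 \<le> m" for t m
    using sq_int_law_eq(1)[OF law_C[OF that, of t 0] meas_C[OF that]] sq0 by simp
  have meanC: "(\<integral>\<omega>. C t m \<omega> \<partial>M) = 0" if "1 \<le> m" for t m
    using sq_int_law_eq(3)[OF law_C[OF that, of t 0] meas_C[OF that]] mean0 by simp
  have err0: "0 \<le> err m" for m by (simp add: err_def)
  define E where "E = (\<Sum>m. err (Suc m))"
  have E0: "0 \<le> E" unfolding E_def using sum err0 by (rule suminf_nonneg)
  have errlim: "err \<longlonglongrightarrow> 0" using summable_LIMSEQ_zero[OF sum] by (simp add: filterlim_sequentially_Suc[of err])
  \<comment> \<open>This is the bound with perfect truncation, where \<open>d\<close> is
    \<open>err m\<close>; the rate condition handles the part multiplied by \<open>m\<close>. The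
    factor 4 leaves room over the 2 that is needed. The truncation level is chosen later, for this
    fixed \<open>m\<close>.\<close>
  have "(\<lambda>m. 4 * ((real m * err m) * err m + err m * E)) \<longlonglongrightarrow> 4 * (0 * 0 + 0 * E)"
    by (intro tendsto_intros rate errlim)
  then have "\<forall>\<^sub>F m in sequentially. 4 * ((real m * err m) * err m + err m * E) < \<eta> \<and> 1 \<le> m"
    using \<open>\<eta> > 0\<close> by (intro eventually_conj order_tendstoD(2) eventually_ge_at_top) auto
  then obtain m where m: "4 * ((real m * err m) * err m + err m * E) < \<eta>" "1 \<le> m"
    by (auto simp: eventually_sequentially)
  define \<tau> where "\<tau> T = rms M (\<lambda>\<omega>. X 0 \<omega> - truncate (real T) (X 0 \<omega>))" for T
  have "(\<lambda>T. 4 * (real m * (err m + 2 * \<tau> T)\<^sup>2 + (err m + 2 * \<tau> T) * E)) \<longlonglongrightarrow>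
      4 * (real m * (err m + 2 * 0)\<^sup>2 + (err m + 2 * 0) * E)"
    unfolding \<tau>_def by (intro tendsto_intros truncation_error_tendsto sq0)
  then have "\<forall>\<^sub>F T in sequentially. 4 * (real m * (err m + 2 * \<tau> T)\<^sup>2 + (err m + 2 * \<tau> T) * E) < \<eta>"
    using m(1) by (intro order_tendstoD(2)) (auto simp: power2_eq_square mult.assoc)
  then obtain T where T: "4 * (real m * (err m + 2 * \<tau> T)\<^sup>2 + (err m + 2 * \<tau> T) * E) < \<eta>"
    by (auto simp: eventually_sequentially)
  define d where "d = err m + 2 * \<tau> T"
  have d0: "0 \<le> d" by (simp add: d_def \<tau>_def err0)
  define c where "c = (\<integral>\<omega>. truncate (real T) (X 0 \<omega>) \<partial>M)"
  \<comment> \<open>The recentring constant \<open>c\<close> is the same for all times, because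
    every coupled variable has the law of \<open>X 0\<close>.\<close>
  define Z where "Z t \<omega> = truncate (real T) (C t m \<omega>) - c" for t \<omega>
  note [measurable] = meas_C[OF m(2)]
  have meas_Z [measurable]: "Z t \<in> borel_measurable M" for t unfolding Z_def[abs_def] by measurable
  have sqT: "sq_int M (\<lambda>\<omega>. truncate (real T) (V \<omega>))" if "V \<in> borel_measurable M" for V
    using that by (intro sq_int_bounded[where T="real T"]) (auto simp: norm_truncate)
  have trunc_law: "distr M borel (\<lambda>\<omega>. g (C t m \<omega>)) = distr M borel (\<lambda>\<omega>. g (X 0 \<omega>))"
    if g [measurable]: "g \<in> borel_measurable borel" for t and g :: "L2 \<Rightarrow> L2"
  proof -
    have "distr M borel (\<lambda>\<omega>. g (C t m \<omega>)) = distr (distr M borel (C t m)) borel g"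
      by (subst distr_distr) (auto simp: comp_def)
    also have "\<dots> = distr (distr M borel (X 0)) borel g" by (simp only: law_C[OF m(2), of t 0])
    also have "\<dots> = distr M borel (\<lambda>\<omega>. g (X 0 \<omega>))" by (subst distr_distr) (auto simp: comp_def)
    finally show ?thesis .
  qed
  have c_eq: "(\<integral>\<omega>. truncate (real T) (C t m \<omega>) \<partial>M) = c" for t
    unfolding c_def by (rule sq_int_law_eq(3)[OF trunc_law]) auto
  have "c = (\<integral>\<omega>. truncate (real T) (X 0 \<omega>) - X 0 \<omega> \<partial>M)"
    unfolding c_def using integrable_sq_int[OF sqT[OF meas_X]] integrable_sq_int[OF sq0] by (simp add: mean0)
  also have "norm \<dots> \<le> rms M (\<lambda>\<omega>. truncate (real T) (X 0 \<omega>) - X 0 \<omega>)"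
    by (intro norm_integral_le_rms sq_int_diff sqT sq0) simp
  also have "\<dots> = \<tau> T" unfolding \<tau>_def rms_def by (simp add: norm_minus_commute)
  finally have c_le: "norm c \<le> \<tau> T" .
  have sqZ: "sq_int M (Z t)" for t
    unfolding Z_def[abs_def] by (intro sq_int_diff sqT) auto
  have meanZ: "(\<integral>\<omega>. Z t \<omega> \<partial>M) = 0" for t
    unfolding Z_def using integrable_sq_int[OF sqT[of "C t m"]] by (simp add: c_eq prob_space)
  have boundZ: "norm (Z t \<omega>) \<le> real T + norm c" for t \<omega>
    unfolding Z_def using norm_triangle_ineq4[of "truncate (real T) (C t m \<omega>)" c] norm_truncate[of "real T" "C t m \<omega>"] by simp
  define D where "D t \<omega> = X t \<omega> - Z t \<omega>" for t \<omega>
  have sqD: "sq_int M (D t)" for t unfolding D_def[abs_def] by (intro sq_int_diff sqX sqZ)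
  have rmsD: "rms M (D t) \<le> d" for t
  proof -
    have 1: "sq_int M (\<lambda>\<omega>. X t \<omega> - C t m \<omega>)" by (intro sq_int_diff sqX sqC m(2))
    have 2: "sq_int M (\<lambda>\<omega>. C t m \<omega> - truncate (real T) (C t m \<omega>))" by (intro sq_int_diff sqC[OF m(2)] sqT) auto
    \<comment> \<open>Coupling error, truncation error and recentring; the last two cost
      \<open>\<tau> T\<close> each, hence the \<open>2\<close> in \<open>d\<close>.\<close>
    have eq: "D t = (\<lambda>\<omega>. (X t \<omega> - C t m \<omega>) + ((C t m \<omega> - truncate (real T) (C t m \<omega>)) + c))"
      by (auto simp: D_def Z_def)
    have "rms M (\<lambda>\<omega>. C t m \<omega> - truncate (real T) (C t m \<omega>)) = \<tau> T"
      unfolding \<tau>_def by (rule sq_int_law_eq(2)[OF trunc_law]) auto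
    then have "rms M (\<lambda>\<omega>. (C t m \<omega> - truncate (real T) (C t m \<omega>)) + c) \<le> \<tau> T + \<tau> T"
      using rms_add[OF 2 sq_int_const[of c]] c_le by (simp add: rms_const)
    then show ?thesis
      using rms_add[OF 1 sq_int_add[OF 2 sq_int_const[of c]]] rms_X_diff_C[OF m(2), of t]
      unfolding eq d_def by simp
  qed
  have sigZ: "Z t \<in> borel_measurable (sig fam (GC t m))" for t
  proof -
    note [measurable] = sig_C[of t m]
    show ?thesis unfolding Z_def[abs_def] by measurable
  qed
  have sigD: "D t \<in> borel_measurable (sig fam (GX t \<union> GC t m))" for t
    unfolding D_def[abs_def]
    by (intro borel_measurable_diff sig_mono[OF _ sig_X] sig_mono[OF _ sigZ]) auto
  define g where "g h = (if h < m then d\<^sup>2 else d * err h)" for h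
  have covD_le: "\<bar>\<integral>\<omega>. inner (D s \<omega>) (D t \<omega>) \<partial>M\<bar> \<le> g (nat (t - s))" if "s \<le> t" for s t
  proof (cases "nat (t - s) < m")
    case True
    have "\<bar>\<integral>\<omega>. inner (D s \<omega>) (D t \<omega>) \<partial>M\<bar> \<le> rms M (D s) * rms M (D t)" by (rule abs_integral_inner_le[OF sqD sqD])
    also have "\<dots> \<le> d * d" by (intro mult_mono rmsD d0) simp
    finally show ?thesis using True by (simp add: g_def power2_eq_square)
  next
    case False
    define h where "h = nat (t - s)"
    have h: "m \<le> h" "1 \<le> h" "int h = t - s" using False m(2) that by (auto simp: h_def)
    have sub: "GX s \<union> GC s m \<subseteq> Idx" using GX_sub GC_sub[OF m(2)] by blast
    \<comment> \<open>\<open>D s\<close> uses innovations up to time \<open>s\<close> and copies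
      labelled \<open>s\<close>; \<open>Z t\<close> uses innovations after
      \<open>t - m \<ge> s\<close> and copies labelled \<open>t\<close>.\<close>
    have "indep_var borel (D s) borel (Z t)"
      by (rule indep_sig_pair[OF indep_fam sub GC_sub[OF m(2)] _ sigD sigZ])
         (use h m in \<open>auto simp: GX_def GC_def\<close>)
    then have DZ: "(\<integral>\<omega>. inner (D s \<omega>) (Z t \<omega>) \<partial>M) = 0" by (simp add: indep_integral_inner sqD sqZ meanZ)
    \<comment> \<open>The coupling with window exactly \<open>h = t - s\<close> keeps only
      innovations after time \<open>s\<close>.\<close>
    have "indep_var borel (D s) borel (C t h)"
      by (rule indep_sig_pair[OF indep_fam sub GC_sub[OF h(2)] _ sigD sig_C])
         (use h m in \<open>auto simp: GX_def GC_def\<close>)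
    then have DC: "(\<integral>\<omega>. inner (D s \<omega>) (C t h \<omega>) \<partial>M) = 0" by (simp add: indep_integral_inner sqD sqC[OF h(2)] meanC[OF h(2)])
    have "(\<integral>\<omega>. inner (D s \<omega>) (D t \<omega>) \<partial>M) = (\<integral>\<omega>. inner (D s \<omega>) (X t \<omega>) \<partial>M)"
      unfolding D_def[of t] inner_diff_right using DZ by (simp add: integrable_inner_sq_int sqD sqX sqZ)
    also have "\<dots> = (\<integral>\<omega>. inner (D s \<omega>) (X t \<omega> - C t h \<omega>) \<partial>M)"
      unfolding inner_diff_right using DC by (simp add: integrable_inner_sq_int sqD sqX sqC[OF h(2)])
    finally have "\<bar>\<integral>\<omega>. inner (D s \<omega>) (D t \<omega>) \<partial>M\<bar> \<le> rms M (D s) * rms M (\<lambda>\<omega>. X t \<omega> - C t h \<omega>)"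
      by (simp add: abs_integral_inner_le sqD sq_int_diff sqX sqC[OF h(2)])
    also have "\<dots> \<le> d * err h" unfolding rms_X_diff_C[OF h(2)] by (intro mult_right_mono rmsD err0)
    finally show ?thesis using False by (simp add: g_def h_def)
  qed
  have serr: "summable err" using sum by (simp add: summable_Suc_iff)
  have g_split: "g (h + m) = d * err (h + m)" for h by (simp add: g_def)
  have "summable (\<lambda>h. g (h + m))" unfolding g_split using serr by (intro summable_mult) (simp add: summable_iff_shift)
  then have sg: "summable g" by (simp add: summable_iff_shift)
  have g0: "0 \<le> g h" for h using d0 err0 by (simp add: g_def)
  have "(\<Sum>h. g h) = (\<Sum>h. g (h + m)) + (\<Sum>h<m. g h)" by (rule suminf_split_initial_segment[OF sg])
  also have "(\<Sum>h<m. g h) = real m * d\<^sup>2" by (simp add: g_def)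
  also have "(\<Sum>h. g (h + m)) = d * (\<Sum>h. err (h + m))"
    unfolding g_split using serr by (intro suminf_mult) (simp add: summable_iff_shift)
  also have "(\<Sum>h. err (h + m)) \<le> E"
  proof -
    have "(\<Sum>h. err (h + m)) = (\<Sum>h. err (Suc (h + (m - 1))))" using m(2) by simp
    also have "\<dots> \<le> E"
      unfolding E_def using suminf_split_initial_segment[OF sum, of "m - 1"] err0 by (simp add: sum_nonneg)
    finally show ?thesis .
  qed
  finally have "(\<Sum>h. g h) \<le> d * E + real m * d\<^sup>2" using d0 by (simp add: mult_left_mono)
  moreover have "0 \<le> d * E" "0 \<le> real m * d\<^sup>2" using d0 E0 by simp_all
  ultimately have G: "2 * (\<Sum>h. g h) \<le> \<eta>" using T unfolding d_def[symmetric] by argo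
  have "approximant M (\<lambda>t. X (int t)) \<eta> (\<lambda>t. Z (int t)) m (real T + norm c)"
    unfolding approximant_def
  proof (intro conjI allI impI)
    show "m_dep M (\<lambda>t. Z (int t)) m"
      unfolding m_dep_def
    proof (intro allI impI)
      fix J :: "nat set" and K a assume K: "\<forall>i\<in>J. \<forall>j\<in>J. i \<noteq> j \<longrightarrow> (\<forall>s\<in>K i. \<forall>t\<in>K j. m \<le> gap s t)"
      let ?G = "\<lambda>j. \<Union>t\<in>K j. GC (int t) m"
      show "indep_vars (\<lambda>_. borel) (\<lambda>j \<omega>. \<Sum>t\<in>K j. a j t *\<^sub>R Z (int t) \<omega>) J"
      proof (rule indep_sig[OF indep_fam, where K="?G"])
        show "?G j \<subseteq> Idx" for j using GC_sub[OF m(2)] by blast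
        \<comment> \<open>Distance at least \<open>m\<close> separates the windows of kept
          innovations, and \<open>m \<ge> 1\<close> makes the times different, which separates the
          copies.\<close>
        have disj: "GC (int s) m \<inter> GC (int t) m = {}" if "m \<le> gap s t" for s t
          using that m(2) by (auto simp: GC_def gap_def)
        show "disjoint_family_on ?G J"
          unfolding disjoint_family_on_def
        proof (intro ballI impI)
          fix i j assume ij: "i \<in> J" "j \<in> J" "i \<noteq> j"
          have "GC (int s) m \<inter> GC (int t) m = {}" if "s \<in> K i" "t \<in> K j" for s t
            using K ij that by (intro disj) blast
          then show "?G i \<inter> ?G j = {}" by blast
        qed
        show "(\<lambda>\<omega>. \<Sum>t\<in>K j. a j t *\<^sub>R Z (int t) \<omega>) \<in> borel_measurable (sig fam (?G j))" for j
          by (intro borel_measurable_sum borel_measurable_scaleR measurable_const sig_mono[OF _ sigZ]) auto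
      qed
    qed
    show "(\<integral>\<omega>. (norm (\<Sum>t\<in>A. a t *\<^sub>R (X (int t) \<omega> - Z (int t) \<omega>)))\<^sup>2 \<partial>M) \<le> \<eta> * (\<Sum>t\<in>A. (a t)\<^sup>2)"
      if "finite A" for A and a :: "nat \<Rightarrow> real"
    proof -
      have "(\<integral>\<omega>. (norm (\<Sum>t\<in>A. a t *\<^sub>R (X (int t) \<omega> - Z (int t) \<omega>)))\<^sup>2 \<partial>M)
          = (\<Sum>s\<in>A. \<Sum>t\<in>A. a s * a t * (\<integral>\<omega>. inner (D (int s) \<omega>) (D (int t) \<omega>) \<partial>M))"
        unfolding D_def[symmetric] power2_norm_eq_inner
        by (rule weighted_sum_second_moment[of "\<lambda>t. D (int t)", OF sqD bounded_linear_ident])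
      also have "\<dots> \<le> \<bar>\<dots>\<bar>" by simp
      also have "\<dots> \<le> 2 * (\<Sum>h. g h) * (\<Sum>t\<in>A. (a t)\<^sup>2)"
      proof (rule weighted_double_sum_le[OF _ sg g0 that])
        fix s t
        show "\<bar>\<integral>\<omega>. inner (D (int s) \<omega>) (D (int t) \<omega>) \<partial>M\<bar> \<le> g (gap s t)"
        proof (cases "s \<le> t")
          case True
          then have "nat (int t - int s) = gap s t" by (simp add: gap_def)
          then show ?thesis using covD_le[of "int s" "int t"] True by simp
        next
          case False
          then have "nat (int s - int t) = gap s t" by (simp add: gap_def)
          then show ?thesis using covD_le[of "int t" "int s"] False by (simp add: inner_commute)
        qed
      qed
      also have "\<dots> \<le> \<eta> * (\<Sum>t\<in>A. (a t)\<^sup>2)" by (intro mult_right_mono G sum_nonneg) simp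
      finally show ?thesis .
    qed
  qed (use boundZ meanZ in auto)
  then show ?thesis by blast
qed

text \<open>At a lag \<open>h \<ge> 1\<close> the variable \<open>C t h\<close> is centred and
  independent of \<open>X s\<close>, so only the coupling error contributes to the covariance. At
  lag zero plain Cauchy-Schwarz is used, hence the separate value there.\<close>

theorem weak_dep_shift_process:
  assumes sq0: "sq_int M (X 0)" and mean0: "(\<integral>\<omega>. X 0 \<omega> \<partial>M) = 0"
    and sum: "summable (\<lambda>m. err (Suc m))" and rate: "(\<lambda>m. real m * err m) \<longlonglongrightarrow> 0"
  shows "weak_dep M (\<lambda>t. X (int t)) (\<lambda>h. if h = 0 then rms M (X 0) else err h)"
proof
  have sqX: "sq_int M (X t)" for t using sq_int_law_eq(1)[OF law_X_eq[of t 0]] sq0 by simp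
  have sqC: "sq_int M (C t m)" if "1 \<le> m" for t m
    using sq_int_law_eq(1)[OF law_C[OF that, of t 0] meas_C[OF that]] sq0 by simp
  show "sq_int M (X (int t))" for t by (rule sqX)
  show "(\<integral>\<omega>. X (int t) \<omega> \<partial>M) = 0" for t using sq_int_law_eq(3)[OF law_X_eq[of t 0]] mean0 by simp
  have "summable (\<lambda>h. if Suc h = 0 then rms M (X 0) else err (Suc h))" using sum by simp
  then show "summable (\<lambda>h. if h = 0 then rms M (X 0) else err h)" by (subst (asm) summable_Suc_iff)
  show "0 \<le> (if h = 0 then rms M (X 0) else err h)" for h by (simp add: err_def)
  show "\<exists>Z m T. approximant M (\<lambda>t. X (int t)) \<eta> Z m T" if "\<eta> > 0" for \<eta>
    by (rule approximant_exists[OF assms that])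
  show "(\<integral>\<omega>. inner (R (X (int s) \<omega>)) (X (int t) \<omega>) \<partial>M) = (\<integral>\<omega>. inner (R (X (int 0) \<omega>)) (X (int (t - s)) \<omega>) \<partial>M)"
    if R: "bounded_linear R" and "s \<le> t" for R :: "L2 \<Rightarrow> L2" and s t
  proof -
    let ?F = "\<lambda>(x, y). inner (R x) y"
    have [measurable]: "R \<in> borel_measurable borel" by (rule borel_measurable_bounded_linear[OF R])
    have F: "?F \<in> borel_measurable (borel \<Otimes>\<^sub>M borel)"
      unfolding split_beta' by (intro borel_measurable_inner measurable_compose[OF measurable_fst] measurable_snd) measurable
    have int: "(\<integral>\<omega>. inner (R (X s \<omega>)) (X t \<omega>) \<partial>M) = integral\<^sup>L (distr M (borel \<Otimes>\<^sub>M borel) (\<lambda>\<omega>. (X s \<omega>, X t \<omega>))) ?F" for s t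
      by (subst integral_distr[OF _ F]) auto
    show ?thesis unfolding int using law_pair[of "int s" "int t"] that by (simp add: of_nat_diff)
  qed
  show "\<bar>\<integral>\<omega>. inner (R (X (int s) \<omega>)) (X (int t) \<omega>) \<partial>M\<bar>
      \<le> rms M (\<lambda>\<omega>. R (X (int 0) \<omega>)) * (if t - s = 0 then rms M (X 0) else err (t - s))"
    if R: "bounded_linear R" and "s \<le> t" for R :: "L2 \<Rightarrow> L2" and s t
  proof -
    have [measurable]: "R \<in> borel_measurable borel" by (rule borel_measurable_bounded_linear[OF R])
    have sqR: "sq_int M (\<lambda>\<omega>. R (X u \<omega>))" for u by (rule sq_int_bounded_linear[OF R sqX])
    have rmsR: "rms M (\<lambda>\<omega>. R (X u \<omega>)) = rms M (\<lambda>\<omega>. R (X 0 \<omega>))" for u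
    proof (rule sq_int_law_eq(2))
      have "distr M borel (\<lambda>\<omega>. R (X v \<omega>)) = distr (distr M borel (X v)) borel R" for v
        by (subst distr_distr) (auto simp: comp_def)
      then show "distr M borel (\<lambda>\<omega>. R (X u \<omega>)) = distr M borel (\<lambda>\<omega>. R (X 0 \<omega>))" by (simp only: law_X)
    qed auto
    show ?thesis
    proof (cases "s = t")
      case True
      have "\<bar>\<integral>\<omega>. inner (R (X (int s) \<omega>)) (X (int s) \<omega>) \<partial>M\<bar> \<le> rms M (\<lambda>\<omega>. R (X (int s) \<omega>)) * rms M (X (int s))"
        by (rule abs_integral_inner_le[OF sqR sqX])
      moreover have "rms M (X (int s)) = rms M (X 0)" by (rule sq_int_law_eq(2)[OF law_X_eq]) auto
      ultimately show ?thesis using True rmsR[of "int s"] by simp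
    next
      case False
      define h where "h = t - s"
      have h: "1 \<le> h" "int t = int s + int h" using False that by (auto simp: h_def)
      have sigR: "(\<lambda>\<omega>. R (X (int s) \<omega>)) \<in> borel_measurable (sig fam (GX (int s)))"
        by (rule measurable_compose[OF sig_X]) measurable
      have "indep_var borel (\<lambda>\<omega>. R (X (int s) \<omega>)) borel (C (int t) h)"
        by (rule indep_sig_pair[OF indep_fam GX_sub GC_sub[OF h(1)] _ sigR sig_C])
           (use h in \<open>auto simp: GX_def GC_def\<close>)
      then have "(\<integral>\<omega>. inner (R (X (int s) \<omega>)) (C (int t) h \<omega>) \<partial>M) = 0"
        using sq_int_law_eq(3)[OF law_C[OF h(1), of "int t" 0] meas_C[OF h(1)]] mean0
        by (simp add: indep_integral_inner sqR sqC[OF h(1)])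
      then have "(\<integral>\<omega>. inner (R (X (int s) \<omega>)) (X (int t) \<omega>) \<partial>M) = (\<integral>\<omega>. inner (R (X (int s) \<omega>)) (X (int t) \<omega> - C (int t) h \<omega>) \<partial>M)"
        unfolding inner_diff_right by (simp add: integrable_inner_sq_int sqR sqX sqC[OF h(1)])
      then have "\<bar>\<integral>\<omega>. inner (R (X (int s) \<omega>)) (X (int t) \<omega>) \<partial>M\<bar> \<le> rms M (\<lambda>\<omega>. R (X (int s) \<omega>)) * rms M (\<lambda>\<omega>. X (int t) \<omega> - C (int t) h \<omega>)"
        by (simp add: abs_integral_inner_le sqR sq_int_diff sqX sqC[OF h(1)])
      then have "\<bar>\<integral>\<omega>. inner (R (X (int s) \<omega>)) (X (int t) \<omega>) \<partial>M\<bar> \<le> rms M (\<lambda>\<omega>. R (X 0 \<omega>)) * err h"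
        by (simp only: rmsR[of "int s"] rms_X_diff_C[OF h(1)])
      moreover have "\<not> t \<le> s" using False that by simp
      ultimately show ?thesis unfolding h_def by simp
    qed
  qed
qed

end

section \<open>Long-run variances and the central limit theorem\<close>

definition selfadj :: "(L2 \<Rightarrow> L2) \<Rightarrow> bool" where
  "selfadj R \<longleftrightarrow> bounded_linear R \<and> (\<forall>x y. inner (R x) y = inner x (R y))"

text \<open>Symmetrised rank-one operator. It turns the covariance of two linear functionals into
  the quadratic form of a self-adjoint operator, so functionals and the norm are treated
  together.\<close>

definition symm :: "L2 \<Rightarrow> L2 \<Rightarrow> L2 \<Rightarrow> L2" where
  "symm u v x = (1/2) *\<^sub>R (inner u x *\<^sub>R v + inner v x *\<^sub>R u)"

lemma selfadj_symm: "selfadj (symm u v)"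
  unfolding selfadj_def
proof (intro conjI allI)
  show "bounded_linear (symm u v)"
    unfolding symm_def [abs_def]
    by (intro bounded_linear_add bounded_linear_scaleR_left[THEN bounded_linear_compose]
        bounded_linear_scaleR_right[THEN bounded_linear_compose] bounded_linear_inner_right)
  show "inner (symm u v x) y = inner x (symm u v y)" for x y
    unfolding symm_def by (simp add: inner_add_left inner_add_right inner_commute[of x])
qed

lemma inner_symm: "inner (symm u v x) x = inner u x * inner v x"
  by (simp add: symm_def inner_add_left)

lemma selfadj_ident: "selfadj (\<lambda>x. x)"
  by (simp add: selfadj_def bounded_linear_ident)

lemma cmod_iexp_diff_le: "cmod (iexp x - iexp y) \<le> \<bar>x - y\<bar>"
proof -
  have "cmod (iexp x - iexp y) = cmod (iexp y * (iexp (x - y) - 1))"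
    by (simp add: right_diff_distrib exp_add[symmetric] algebra_simps)
  also have "\<dots> = cmod (iexp (x - y) - 1)" by (simp add: norm_mult)
  also have "\<dots> \<le> \<bar>x - y\<bar>" using iexp_approx1[of "x - y" 0] by simp
  finally show ?thesis .
qed

lemma exp_half_diff_le:
  fixes x y :: real
  assumes "0 \<le> x" "0 \<le> y"
  shows "\<bar>exp (- x / 2) - exp (- y / 2)\<bar> \<le> \<bar>x - y\<bar> / 2"
proof -
  have one: "exp (- x / 2) - exp (- y / 2) \<le> (y - x) / 2" if "0 \<le> x" "x \<le> y" for x y :: real
  proof -
    have "1 - (y - x) / 2 \<le> exp (- ((y - x) / 2))" using exp_ge_add_one_self[of "- ((y - x) / 2)"] by simp
    then have "1 - exp (- ((y - x) / 2)) \<le> (y - x) / 2" by linarith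
    moreover have "0 \<le> 1 - exp (- ((y - x) / 2))" using that by simp
    moreover have "exp (- x / 2) \<le> 1" using that by simp
    ultimately have "exp (- x / 2) * (1 - exp (- ((y - x) / 2))) \<le> 1 * ((y - x) / 2)"
      using that by (intro mult_mono) simp_all
    moreover have "exp (- x / 2) * exp (- ((y - x) / 2)) = exp (- y / 2)"
      unfolding exp_add[symmetric] by (simp add: field_simps)
    ultimately show ?thesis by (simp add: right_diff_distrib)
  qed
  have mono: "exp (- y / 2) \<le> exp (- x / 2)" if "x \<le> y" for x y :: real using that by simp
  show ?thesis
  proof (cases "x \<le> y")
    case True
    have "\<bar>x - y\<bar> = y - x" using True by simp
    moreover have "\<bar>exp (- x / 2) - exp (- y / 2)\<bar> = exp (- x / 2) - exp (- y / 2)" using mono[OF True] by (intro abs_of_nonneg) linarith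
    ultimately show ?thesis using one[OF assms(1) True] by (simp only:)
  next
    case False
    then have "y \<le> x" by simp
    then have "\<bar>x - y\<bar> = x - y" by simp
    moreover have "\<bar>exp (- x / 2) - exp (- y / 2)\<bar> = - (exp (- x / 2) - exp (- y / 2))" using mono[OF \<open>y \<le> x\<close>] by (intro abs_of_nonpos) linarith
    ultimately show ?thesis using one[OF assms(2) \<open>y \<le> x\<close>] by (simp only: minus_diff_eq)
  qed
qed

text \<open>Carries a Gaussian approximation from \<open>U\<close> to a nearby \<open>S\<close>. The
  four summands come from the Lipschitz property of the exponential, from a bound for the variance
  of \<open>U\<close>, from the difference of the variances of \<open>U\<close> and \<open>S\<close>
  as a difference of squares, and from the distance of the variance of \<open>S\<close> to its
  target \<open>L\<close>. It is applied on the original space and in the bootstrap world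
  alike.\<close>

lemma (in prob_space) char_compare:
  fixes S U :: "'a \<Rightarrow> L2"
  assumes S: "sq_int M S" and U: "sq_int M U" and "0 \<le> L" "0 \<le> \<kappa>"
    and char: "cmod ((CLINT \<omega>|M. iexp (inner h (U \<omega>))) - complex_of_real (exp (- s2 / 2))) \<le> \<kappa> * s2"
    and s2: "s2 = (\<integral>\<omega>. (inner h (U \<omega>))\<^sup>2 \<partial>M)"
    and \<rho>: "rms M (\<lambda>\<omega>. S \<omega> - U \<omega>) \<le> \<rho>"
  shows "cmod ((CLINT \<omega>|M. iexp (inner h (S \<omega>))) - complex_of_real (exp (- L / 2)))
    \<le> norm h * \<rho> + \<kappa> * ((norm h)\<^sup>2 * (rms M S + \<rho>)\<^sup>2) + (norm h)\<^sup>2 * (\<rho> * (2 * rms M S + \<rho>))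
      + \<bar>(\<integral>\<omega>. (inner h (S \<omega>))\<^sup>2 \<partial>M) - L\<bar>"
proof -
  have [measurable]: "S \<in> borel_measurable M" "U \<in> borel_measurable M" using S U by (auto simp: sq_int_def)
  have SU: "sq_int M (\<lambda>\<omega>. S \<omega> - U \<omega>)" by (rule sq_int_diff[OF S U])
  have lin: "sq_int M (\<lambda>\<omega>. inner h (X \<omega>))" if "sq_int M X" for X
    using sq_int_bounded_linear[OF bounded_linear_inner_right that] .
  have rms_lin: "rms M (\<lambda>\<omega>. inner h (X \<omega>)) \<le> norm h * rms M X" if X: "sq_int M X" for X
  proof -
    have "(rms M (\<lambda>\<omega>. inner h (X \<omega>)))\<^sup>2 \<le> (\<integral>\<omega>. (norm h)\<^sup>2 * (norm (X \<omega>))\<^sup>2 \<partial>M)"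
      unfolding rms_power2
    proof (rule integral_mono)
      show "(norm (inner h (X \<omega>)))\<^sup>2 \<le> (norm h)\<^sup>2 * (norm (X \<omega>))\<^sup>2" for \<omega>
        using power_mono[OF Cauchy_Schwarz_ineq2[of h "X \<omega>"] abs_ge_zero, of 2] by (simp add: power_mult_distrib)
    qed (use sq_intD[OF X] sq_intD[OF lin[OF X]] in auto)
    also have "\<dots> = (norm h * rms M X)\<^sup>2" by (simp add: power_mult_distrib rms_power2)
    finally show ?thesis by (rule power2_le_imp_le) simp
  qed
  have rho0: "0 \<le> \<rho>" using \<rho> rms_nonneg[of M "\<lambda>\<omega>. S \<omega> - U \<omega>"] by linarith
  have rmsU: "rms M U \<le> rms M S + \<rho>"
    using rms_diff[OF S SU] \<rho> by simp
  have int: "integrable M (\<lambda>\<omega>. iexp (inner h (X \<omega>)))" if "X \<in> borel_measurable M" for X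
    by (rule integrable_const_bound[of _ 1]) (use that in auto)
  have 1: "cmod ((CLINT \<omega>|M. iexp (inner h (S \<omega>))) - (CLINT \<omega>|M. iexp (inner h (U \<omega>)))) \<le> norm h * \<rho>"
  proof -
    have "cmod ((CLINT \<omega>|M. iexp (inner h (S \<omega>))) - (CLINT \<omega>|M. iexp (inner h (U \<omega>))))
        = cmod (CLINT \<omega>|M. iexp (inner h (S \<omega>)) - iexp (inner h (U \<omega>)))" using int by simp
    also have "\<dots> \<le> (\<integral>\<omega>. cmod (iexp (inner h (S \<omega>)) - iexp (inner h (U \<omega>))) \<partial>M)" by (rule integral_norm_bound)
    also have "\<dots> \<le> (\<integral>\<omega>. norm (inner h (S \<omega> - U \<omega>)) \<partial>M)"
    proof (rule integral_mono)
      show "cmod (iexp (inner h (S \<omega>)) - iexp (inner h (U \<omega>))) \<le> norm (inner h (S \<omega> - U \<omega>))" for \<omega>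
        using cmod_iexp_diff_le[of "inner h (S \<omega>)" "inner h (U \<omega>)"] by (simp add: inner_diff_right)
    qed (use int integrable_sq_int[OF lin[OF SU]] in auto)
    also have "\<dots> \<le> rms M (\<lambda>\<omega>. inner h (S \<omega> - U \<omega>))" by (rule integral_norm_le_rms[OF lin[OF SU]])
    also have "\<dots> \<le> norm h * rms M (\<lambda>\<omega>. S \<omega> - U \<omega>)" by (rule rms_lin[OF SU])
    also have "\<dots> \<le> norm h * \<rho>" using \<rho> by (intro mult_left_mono) auto
    finally show ?thesis .
  qed
  have "s2 = (rms M (\<lambda>\<omega>. inner h (U \<omega>)))\<^sup>2" by (simp add: s2 rms_power2)
  also have "\<dots> \<le> (norm h * (rms M S + \<rho>))\<^sup>2"
    using order_trans[OF rms_lin[OF U] mult_left_mono[OF rmsU]] by (intro power_mono) auto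
  finally have "s2 \<le> (norm h)\<^sup>2 * (rms M S + \<rho>)\<^sup>2" by (simp add: power_mult_distrib)
  then have 2: "\<kappa> * s2 \<le> \<kappa> * ((norm h)\<^sup>2 * (rms M S + \<rho>)\<^sup>2)" using \<open>0 \<le> \<kappa>\<close> by (rule mult_left_mono)
  have 3: "\<bar>s2 - (\<integral>\<omega>. (inner h (S \<omega>))\<^sup>2 \<partial>M)\<bar> \<le> (norm h)\<^sup>2 * (\<rho> * (2 * rms M S + \<rho>))"
  proof -
    have "s2 - (\<integral>\<omega>. (inner h (S \<omega>))\<^sup>2 \<partial>M) = (\<integral>\<omega>. (inner h (U \<omega>))\<^sup>2 - (inner h (S \<omega>))\<^sup>2 \<partial>M)"
      unfolding s2 using sq_intD(2)[OF lin[OF S]] sq_intD(2)[OF lin[OF U]] by simp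
    also have "\<dots> = (\<integral>\<omega>. - inner (inner h (S \<omega> - U \<omega>)) (inner h (S \<omega> + U \<omega>)) \<partial>M)"
      by (rule Bochner_Integration.integral_cong) (simp_all add: inner_diff_right inner_add_right power2_eq_square algebra_simps)
    also have "\<bar>\<dots>\<bar> \<le> rms M (\<lambda>\<omega>. inner h (S \<omega> - U \<omega>)) * rms M (\<lambda>\<omega>. inner h (S \<omega> + U \<omega>))"
      using abs_integral_inner_le[OF lin[OF SU] lin[OF sq_int_add[OF S U]]] by simp
    also have "\<dots> \<le> (norm h * \<rho>) * (norm h * (2 * rms M S + \<rho>))"
    proof (intro mult_mono)
      show "rms M (\<lambda>\<omega>. inner h (S \<omega> - U \<omega>)) \<le> norm h * \<rho>"
        using order_trans[OF rms_lin[OF SU] mult_left_mono[OF \<rho>]] by simp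
      have "rms M (\<lambda>\<omega>. S \<omega> + U \<omega>) \<le> 2 * rms M S + \<rho>" using rms_add[OF S U] rmsU by linarith
      then show "rms M (\<lambda>\<omega>. inner h (S \<omega> + U \<omega>)) \<le> norm h * (2 * rms M S + \<rho>)"
        using order_trans[OF rms_lin[OF sq_int_add[OF S U]] mult_left_mono] by fastforce
    qed (use rho0 in auto)
    finally show ?thesis by (simp add: power2_eq_square mult_ac)
  qed
  have "0 \<le> s2" by (simp add: s2)
  then have "\<bar>exp (- s2 / 2) - exp (- L / 2)\<bar> \<le> \<bar>s2 - L\<bar> / 2" using \<open>0 \<le> L\<close> by (rule exp_half_diff_le)
  then have 4: "cmod (complex_of_real (exp (- s2 / 2)) - complex_of_real (exp (- L / 2))) \<le> \<bar>s2 - L\<bar>"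
    unfolding of_real_diff[symmetric] norm_of_real using abs_ge_zero[of "s2 - L"] by argo
  have "cmod ((CLINT \<omega>|M. iexp (inner h (S \<omega>))) - complex_of_real (exp (- L / 2)))
      \<le> cmod ((CLINT \<omega>|M. iexp (inner h (S \<omega>))) - (CLINT \<omega>|M. iexp (inner h (U \<omega>))))
        + cmod ((CLINT \<omega>|M. iexp (inner h (U \<omega>))) - complex_of_real (exp (- s2 / 2)))
        + cmod (complex_of_real (exp (- s2 / 2)) - complex_of_real (exp (- L / 2)))"
    (is "cmod (?A - ?D) \<le> cmod (?A - ?B) + cmod (?B - ?C) + cmod (?C - ?D)")
    using norm_triangle_ineq[of "?A - ?B" "?B - ?C"] norm_triangle_ineq[of "?A - ?C" "?C - ?D"]
    unfolding diff_add_cancel[of _ _] by simp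
  then show ?thesis using 1 2 3 4 char by linarith
qed

section \<open>Long-run variances of quadratic forms\<close>

context weak_dep begin

definition \<gamma> :: "(L2 \<Rightarrow> L2) \<Rightarrow> nat \<Rightarrow> real" where
  "\<gamma> R h = (\<integral>\<omega>. inner (R (Y 0 \<omega>)) (Y h \<omega>) \<partial>M)"

text \<open>For self-adjoint \<open>R\<close> the covariances are even in the lag, so this is the
  folded two-sided sum: the trace of \<open>R\<close> against the long-run covariance
  operator.\<close>

definition lrv :: "(L2 \<Rightarrow> L2) \<Rightarrow> real" where
  "lrv R = \<gamma> R 0 + 2 * (\<Sum>h. \<gamma> R (Suc h))"

definition mass :: real where
  "mass = 2 * (\<Sum>h. \<nu> h)"

lemma mass_nonneg: "0 \<le> mass"
  unfolding mass_def using \<nu> by (simp add: suminf_nonneg)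

lemma meas_Y [measurable]: "Y t \<in> borel_measurable M"
  using sq by (rule sq_intD)

lemma \<gamma>_le: "bounded_linear R \<Longrightarrow> \<bar>\<gamma> R h\<bar> \<le> rms M (\<lambda>\<omega>. R (Y 0 \<omega>)) * \<nu> h"
  unfolding \<gamma>_def using cov[of R 0 h] by simp

lemma cov_gap:
  assumes "selfadj R"
  shows "(\<integral>\<omega>. inner (R (Y s \<omega>)) (Y t \<omega>) \<partial>M) = \<gamma> R (gap s t)"
proof -
  have R: "bounded_linear R" "\<And>x y. inner (R x) y = inner x (R y)" using assms by (auto simp: selfadj_def)
  show ?thesis
  proof (cases "s \<le> t")
    case True
    then show ?thesis unfolding \<gamma>_def using stat[OF R(1) True] by (simp add: gap_def)
  next
    case False
    have "(\<integral>\<omega>. inner (R (Y s \<omega>)) (Y t \<omega>) \<partial>M) = (\<integral>\<omega>. inner (R (Y t \<omega>)) (Y s \<omega>) \<partial>M)"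
    proof (rule Bochner_Integration.integral_cong[OF refl])
      fix \<omega>
      show "inner (R (Y s \<omega>)) (Y t \<omega>) = inner (R (Y t \<omega>)) (Y s \<omega>)"
        using R(2)[of "Y t \<omega>" "Y s \<omega>"] by (simp add: inner_commute)
    qed
    then show ?thesis unfolding \<gamma>_def using stat[OF R(1), of t s] False by (simp add: gap_def)
  qed
qed

lemma sq_int_weighted: "sq_int M (\<lambda>\<omega>. \<Sum>t\<in>A. a t *\<^sub>R Y (g t) \<omega>)"
  by (intro sq_int_sum sq_int_scaleR sq)

lemma quad_weighted:
  assumes "selfadj R"
  shows "(\<integral>\<omega>. inner (R (\<Sum>t\<in>A. a t *\<^sub>R Y (u + t) \<omega>)) (\<Sum>t\<in>A. a t *\<^sub>R Y (u + t) \<omega>) \<partial>M)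
    = (\<Sum>s\<in>A. \<Sum>t\<in>A. a s * a t * \<gamma> R (gap s t))"
proof -
  have "gap (u + s) (u + t) = gap s t" for s t by (simp add: gap_def)
  then show ?thesis
    using weighted_sum_second_moment[of "\<lambda>t. Y (u + t)" R a A, OF sq] assms
    by (simp add: cov_gap[OF assms]) (simp add: selfadj_def)
qed

lemma quad_weighted_le:
  assumes "selfadj R" "finite A"
  shows "\<bar>\<integral>\<omega>. inner (R (\<Sum>t\<in>A. a t *\<^sub>R Y (u + t) \<omega>)) (\<Sum>t\<in>A. a t *\<^sub>R Y (u + t) \<omega>) \<partial>M\<bar>
    \<le> mass * rms M (\<lambda>\<omega>. R (Y 0 \<omega>)) * (\<Sum>t\<in>A. (a t)\<^sup>2)"
proof -
  have "\<bar>\<Sum>s\<in>A. \<Sum>t\<in>A. a s * a t * \<gamma> R (gap s t)\<bar> \<le> 2 * (\<Sum>h. rms M (\<lambda>\<omega>. R (Y 0 \<omega>)) * \<nu> h) * (\<Sum>t\<in>A. (a t)\<^sup>2)"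
    by (rule weighted_double_sum_le) (use assms \<gamma>_le \<nu> in \<open>auto simp: selfadj_def intro: summable_mult\<close>)
  then show ?thesis unfolding quad_weighted[OF assms(1)] mass_def suminf_mult[OF \<nu>(1)] by (simp add: mult_ac)
qed

definition bnd :: real where
  "bnd = mass * rms M (Y 0)"

lemma bnd_nonneg: "0 \<le> bnd"
  by (simp add: bnd_def mass_nonneg)

lemma rms_weighted_le:
  assumes "finite A"
  shows "rms M (\<lambda>\<omega>. \<Sum>t\<in>A. a t *\<^sub>R Y (u + t) \<omega>) \<le> sqrt (bnd * (\<Sum>t\<in>A. (a t)\<^sup>2))"
proof (rule real_le_rsqrt)
  show "(rms M (\<lambda>\<omega>. \<Sum>t\<in>A. a t *\<^sub>R Y (u + t) \<omega>))\<^sup>2 \<le> bnd * (\<Sum>t\<in>A. (a t)\<^sup>2)"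
    unfolding rms_power2 power2_norm_eq_inner bnd_def
    using quad_weighted_le[OF selfadj_ident assms, of a u] by linarith
qed

lemma quad_tendsto_lrv:
  assumes R: "selfadj R" and a: "\<And>j. norm_weights (b j) (a j)" and rough: "(\<lambda>j. roughness (b j) (a j)) \<longlonglongrightarrow> 0"
  shows "(\<lambda>j. \<integral>\<omega>. inner (R (\<Sum>t=1..b j. a j t *\<^sub>R Y (u j + t) \<omega>)) (\<Sum>t=1..b j. a j t *\<^sub>R Y (u j + t) \<omega>) \<partial>M) \<longlonglongrightarrow> lrv R"
  unfolding quad_weighted[OF R] lrv_def
  by (rule toeplitz_tendsto[OF a rough \<gamma>_le summable_mult[OF \<nu>(1)]]) (use R in \<open>simp add: selfadj_def\<close>)

definition S :: "nat \<Rightarrow> 'a \<Rightarrow> L2" where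
  "S n \<omega> = (\<Sum>t=1..n. (1 / sqrt (real n)) *\<^sub>R Y t \<omega>)"

lemma sq_int_S: "sq_int M (S n)"
  unfolding S_def by (rule sq_int_weighted)

lemma S_quad_tendsto:
  assumes R: "selfadj R"
  shows "(\<lambda>n. \<integral>\<omega>. inner (R (S n \<omega>)) (S n \<omega>) \<partial>M) \<longlonglongrightarrow> lrv R"
proof -
  let ?a = "\<lambda>n i. if i \<in> {1..n} then 1 / sqrt (real n) else 0"
  \<comment> \<open>The index starts at one because the constant weights are normalised only for a
    positive sample size.\<close>
  have "(\<lambda>j. \<integral>\<omega>. inner (R (\<Sum>t=1..Suc j. ?a (Suc j) t *\<^sub>R Y (0 + t) \<omega>)) (\<Sum>t=1..Suc j. ?a (Suc j) t *\<^sub>R Y (0 + t) \<omega>) \<partial>M) \<longlonglongrightarrow> lrv R"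
  proof (rule quad_tendsto_lrv[OF R])
    show "norm_weights (Suc j) (?a (Suc j))" for j by (rule const_weights) simp
    have "(\<lambda>j. 2 * (1 / real (Suc j))) \<longlonglongrightarrow> 2 * 0"
      by (intro tendsto_intros LIMSEQ_Suc lim_1_over_n)
    then show "(\<lambda>j. roughness (Suc j) (?a (Suc j))) \<longlonglongrightarrow> 0"
      unfolding const_weights(2)[OF zero_less_Suc] by simp
  qed
  moreover have eq: "(\<Sum>t=1..n. ?a n t *\<^sub>R Y (0 + t) \<omega>) = S n \<omega>" for n \<omega>
    unfolding S_def by (rule sum.cong) auto
  ultimately have "(\<lambda>j. \<integral>\<omega>. inner (R (S (Suc j) \<omega>)) (S (Suc j) \<omega>) \<partial>M) \<longlonglongrightarrow> lrv R" unfolding eq by blast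
  then show ?thesis by (rule LIMSEQ_imp_Suc)
qed

lemma rms_S_le: "rms M (S n) \<le> sqrt bnd"
proof (cases "n = 0")
  case True
  then show ?thesis using bnd_nonneg by (simp add: S_def[abs_def] rms_def)
next
  case False
  have "rms M (S n) \<le> sqrt (bnd * (\<Sum>t=1..n. (1 / sqrt (real n))\<^sup>2))"
    unfolding S_def using rms_weighted_le[of "{1..n}" "\<lambda>_. 1 / sqrt (real n)" 0] by simp
  also have "(\<Sum>t=1..n. (1 / sqrt (real n))\<^sup>2) = 1" using False by (simp add: power_divide)
  finally show ?thesis by simp
qed

lemma lrv_nonneg: "0 \<le> lrv (symm h h)"
  by (rule tendsto_lowerbound[OF S_quad_tendsto[OF selfadj_symm]]) (auto simp: inner_symm)

lemma approximant_rms: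
  assumes "approximant M Y \<eta> Z m T" "finite A" "0 \<le> \<eta>"
  shows "rms M (\<lambda>\<omega>. \<Sum>t\<in>A. a t *\<^sub>R (Y t \<omega> - Z t \<omega>)) \<le> sqrt (\<eta> * (\<Sum>t\<in>A. (a t)\<^sup>2))"
  unfolding rms_def by (rule real_sqrt_le_mono) (use assms in \<open>auto simp: approximant_def\<close>)

section \<open>The central limit theorem by blocking\<close>

lemma card_gaps_le:
  assumes "0 < q" "q = P + m"
  shows "card {t \<in> {1..n}. P \<le> t mod q} \<le> (n div q + 1) * m"
proof -
  have "{t \<in> {1..n}. P \<le> t mod q} \<subseteq> (\<lambda>(u, r). u * q + P + r) ` ({..n div q} \<times> {..<m})"
  proof
    fix t assume t: "t \<in> {t \<in> {1..n}. P \<le> t mod q}"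
    have "t mod q < q" using assms by simp
    moreover have "P \<le> t mod q" using t by simp
    ultimately have r: "t mod q - P < m" using assms(2) by linarith
    have "t = (t div q) * q + P + (t mod q - P)" using t by simp
    moreover have "t div q \<le> n div q" using t by (intro div_le_mono) auto
    ultimately show "t \<in> (\<lambda>(u, r). u * q + P + r) ` ({..n div q} \<times> {..<m})"
      using r by (intro image_eqI[of _ _ "(t div q, t mod q - P)"]) auto
  qed
  then have "card {t \<in> {1..n}. P \<le> t mod q} \<le> card ((\<lambda>(u, r). u * q + P + r) ` ({..n div q} \<times> {..<m}))"
    by (intro card_mono) auto
  also have "\<dots> \<le> card ({..n div q} \<times> {..<m})" by (rule card_image_le) auto
  finally show ?thesis by (simp add: card_cartesian_product)
qed

text \<open>Bernstein's blocks: blocks of \<open>P\<close> consecutive times, separated by gaps of length \<open>m\<close>.\<close>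

lemma block_char_bound:
  fixes h :: L2
  assumes ap: "approximant M Y \<eta> Z m T" and "0 < P" "0 < n" "0 \<le> \<eta>"
  defines "q \<equiv> P + m" and "\<beta> \<equiv> norm h * (real P * T) / sqrt (real n)"
    and "\<rho> \<equiv> sqrt \<eta> + sqrt (bnd * (real m / real (P + m) + real m / real n))"
  shows "cmod ((CLINT \<omega>|M. iexp (inner h (S n \<omega>))) - complex_of_real (exp (- lrv (symm h h) / 2)))
    \<le> norm h * \<rho> + (\<beta> / 6 + \<beta>\<^sup>2 / 8) * ((norm h)\<^sup>2 * (sqrt bnd + \<rho>)\<^sup>2) + (norm h)\<^sup>2 * (\<rho> * (2 * sqrt bnd + \<rho>))
      + \<bar>(\<integral>\<omega>. (inner h (S n \<omega>))\<^sup>2 \<partial>M) - lrv (symm h h)\<bar>"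
proof -
  let ?c = "1 / sqrt (real n)"
  have q0: "0 < q" using \<open>0 < P\<close> by (simp add: q_def)
  have Z: "Z t \<in> borel_measurable M" "norm (Z t \<omega>) \<le> T" "(\<integral>\<omega>. Z t \<omega> \<partial>M) = 0" "m_dep M Z m" for t \<omega>
    using ap by (auto simp: approximant_def)
  have T0: "0 \<le> T" using Z(2) norm_ge_zero order_trans by blast
  have sqZ: "sq_int M (Z t)" for t using sq_int_bounded(1)[OF Z(1,2)] .
  define B where "B = {t \<in> {1..n}. t mod q < P}"
  define Gp where "Gp = {t \<in> {1..n}. P \<le> t mod q}"
  define K where "K j = {t \<in> B. t div q = j}" for j
  define W where "W j \<omega> = (\<Sum>t\<in>K j. ?c *\<^sub>R Z t \<omega>)" for j \<omega>
  define U where "U \<omega> = (\<Sum>t\<in>B. ?c *\<^sub>R Z t \<omega>)" for \<omega>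
  have fin: "finite B" "finite Gp" "finite (K j)" for j by (auto simp: B_def Gp_def K_def)
  \<comment> \<open>The range \<open>{..n}\<close> is generous: surplus blocks are empty and
    contribute zero.\<close>
  have UW: "U \<omega> = (\<Sum>j\<in>{..n}. W j \<omega>)" for \<omega>
  proof -
    have "(\<lambda>t. t div q) ` B \<subseteq> {..n}"
    proof (rule image_subsetI)
      fix t assume "t \<in> B"
      then have "t \<le> n" by (simp add: B_def)
      from le_trans[OF div_le_dividend this] show "t div q \<in> {..n}" by simp
    qed
    from sum.group[OF fin(1) finite_atMost this, of "\<lambda>t. ?c *\<^sub>R Z t \<omega>"] show ?thesis
      by (simp add: U_def W_def K_def)
  qed
  have sqW: "sq_int M (W j)" for j unfolding W_def[abs_def] by (intro sq_int_sum sq_int_scaleR sqZ)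
  have sqU: "sq_int M U" unfolding U_def[abs_def] by (intro sq_int_sum sq_int_scaleR sqZ)
  have indepW: "indep_vars (\<lambda>_. borel) W {..n}"
  proof -
    have sep: "m \<le> gap s t" if "i \<noteq> j" "s \<in> K i" "t \<in> K j" for i j s t
    proof -
      \<comment> \<open>From the end of one long block to a later period lies a whole gap of length
        \<open>m\<close>, since \<open>u\<close> has remainder below \<open>P\<close> and the period
        is \<open>P + m\<close>.\<close>
      have far: "m \<le> v - u" if "u div q < v div q" "u mod q < P" for u v
      proof -
        have "u div q * q + u mod q = u" by (rule div_mult_mod_eq)
        moreover have "v div q * q \<le> v" by (rule div_times_less_eq_dividend)
        moreover have "(u div q + 1) * q \<le> v div q * q" using that(1) by (intro mult_right_mono) auto
        then have "u div q * q + q \<le> v div q * q" by (simp add: distrib_right)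
        moreover have "q = P + m" by (simp add: q_def)
        ultimately show ?thesis using that(2) by linarith
      qed
      have st: "s div q = i" "t div q = j" "s mod q < P" "t mod q < P" using that by (auto simp: K_def B_def)
      show ?thesis
      proof (cases "i < j")
        case True
        then have "m \<le> t - s" using far[of s t] st by simp
        then show ?thesis by (simp add: gap_def)
      next
        case False
        then have "m \<le> s - t" using far[of t s] st that(1) by simp
        then show ?thesis by (simp add: gap_def)
      qed
    qed
    show ?thesis
      unfolding W_def[abs_def]
      by (rule Z(4)[unfolded m_dep_def, THEN spec, THEN spec, THEN spec, of "{..n}" K "\<lambda>_ _. ?c", THEN mp])
         (intro ballI impI, erule (2) sep)
  qed
  have indep: "indep_vars (\<lambda>_. borel) (\<lambda>j \<omega>. inner h (W j \<omega>)) {..n}"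
    using indep_vars_compose2[OF indepW, of "\<lambda>_. inner h" "\<lambda>_. borel"] by simp
  have cardK: "card (K j) \<le> P" for j
  proof -
    have "K j \<subseteq> (\<lambda>r. j * q + r) ` {..<P}"
    proof
      fix t assume "t \<in> K j"
      then have jt: "t div q = j" and l: "t mod q \<in> {..<P}" by (auto simp: K_def B_def)
      have e: "j * q + t mod q = t" unfolding jt[symmetric] by (rule div_mult_mod_eq)
      show "t \<in> (\<lambda>r. j * q + r) ` {..<P}" using imageI[OF l, of "\<lambda>r. j * q + r"] by (simp only: e)
    qed
    then have "card (K j) \<le> card ((\<lambda>r. j * q + r) ` {..<P})" by (intro card_mono) auto
    also have "\<dots> \<le> P" using card_image_le[of "{..<P}" "\<lambda>r. j * q + r"] by simp
    finally show ?thesis .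
  qed
  have bound: "\<bar>inner h (W j \<omega>)\<bar> \<le> \<beta>" for j \<omega>
  proof -
    have "norm (W j \<omega>) \<le> (\<Sum>t\<in>K j. ?c * T)"
      unfolding W_def by (rule sum_norm_le) (use Z(2) in \<open>simp add: divide_right_mono\<close>)
    also have "\<dots> \<le> real P * (?c * T)" using cardK[of j] T0 unfolding sum_constant by (intro mult_right_mono) auto
    finally have "norm h * norm (W j \<omega>) \<le> norm h * (real P * (?c * T))" by (intro mult_left_mono) auto
    then show ?thesis using Cauchy_Schwarz_ineq2[of h "W j \<omega>"] unfolding \<beta>_def by simp
  qed
  have meanW: "(\<integral>\<omega>. W j \<omega> \<partial>M) = 0" for j
    unfolding W_def using integrable_sq_int[OF sqZ] by (simp add: Z(3))
  have mean0: "expectation (\<lambda>\<omega>. inner h (W j \<omega>)) = 0" for j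
    using integrable_sq_int[OF sqW] by (simp add: meanW)
  define s2 where "s2 = (\<Sum>j\<in>{..n}. expectation (\<lambda>\<omega>. (inner h (W j \<omega>))\<^sup>2))"
  have hU: "inner h (U \<omega>) = (\<Sum>j\<in>{..n}. inner h (W j \<omega>))" for \<omega> by (simp add: UW inner_sum_right)
  have "s2 = (\<integral>\<omega>. (inner h (U \<omega>))\<^sup>2 \<partial>M)"
  proof -
    have "(\<integral>\<omega>. inner (symm h h (\<Sum>j\<in>{..n}. W j \<omega>)) (\<Sum>j\<in>{..n}. W j \<omega>) \<partial>M) = (\<Sum>j\<in>{..n}. \<integral>\<omega>. inner (symm h h (W j \<omega>)) (W j \<omega>) \<partial>M)"
      by (rule indep_sum_second_moment[OF _ indepW]) (use selfadj_symm in \<open>auto simp: selfadj_def sqW meanW\<close>)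
    then show ?thesis by (simp add: s2_def inner_symm UW[symmetric] power2_eq_square)
  qed
  moreover have "cmod ((CLINT \<omega>|M. iexp (inner h (U \<omega>))) - complex_of_real (exp (- s2 / 2))) \<le> (\<beta> / 6 + \<beta>\<^sup>2 / 8) * s2"
    unfolding hU s2_def by (rule char_sum_indep_bounded[OF finite_atMost indep bound mean0])
  moreover have "rms M (\<lambda>\<omega>. S n \<omega> - U \<omega>) \<le> \<rho>"
  proof -
    have AB: "{1..n} = B \<union> Gp" "B \<inter> Gp = {}" by (auto simp: B_def Gp_def)
    \<comment> \<open>The error splits into the approximation error on the long blocks and the
      omitted gaps. The first is at most \<open>sqrt \<eta>\<close>; the second is governed by the
      proportion of times that fall into gaps.\<close>
    have eq: "S n \<omega> - U \<omega> = (\<Sum>t\<in>B. ?c *\<^sub>R (Y t \<omega> - Z t \<omega>)) + (\<Sum>t\<in>Gp. ?c *\<^sub>R Y t \<omega>)" for \<omega>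
      unfolding S_def U_def AB(1) sum.union_disjoint[OF fin(1,2) AB(2)]
      by (simp add: scaleR_diff_right sum_subtractf)
    have sq1: "sq_int M (\<lambda>\<omega>. \<Sum>t\<in>B. ?c *\<^sub>R (Y t \<omega> - Z t \<omega>))" by (intro sq_int_sum sq_int_scaleR sq_int_diff sq sqZ)
    have c2: "(\<Sum>t\<in>A. ?c\<^sup>2) = real (card A) / real n" for A by (simp add: power_divide)
    have "rms M (\<lambda>\<omega>. S n \<omega> - U \<omega>) \<le> rms M (\<lambda>\<omega>. \<Sum>t\<in>B. ?c *\<^sub>R (Y t \<omega> - Z t \<omega>)) + rms M (\<lambda>\<omega>. \<Sum>t\<in>Gp. ?c *\<^sub>R Y t \<omega>)"
      unfolding eq by (intro rms_add sq1 sq_int_weighted)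
    also have "rms M (\<lambda>\<omega>. \<Sum>t\<in>B. ?c *\<^sub>R (Y t \<omega> - Z t \<omega>)) \<le> sqrt (\<eta> * (\<Sum>t\<in>B. ?c\<^sup>2))"
      by (rule approximant_rms[OF ap fin(1) \<open>0 \<le> \<eta>\<close>])
    also have "\<dots> \<le> sqrt \<eta>"
    proof -
      have "B \<subseteq> {1..n}" by (auto simp: B_def)
      from card_mono[OF finite_atLeastAtMost this] have "card B \<le> n" by simp
      then have "\<eta> * (real (card B) / real n) \<le> \<eta> * 1" using \<open>0 \<le> \<eta>\<close> \<open>0 < n\<close> by (intro mult_left_mono) auto
      then show ?thesis unfolding c2 by simp
    qed
    also have "rms M (\<lambda>\<omega>. \<Sum>t\<in>Gp. ?c *\<^sub>R Y t \<omega>) \<le> sqrt (bnd * (\<Sum>t\<in>Gp. ?c\<^sup>2))"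
      using rms_weighted_le[OF fin(2), of "\<lambda>_. ?c" 0] by simp
    also have "\<dots> \<le> sqrt (bnd * (real m / real (P + m) + real m / real n))"
    proof -
      have "real (card Gp) \<le> real ((n div q + 1) * m)"
        unfolding Gp_def using card_gaps_le[OF q0 q_def[THEN meta_eq_to_obj_eq], of n] by (simp only: of_nat_le_iff)
      also have "\<dots> \<le> (real n / real q + 1) * real m"
      proof -
        have "real (n div q * q) \<le> real n" by (simp only: of_nat_le_iff div_times_less_eq_dividend)
        then have "real (n div q) \<le> real n / real q" using q0 by (simp add: pos_le_divide_eq)
        then have "(real (n div q) + 1) * real m \<le> (real n / real q + 1) * real m" by (intro mult_right_mono) auto
        then show ?thesis unfolding of_nat_mult of_nat_add of_nat_1 .
      qed
      finally have "real (card Gp) / real n \<le> (real n / real q + 1) * real m / real n" by (simp add: divide_right_mono)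
      also have "\<dots> = real m / real q + real m / real n" using \<open>0 < n\<close> by (simp add: field_simps)
      finally show ?thesis unfolding c2 q_def using bnd_nonneg by (intro real_sqrt_le_mono mult_left_mono)
    qed
    finally show ?thesis by (simp add: \<rho>_def)
  qed
  moreover have b0: "0 \<le> \<beta>" unfolding \<beta>_def using T0 by simp
  ultimately have "cmod ((CLINT \<omega>|M. iexp (inner h (S n \<omega>))) - complex_of_real (exp (- lrv (symm h h) / 2)))
    \<le> norm h * \<rho> + (\<beta> / 6 + \<beta>\<^sup>2 / 8) * ((norm h)\<^sup>2 * (rms M (S n) + \<rho>)\<^sup>2) + (norm h)\<^sup>2 * (\<rho> * (2 * rms M (S n) + \<rho>))
      + \<bar>(\<integral>\<omega>. (inner h (S n \<omega>))\<^sup>2 \<partial>M) - lrv (symm h h)\<bar>"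
    by (intro char_compare[OF sq_int_S sqU lrv_nonneg]) auto
  also have "\<dots> \<le> norm h * \<rho> + (\<beta> / 6 + \<beta>\<^sup>2 / 8) * ((norm h)\<^sup>2 * (sqrt bnd + \<rho>)\<^sup>2) + (norm h)\<^sup>2 * (\<rho> * (2 * sqrt bnd + \<rho>))
      + \<bar>(\<integral>\<omega>. (inner h (S n \<omega>))\<^sup>2 \<partial>M) - lrv (symm h h)\<bar>"
  proof -
    have r0: "0 \<le> \<rho>" unfolding \<rho>_def using \<open>0 \<le> \<eta>\<close> bnd_nonneg by simp
    show ?thesis using rms_S_le[of n] r0 b0 by (intro add_mono mult_left_mono power_mono order_refl) auto
  qed
  finally show ?thesis .
qed

text \<open>The order of choices matters: \<open>r\<close> from the target accuracy, the approximant
  from \<open>r\<close>, the block length \<open>P\<close> so that the gaps form a small proportion,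
  and only then large \<open>n\<close>, which makes \<open>\<beta>\<close> and the variance error
  vanish.\<close>

theorem S_char_tendsto:
  "(\<lambda>n. CLINT \<omega>|M. iexp (inner h (S n \<omega>))) \<longlonglongrightarrow> complex_of_real (exp (- lrv (symm h h) / 2))"
proof (rule metric_LIMSEQ_I)
  fix \<epsilon> :: real assume "\<epsilon> > 0"
  let ?H = "norm h"
  have "((\<lambda>r. ?H * r + ?H\<^sup>2 * (r * (2 * sqrt bnd + r))) \<longlongrightarrow> ?H * 0 + ?H\<^sup>2 * (0 * (2 * sqrt bnd + 0))) (at_right 0)"
    by (intro tendsto_intros)
  then have "\<forall>\<^sub>F r in at_right 0. ?H * r + ?H\<^sup>2 * (r * (2 * sqrt bnd + r)) < \<epsilon> / 2"
    by (rule order_tendstoD) (use \<open>\<epsilon> > 0\<close> in simp)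
  moreover have "\<forall>\<^sub>F r in at_right (0::real). 0 < r" by (rule eventually_at_right_less)
  ultimately have "\<forall>\<^sub>F r in at_right (0::real). 0 < r \<and> ?H * r + ?H\<^sup>2 * (r * (2 * sqrt bnd + r)) < \<epsilon> / 2"
    by eventually_elim simp
  then obtain r where r: "0 < r" "?H * r + ?H\<^sup>2 * (r * (2 * sqrt bnd + r)) < \<epsilon> / 2"
    using eventually_happens'[OF trivial_limit_at_right_real] by blast
  \<comment> \<open>One half of \<open>r\<close> is reserved for the approximation error and the
    other for the gaps.\<close>
  define \<eta> where "\<eta> = (r / 2)\<^sup>2"
  have \<eta>: "0 < \<eta>" "sqrt \<eta> = r / 2" using r(1) by (auto simp: \<eta>_def)
  obtain Z m T where ap: "approximant M Y \<eta> Z m T" using approx[OF \<eta>(1)] by blast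
  have "(\<lambda>P. bnd * (real m * (1 / real (P + m)))) \<longlonglongrightarrow> bnd * (real m * 0)"
    by (intro tendsto_intros LIMSEQ_ignore_initial_segment lim_1_over_n)
  then have "\<forall>\<^sub>F P in sequentially. bnd * (real m * (1 / real (P + m))) < \<eta> / 2"
    by (rule order_tendstoD) (use \<eta> in simp)
  then have "\<forall>\<^sub>F P in sequentially. bnd * (real m * (1 / real (P + m))) < \<eta> / 2 \<and> 0 < P"
    using eventually_gt_at_top[of 0] by eventually_elim simp
  then obtain P where P: "bnd * (real m / real (P + m)) < \<eta> / 2" "0 < P"
    by (auto simp: eventually_sequentially)
  have "(\<lambda>n. bnd * (real m * (1 / real n))) \<longlonglongrightarrow> bnd * (real m * 0)"
    by (intro tendsto_intros lim_1_over_n)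
  then have 1: "\<forall>\<^sub>F n in sequentially. bnd * (real m * (1 / real n)) < \<eta> / 2"
    by (rule order_tendstoD) (use \<eta> in simp)
  define \<beta> where "\<beta> n = ?H * (real P * T) / sqrt (real n)" for n
  have sq0: "(\<lambda>n. 1 / sqrt (real n)) \<longlonglongrightarrow> 0"
    using tendsto_real_sqrt[OF lim_1_over_n] by (simp add: real_sqrt_divide)
  have \<beta>: "\<beta> \<longlonglongrightarrow> 0"
    unfolding \<beta>_def using tendsto_mult_left[OF sq0, of "?H * (real P * T)"] by simp
  have var: "(\<lambda>n. \<integral>\<omega>. (inner h (S n \<omega>))\<^sup>2 \<partial>M) \<longlonglongrightarrow> lrv (symm h h)"
    using S_quad_tendsto[OF selfadj_symm, of h h] by (simp add: inner_symm power2_eq_square)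
  have "(\<lambda>n. (\<beta> n / 6 + (\<beta> n)\<^sup>2 / 8) * (?H\<^sup>2 * (sqrt bnd + r)\<^sup>2) + \<bar>(\<integral>\<omega>. (inner h (S n \<omega>))\<^sup>2 \<partial>M) - lrv (symm h h)\<bar>)
      \<longlonglongrightarrow> (0 / 6 + 0\<^sup>2 / 8) * (?H\<^sup>2 * (sqrt bnd + r)\<^sup>2) + \<bar>lrv (symm h h) - lrv (symm h h)\<bar>"
    by (intro tendsto_intros \<beta> var) simp_all
  then have 2: "\<forall>\<^sub>F n in sequentially. (\<beta> n / 6 + (\<beta> n)\<^sup>2 / 8) * (?H\<^sup>2 * (sqrt bnd + r)\<^sup>2)
      + \<bar>(\<integral>\<omega>. (inner h (S n \<omega>))\<^sup>2 \<partial>M) - lrv (symm h h)\<bar> < \<epsilon> / 2"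
    by (rule order_tendstoD) (use \<open>\<epsilon> > 0\<close> in simp)
  have T0: "0 \<le> T"
  proof -
    have "norm (Z 0 \<omega>) \<le> T" for \<omega> using ap unfolding approximant_def by blast
    then show ?thesis using norm_ge_zero order_trans by blast
  qed
  have "\<forall>\<^sub>F n in sequentially. dist (CLINT \<omega>|M. iexp (inner h (S n \<omega>))) (complex_of_real (exp (- lrv (symm h h) / 2))) < \<epsilon>"
    using 1 2 eventually_gt_at_top[of 0]
  proof eventually_elim
    case (elim n)
    define \<rho> where "\<rho> = sqrt \<eta> + sqrt (bnd * (real m / real (P + m) + real m / real n))"
    have "bnd * (real m / real (P + m) + real m / real n) = bnd * (real m / real (P + m)) + bnd * (real m * (1 / real n))"
      unfolding distrib_left by simp
    then have "bnd * (real m / real (P + m) + real m / real n) \<le> \<eta>" using P(1) elim(1) by linarith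
    from real_sqrt_le_mono[OF this] have "sqrt (bnd * (real m / real (P + m) + real m / real n)) \<le> r / 2"
      unfolding \<eta>(2) .
    then have \<rho>: "\<rho> \<le> r" unfolding \<rho>_def \<eta>(2) by simp
    have \<rho>0: "0 \<le> \<rho>" unfolding \<rho>_def using \<eta>(1) bnd_nonneg by simp
    have \<beta>0: "0 \<le> \<beta> n" unfolding \<beta>_def using T0 by simp
    have "dist (CLINT \<omega>|M. iexp (inner h (S n \<omega>))) (complex_of_real (exp (- lrv (symm h h) / 2)))
      \<le> ?H * \<rho> + (\<beta> n / 6 + (\<beta> n)\<^sup>2 / 8) * (?H\<^sup>2 * (sqrt bnd + \<rho>)\<^sup>2) + ?H\<^sup>2 * (\<rho> * (2 * sqrt bnd + \<rho>))
      + \<bar>(\<integral>\<omega>. (inner h (S n \<omega>))\<^sup>2 \<partial>M) - lrv (symm h h)\<bar>"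
      unfolding dist_norm \<rho>_def \<beta>_def
      by (rule block_char_bound[OF ap P(2) elim(3)]) (use \<eta>(1) in simp)
    also have "\<dots> \<le> ?H * r + (\<beta> n / 6 + (\<beta> n)\<^sup>2 / 8) * (?H\<^sup>2 * (sqrt bnd + r)\<^sup>2) + ?H\<^sup>2 * (r * (2 * sqrt bnd + r))
      + \<bar>(\<integral>\<omega>. (inner h (S n \<omega>))\<^sup>2 \<partial>M) - lrv (symm h h)\<bar>"
      using \<rho> \<rho>0 \<beta>0 bnd_nonneg r(1)
      by (intro add_mono mult_mono power_mono order_refl) auto
    also have "\<dots> < \<epsilon>" using r(2) elim(2) by linarith
    finally show ?case .
  qed
  then show "\<exists>n0. \<forall>n\<ge>n0. dist (CLINT \<omega>|M. iexp (inner h (S n \<omega>))) (complex_of_real (exp (- lrv (symm h h) / 2))) < \<epsilon>"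
    by (simp add: eventually_sequentially)
qed

end

section \<open>The bootstrap world\<close>

text \<open>The default \<open>undefined\<close> makes the draws extensional functions, matching the
  restricted index vector on the original space.\<close>

definition start_pmf :: "nat \<Rightarrow> nat \<Rightarrow> (nat \<Rightarrow> nat) pmf" where
  "start_pmf k N = Pi_pmf {1..k} undefined (\<lambda>_. pmf_of_set {1..N})"

definition avg :: "nat \<Rightarrow> (nat \<Rightarrow> 'b::real_vector) \<Rightarrow> 'b" where
  "avg N v = (1 / real N) *\<^sub>R (\<Sum>t=1..N. v t)"

text \<open>The normalised bootstrap mean for block values \<open>v\<close>. The average over all
  starting points is its conditional mean, so any constant added to \<open>v\<close>
  cancels.\<close>

definition star :: "nat \<Rightarrow> nat \<Rightarrow> (nat \<Rightarrow> L2) \<Rightarrow> (nat \<Rightarrow> nat) \<Rightarrow> L2" where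
  "star k N v J = (\<Sum>i=1..k. (1 / sqrt (real k)) *\<^sub>R (v (J i) - avg N v))"

lemma avg_linear: "linear R \<Longrightarrow> avg N (\<lambda>t. R (v t)) = R (avg N v)"
  by (simp add: avg_def linear_scale linear_sum)

lemma avg_mono: "(\<And>t. t \<in> {1..N} \<Longrightarrow> v t \<le> w t) \<Longrightarrow> avg N v \<le> (avg N w :: real)"
  unfolding avg_def by (intro scaleR_left_mono sum_mono) auto

lemma avg_const: "0 < N \<Longrightarrow> avg N (\<lambda>_. c) = c"
  by (simp add: avg_def scaleR_left.sum[symmetric] sum_constant_scaleR)

lemma avg_diff: "avg N (\<lambda>t. v t - w t) = avg N v - avg N w"
  by (simp add: avg_def sum_subtractf scaleR_diff_right)

lemma (in prob_space) integral_avg: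
  fixes X :: "nat \<Rightarrow> 'a \<Rightarrow> 'b::{banach, second_countable_topology}"
  shows "(\<And>t. integrable M (X t)) \<Longrightarrow> (\<integral>\<omega>. avg N (\<lambda>t. X t \<omega>) \<partial>M) = avg N (\<lambda>t. \<integral>\<omega>. X t \<omega> \<partial>M)"
  by (simp add: avg_def)

context
  fixes k N :: nat
  assumes k: "0 < k" and N: "0 < N"
begin

lemma finite_start_pmf: "finite (set_pmf (start_pmf k N))"
proof -
  have "set_pmf (start_pmf k N) = PiE_dflt {1..k} undefined (set_pmf \<circ> (\<lambda>_. pmf_of_set {1..N}))"
    unfolding start_pmf_def by (rule set_Pi_pmf) simp
  also have "finite \<dots>" using N by (intro finite_PiE_dflt) (auto simp: set_pmf_of_set)
  finally show ?thesis .
qed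

lemma integrable_start: "integrable (measure_pmf (start_pmf k N)) (F :: _ \<Rightarrow> 'b::{banach, second_countable_topology})"
  by (rule integrable_measure_pmf_finite[OF finite_start_pmf])

lemma sq_int_start: "sq_int (measure_pmf (start_pmf k N)) F"
  by (simp add: sq_int_def integrable_start)

lemma integral_start_component:
  fixes F :: "nat \<Rightarrow> 'b::{banach, second_countable_topology}"
  assumes "i \<in> {1..k}"
  shows "(\<integral>J. F (J i) \<partial>measure_pmf (start_pmf k N)) = avg N F"
proof -
  have "(\<integral>J. F (J i) \<partial>measure_pmf (start_pmf k N)) = (\<integral>t. F t \<partial>measure_pmf (map_pmf (\<lambda>J. J i) (start_pmf k N)))"
    by simp
  also have "map_pmf (\<lambda>J. J i) (start_pmf k N) = pmf_of_set {1..N}"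
    unfolding start_pmf_def using assms by (subst Pi_pmf_component) auto
  also have "(\<integral>t. F t \<partial>measure_pmf (pmf_of_set {1..N})) = (\<Sum>t\<in>{1..N}. pmf (pmf_of_set {1..N}) t *\<^sub>R F t)"
    by (rule integral_measure_pmf) (use N in \<open>auto simp: set_pmf_of_set\<close>)
  also have "\<dots> = avg N F" using N by (simp add: avg_def scaleR_sum_right)
  finally show ?thesis .
qed

lemma indep_start: "prob_space.indep_vars (measure_pmf (start_pmf k N)) (\<lambda>_. borel) (\<lambda>i J. F (J i)) {1..k}"
  using prob_space.indep_vars_compose2[OF measure_pmf.prob_space_axioms indep_vars_Pi_pmf[of "{1..k}" undefined "\<lambda>_. pmf_of_set {1..N}", folded start_pmf_def], of "\<lambda>_. F" "\<lambda>_. borel"]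
  by simp

text \<open>Independence of the draws reduces the second moment to that of one draw: the empirical
  covariance over the overlapping blocks.\<close>

lemma star_second_moment:
  assumes R: "bounded_linear R"
  shows "(\<integral>J. inner (R (star k N v J)) (star k N v J) \<partial>measure_pmf (start_pmf k N))
    = avg N (\<lambda>t. inner (R (v t)) (v t)) - inner (R (avg N v)) (avg N v)"
proof -
  let ?W = "\<lambda>i J. (1 / sqrt (real k)) *\<^sub>R (v (J i) - avg N v)"
  note lin = bounded_linear.linear[OF R]
  have mean: "(\<integral>J. ?W i J \<partial>measure_pmf (start_pmf k N)) = 0" if "i \<in> {1..k}" for i
    using integral_start_component[OF that, of "\<lambda>t. v t - avg N v"] avg_const[OF N, of "avg N v"] by (simp add: avg_diff)
  have "(\<integral>J. inner (R (star k N v J)) (star k N v J) \<partial>measure_pmf (start_pmf k N))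
      = (\<Sum>i=1..k. \<integral>J. inner (R (?W i J)) (?W i J) \<partial>measure_pmf (start_pmf k N))"
    unfolding star_def
    by (rule measure_pmf.indep_sum_second_moment[OF R]) (use mean sq_int_start indep_start[of "\<lambda>t. (1 / sqrt (real k)) *\<^sub>R (v t - avg N v)"] in auto)
  also have "\<dots> = (\<Sum>i=1..k. (1 / real k) * avg N (\<lambda>t. inner (R (v t - avg N v)) (v t - avg N v)))"
  proof (rule sum.cong[OF refl])
    fix i assume i: "i \<in> {1..k}"
    have "(1 / sqrt (real k)) * ((1 / sqrt (real k)) * x) = 1 / real k * x" for x :: real
      using k by (simp add: field_simps)
    then have "inner (R (?W i J)) (?W i J) = 1 / real k * inner (R (v (J i) - avg N v)) (v (J i) - avg N v)" for J
      unfolding linear_scale[OF lin] inner_scaleR_left inner_scaleR_right .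
    then show "(\<integral>J. inner (R (?W i J)) (?W i J) \<partial>measure_pmf (start_pmf k N)) = (1 / real k) * avg N (\<lambda>t. inner (R (v t - avg N v)) (v t - avg N v))"
      using integral_start_component[OF i, of "\<lambda>t. inner (R (v t - avg N v)) (v t - avg N v)"] by simp
  qed
  also have "\<dots> = avg N (\<lambda>t. inner (R (v t - avg N v)) (v t - avg N v))" using k by simp
  also have "\<dots> = avg N (\<lambda>t. inner (R (v t)) (v t) - inner (R (avg N v)) (v t) - inner (R (v t)) (avg N v) + inner (R (avg N v)) (avg N v))"
    by (simp add: linear_diff[OF lin] inner_diff_left inner_diff_right algebra_simps)
  also have "\<dots> = avg N (\<lambda>t. inner (R (v t)) (v t)) - avg N (\<lambda>t. inner (R (avg N v)) (v t))
      - avg N (\<lambda>t. inner (R (v t)) (avg N v)) + inner (R (avg N v)) (avg N v)"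
    using avg_const[OF N, of "inner (R (avg N v)) (avg N v)"]
    by (simp add: avg_def sum.distrib sum_subtractf scaleR_diff_right scaleR_add_right distrib_left right_diff_distrib)
  also have "avg N (\<lambda>t. inner (R (avg N v)) (v t)) = inner (R (avg N v)) (avg N v)"
    by (rule avg_linear) (simp add: bounded_linear.linear[OF bounded_linear_inner_right])
  also have "avg N (\<lambda>t. inner (R (v t)) (avg N v)) = inner (R (avg N v)) (avg N v)"
    by (rule avg_linear[of "\<lambda>x. inner (R x) (avg N v)"])
       (simp add: bounded_linear.linear[OF bounded_linear_compose[OF bounded_linear_inner_left R]])
  finally show ?thesis by simp
qed

lemma rms_star_le: "(rms (measure_pmf (start_pmf k N)) (star k N v))\<^sup>2 \<le> avg N (\<lambda>t. (norm (v t))\<^sup>2)"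
  unfolding rms_power2 power2_norm_eq_inner star_second_moment[OF bounded_linear_ident, of v] by simp

lemma star_diff: "star k N v J - star k N z J = star k N (\<lambda>t. v t - z t) J"
  unfolding star_def avg_diff sum_subtractf[symmetric]
  by (rule sum.cong) (simp_all add: algebra_simps)

text \<open>An instance of \<open>char_compare\<close> in the bootstrap world, with \<open>U\<close>
  the same resampling applied to bounded block values \<open>z\<close>. A centred value is at most
  \<open>2 * \<tau>\<close>, which explains \<open>\<beta>\<close>.\<close>

lemma star_char_bound:
  fixes h :: L2 and v z :: "nat \<Rightarrow> L2"
  assumes "0 \<le> L" and z: "\<And>t. norm (z t) \<le> \<tau>"
  defines "\<beta> \<equiv> 2 * norm h * \<tau> / sqrt (real k)"
    and "\<rho> \<equiv> sqrt (avg N (\<lambda>t. (norm (v t - z t))\<^sup>2))" and "r \<equiv> sqrt (avg N (\<lambda>t. (norm (v t))\<^sup>2))"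
  shows "cmod ((CLINT J|measure_pmf (start_pmf k N). iexp (inner h (star k N v J))) - complex_of_real (exp (- L / 2)))
    \<le> norm h * \<rho> + (\<beta> / 6 + \<beta>\<^sup>2 / 8) * ((norm h)\<^sup>2 * (r + \<rho>)\<^sup>2) + (norm h)\<^sup>2 * (\<rho> * (2 * r + \<rho>))
      + \<bar>(\<integral>J. (inner h (star k N v J))\<^sup>2 \<partial>measure_pmf (start_pmf k N)) - L\<bar>"
proof -
  let ?p = "measure_pmf (start_pmf k N)"
  let ?\<zeta> = "\<lambda>i J. inner h ((1 / sqrt (real k)) *\<^sub>R (z (J i) - avg N z))"
  have nn: "0 \<le> avg N (\<lambda>t. (norm (u t))\<^sup>2)" for u :: "nat \<Rightarrow> L2" unfolding avg_def by (simp add: sum_nonneg)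
  have \<tau>0: "0 \<le> \<tau>" using z[of 0] norm_ge_zero order_trans by blast
  have \<beta>0: "0 \<le> \<beta>" unfolding \<beta>_def using \<tau>0 by simp
  have bound: "\<bar>?\<zeta> i J\<bar> \<le> \<beta>" for i J
  proof -
    have "norm (avg N z) \<le> \<tau>"
    proof -
      have "norm (\<Sum>t=1..N. z t) \<le> (\<Sum>t=1..N. \<tau>)" by (rule sum_norm_le) (use z in auto)
      then have "norm (\<Sum>t=1..N. z t) / real N \<le> \<tau>" using N by (simp add: pos_divide_le_eq mult.commute)
      moreover have "norm (avg N z) = norm (\<Sum>t=1..N. z t) / real N" unfolding avg_def by simp
      ultimately show ?thesis by (simp only:)
    qed
    then have "norm (z (J i) - avg N z) \<le> 2 * \<tau>" using norm_triangle_ineq4[of "z (J i)" "avg N z"] z[of "J i"] by linarith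
    then have "norm h * norm (z (J i) - avg N z) \<le> norm h * (2 * \<tau>)" by (rule mult_left_mono) simp
    then have "\<bar>inner h (z (J i) - avg N z)\<bar> \<le> 2 * norm h * \<tau>" using Cauchy_Schwarz_ineq2[of h "z (J i) - avg N z"] by linarith
    then show ?thesis unfolding \<beta>_def by (simp add: abs_mult divide_right_mono)
  qed
  have indep: "prob_space.indep_vars (measure_pmf (start_pmf k N)) (\<lambda>_. borel) ?\<zeta> {1..k}" by (rule indep_start)
  have mean: "measure_pmf.expectation (start_pmf k N) (?\<zeta> i) = 0" if "i \<in> {1..k}" for i
  proof -
    have lin: "linear (\<lambda>x. inner h ((1 / sqrt (real k)) *\<^sub>R x))"
      by (rule bounded_linear.linear[OF bounded_linear_compose[OF bounded_linear_inner_right bounded_linear_scaleR_right]])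
    have "measure_pmf.expectation (start_pmf k N) (?\<zeta> i) = avg N (\<lambda>t. inner h ((1 / sqrt (real k)) *\<^sub>R (z t - avg N z)))"
      by (rule integral_start_component[OF that])
    also have "\<dots> = inner h ((1 / sqrt (real k)) *\<^sub>R avg N (\<lambda>t. z t - avg N z))" by (rule avg_linear[OF lin])
    finally show ?thesis by (simp add: avg_diff avg_const[OF N])
  qed
  have hs: "inner h (star k N z J) = (\<Sum>i=1..k. ?\<zeta> i J)" for J by (simp add: star_def inner_sum_right)
  define s2 where "s2 = (\<Sum>i=1..k. measure_pmf.expectation (start_pmf k N) (\<lambda>J. (?\<zeta> i J)\<^sup>2))"
  have char: "cmod ((CLINT J|?p. iexp (inner h (star k N z J))) - complex_of_real (exp (- s2 / 2))) \<le> (\<beta> / 6 + \<beta>\<^sup>2 / 8) * s2"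
    unfolding hs s2_def by (rule measure_pmf.char_sum_indep_bounded[where A="{1..k}"]) (fact indep | rule bound | erule mean | simp)+
  have s2: "s2 = (\<integral>J. (inner h (star k N z J))\<^sup>2 \<partial>?p)"
  proof -
    have "(\<integral>J. inner ((\<Sum>i=1..k. ?\<zeta> i J)) (\<Sum>i=1..k. ?\<zeta> i J) \<partial>?p) = (\<Sum>i=1..k. \<integral>J. inner (?\<zeta> i J) (?\<zeta> i J) \<partial>?p)"
      by (rule measure_pmf.indep_sum_second_moment[OF bounded_linear_ident indep]) (use mean sq_int_start in auto)
    then show ?thesis unfolding hs s2_def by (simp add: power2_eq_square)
  qed
  have \<rho>: "rms ?p (\<lambda>J. star k N v J - star k N z J) \<le> \<rho>"
    unfolding \<rho>_def star_diff by (rule real_le_rsqrt[OF rms_star_le])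
  have r: "rms ?p (star k N v) \<le> r" unfolding r_def by (rule real_le_rsqrt[OF rms_star_le])
  have \<rho>0: "0 \<le> \<rho>" unfolding \<rho>_def using nn by simp
  have "cmod ((CLINT J|?p. iexp (inner h (star k N v J))) - complex_of_real (exp (- L / 2)))
    \<le> norm h * \<rho> + (\<beta> / 6 + \<beta>\<^sup>2 / 8) * ((norm h)\<^sup>2 * (rms ?p (star k N v) + \<rho>)\<^sup>2) + (norm h)\<^sup>2 * (\<rho> * (2 * rms ?p (star k N v) + \<rho>))
      + \<bar>(\<integral>J. (inner h (star k N v J))\<^sup>2 \<partial>?p) - L\<bar>"
    by (rule measure_pmf.char_compare[OF sq_int_start sq_int_start \<open>0 \<le> L\<close> _ char s2 \<rho>]) (use \<beta>0 in simp)
  also have "\<dots> \<le> norm h * \<rho> + (\<beta> / 6 + \<beta>\<^sup>2 / 8) * ((norm h)\<^sup>2 * (r + \<rho>)\<^sup>2) + (norm h)\<^sup>2 * (\<rho> * (2 * r + \<rho>))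
      + \<bar>(\<integral>J. (inner h (star k N v J))\<^sup>2 \<partial>?p) - L\<bar>"
    using r \<rho>0 \<beta>0 by (intro add_mono mult_left_mono power_mono order_refl) auto
  finally show ?thesis .
qed

end

section \<open>Averages over overlapping blocks\<close>

context prob_space begin

lemma rms_sum_le:
  assumes "\<And>i. i \<in> A \<Longrightarrow> sq_int M (X i)"
  shows "rms M (\<lambda>\<omega>. \<Sum>i\<in>A. X i \<omega>) \<le> (\<Sum>i\<in>A. rms M (X i))"
  using assms
proof (induction A rule: infinite_finite_induct)
  case (insert x F)
  then show ?case
    using rms_add[of M "X x" "\<lambda>\<omega>. \<Sum>i\<in>F. X i \<omega>"] sq_int_sum[of F M X] by fastforce
qed (simp_all add: rms_def)

text \<open>Weights \<open>1 / N\<close> and covariances confined to lags below \<open>c\<close>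
  give variance at most \<open>2 * c * d\<^sup>2 / N\<close>.\<close>

lemma expectation_abs_avg_le:
  fixes Q :: "nat \<Rightarrow> 'a \<Rightarrow> real"
  assumes sq: "\<And>t. sq_int M (Q t)" and rms: "\<And>t. rms M (Q t) \<le> d" and N: "0 < N"
    and uncor: "\<And>s t. s \<in> {1..N} \<Longrightarrow> t \<in> {1..N} \<Longrightarrow> c \<le> gap s t \<Longrightarrow> (\<integral>\<omega>. Q s \<omega> * Q t \<omega> \<partial>M) = 0"
  shows "(\<integral>\<omega>. \<bar>avg N (\<lambda>t. Q t \<omega>)\<bar> \<partial>M) \<le> sqrt (2 * real c * d\<^sup>2 / real N)"
proof -
  have d0: "0 \<le> d" using rms[of 0] rms_nonneg[of M "Q 0"] by linarith
  have sqA: "sq_int M (\<lambda>\<omega>. avg N (\<lambda>t. Q t \<omega>))" unfolding avg_def by (intro sq_int_scaleR sq_int_sum sq)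
  define g where "g h = (if h < c then d\<^sup>2 else 0)" for h
  have g0: "0 \<le> g h" for h by (simp add: g_def)
  have sg: "summable g" "(\<Sum>h. g h) = real c * d\<^sup>2"
  proof -
    have "g sums (\<Sum>h<c. g h)" by (rule sums_finite) (auto simp: g_def)
    moreover have "(\<Sum>h<c. g h) = real c * d\<^sup>2" by (simp add: g_def)
    ultimately show "summable g" "(\<Sum>h. g h) = real c * d\<^sup>2" by (auto simp only: sums_iff)
  qed
  have cov: "\<bar>\<integral>\<omega>. Q s \<omega> * Q t \<omega> \<partial>M\<bar> \<le> g (gap s t)" if "s \<in> {1..N}" "t \<in> {1..N}" for s t
  proof (cases "gap s t < c")
    case True
    have "\<bar>\<integral>\<omega>. Q s \<omega> * Q t \<omega> \<partial>M\<bar> \<le> rms M (Q s) * rms M (Q t)"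
      using abs_integral_inner_le[OF sq sq, of s t] by simp
    also have "\<dots> \<le> d * d" by (intro mult_mono rms d0) simp
    finally show ?thesis using True by (simp add: g_def power2_eq_square)
  next
    case False
    then show ?thesis using uncor[OF that] g0 by simp
  qed
  have int: "integrable M (\<lambda>\<omega>. Q s \<omega> * Q t \<omega>)" for s t using integrable_inner_sq_int[OF sq sq, of s t] by simp
  have "(rms M (\<lambda>\<omega>. avg N (\<lambda>t. Q t \<omega>)))\<^sup>2 = (\<integral>\<omega>. (\<Sum>s=1..N. \<Sum>t=1..N. (1 / real N) * (1 / real N) * (Q s \<omega> * Q t \<omega>)) \<partial>M)"
    unfolding rms_power2 avg_def
    by (rule Bochner_Integration.integral_cong) (simp_all add: power2_eq_square sum_product sum_divide_distrib)
  also have "\<dots> = (\<Sum>s=1..N. \<Sum>t=1..N. (1 / real N) * (1 / real N) * (\<integral>\<omega>. Q s \<omega> * Q t \<omega> \<partial>M))"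
    using int by (simp add: Bochner_Integration.integrable_sum)
  also have "\<dots> \<le> \<bar>\<dots>\<bar>" by simp
  also have "\<dots> \<le> 2 * (\<Sum>h. g h) * (\<Sum>s=1..N. (1 / real N)\<^sup>2)"
    by (rule weighted_double_sum_le[OF cov sg(1) g0]) auto
  also have "\<dots> = 2 * real c * d\<^sup>2 / real N" using N sg(2) by (simp add: power2_eq_square)
  finally have "rms M (\<lambda>\<omega>. avg N (\<lambda>t. Q t \<omega>)) \<le> sqrt (2 * real c * d\<^sup>2 / real N)" by (rule real_le_rsqrt)
  then show ?thesis using integral_norm_le_rms[OF sqA] by simp
qed

end

text \<open>The block starting at \<open>t \<ge> 1\<close> covers the times \<open>t\<close> to
  \<open>t + b - 1\<close>. By natural subtraction \<open>t = 0\<close> repeats the block at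
  \<open>1\<close>; this start is never drawn.\<close>

definition blk :: "nat \<Rightarrow> (nat \<Rightarrow> real) \<Rightarrow> (nat \<Rightarrow> 'a \<Rightarrow> L2) \<Rightarrow> nat \<Rightarrow> 'a \<Rightarrow> L2" where
  "blk b a Z t \<omega> = (\<Sum>i=1..b. a i *\<^sub>R Z (t - 1 + i) \<omega>)"

text \<open>Indexing by absolute times is the form required by \<open>m_dep\<close> and
  \<open>approximant\<close>.\<close>

lemma blk_window: "1 \<le> t \<Longrightarrow> blk b a Z t \<omega> = (\<Sum>u\<in>{t..<t + b}. a (u + 1 - t) *\<^sub>R Z u \<omega>)"
  unfolding blk_def by (rule sum.reindex_bij_witness[of _ "\<lambda>u. u + 1 - t" "\<lambda>i. t - 1 + i"]) auto

lemma norm_weights_window: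
  assumes "norm_weights b a"
  shows "(\<Sum>u\<in>{t..<t + b}. (a (u + 1 - t))\<^sup>2) = 1"
proof -
  have "(\<Sum>u\<in>{t..<t + b}. (a (u + 1 - t))\<^sup>2) = (\<Sum>i=1..b. (a i)\<^sup>2)"
    by (rule sum.reindex_bij_witness[of _ "\<lambda>i. t + i - 1" "\<lambda>u. u + 1 - t"]) auto
  then show ?thesis using assms by (simp add: norm_weights_def)
qed

lemma norm_weights_sum_abs:
  assumes "norm_weights b a"
  shows "(\<Sum>i=1..b. \<bar>a i\<bar>) \<le> sqrt (real b)"
proof (rule real_le_rsqrt)
  have "(\<Sum>i=1..b. 1 * \<bar>a i\<bar>)\<^sup>2 \<le> (\<Sum>i=1..b. 1\<^sup>2) * (\<Sum>i=1..b. \<bar>a i\<bar>\<^sup>2)" by (rule Cauchy_Schwarz_ineq_sum)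
  then show "(\<Sum>i=1..b. \<bar>a i\<bar>)\<^sup>2 \<le> real b" using assms by (simp add: norm_weights_def)
qed

lemma blk_bound:
  assumes a: "norm_weights b a" and Z: "\<And>t. norm (Z t \<omega>) \<le> T" and "0 \<le> T"
  shows "norm (blk b a Z t \<omega>) \<le> sqrt (real b) * T"
proof -
  have "norm (blk b a Z t \<omega>) \<le> (\<Sum>i=1..b. \<bar>a i\<bar> * T)"
    unfolding blk_def by (rule sum_norm_le) (use Z in \<open>simp add: mult_left_mono\<close>)
  also have "\<dots> = (\<Sum>i=1..b. \<bar>a i\<bar>) * T" by (simp add: sum_distrib_right)
  also have "\<dots> \<le> sqrt (real b) * T" using norm_weights_sum_abs[OF a] \<open>0 \<le> T\<close> by (rule mult_right_mono)
  finally show ?thesis .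
qed

lemma bounded_selfadj:
  assumes "selfadj R"
  shows "\<exists>K>0. \<forall>x. norm (R x) \<le> K * norm x"
proof -
  have "bounded_linear R" using assms by (simp add: selfadj_def)
  from bounded_linear.pos_bounded[OF this] show ?thesis by (simp only: mult.commute)
qed

lemma rms_bounded_map:
  assumes "bounded_linear R" "\<And>x. norm (R x) \<le> K * norm x" "0 \<le> K" "sq_int M X"
  shows "rms M (\<lambda>\<omega>. R (X \<omega>)) \<le> K * rms M X"
proof -
  have "(rms M (\<lambda>\<omega>. R (X \<omega>)))\<^sup>2 \<le> (\<integral>\<omega>. K\<^sup>2 * (norm (X \<omega>))\<^sup>2 \<partial>M)"
    unfolding rms_power2
  proof (rule integral_mono)
    show "(norm (R (X \<omega>)))\<^sup>2 \<le> K\<^sup>2 * (norm (X \<omega>))\<^sup>2" for \<omega>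
      using power_mono[OF assms(2)[of "X \<omega>"] norm_ge_zero, of 2] by (simp add: power_mult_distrib)
  qed (use sq_intD[OF assms(4)] sq_intD[OF sq_int_bounded_linear[OF assms(1,4)]] in auto)
  also have "\<dots> = (K * rms M X)\<^sup>2" by (simp add: power_mult_distrib rms_power2)
  finally show ?thesis by (rule power2_le_imp_le) (use assms(3) in simp)
qed

context weak_dep begin

lemma sq_int_blk: "sq_int M (blk b a Y t)"
  unfolding blk_def[abs_def] by (intro sq_int_sum sq_int_scaleR sq)

lemma rms_blk_le:
  assumes "norm_weights b a"
  shows "rms M (blk b a Y t) \<le> sqrt bnd"
  using rms_weighted_le[of "{1..b}" a "t - 1"] assms unfolding blk_def[abs_def] by (simp add: norm_weights_def)

text \<open>With the sums exchanged, each position in the block carries a long average of the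
  process, of order \<open>1 / sqrt N\<close>, and the absolute weights add up to at most
  \<open>sqrt b\<close>. This makes the subtracted term in \<open>star_second_moment\<close>
  negligible.\<close>

lemma rms_avg_blk_le:
  assumes a: "norm_weights b a" and N: "0 < N"
  shows "rms M (\<lambda>\<omega>. avg N (\<lambda>t. blk b a Y t \<omega>)) \<le> sqrt (real b) * sqrt (bnd / real N)"
proof -
  have eq: "avg N (\<lambda>t. blk b a Y t \<omega>) = (\<Sum>i=1..b. a i *\<^sub>R (\<Sum>t=1..N. (1 / real N) *\<^sub>R Y (i - 1 + t) \<omega>))" for \<omega>
  proof -
    have "avg N (\<lambda>t. blk b a Y t \<omega>) = (\<Sum>t=1..N. \<Sum>i=1..b. a i *\<^sub>R (1 / real N) *\<^sub>R Y (i - 1 + t) \<omega>)"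
      unfolding avg_def blk_def scaleR_sum_right
    proof (intro sum.cong refl)
      fix t i assume "t \<in> {1..N}" "i \<in> {1..b}"
      then have "t - 1 + i = i - 1 + t" by auto
      then show "(1 / real N) *\<^sub>R a i *\<^sub>R Y (t - 1 + i) \<omega> = a i *\<^sub>R (1 / real N) *\<^sub>R Y (i - 1 + t) \<omega>" by simp
    qed
    then show ?thesis by (subst (asm) sum.swap) (simp add: scaleR_sum_right)
  qed
  have sqi: "sq_int M (\<lambda>\<omega>. \<Sum>t=1..N. (1 / real N) *\<^sub>R Y (i - 1 + t) \<omega>)" for i by (rule sq_int_weighted)
  have one: "rms M (\<lambda>\<omega>. \<Sum>t=1..N. (1 / real N) *\<^sub>R Y (i - 1 + t) \<omega>) \<le> sqrt (bnd / real N)" for i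
    using rms_weighted_le[of "{1..N}" "\<lambda>_. 1 / real N" "i - 1"] N by (simp add: power2_eq_square)
  have "rms M (\<lambda>\<omega>. avg N (\<lambda>t. blk b a Y t \<omega>)) \<le> (\<Sum>i=1..b. rms M (\<lambda>\<omega>. a i *\<^sub>R (\<Sum>t=1..N. (1 / real N) *\<^sub>R Y (i - 1 + t) \<omega>)))"
    unfolding eq by (rule rms_sum_le) (intro sq_int_scaleR sqi)
  also have "\<dots> \<le> (\<Sum>i=1..b. \<bar>a i\<bar> * sqrt (bnd / real N))"
    unfolding rms_scaleR by (intro sum_mono mult_left_mono one) simp
  also have "\<dots> = (\<Sum>i=1..b. \<bar>a i\<bar>) * sqrt (bnd / real N)" by (simp add: sum_distrib_right)
  also have "\<dots> \<le> sqrt (real b) * sqrt (bnd / real N)"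
    using norm_weights_sum_abs[OF a] bnd_nonneg by (intro mult_right_mono) auto
  finally show ?thesis .
qed

lemma rms_blk_diff_le:
  assumes ap: "approximant M Y \<eta> Z m T" and \<eta>: "0 \<le> \<eta>" and a: "norm_weights b a" and t: "1 \<le> t"
  shows "rms M (\<lambda>\<omega>. blk b a Y t \<omega> - blk b a Z t \<omega>) \<le> sqrt \<eta>"
proof -
  have "blk b a Y t \<omega> - blk b a Z t \<omega> = (\<Sum>u\<in>{t..<t + b}. a (u + 1 - t) *\<^sub>R (Y u \<omega> - Z u \<omega>))" for \<omega>
    unfolding blk_window[OF t] by (simp add: scaleR_diff_right sum_subtractf)
  then show ?thesis
    using approximant_rms[OF ap _ \<eta>, of "{t..<t + b}" "\<lambda>u. a (u + 1 - t)"] norm_weights_window[OF a, of t] by simp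
qed

text \<open>Passing from the block sums \<open>V\<close> to the bounded blocks \<open>W\<close> of
  the approximant costs \<open>e1\<close> twice: for the values and for their expectations. The
  centred forms of \<open>W\<close> are uncorrelated at lags from \<open>b + m\<close> on, so their
  average obeys a law of large numbers. What remains is the bias of a single block, the same for all
  starting points by stationarity.\<close>

lemma avg_quad_error:
  assumes ap: "approximant M Y \<eta> Z m T" and \<eta>: "0 \<le> \<eta>" and a: "norm_weights b a" and N: "0 < N"
    and R: "selfadj R" and K: "0 < K" "\<And>x. norm (R x) \<le> K * norm x"
  defines "e1 \<equiv> K * sqrt \<eta> * (2 * sqrt bnd + sqrt \<eta>)" and "d \<equiv> K * (sqrt (real b) * T) * (sqrt bnd + sqrt \<eta>)"
    and "V \<equiv> blk b a Y"
  shows "(\<integral>\<omega>. \<bar>avg N (\<lambda>t. inner (R (V t \<omega>)) (V t \<omega>)) - L\<bar> \<partial>M)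
    \<le> 2 * e1 + sqrt (2 * real (b + m) * d\<^sup>2 / real N) + \<bar>(\<integral>\<omega>. inner (R (V 1 \<omega>)) (V 1 \<omega>) \<partial>M) - L\<bar>"
proof -
  have Rl: "bounded_linear R" and Rs: "\<And>x y. inner (R x) y = inner x (R y)" using R by (auto simp: selfadj_def)
  have [measurable]: "R \<in> borel_measurable borel" by (rule borel_measurable_bounded_linear[OF Rl])
  have Z: "Z t \<in> borel_measurable M" "norm (Z t \<omega>) \<le> T" "(\<integral>\<omega>. Z t \<omega> \<partial>M) = 0" "m_dep M Z m" for t \<omega>
    using ap by (auto simp: approximant_def)
  have T0: "0 \<le> T" using Z(2) norm_ge_zero order_trans by blast
  have sqZ: "sq_int M (Z t)" for t using sq_int_bounded(1)[OF Z(1,2)] .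
  define W where "W = blk b a Z"
  have sqV: "sq_int M (V t)" for t unfolding V_def by (rule sq_int_blk)
  have sqW: "sq_int M (W t)" for t unfolding W_def blk_def[abs_def] by (intro sq_int_sum sq_int_scaleR sqZ)
  have measW [measurable]: "W t \<in> borel_measurable M" for t using sqW by (rule sq_intD)
  have boundW: "norm (W t \<omega>) \<le> sqrt (real b) * T" for t \<omega>
    unfolding W_def by (rule blk_bound[OF a _ T0]) (rule Z(2))
  have VW: "rms M (\<lambda>\<omega>. V t \<omega> - W t \<omega>) \<le> sqrt \<eta>" if "1 \<le> t" for t
    unfolding V_def W_def by (rule rms_blk_diff_le[OF ap \<eta> a that])
  have rV: "rms M (V t) \<le> sqrt bnd" for t unfolding V_def by (rule rms_blk_le[OF a])
  have rW: "rms M (W t) \<le> sqrt bnd + sqrt \<eta>" if "1 \<le> t" for t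
    using rms_diff[OF sqV[of t] sq_int_diff[OF sqV[of t] sqW[of t]]] VW[OF that] rV[of t] by simp
  define q where "q x = inner (R x) x" for x
  have qint: "integrable M (\<lambda>\<omega>. q (X \<omega>))" if "sq_int M X" for X
    unfolding q_def by (intro integrable_inner_sq_int sq_int_bounded_linear[OF Rl] that)
  have qdiff: "(\<integral>\<omega>. \<bar>q (V t \<omega>) - q (W t \<omega>)\<bar> \<partial>M) \<le> e1" if t: "1 \<le> t" for t
  proof -
    have D: "sq_int M (\<lambda>\<omega>. V t \<omega> - W t \<omega>)" by (intro sq_int_diff sqV sqW)
    have "q x - q y = inner (R (x - y)) (x + y)" for x y
    proof -
      have "inner (R y) x = inner (R x) y" using Rs[of x y] inner_commute[of x "R y"] by simp
      then show ?thesis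
        unfolding q_def by (simp add: linear_diff[OF bounded_linear.linear[OF Rl]] inner_diff_left inner_add_right)
    qed
    then have "(\<integral>\<omega>. \<bar>q (V t \<omega>) - q (W t \<omega>)\<bar> \<partial>M) = (\<integral>\<omega>. \<bar>inner (R (V t \<omega> - W t \<omega>)) (V t \<omega> + W t \<omega>)\<bar> \<partial>M)" by simp
    also have "\<dots> \<le> rms M (\<lambda>\<omega>. R (V t \<omega> - W t \<omega>)) * rms M (\<lambda>\<omega>. V t \<omega> + W t \<omega>)"
      by (intro integral_abs_inner_le sq_int_bounded_linear[OF Rl] D sq_int_add sqV sqW)
    also have "\<dots> \<le> (K * sqrt \<eta>) * (2 * sqrt bnd + sqrt \<eta>)"
    proof (intro mult_mono)
      show "rms M (\<lambda>\<omega>. R (V t \<omega> - W t \<omega>)) \<le> K * sqrt \<eta>"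
        using order_trans[OF rms_bounded_map[OF Rl K(2) _ D] mult_left_mono[OF VW[OF t]]] K(1) by simp
      show "rms M (\<lambda>\<omega>. V t \<omega> + W t \<omega>) \<le> 2 * sqrt bnd + sqrt \<eta>"
        using rms_add[OF sqV[of t] sqW[of t]] rV[of t] rW[OF t] by linarith
    qed (use K(1) \<eta> in auto)
    finally show ?thesis by (simp add: e1_def)
  qed
  define Q where "Q t \<omega> = q (W t \<omega>) - (\<integral>\<omega>. q (W t \<omega>) \<partial>M)" for t \<omega>
  have q_bound: "\<bar>q x\<bar> \<le> K * norm x * norm x" for x
    unfolding q_def using Cauchy_Schwarz_ineq2[of "R x" x] mult_right_mono[OF K(2)[of x] norm_ge_zero[of x]] by linarith
  have qmeas [measurable]: "q \<in> borel_measurable borel" unfolding q_def[abs_def] by measurable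
  have sqqW: "sq_int M (\<lambda>\<omega>. q (W t \<omega>))" for t
  proof (rule sq_int_bounded(1))
    show "norm (q (W t \<omega>)) \<le> K * (sqrt (real b) * T) * (sqrt (real b) * T)" for \<omega>
      unfolding real_norm_def
      by (rule order_trans[OF q_bound]) (use boundW[of t \<omega>] K(1) T0 in \<open>intro mult_mono; simp\<close>)
  qed measurable
  \<comment> \<open>Only one of the two factors \<open>norm (W t \<omega>)\<close> is replaced by
    its bound of order \<open>sqrt b\<close>; the other stays in mean square. So \<open>d\<close>
    has order \<open>sqrt b\<close>, and the law of large numbers needs no more than small
    \<open>b\<^sup>2 / N\<close>.\<close>
  have rms_qW: "rms M (\<lambda>\<omega>. q (W t \<omega>)) \<le> d" if t: "1 \<le> t" for t
  proof -
    have "(rms M (\<lambda>\<omega>. q (W t \<omega>)))\<^sup>2 \<le> (\<integral>\<omega>. (K * (sqrt (real b) * T))\<^sup>2 * (norm (W t \<omega>))\<^sup>2 \<partial>M)"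
      unfolding rms_power2
    proof (rule integral_mono)
      show "(norm (q (W t \<omega>)))\<^sup>2 \<le> (K * (sqrt (real b) * T))\<^sup>2 * (norm (W t \<omega>))\<^sup>2" for \<omega>
      proof -
        have "\<bar>q (W t \<omega>)\<bar> \<le> K * (sqrt (real b) * T) * norm (W t \<omega>)"
          by (rule order_trans[OF q_bound]) (use boundW[of t \<omega>] K(1) T0 in \<open>intro mult_mono; simp\<close>)
        from power_mono[OF this abs_ge_zero, of 2] show ?thesis by (simp add: power_mult_distrib)
      qed
    qed (use sq_intD[OF sqqW] sq_intD[OF sqW] in auto)
    also have "\<dots> = (K * (sqrt (real b) * T) * rms M (W t))\<^sup>2" by (simp add: power_mult_distrib rms_power2)
    also have "\<dots> \<le> d\<^sup>2"
      unfolding d_def using rW[OF t] K(1) T0 by (intro power_mono mult_left_mono) auto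
    finally show ?thesis
      by (rule power2_le_imp_le) (use K(1) T0 bnd_nonneg \<eta> in \<open>simp add: d_def\<close>)
  qed
  \<comment> \<open>\<open>expectation_abs_avg_le\<close> asks for the moment bound at every index,
    but the block bounds hold from \<open>1\<close> on; the start \<open>0\<close> is moved there
    without affecting the average.\<close>
  define Q' where "Q' t = Q (max 1 t)" for t
  have avgQ: "avg N (\<lambda>t. Q' t \<omega>) = avg N (\<lambda>t. Q t \<omega>)" for \<omega>
    unfolding avg_def Q'_def by (intro arg_cong[of _ _ "scaleR _"] sum.cong) auto
  have sqQ: "sq_int M (Q t)" for t unfolding Q_def[abs_def] by (intro sq_int_diff sqqW) simp
  have rmsQ: "rms M (Q t) \<le> d" if t: "1 \<le> t" for t
  proof -
    have "(rms M (Q t))\<^sup>2 \<le> (rms M (\<lambda>\<omega>. q (W t \<omega>)))\<^sup>2"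
      unfolding Q_def[abs_def] variance_le[OF sqqW] by simp
    also have "\<dots> \<le> d\<^sup>2" by (rule power_mono[OF rms_qW[OF t] rms_nonneg])
    finally show ?thesis by (rule power2_le_imp_le) (rule order_trans[OF rms_nonneg rms_qW[OF t]])
  qed
  have LLN: "(\<integral>\<omega>. \<bar>avg N (\<lambda>t. Q' t \<omega>)\<bar> \<partial>M) \<le> sqrt (2 * real (b + m) * d\<^sup>2 / real N)"
  proof (rule expectation_abs_avg_le[OF _ _ N])
    show "sq_int M (Q' t)" for t unfolding Q'_def by (rule sqQ)
    show "rms M (Q' t) \<le> d" for t unfolding Q'_def by (rule rmsQ) simp
    fix s t assume st: "s \<in> {1..N}" "t \<in> {1..N}" "b + m \<le> gap s t"
    \<comment> \<open>Two windows of length \<open>b\<close> whose starts differ by at least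
      \<open>b + m\<close> are at distance at least \<open>m\<close>, so \<open>m_dep\<close>
      applies with two groups.\<close>
    define J where "J = {0, 1 :: nat}"
    define Kf where "Kf i = (if i = 0 then {s..<s + b} else {t..<t + b})" for i :: nat
    define af where "af i u = (if i = 0 then a (u + 1 - s) else a (u + 1 - t))" for i u :: nat
    have "m \<le> gap u v" if "u \<in> {s..<s + b}" "v \<in> {t..<t + b}" for u v
      using that st(3) unfolding gap_def by auto
    moreover have "gap u v = gap v u" for u v by (rule gap_commute)
    ultimately have "\<forall>i\<in>J. \<forall>j\<in>J. i \<noteq> j \<longrightarrow> (\<forall>u\<in>Kf i. \<forall>v\<in>Kf j. m \<le> gap u v)"
      unfolding J_def Kf_def by fastforce
    from Z(4)[unfolded m_dep_def, THEN spec, THEN spec, THEN spec, of J Kf af, THEN mp, OF this]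
    have ind: "indep_vars (\<lambda>_. borel) (\<lambda>j \<omega>. \<Sum>u\<in>Kf j. af j u *\<^sub>R Z u \<omega>) J" .
    have "indep_var borel (\<lambda>\<omega>. \<Sum>u\<in>Kf 0. af 0 u *\<^sub>R Z u \<omega>) borel (\<lambda>\<omega>. \<Sum>u\<in>Kf 1. af 1 u *\<^sub>R Z u \<omega>)"
      by (rule indep_vars_pair[OF ind]) (auto simp: J_def)
    moreover have "(\<lambda>\<omega>. \<Sum>u\<in>Kf 0. af 0 u *\<^sub>R Z u \<omega>) = W s" "(\<lambda>\<omega>. \<Sum>u\<in>Kf 1. af 1 u *\<^sub>R Z u \<omega>) = W t"
      using st(1,2) unfolding W_def by (auto simp: blk_window Kf_def af_def)
    ultimately have WW: "indep_var borel (W s) borel (W t)" by simp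
    define c where "c t = (\<integral>\<omega>. q (W t \<omega>) \<partial>M)" for t
    have "indep_var borel ((\<lambda>x. q x - c s) \<circ> W s) borel ((\<lambda>x. q x - c t) \<circ> W t)"
      by (rule indep_var_compose[OF WW]) auto
    then have "indep_var borel (Q s) borel (Q t)" by (simp add: comp_def Q_def[abs_def] c_def)
    from indep_integral_inner[OF this sqQ sqQ] have "(\<integral>\<omega>. Q s \<omega> * Q t \<omega> \<partial>M) = (\<integral>\<omega>. Q s \<omega> \<partial>M) * (\<integral>\<omega>. Q t \<omega> \<partial>M)" by simp
    moreover have "(\<integral>\<omega>. Q s \<omega> \<partial>M) = 0" unfolding Q_def using qint[OF sqW] by (simp add: prob_space)
    moreover have "Q' s = Q s" "Q' t = Q t" using st(1,2) by (auto simp: Q'_def max_def)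
    ultimately show "(\<integral>\<omega>. Q' s \<omega> * Q' t \<omega> \<partial>M) = 0" by simp
  qed
  have EV: "(\<integral>\<omega>. q (V t \<omega>) \<partial>M) = (\<integral>\<omega>. q (V 1 \<omega>) \<partial>M)" for t
    unfolding q_def V_def blk_def by (simp only: quad_weighted[OF R])
  have meanW: "\<bar>avg N (\<lambda>t. \<integral>\<omega>. q (W t \<omega>) \<partial>M) - (\<integral>\<omega>. q (V 1 \<omega>) \<partial>M)\<bar> \<le> e1"
  proof -
    have one: "\<bar>(\<integral>\<omega>. q (W t \<omega>) \<partial>M) - (\<integral>\<omega>. q (V 1 \<omega>) \<partial>M)\<bar> \<le> e1" if "t \<in> {1..N}" for t
    proof -
      have "(\<integral>\<omega>. q (W t \<omega>) \<partial>M) - (\<integral>\<omega>. q (V 1 \<omega>) \<partial>M) = - (\<integral>\<omega>. q (V t \<omega>) - q (W t \<omega>) \<partial>M)"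
        using qint[OF sqV[of t]] qint[OF sqW[of t]] EV[of t] by simp
      moreover have "1 \<le> t" using that by simp
      ultimately show ?thesis using order_trans[OF integral_abs_bound qdiff[OF \<open>1 \<le> t\<close>]] by simp
    qed
    have "avg N (\<lambda>t. (\<integral>\<omega>. q (W t \<omega>) \<partial>M) - (\<integral>\<omega>. q (V 1 \<omega>) \<partial>M)) \<le> avg N (\<lambda>t. e1)"
      using one by (intro avg_mono) (simp add: abs_le_iff)
    moreover have "avg N (\<lambda>t. - e1) \<le> avg N (\<lambda>t. (\<integral>\<omega>. q (W t \<omega>) \<partial>M) - (\<integral>\<omega>. q (V 1 \<omega>) \<partial>M))"
      using one by (intro avg_mono) (force simp: abs_le_iff)
    ultimately show ?thesis unfolding avg_diff avg_const[OF N] by (simp add: abs_le_iff)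
  qed
  have bound: "\<bar>avg N (\<lambda>t. q (V t \<omega>)) - L\<bar> \<le> avg N (\<lambda>t. \<bar>q (V t \<omega>) - q (W t \<omega>)\<bar>) + \<bar>avg N (\<lambda>t. Q' t \<omega>)\<bar>
      + (e1 + \<bar>(\<integral>\<omega>. q (V 1 \<omega>) \<partial>M) - L\<bar>)" for \<omega>
  proof -
    have "avg N (\<lambda>t. q (V t \<omega>)) - L = avg N (\<lambda>t. q (V t \<omega>) - q (W t \<omega>)) + avg N (\<lambda>t. Q t \<omega>)
        + (avg N (\<lambda>t. \<integral>\<omega>. q (W t \<omega>) \<partial>M) - (\<integral>\<omega>. q (V 1 \<omega>) \<partial>M)) + ((\<integral>\<omega>. q (V 1 \<omega>) \<partial>M) - L)"
      unfolding Q_def avg_diff by simp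
    moreover have "\<bar>avg N (\<lambda>t. q (V t \<omega>) - q (W t \<omega>))\<bar> \<le> avg N (\<lambda>t. \<bar>q (V t \<omega>) - q (W t \<omega>)\<bar>)"
      unfolding avg_def by (simp add: divide_right_mono sum_abs)
    ultimately show ?thesis using meanW unfolding avgQ by linarith
  qed
  have int1: "integrable M (\<lambda>\<omega>. avg N (\<lambda>t. q (V t \<omega>)) - L)"
    using qint[OF sqV] unfolding avg_def by (simp add: Bochner_Integration.integrable_sum)
  have int2: "integrable M (\<lambda>\<omega>. avg N (\<lambda>t. \<bar>q (V t \<omega>) - q (W t \<omega>)\<bar>))"
    using qint[OF sqV] qint[OF sqW] unfolding avg_def by (simp add: Bochner_Integration.integrable_sum)
  have int3: "integrable M (\<lambda>\<omega>. \<bar>avg N (\<lambda>t. Q' t \<omega>)\<bar>)"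
    using integrable_sq_int[OF sqQ] unfolding avg_def Q'_def by (simp add: Bochner_Integration.integrable_sum)
  have "(\<integral>\<omega>. \<bar>avg N (\<lambda>t. q (V t \<omega>)) - L\<bar> \<partial>M) \<le> (\<integral>\<omega>. avg N (\<lambda>t. \<bar>q (V t \<omega>) - q (W t \<omega>)\<bar>) + \<bar>avg N (\<lambda>t. Q' t \<omega>)\<bar>
      + (e1 + \<bar>(\<integral>\<omega>. q (V 1 \<omega>) \<partial>M) - L\<bar>) \<partial>M)"
    by (rule integral_mono) (use int1 int2 int3 bound in auto)
  also have "\<dots> = avg N (\<lambda>t. \<integral>\<omega>. \<bar>q (V t \<omega>) - q (W t \<omega>)\<bar> \<partial>M) + (\<integral>\<omega>. \<bar>avg N (\<lambda>t. Q' t \<omega>)\<bar> \<partial>M)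
      + (e1 + \<bar>(\<integral>\<omega>. q (V 1 \<omega>) \<partial>M) - L\<bar>)"
    using int2 int3 qint[OF sqV] qint[OF sqW] by (simp add: prob_space integral_avg)
  also have "avg N (\<lambda>t. \<integral>\<omega>. \<bar>q (V t \<omega>) - q (W t \<omega>)\<bar> \<partial>M) \<le> avg N (\<lambda>t. e1)"
    using qdiff by (intro avg_mono) simp
  finally show ?thesis using LLN unfolding avg_const[OF N] q_def by simp
qed

end

text \<open>\<open>bN\<close> serves the law of large numbers over the blocks and \<open>bk\<close>
  the smallness of single summands.\<close>

locale boot_setup = weak_dep +
  fixes a :: "nat \<Rightarrow> nat \<Rightarrow> real" and b k N :: "nat \<Rightarrow> nat"
  assumes a: "norm_weights (b j) (a j)" and rough: "(\<lambda>j. roughness (b j) (a j)) \<longlonglongrightarrow> 0"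
    and N: "0 < N j" and k: "0 < k j"
    and bN: "(\<lambda>j. (real (b j))\<^sup>2 / real (N j)) \<longlonglongrightarrow> 0" and bk: "(\<lambda>j. real (b j) / real (k j)) \<longlonglongrightarrow> 0"
begin

abbreviation V :: "nat \<Rightarrow> nat \<Rightarrow> 'a \<Rightarrow> L2" where
  "V j \<equiv> blk (b j) (a j) Y"

definition Vs :: "nat \<Rightarrow> 'a \<Rightarrow> (nat \<Rightarrow> nat) \<Rightarrow> L2" where
  "Vs j \<omega> = star (k j) (N j) (\<lambda>t. V j t \<omega>)"

abbreviation P :: "nat \<Rightarrow> (nat \<Rightarrow> nat) measure" where
  "P j \<equiv> measure_pmf (start_pmf (k j) (N j))"

lemma b_pos: "1 \<le> b j"
  using a[of j] by (cases "b j") (auto simp: norm_weights_def)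

text \<open>The draws have finite support, so the conditional expectation is a finite sum of
  measurable functions of the data.\<close>

lemma measurable_boot_integral:
  fixes G :: "L2 \<Rightarrow> 'c::{banach, second_countable_topology}"
  assumes [measurable]: "G \<in> borel_measurable borel"
  shows "(\<lambda>\<omega>. \<integral>J. G (Vs j \<omega> J) \<partial>P j) \<in> borel_measurable M"
proof -
  have meas [measurable]: "V j t \<in> borel_measurable M" for t by (rule sq_intD(1)[OF sq_int_blk])
  have "(\<integral>J. G (Vs j \<omega> J) \<partial>P j) = (\<Sum>J\<in>set_pmf (start_pmf (k j) (N j)). pmf (start_pmf (k j) (N j)) J *\<^sub>R G (Vs j \<omega> J))" for \<omega>
    by (rule integral_measure_pmf[OF finite_start_pmf[OF k N]]) auto
  moreover have "(\<lambda>\<omega>. G (Vs j \<omega> J)) \<in> borel_measurable M" for J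
    unfolding Vs_def star_def avg_def by measurable
  ultimately show ?thesis by simp
qed

text \<open>By \<open>star_second_moment\<close> the conditional form is an empirical form minus
  that of the empirical mean. The former tends to \<open>lrv R\<close> by
  \<open>avg_quad_error\<close>; the latter has expectation of order \<open>b / N\<close>.\<close>

theorem boot_quad_tendsto:
  assumes R: "selfadj R"
  shows "(\<lambda>j. \<integral>\<omega>. \<bar>(\<integral>J. inner (R (Vs j \<omega> J)) (Vs j \<omega> J) \<partial>P j) - lrv R\<bar> \<partial>M) \<longlonglongrightarrow> 0"
proof (rule metric_LIMSEQ_I)
  fix \<epsilon> :: real assume "\<epsilon> > 0"
  have Rl: "bounded_linear R" using R by (simp add: selfadj_def)
  obtain K where K: "0 < K" "\<And>x. norm (R x) \<le> K * norm x" using bounded_selfadj[OF R] by (elim exE conjE) simp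
  have "((\<lambda>r. 2 * (K * r * (2 * sqrt bnd + r))) \<longlongrightarrow> 2 * (K * 0 * (2 * sqrt bnd + 0))) (at_right 0)"
    by (intro tendsto_intros)
  then have "\<forall>\<^sub>F r in at_right 0. 2 * (K * r * (2 * sqrt bnd + r)) < \<epsilon> / 2"
    by (rule order_tendstoD) (use \<open>\<epsilon> > 0\<close> in simp)
  moreover have "\<forall>\<^sub>F r in at_right (0::real). 0 < r" by (rule eventually_at_right_less)
  ultimately have "\<forall>\<^sub>F r in at_right (0::real). 0 < r \<and> 2 * (K * r * (2 * sqrt bnd + r)) < \<epsilon> / 2"
    by eventually_elim simp
  then obtain r where r: "0 < r" "2 * (K * r * (2 * sqrt bnd + r)) < \<epsilon> / 2"
    using eventually_happens'[OF trivial_limit_at_right_real] by blast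
  have sr: "sqrt (r\<^sup>2) = r" "0 < r\<^sup>2" using r(1) by auto
  obtain Z m T where ap: "approximant M Y (r\<^sup>2) Z m T" using approx[OF sr(2)] by blast
  \<comment> \<open>Collects the constants of the variance term after
    \<open>b + m \<le> (1 + m) * b\<close>, which leaves a multiple of
    \<open>b\<^sup>2 / N\<close>.\<close>
  define c where "c = (1 + real m) * (K * T * (sqrt bnd + r))\<^sup>2"
  have var: "(\<lambda>j. \<integral>\<omega>. inner (R (V j 1 \<omega>)) (V j 1 \<omega>) \<partial>M) \<longlonglongrightarrow> lrv R"
    unfolding blk_def by (rule quad_tendsto_lrv[OF R a rough])
  have "(\<lambda>j. sqrt (2 * c * ((real (b j))\<^sup>2 / real (N j))) + \<bar>(\<integral>\<omega>. inner (R (V j 1 \<omega>)) (V j 1 \<omega>) \<partial>M) - lrv R\<bar>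
        + K * bnd * ((real (b j))\<^sup>2 / real (N j)))
      \<longlonglongrightarrow> sqrt (2 * c * 0) + \<bar>lrv R - lrv R\<bar> + K * bnd * 0"
    by (intro tendsto_intros bN var)
  then have "\<forall>\<^sub>F j in sequentially. sqrt (2 * c * ((real (b j))\<^sup>2 / real (N j))) + \<bar>(\<integral>\<omega>. inner (R (V j 1 \<omega>)) (V j 1 \<omega>) \<partial>M) - lrv R\<bar>
        + K * bnd * ((real (b j))\<^sup>2 / real (N j)) < \<epsilon> / 2"
    by (rule order_tendstoD) (use \<open>\<epsilon> > 0\<close> in simp)
  then obtain j0 where j0: "\<And>j. j \<ge> j0 \<Longrightarrow> sqrt (2 * c * ((real (b j))\<^sup>2 / real (N j))) + \<bar>(\<integral>\<omega>. inner (R (V j 1 \<omega>)) (V j 1 \<omega>) \<partial>M) - lrv R\<bar>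
        + K * bnd * ((real (b j))\<^sup>2 / real (N j)) < \<epsilon> / 2"
    by (auto simp: eventually_sequentially)
  have "dist (\<integral>\<omega>. \<bar>(\<integral>J. inner (R (Vs j \<omega> J)) (Vs j \<omega> J) \<partial>P j) - lrv R\<bar> \<partial>M) 0 < \<epsilon>" if j: "j \<ge> j0" for j
  proof -
    let ?q = "\<lambda>\<omega>. avg (N j) (\<lambda>t. inner (R (V j t \<omega>)) (V j t \<omega>))" and ?A = "\<lambda>\<omega>. avg (N j) (\<lambda>t. V j t \<omega>)"
    have sqA: "sq_int M ?A" unfolding avg_def by (intro sq_int_scaleR sq_int_sum sq_int_blk)
    have intq: "integrable M (\<lambda>\<omega>. ?q \<omega> - lrv R)"
      unfolding avg_def using integrable_inner_sq_int[OF sq_int_bounded_linear[OF Rl sq_int_blk] sq_int_blk]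
      by (simp add: Bochner_Integration.integrable_sum)
    have intA: "integrable M (\<lambda>\<omega>. inner (R (?A \<omega>)) (?A \<omega>))"
      by (intro integrable_inner_sq_int sq_int_bounded_linear[OF Rl] sqA)
    have b1: "real (b j) \<le> (real (b j))\<^sup>2" using b_pos[of j] by (simp add: power2_eq_square)
    have A: "(\<integral>\<omega>. \<bar>inner (R (?A \<omega>)) (?A \<omega>)\<bar> \<partial>M) \<le> K * bnd * ((real (b j))\<^sup>2 / real (N j))"
    proof -
      have "(\<integral>\<omega>. \<bar>inner (R (?A \<omega>)) (?A \<omega>)\<bar> \<partial>M) \<le> rms M (\<lambda>\<omega>. R (?A \<omega>)) * rms M ?A"
        by (intro integral_abs_inner_le sq_int_bounded_linear[OF Rl] sqA)
      also have "\<dots> \<le> (K * rms M ?A) * rms M ?A"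
        using rms_bounded_map[OF Rl K(2) _ sqA] K(1) by (intro mult_right_mono) auto
      also have "\<dots> = K * (rms M ?A)\<^sup>2" by (simp add: power2_eq_square)
      also have "\<dots> \<le> K * (sqrt (real (b j)) * sqrt (bnd / real (N j)))\<^sup>2"
        using K(1) by (intro mult_left_mono power_mono rms_avg_blk_le a N) auto
      also have "\<dots> = K * bnd * (real (b j) / real (N j))"
        using bnd_nonneg by (simp add: power_mult_distrib)
      also have "\<dots> \<le> K * bnd * ((real (b j))\<^sup>2 / real (N j))"
        using b1 K(1) bnd_nonneg by (intro mult_left_mono divide_right_mono) auto
      finally show ?thesis .
    qed
    have "(\<integral>\<omega>. \<bar>(\<integral>J. inner (R (Vs j \<omega> J)) (Vs j \<omega> J) \<partial>P j) - lrv R\<bar> \<partial>M)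
        = (\<integral>\<omega>. \<bar>(?q \<omega> - lrv R) - inner (R (?A \<omega>)) (?A \<omega>)\<bar> \<partial>M)"
      unfolding Vs_def star_second_moment[OF k N Rl] by (simp add: algebra_simps)
    also have "\<dots> \<le> (\<integral>\<omega>. \<bar>?q \<omega> - lrv R\<bar> + \<bar>inner (R (?A \<omega>)) (?A \<omega>)\<bar> \<partial>M)"
      by (rule integral_mono) (use intq intA in auto)
    also have "\<dots> = (\<integral>\<omega>. \<bar>?q \<omega> - lrv R\<bar> \<partial>M) + (\<integral>\<omega>. \<bar>inner (R (?A \<omega>)) (?A \<omega>)\<bar> \<partial>M)"
      using intq intA by simp
    also have "(\<integral>\<omega>. \<bar>?q \<omega> - lrv R\<bar> \<partial>M) \<le> 2 * (K * sqrt (r\<^sup>2) * (2 * sqrt bnd + sqrt (r\<^sup>2)))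
        + sqrt (2 * real (b j + m) * (K * (sqrt (real (b j)) * T) * (sqrt bnd + sqrt (r\<^sup>2)))\<^sup>2 / real (N j))
        + \<bar>(\<integral>\<omega>. inner (R (V j 1 \<omega>)) (V j 1 \<omega>) \<partial>M) - lrv R\<bar>"
      using sr(2) by (intro avg_quad_error[OF ap _ a N R K]) simp
    also have "sqrt (2 * real (b j + m) * (K * (sqrt (real (b j)) * T) * (sqrt bnd + sqrt (r\<^sup>2)))\<^sup>2 / real (N j))
        \<le> sqrt (2 * c * ((real (b j))\<^sup>2 / real (N j)))"
    proof (rule real_sqrt_le_mono)
      let ?C = "(K * T * (sqrt bnd + r))\<^sup>2"
      have "real (b j + m) \<le> (1 + real m) * real (b j)"
        using b_pos[of j] mult_left_mono[of 1 "real (b j)" "real m"] by (simp add: distrib_right)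
      then have "real (b j + m) * (real (b j) * ?C) \<le> ((1 + real m) * real (b j)) * (real (b j) * ?C)"
        by (rule mult_right_mono) simp
      also have "\<dots> = c * (real (b j))\<^sup>2" by (simp add: c_def power2_eq_square)
      finally have "2 * (real (b j + m) * (real (b j) * ?C)) / real (N j) \<le> 2 * (c * (real (b j))\<^sup>2) / real (N j)"
        by (intro divide_right_mono mult_left_mono) auto
      then show "2 * real (b j + m) * (K * (sqrt (real (b j)) * T) * (sqrt bnd + sqrt (r\<^sup>2)))\<^sup>2 / real (N j) \<le> 2 * c * ((real (b j))\<^sup>2 / real (N j))"
      proof -
        assume le: "2 * (real (b j + m) * (real (b j) * ?C)) / real (N j) \<le> 2 * (c * (real (b j))\<^sup>2) / real (N j)"
        have "(K * (sqrt (real (b j)) * T) * (sqrt bnd + r))\<^sup>2 = real (b j) * ?C"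
          by (simp add: power_mult_distrib mult_ac)
        then show ?thesis using le unfolding sr(1) by (simp only: mult.assoc times_divide_eq_right)
      qed
    qed
    finally have le: "(\<integral>\<omega>. \<bar>(\<integral>J. inner (R (Vs j \<omega> J)) (Vs j \<omega> J) \<partial>P j) - lrv R\<bar> \<partial>M) < \<epsilon>"
      using A j0[OF j] r(2) unfolding sr(1) by linarith
    have "0 \<le> (\<integral>\<omega>. \<bar>(\<integral>J. inner (R (Vs j \<omega> J)) (Vs j \<omega> J) \<partial>P j) - lrv R\<bar> \<partial>M)"
      by (rule Bochner_Integration.integral_nonneg) simp
    then show ?thesis using le unfolding dist_real_def by linarith
  qed
  then show "\<exists>j0. \<forall>j\<ge>j0. dist (\<integral>\<omega>. \<bar>(\<integral>J. inner (R (Vs j \<omega> J)) (Vs j \<omega> J) \<partial>P j) - lrv R\<bar> \<partial>M) 0 < \<epsilon>" by blast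
qed

end

context boot_setup begin

text \<open>\<open>star_char_bound\<close> holds for each sample with random \<open>\<rho>\<close>
  and \<open>r\<close>, namely the roots of \<open>A\<close> and \<open>B\<close>. Its right side is
  at most quadratic in these roots, so Cauchy-Schwarz and the bounds on the expectations of
  \<open>A\<close> and \<open>B\<close> suffice to integrate it.\<close>

theorem boot_char_tendsto:
  fixes h :: L2
  defines "L \<equiv> lrv (symm h h)"
  shows "(\<lambda>j. \<integral>\<omega>. cmod ((CLINT J|P j. iexp (inner h (Vs j \<omega> J))) - complex_of_real (exp (- L / 2))) \<partial>M) \<longlonglongrightarrow> 0"
proof (rule metric_LIMSEQ_I)
  fix \<epsilon> :: real assume "\<epsilon> > 0"
  let ?H = "norm h"
  have "((\<lambda>r. ?H * r + ?H\<^sup>2 * (2 * (r * sqrt bnd) + r\<^sup>2)) \<longlongrightarrow> ?H * 0 + ?H\<^sup>2 * (2 * (0 * sqrt bnd) + 0\<^sup>2)) (at_right 0)"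
    by (intro tendsto_intros)
  then have "\<forall>\<^sub>F r in at_right 0. ?H * r + ?H\<^sup>2 * (2 * (r * sqrt bnd) + r\<^sup>2) < \<epsilon> / 2"
    by (rule order_tendstoD) (use \<open>\<epsilon> > 0\<close> in simp)
  moreover have "\<forall>\<^sub>F r in at_right (0::real). 0 < r" by (rule eventually_at_right_less)
  ultimately have "\<forall>\<^sub>F r in at_right (0::real). 0 < r \<and> ?H * r + ?H\<^sup>2 * (2 * (r * sqrt bnd) + r\<^sup>2) < \<epsilon> / 2"
    by eventually_elim simp
  then obtain r where r: "0 < r" "?H * r + ?H\<^sup>2 * (2 * (r * sqrt bnd) + r\<^sup>2) < \<epsilon> / 2"
    using eventually_happens'[OF trivial_limit_at_right_real] by blast
  have sr: "sqrt (r\<^sup>2) = r" "0 < r\<^sup>2" using r(1) by auto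
  obtain Z m T where ap: "approximant M Y (r\<^sup>2) Z m T" using approx[OF sr(2)] by blast
  have Z: "Z t \<in> borel_measurable M" "norm (Z t \<omega>) \<le> T" for t \<omega> using ap by (auto simp: approximant_def)
  have T0: "0 \<le> T" using Z(2) norm_ge_zero order_trans by blast
  define \<beta> where "\<beta> j = 2 * ?H * (sqrt (real (b j)) * T) / sqrt (real (k j))" for j
  define \<kappa> where "\<kappa> j = \<beta> j / 6 + (\<beta> j)\<^sup>2 / 8" for j
  define m2 where "m2 j = (\<integral>\<omega>. \<bar>(\<integral>J. (inner h (Vs j \<omega> J))\<^sup>2 \<partial>P j) - L\<bar> \<partial>M)" for j
  have m2: "m2 \<longlonglongrightarrow> 0"
    using boot_quad_tendsto[OF selfadj_symm, of h h] unfolding m2_def L_def by (simp add: inner_symm power2_eq_square)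
  have "(\<lambda>j. 2 * ?H * T * sqrt (real (b j) / real (k j))) \<longlonglongrightarrow> 2 * ?H * T * sqrt 0"
    by (intro tendsto_intros bk)
  then have \<beta>: "\<beta> \<longlonglongrightarrow> 0" unfolding \<beta>_def by (simp add: real_sqrt_divide mult_ac)
  have "(\<lambda>j. \<kappa> j * (?H\<^sup>2 * (2 * r\<^sup>2 + 2 * bnd)) + m2 j) \<longlonglongrightarrow> (0 / 6 + 0\<^sup>2 / 8) * (?H\<^sup>2 * (2 * r\<^sup>2 + 2 * bnd)) + 0"
    unfolding \<kappa>_def by (intro tendsto_intros \<beta> m2) simp_all
  then have "\<forall>\<^sub>F j in sequentially. \<kappa> j * (?H\<^sup>2 * (2 * r\<^sup>2 + 2 * bnd)) + m2 j < \<epsilon> / 2"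
    by (rule order_tendstoD) (use \<open>\<epsilon> > 0\<close> in simp)
  then obtain j0 where j0: "\<And>j. j \<ge> j0 \<Longrightarrow> \<kappa> j * (?H\<^sup>2 * (2 * r\<^sup>2 + 2 * bnd)) + m2 j < \<epsilon> / 2"
    by (auto simp: eventually_sequentially)
  have "dist (\<integral>\<omega>. cmod ((CLINT J|P j. iexp (inner h (Vs j \<omega> J))) - complex_of_real (exp (- L / 2))) \<partial>M) 0 < \<epsilon>"
    if j: "j \<ge> j0" for j
  proof -
    let ?c = "\<lambda>\<omega>. cmod ((CLINT J|P j. iexp (inner h (Vs j \<omega> J))) - complex_of_real (exp (- L / 2)))"
    let ?m = "\<lambda>\<omega>. \<integral>J. (inner h (Vs j \<omega> J))\<^sup>2 \<partial>P j"
    define W where "W = blk (b j) (a j) Z"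
    define A where "A \<omega> = avg (N j) (\<lambda>t. (norm (V j t \<omega> - W t \<omega>))\<^sup>2)" for \<omega>
    define B where "B \<omega> = avg (N j) (\<lambda>t. (norm (V j t \<omega>))\<^sup>2)" for \<omega>
    have sqV: "sq_int M (V j t)" for t by (rule sq_int_blk)
    have sqW: "sq_int M (W t)" for t
      unfolding W_def blk_def[abs_def] by (intro sq_int_sum sq_int_scaleR sq_int_bounded(1)[OF Z])
    have sqVW: "sq_int M (\<lambda>\<omega>. V j t \<omega> - W t \<omega>)" for t by (intro sq_int_diff sqV sqW)
    have boundW: "norm (W t \<omega>) \<le> sqrt (real (b j)) * T" for t \<omega>
      unfolding W_def by (rule blk_bound[OF a _ T0]) (rule Z(2))
    have nn: "0 \<le> A \<omega>" "0 \<le> B \<omega>" for \<omega> unfolding A_def B_def avg_def by (simp_all add: sum_nonneg)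
    have intA: "integrable M A" and intB: "integrable M B"
      unfolding A_def[abs_def] B_def[abs_def] avg_def using sq_intD(2)[OF sqV] sq_intD(2)[OF sqVW]
      by (simp_all add: Bochner_Integration.integrable_sum)
    have [measurable]: "A \<in> borel_measurable M" "B \<in> borel_measurable M" using intA intB by auto
    have EA: "(\<integral>\<omega>. A \<omega> \<partial>M) \<le> r\<^sup>2"
    proof -
      have "(\<integral>\<omega>. A \<omega> \<partial>M) = avg (N j) (\<lambda>t. (rms M (\<lambda>\<omega>. V j t \<omega> - W t \<omega>))\<^sup>2)"
        unfolding A_def rms_power2 using sq_intD(2)[OF sqVW] by (simp add: integral_avg)
      also have "\<dots> \<le> avg (N j) (\<lambda>t. r\<^sup>2)"
      proof (rule avg_mono)
        fix t assume "t \<in> {1..N j}"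
        then have "rms M (\<lambda>\<omega>. V j t \<omega> - W t \<omega>) \<le> sqrt (r\<^sup>2)"
          unfolding W_def using sr(2) by (intro rms_blk_diff_le[OF ap _ a]) auto
        then show "(rms M (\<lambda>\<omega>. V j t \<omega> - W t \<omega>))\<^sup>2 \<le> r\<^sup>2" unfolding sr(1) by (rule power_mono) simp
      qed
      finally show ?thesis by (simp add: avg_const[OF N])
    qed
    have EB: "(\<integral>\<omega>. B \<omega> \<partial>M) \<le> bnd"
    proof -
      have "(\<integral>\<omega>. B \<omega> \<partial>M) = avg (N j) (\<lambda>t. (rms M (V j t))\<^sup>2)"
        unfolding B_def rms_power2 using sq_intD(2)[OF sqV] by (simp add: integral_avg)
      also have "\<dots> \<le> avg (N j) (\<lambda>t. bnd)"
      proof (rule avg_mono)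
        fix t
        have "rms M (V j t) \<le> sqrt bnd" by (rule rms_blk_le[OF a])
        from power_mono[OF this rms_nonneg, of 2] show "(rms M (V j t))\<^sup>2 \<le> bnd" using bnd_nonneg by simp
      qed
      finally show ?thesis by (simp add: avg_const[OF N])
    qed
    have sqA: "sq_int M (\<lambda>\<omega>. sqrt (A \<omega>))" and sqB: "sq_int M (\<lambda>\<omega>. sqrt (B \<omega>))"
      using intA intB nn by (simp_all add: sq_int_def)
    have rA: "rms M (\<lambda>\<omega>. sqrt (A \<omega>)) \<le> r"
      using real_sqrt_le_mono[OF EA] unfolding sr(1) rms_def by (simp add: nn)
    have rB: "rms M (\<lambda>\<omega>. sqrt (B \<omega>)) \<le> sqrt bnd"
      using real_sqrt_le_mono[OF EB] unfolding rms_def by (simp add: nn)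
    have 1: "(\<integral>\<omega>. sqrt (A \<omega>) \<partial>M) \<le> r"
      using integral_norm_le_rms[OF sqA] rA nn by simp
    have 2: "(\<integral>\<omega>. sqrt (A \<omega>) * sqrt (B \<omega>) \<partial>M) \<le> r * sqrt bnd"
    proof -
      have "(\<integral>\<omega>. sqrt (A \<omega>) * sqrt (B \<omega>) \<partial>M) \<le> rms M (\<lambda>\<omega>. sqrt (A \<omega>)) * rms M (\<lambda>\<omega>. sqrt (B \<omega>))"
        using integral_norm_mult_le[OF sqA sqB] nn by simp
      also have "\<dots> \<le> r * sqrt bnd" using rA rB r(1) by (intro mult_mono) auto
      finally show ?thesis .
    qed
    have int2: "integrable M (\<lambda>\<omega>. sqrt (A \<omega>) * sqrt (B \<omega>))" using integrable_inner_sq_int[OF sqA sqB] by simp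
    have \<kappa>0: "0 \<le> \<kappa> j" unfolding \<kappa>_def \<beta>_def using T0 by (intro add_nonneg_nonneg) auto
    have pt: "?c \<omega> \<le> ?H * sqrt (A \<omega>) + \<kappa> j * (?H\<^sup>2 * (2 * A \<omega> + 2 * B \<omega>)) + ?H\<^sup>2 * (2 * (sqrt (A \<omega>) * sqrt (B \<omega>)) + A \<omega>)
        + \<bar>?m \<omega> - L\<bar>" for \<omega>
    proof -
      have "?c \<omega> \<le> ?H * sqrt (A \<omega>) + \<kappa> j * (?H\<^sup>2 * (sqrt (B \<omega>) + sqrt (A \<omega>))\<^sup>2) + ?H\<^sup>2 * (sqrt (A \<omega>) * (2 * sqrt (B \<omega>) + sqrt (A \<omega>)))
        + \<bar>?m \<omega> - L\<bar>"
        unfolding Vs_def \<kappa>_def \<beta>_def A_def B_def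
        by (rule star_char_bound[OF k N _ boundW]) (simp add: L_def lrv_nonneg)
      \<comment> \<open>The square of the sum is made linear in \<open>A\<close> and
        \<open>B\<close>, whose expectations are known.\<close>
      moreover have "\<kappa> j * (?H\<^sup>2 * (sqrt (B \<omega>) + sqrt (A \<omega>))\<^sup>2) \<le> \<kappa> j * (?H\<^sup>2 * (2 * A \<omega> + 2 * B \<omega>))"
      proof (intro mult_left_mono \<kappa>0)
        have "0 \<le> (sqrt (B \<omega>) - sqrt (A \<omega>))\<^sup>2" by simp
        then show "(sqrt (B \<omega>) + sqrt (A \<omega>))\<^sup>2 \<le> 2 * A \<omega> + 2 * B \<omega>"
          using nn[of \<omega>] by (simp add: power2_sum power2_diff)
      qed simp
      moreover have "sqrt (A \<omega>) * (2 * sqrt (B \<omega>) + sqrt (A \<omega>)) = 2 * (sqrt (A \<omega>) * sqrt (B \<omega>)) + A \<omega>"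
        using nn(1)[of \<omega>] by (simp add: distrib_left)
      ultimately show ?thesis by simp
    qed
    have meas_c: "?c \<in> borel_measurable M"
      by (intro borel_measurable_norm[THEN measurable_compose[rotated], unfolded comp_def] borel_measurable_diff measurable_boot_integral measurable_const)
         measurable
    have c_le: "norm (?c \<omega>) \<le> 2" for \<omega>
    proof -
      have "cmod (CLINT J|P j. iexp (inner h (Vs j \<omega> J))) \<le> (\<integral>J. cmod (iexp (inner h (Vs j \<omega> J))) \<partial>P j)"
        by (rule integral_norm_bound)
      also have "\<dots> = 1" by simp
      finally have "cmod (CLINT J|P j. iexp (inner h (Vs j \<omega> J))) \<le> 1" .
      moreover have "cmod (complex_of_real (exp (- L / 2))) \<le> 1" using lrv_nonneg[of h] by (simp add: L_def)
      ultimately show ?thesis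
        using norm_triangle_ineq4[of "CLINT J|P j. iexp (inner h (Vs j \<omega> J))" "complex_of_real (exp (- L / 2))"]
        unfolding real_norm_def abs_norm_cancel by linarith
    qed
    have intc: "integrable M ?c" by (rule integrable_const_bound[of _ 2]) (use c_le meas_c in auto)
    have intm: "integrable M (\<lambda>\<omega>. \<bar>?m \<omega> - L\<bar>)"
    proof -
      have [measurable]: "?m \<in> borel_measurable M" by (rule measurable_boot_integral) measurable
      have "\<bar>?m \<omega>\<bar> \<le> ?H\<^sup>2 * B \<omega>" for \<omega>
      proof -
        have "?m \<omega> \<le> (\<integral>J. ?H\<^sup>2 * (norm (Vs j \<omega> J))\<^sup>2 \<partial>P j)"
        proof (rule integral_mono)
          show "(inner h (Vs j \<omega> J))\<^sup>2 \<le> ?H\<^sup>2 * (norm (Vs j \<omega> J))\<^sup>2" for J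
            using power_mono[OF Cauchy_Schwarz_ineq2[of h "Vs j \<omega> J"] abs_ge_zero, of 2] by (simp add: power_mult_distrib)
        qed (rule integrable_start[OF k N])+
        also have "\<dots> \<le> ?H\<^sup>2 * B \<omega>"
          using rms_star_le[OF k N, where v="\<lambda>t. V j t \<omega>"] unfolding rms_power2 B_def Vs_def by (simp add: mult_left_mono)
        finally show ?thesis by simp
      qed
      then have "integrable M ?m"
        by (intro Bochner_Integration.integrable_bound[OF integrable_mult_right[OF intB, of "?H\<^sup>2"]]) (auto simp: nn)
      then show ?thesis by simp
    qed
    have "(\<integral>\<omega>. ?c \<omega> \<partial>M) \<le> (\<integral>\<omega>. ?H * sqrt (A \<omega>) + \<kappa> j * (?H\<^sup>2 * (2 * A \<omega> + 2 * B \<omega>)) + ?H\<^sup>2 * (2 * (sqrt (A \<omega>) * sqrt (B \<omega>)) + A \<omega>)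
        + \<bar>?m \<omega> - L\<bar> \<partial>M)"
      by (rule integral_mono[OF intc _ pt]) (use intA intB int2 intm integrable_sq_int[OF sqA] in simp)
    also have "\<dots> = ?H * (\<integral>\<omega>. sqrt (A \<omega>) \<partial>M) + \<kappa> j * (?H\<^sup>2 * (2 * (\<integral>\<omega>. A \<omega> \<partial>M) + 2 * (\<integral>\<omega>. B \<omega> \<partial>M)))
        + ?H\<^sup>2 * (2 * (\<integral>\<omega>. sqrt (A \<omega>) * sqrt (B \<omega>) \<partial>M) + (\<integral>\<omega>. A \<omega> \<partial>M)) + m2 j"
      unfolding m2_def using intA intB int2 intm integrable_sq_int[OF sqA] by simp
    also have "\<dots> \<le> ?H * r + \<kappa> j * (?H\<^sup>2 * (2 * r\<^sup>2 + 2 * bnd)) + ?H\<^sup>2 * (2 * (r * sqrt bnd) + r\<^sup>2) + m2 j"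
      using 1 2 EA EB \<kappa>0 by (intro add_mono mult_left_mono order_refl) auto
    also have "\<dots> < \<epsilon>" using j0[OF j] r(2) by linarith
    finally show ?thesis by (simp add: dist_real_def)
  qed
  then show "\<exists>j0. \<forall>j\<ge>j0. dist (\<integral>\<omega>. cmod ((CLINT J|P j. iexp (inner h (Vs j \<omega> J))) - complex_of_real (exp (- L / 2))) \<partial>M) 0 < \<epsilon>" by blast
qed

definition boot_law :: "nat \<Rightarrow> 'a \<Rightarrow> L2 measure" where
  "boot_law j \<omega> = distr (P j) borel (Vs j \<omega>)"

lemma integral_boot_law:
  fixes F :: "L2 \<Rightarrow> 'c::{banach, second_countable_topology}"
  shows "F \<in> borel_measurable borel \<Longrightarrow> (\<integral>x. F x \<partial>boot_law j \<omega>) = (\<integral>J. F (Vs j \<omega> J) \<partial>P j)"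
  unfolding boot_law_def by (rule integral_distr) auto

lemma good_boot_law: "good_law (boot_law j \<omega>)"
  unfolding good_law_def
proof (intro conjI)
  show "prob_space (boot_law j \<omega>)" unfolding boot_law_def by (rule measure_pmf.prob_space_distr) simp
  show "integrable (boot_law j \<omega>) (\<lambda>x. (norm x)\<^sup>2)"
    unfolding boot_law_def by (subst integrable_distr_eq) (auto intro: integrable_start[OF k N])
qed (simp add: boot_law_def)

end

lemma (in prob_space) integral_cos_sin:
  assumes [measurable]: "f \<in> borel_measurable M"
  shows "(\<integral>x. cos (f x) \<partial>M) = Re (CLINT x|M. iexp (f x))" "(\<integral>x. sin (f x) \<partial>M) = Im (CLINT x|M. iexp (f x))"
proof -
  have int: "complex_integrable M (\<lambda>x. iexp (f x))" by (rule integrable_const_bound[of _ 1]) auto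
  show "(\<integral>x. cos (f x) \<partial>M) = Re (CLINT x|M. iexp (f x))" using integral_Re[OF int] by (simp add: Re_exp)
  show "(\<integral>x. sin (f x) \<partial>M) = Im (CLINT x|M. iexp (f x))" using integral_Im[OF int] by (simp add: Im_exp)
qed

section \<open>The Gaussian limit law and the limit of the normalised mean\<close>

locale weak_dep_basis = weak_dep M Y \<nu> + L2_basis e for M :: "'a measure" and Y \<nu> e
begin

text \<open>Algebraic identities for \<open>lrv\<close> are inherited from exact identities for the
  second moments of \<open>S n\<close> by uniqueness of limits, which avoids manipulating the series
  over lags.\<close>

lemma lrv_eqI:
  assumes "selfadj R" "\<And>n. (\<integral>\<omega>. inner (R (S n \<omega>)) (S n \<omega>) \<partial>M) = g n" "g \<longlonglongrightarrow> l"
  shows "lrv R = l"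
  using S_quad_tendsto[OF assms(1)] assms(3) unfolding assms(2) by (rule LIMSEQ_unique)

lemma int_SS: "integrable M (\<lambda>\<omega>. inner u (S n \<omega>) * inner v (S n \<omega>))"
  using integrable_inner_sq_int[OF sq_int_bounded_linear[OF bounded_linear_inner_right sq_int_S]
      sq_int_bounded_linear[OF bounded_linear_inner_right sq_int_S], of u n v n] by simp

lemma symm_tendsto: "(\<lambda>n. \<integral>\<omega>. inner u (S n \<omega>) * inner v (S n \<omega>) \<partial>M) \<longlonglongrightarrow> lrv (symm u v)"
  using S_quad_tendsto[OF selfadj_symm, of u v] by (simp add: inner_symm)

lemma quad_form_lrv:
  "quad_form r a (\<lambda>i l. lrv (symm (e i) (e l))) = lrv (symm (\<Sum>i<r. a i *\<^sub>R e i) (\<Sum>i<r. a i *\<^sub>R e i))"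
proof (rule lrv_eqI[OF selfadj_symm, symmetric])
  let ?h = "\<Sum>i<r. a i *\<^sub>R e i"
  fix n
  have "inner (symm ?h ?h x) x = (\<Sum>i<r. \<Sum>l<r. a i * a l * (inner (e i) x * inner (e l) x))" for x
    unfolding inner_symm by (simp add: inner_sum_left sum_product mult_ac)
  then show "(\<integral>\<omega>. inner (symm ?h ?h (S n \<omega>)) (S n \<omega>) \<partial>M)
      = (\<Sum>i<r. \<Sum>l<r. a i * a l * (\<integral>\<omega>. inner (e i) (S n \<omega>) * inner (e l) (S n \<omega>) \<partial>M))"
    using int_SS by (simp add: Bochner_Integration.integrable_sum)
next
  show "(\<lambda>n. \<Sum>i<r. \<Sum>l<r. a i * a l * (\<integral>\<omega>. inner (e i) (S n \<omega>) * inner (e l) (S n \<omega>) \<partial>M))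
      \<longlonglongrightarrow> quad_form r a (\<lambda>i l. lrv (symm (e i) (e l)))"
    unfolding quad_form_def by (intro tendsto_intros symm_tendsto)
qed

lemma psd_lrv: "psd (\<lambda>i l. lrv (symm (e i) (e l)))"
  unfolding psd_def
proof (intro conjI allI)
  show "lrv (symm (e i) (e l)) = lrv (symm (e l) (e i))" for i l
    by (rule lrv_eqI[OF selfadj_symm _ symm_tendsto]) (simp add: inner_symm mult.commute)
  show "0 \<le> quad_form r a (\<lambda>i l. lrv (symm (e i) (e l)))" for r a
    unfolding quad_form_lrv by (rule lrv_nonneg)
qed

text \<open>The difference between the total and a partial trace is the long-run variance for the
  projection residual. It is bounded by \<open>mass\<close> times the root mean square of the
  residual of \<open>Y 0\<close>, which vanishes by dominated convergence. So the limit covariance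
  is trace class and its trace is the limit of the second moments of the norm.\<close>

lemma trace_lrv: "(\<lambda>i. lrv (symm (e i) (e i))) sums lrv (\<lambda>x. x)"
proof -
  let ?R = "\<lambda>r x. x - proj r x"
  have adj: "selfadj (?R r)" for r
    unfolding selfadj_def
    by (intro conjI allI bounded_linear_sub bounded_linear_ident bounded_linear_proj)
       (simp add: inner_diff_left inner_diff_right proj_selfadjoint)
  have rest: "lrv (?R r) = lrv (\<lambda>x. x) - (\<Sum>i<r. lrv (symm (e i) (e i)))" for r
  proof (rule lrv_eqI[OF adj])
    fix n
    have "inner (?R r x) x = inner x x - (\<Sum>i<r. inner (e i) x * inner (e i) x)" for x
      unfolding inner_diff_left inner_proj_left by (simp add: inner_commute)
    then show "(\<integral>\<omega>. inner (?R r (S n \<omega>)) (S n \<omega>) \<partial>M)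
        = (\<integral>\<omega>. inner (S n \<omega>) (S n \<omega>) \<partial>M) - (\<Sum>i<r. \<integral>\<omega>. inner (e i) (S n \<omega>) * inner (e i) (S n \<omega>) \<partial>M)"
      using int_SS integrable_inner_sq_int[OF sq_int_S sq_int_S] by (simp add: Bochner_Integration.integrable_sum)
  next
    show "(\<lambda>n. (\<integral>\<omega>. inner (S n \<omega>) (S n \<omega>) \<partial>M) - (\<Sum>i<r. \<integral>\<omega>. inner (e i) (S n \<omega>) * inner (e i) (S n \<omega>) \<partial>M))
        \<longlonglongrightarrow> lrv (\<lambda>x. x) - (\<Sum>i<r. lrv (symm (e i) (e i)))"
      using S_quad_tendsto[OF selfadj_ident] by (intro tendsto_intros symm_tendsto)
  qed
  have bound: "\<bar>lrv (?R r)\<bar> \<le> mass * rms M (\<lambda>\<omega>. Y 0 \<omega> - proj r (Y 0 \<omega>))" for r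
  proof (rule tendsto_upperbound[OF tendsto_rabs[OF S_quad_tendsto[OF adj]]])
    show "\<forall>\<^sub>F n in sequentially. \<bar>\<integral>\<omega>. inner (?R r (S n \<omega>)) (S n \<omega>) \<partial>M\<bar> \<le> mass * rms M (\<lambda>\<omega>. Y 0 \<omega> - proj r (Y 0 \<omega>))"
      using eventually_gt_at_top[of 0]
    proof eventually_elim
      case (elim n)
      have "(\<Sum>t=1..n. (1 / sqrt (real n))\<^sup>2) = 1" using elim by (simp add: power_divide)
      then show ?case
        using quad_weighted_le[OF adj[of r], of "{1..n}" "\<lambda>_. 1 / sqrt (real n)" 0] unfolding S_def by simp
    qed
  qed simp
  have "(\<lambda>r. rms M (\<lambda>\<omega>. Y 0 \<omega> - proj r (Y 0 \<omega>))) \<longlonglongrightarrow> 0"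
  proof -
    have [measurable]: "proj r \<in> borel_measurable borel" for r by (rule borel_measurable_bounded_linear[OF bounded_linear_proj])
    have "(\<lambda>r. \<integral>\<omega>. (norm (Y 0 \<omega> - proj r (Y 0 \<omega>)))\<^sup>2 \<partial>M) \<longlonglongrightarrow> (\<integral>\<omega>. 0 \<partial>M)"
    proof (rule integral_dominated_convergence[where w="\<lambda>\<omega>. (norm (Y 0 \<omega>))\<^sup>2"])
      show "AE \<omega> in M. (\<lambda>r. (norm (Y 0 \<omega> - proj r (Y 0 \<omega>)))\<^sup>2) \<longlonglongrightarrow> 0"
      proof (rule AE_I2)
        fix \<omega>
        show "(\<lambda>r. (norm (Y 0 \<omega> - proj r (Y 0 \<omega>)))\<^sup>2) \<longlonglongrightarrow> 0"
          using tendsto_power[OF tendsto_norm[OF tendsto_diff[OF tendsto_const proj_tendsto]], of "Y 0 \<omega>" "Y 0 \<omega>" 2] by simp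
      qed
      show "AE \<omega> in M. norm ((norm (Y 0 \<omega> - proj r (Y 0 \<omega>)))\<^sup>2) \<le> (norm (Y 0 \<omega>))\<^sup>2" for r
      proof (rule AE_I2)
        fix \<omega>
        have "0 \<le> (\<Sum>i<r. (inner (Y 0 \<omega>) (e i))\<^sup>2)" by (intro sum_nonneg) simp
        then have "(norm (Y 0 \<omega> - proj r (Y 0 \<omega>)))\<^sup>2 \<le> (norm (Y 0 \<omega>))\<^sup>2" using norm_diff_proj[of "Y 0 \<omega>" r] by linarith
        then show "norm ((norm (Y 0 \<omega> - proj r (Y 0 \<omega>)))\<^sup>2) \<le> (norm (Y 0 \<omega>))\<^sup>2" by simp
      qed
      show "integrable M (\<lambda>\<omega>. (norm (Y 0 \<omega>))\<^sup>2)" by (rule sq_intD(2)[OF sq])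
      have [measurable]: "Y 0 \<in> borel_measurable M" by (rule sq_intD(1)[OF sq])
      show "(\<lambda>\<omega>. (norm (Y 0 \<omega> - proj r (Y 0 \<omega>)))\<^sup>2) \<in> borel_measurable M" for r by measurable
    qed simp
    from tendsto_real_sqrt[OF this] show ?thesis by (simp add: rms_def)
  qed
  from tendsto_mult_left[OF this, of mass]
  have lim0: "(\<lambda>r. mass * rms M (\<lambda>\<omega>. Y 0 \<omega> - proj r (Y 0 \<omega>))) \<longlonglongrightarrow> 0" by simp
  have "(\<lambda>r. lrv (?R r)) \<longlonglongrightarrow> 0"
  proof (rule Lim_null_comparison[OF _ lim0])
    show "\<forall>\<^sub>F r in sequentially. norm (lrv (?R r)) \<le> mass * rms M (\<lambda>\<omega>. Y 0 \<omega> - proj r (Y 0 \<omega>))"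
      by (rule always_eventually, rule allI, subst real_norm_def, rule bound)
  qed
  then have "(\<lambda>r. lrv (\<lambda>x. x) - lrv (?R r)) \<longlonglongrightarrow> lrv (\<lambda>x. x) - 0" by (rule tendsto_diff[OF tendsto_const])
  then show ?thesis unfolding rest sums_def by (simp only: diff_diff_eq2 add_diff_cancel_left' diff_zero)
qed

text \<open>Records the values of all test integrals of the limit; only these are used from here
  on.\<close>

definition is_limit_law :: "L2 measure \<Rightarrow> bool" where
  "is_limit_law Q \<longleftrightarrow> good_law Q \<and> (\<forall>i l. second_moment Q i l = lrv (symm (e i) (e l))) \<and> total_moment Q = lrv (\<lambda>x. x) \<and>
     (\<forall>h\<in>rat_span. (CLINT x|Q. iexp (inner h x)) = complex_of_real (exp (- lrv (symm h h) / 2)))"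

lemma limit_law_exists: "\<exists>Q. is_limit_law Q"
proof -
  obtain Q where Q: "good_law Q" "\<And>i l. second_moment Q i l = lrv (symm (e i) (e l))"
    "\<And>r a. (CLINT x|Q. iexp (\<Sum>i<r. a i * inner x (e i))) = complex_of_real (exp (- quad_form r a (\<lambda>i l. lrv (symm (e i) (e l))) / 2))"
    by (rule gaussian_law_exists[OF psd_lrv sums_summable[OF trace_lrv]]) (rule that)
  have "total_moment Q = lrv (\<lambda>x. x)"
    using second_moment_sums[OF Q(1)] trace_lrv unfolding Q(2) by (rule sums_unique2)
  moreover have "(CLINT x|Q. iexp (inner h x)) = complex_of_real (exp (- lrv (symm h h) / 2))" if h: "h \<in> rat_span" for h
  proof -
    obtain r where r: "proj r h = h" using rat_span_finite_expansion[OF h] by blast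
    have "(\<Sum>i<r. inner h (e i) * inner x (e i)) = inner h x" for x
      using inner_proj_left[of r h x] r by simp
    moreover have "(\<Sum>i<r. inner h (e i) *\<^sub>R e i) = h" using r by (simp add: proj_def)
    ultimately show ?thesis using Q(3)[of "\<lambda>i. inner h (e i)" r] unfolding quad_form_lrv by simp
  qed
  ultimately show ?thesis using Q(1,2) unfolding is_limit_law_def by blast
qed

definition S_law :: "nat \<Rightarrow> L2 measure" where
  "S_law n = distr M borel (S n)"

lemma good_S_law: "good_law (S_law n)"
proof -
  have [measurable]: "S n \<in> borel_measurable M" by (rule sq_intD(1)[OF sq_int_S])
  have "integrable (S_law n) (\<lambda>x. (norm x)\<^sup>2)"
    unfolding S_law_def using sq_intD(2)[OF sq_int_S[of n]] by (subst integrable_distr_eq) auto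
  then show ?thesis unfolding good_law_def S_law_def by (simp add: prob_space_distr)
qed

theorem S_law_tendsto:
  assumes Q: "is_limit_law Q"
  shows "conv_tests S_law Q"
  unfolding conv_tests_def
proof (intro conjI allI ballI good_S_law)
  have meas [measurable]: "S n \<in> borel_measurable M" for n by (rule sq_intD(1)[OF sq_int_S])
  note Q' = Q[unfolded is_limit_law_def]
  show good: "good_law Q" using Q' by blast
  interpret Q: prob_space Q using good by (rule good_lawD)
  have id: "(\<lambda>x. inner h x) \<in> borel_measurable Q" for h by (rule good_law_borel[OF good]) simp
  have int: "(\<integral>x. F x \<partial>S_law n) = (\<integral>\<omega>. F (S n \<omega>) \<partial>M)" if "F \<in> borel_measurable borel"
    for F :: "L2 \<Rightarrow> real" and n
    unfolding S_law_def using that by (intro integral_distr) auto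
  fix F assume F: "F \<in> tests"
  from F show "(\<lambda>m. \<integral>x. F x \<partial>S_law m) \<longlonglongrightarrow> (\<integral>x. F x \<partial>Q)"
  proof cases
    case (cos h)
    have "(CLINT x|Q. iexp (inner h x)) = complex_of_real (exp (- lrv (symm h h) / 2))" using Q' cos by blast
    then show ?thesis unfolding int[OF borel_tests[OF F]] unfolding cos using tendsto_Re[OF S_char_tendsto[of h]]
      by (simp add: integral_cos_sin Q.integral_cos_sin id)
  next
    case (sin h)
    have "(CLINT x|Q. iexp (inner h x)) = complex_of_real (exp (- lrv (symm h h) / 2))" using Q' sin by blast
    then show ?thesis unfolding int[OF borel_tests[OF F]] unfolding sin using tendsto_Im[OF S_char_tendsto[of h]]
      by (simp add: integral_cos_sin Q.integral_cos_sin id)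
  next
    case (prod i l)
    have "(\<integral>x. inner x (e i) * inner x (e l) \<partial>Q) = lrv (symm (e i) (e l))" using Q' by (simp add: second_moment_def)
    then show ?thesis unfolding int[OF borel_tests[OF F]] unfolding prod using symm_tendsto[of "e i" "e l"] by (simp add: inner_commute)
  next
    case sq_norm
    have "(\<integral>x. (norm x)\<^sup>2 \<partial>Q) = lrv (\<lambda>x. x)" using Q' by (simp add: total_moment_def)
    then show ?thesis unfolding int[OF borel_tests[OF F]] unfolding sq_norm using S_quad_tendsto[OF selfadj_ident] by (simp add: power2_norm_eq_inner)
  qed
qed

end

locale boot_basis = boot_setup M Y \<nu> a b k N + weak_dep_basis M Y \<nu> e
  for M :: "'a measure" and Y \<nu> a b k N e
begin

text \<open>Trigonometric tests are real and imaginary parts of characteristic functions; the other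
  tests are quadratic forms of self-adjoint operators.\<close>

theorem boot_law_tests:
  assumes Q: "is_limit_law Q" and F: "F \<in> tests"
  shows "integrable M (\<lambda>\<omega>. \<integral>x. F x \<partial>boot_law j \<omega>)"
    and "(\<lambda>j. \<integral>\<omega>. \<bar>(\<integral>x. F x \<partial>boot_law j \<omega>) - (\<integral>x. F x \<partial>Q)\<bar> \<partial>M) \<longlonglongrightarrow> 0"
proof -
  have [measurable]: "F \<in> borel_measurable borel" by (rule borel_tests[OF F])
  have eq: "(\<integral>x. F x \<partial>boot_law j \<omega>) = (\<integral>J. F (Vs j \<omega> J) \<partial>P j)" for j \<omega> by (rule integral_boot_law) simp
  have intB: "integrable M (\<lambda>\<omega>. 1 + avg (N j) (\<lambda>t. (norm (V j t \<omega>))\<^sup>2))" for j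
    unfolding avg_def using sq_intD(2)[OF sq_int_blk] by (simp add: Bochner_Integration.integrable_sum)
  show int: "integrable M (\<lambda>\<omega>. \<integral>x. F x \<partial>boot_law j \<omega>)" for j
    unfolding eq
  proof (rule Bochner_Integration.integrable_bound[OF intB])
    show "(\<lambda>\<omega>. \<integral>J. F (Vs j \<omega> J) \<partial>P j) \<in> borel_measurable M" by (rule measurable_boot_integral) simp
    show "AE \<omega> in M. norm (\<integral>J. F (Vs j \<omega> J) \<partial>P j) \<le> norm (1 + avg (N j) (\<lambda>t. (norm (V j t \<omega>))\<^sup>2))"
    proof (rule AE_I2)
      fix \<omega>
      have "\<bar>\<integral>J. F (Vs j \<omega> J) \<partial>P j\<bar> \<le> (\<integral>J. \<bar>F (Vs j \<omega> J)\<bar> \<partial>P j)" by (rule integral_abs_bound)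
      also have "\<dots> \<le> (\<integral>J. 1 + (norm (Vs j \<omega> J))\<^sup>2 \<partial>P j)"
        by (intro integral_mono integrable_start[OF k N] tests_bound F)
      also have "\<dots> = 1 + (\<integral>J. (norm (Vs j \<omega> J))\<^sup>2 \<partial>P j)"
        using integrable_start[OF k N, where F="\<lambda>J. (norm (Vs j \<omega> J))\<^sup>2"] by simp
      also have "\<dots> \<le> 1 + avg (N j) (\<lambda>t. (norm (V j t \<omega>))\<^sup>2)"
        using rms_star_le[OF k N, where v="\<lambda>t. V j t \<omega>"] unfolding rms_power2 Vs_def by simp
      finally show "norm (\<integral>J. F (Vs j \<omega> J) \<partial>P j) \<le> norm (1 + avg (N j) (\<lambda>t. (norm (V j t \<omega>))\<^sup>2))" by simp
    qed
  qed
  note Q' = Q[unfolded is_limit_law_def]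
  have good: "good_law Q" using Q' by blast
  interpret Q: prob_space Q using good by (rule good_lawD)
  have id: "(\<lambda>x. inner h x) \<in> borel_measurable Q" for h by (rule good_law_borel[OF good]) simp
  have charQ: "(CLINT x|Q. iexp (inner h x)) = complex_of_real (exp (- lrv (symm h h) / 2))" if "h \<in> rat_span" for h
    using Q' that by blast
  have char_int: "integrable M (\<lambda>\<omega>. cmod ((CLINT J|P j. iexp (inner h (Vs j \<omega> J))) - c))" for j h c
  proof -
    have m: "(\<lambda>\<omega>. CLINT J|P j. iexp (inner h (Vs j \<omega> J))) \<in> borel_measurable M"
      by (rule measurable_boot_integral[of "\<lambda>x. iexp (inner h x)"]) measurable
    show ?thesis
    proof (rule integrable_const_bound[of _ "1 + cmod c"])
      show "AE \<omega> in M. norm (cmod ((CLINT J|P j. iexp (inner h (Vs j \<omega> J))) - c)) \<le> 1 + cmod c"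
      proof (rule AE_I2)
        fix \<omega>
        have "cmod (CLINT J|P j. iexp (inner h (Vs j \<omega> J))) \<le> (\<integral>J. cmod (iexp (inner h (Vs j \<omega> J))) \<partial>P j)"
          by (rule integral_norm_bound)
        then have "cmod (CLINT J|P j. iexp (inner h (Vs j \<omega> J))) \<le> 1" by simp
        then show "norm (cmod ((CLINT J|P j. iexp (inner h (Vs j \<omega> J))) - c)) \<le> 1 + cmod c"
          using norm_triangle_ineq4[of "CLINT J|P j. iexp (inner h (Vs j \<omega> J))" c] by simp
      qed
    qed (use m in measurable)
  qed
  have sandwich: "(\<lambda>j. \<integral>\<omega>. \<bar>f j \<omega>\<bar> \<partial>M) \<longlonglongrightarrow> 0"
    if "\<And>j \<omega>. \<bar>f j \<omega>\<bar> \<le> g j \<omega>" "(\<lambda>j. \<integral>\<omega>. g j \<omega> \<partial>M) \<longlonglongrightarrow> 0" "\<And>j. integrable M (f j)" "\<And>j. integrable M (g j)"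
    for f g :: "nat \<Rightarrow> 'a \<Rightarrow> real"
  proof (rule Lim_null_comparison[OF _ that(2)])
    show "\<forall>\<^sub>F j in sequentially. norm (\<integral>\<omega>. \<bar>f j \<omega>\<bar> \<partial>M) \<le> (\<integral>\<omega>. g j \<omega> \<partial>M)"
    proof (rule always_eventually, rule allI)
      fix j
      have "(\<integral>\<omega>. \<bar>f j \<omega>\<bar> \<partial>M) \<le> (\<integral>\<omega>. g j \<omega> \<partial>M)" by (intro integral_mono integrable_abs that)
      then show "norm (\<integral>\<omega>. \<bar>f j \<omega>\<bar> \<partial>M) \<le> (\<integral>\<omega>. g j \<omega> \<partial>M)" by simp
    qed
  qed
  from F show "(\<lambda>j. \<integral>\<omega>. \<bar>(\<integral>x. F x \<partial>boot_law j \<omega>) - (\<integral>x. F x \<partial>Q)\<bar> \<partial>M) \<longlonglongrightarrow> 0"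
  proof cases
    case (cos h)
    show ?thesis
    proof (rule sandwich[OF _ boot_char_tendsto[of h]])
      fix j \<omega>
      have "(\<integral>x. F x \<partial>boot_law j \<omega>) - (\<integral>x. F x \<partial>Q) = Re ((CLINT J|P j. iexp (inner h (Vs j \<omega> J))) - complex_of_real (exp (- lrv (symm h h) / 2)))"
        unfolding eq unfolding cos(1) charQ[OF cos(2), symmetric] by (simp add: measure_pmf.integral_cos_sin Q.integral_cos_sin id)
      then show "\<bar>(\<integral>x. F x \<partial>boot_law j \<omega>) - (\<integral>x. F x \<partial>Q)\<bar> \<le> cmod ((CLINT J|P j. iexp (inner h (Vs j \<omega> J))) - complex_of_real (exp (- lrv (symm h h) / 2)))"
        using abs_Re_le_cmod by metis
    qed (use int char_int in auto)
  next
    case (sin h)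
    show ?thesis
    proof (rule sandwich[OF _ boot_char_tendsto[of h]])
      fix j \<omega>
      have "(\<integral>x. F x \<partial>boot_law j \<omega>) - (\<integral>x. F x \<partial>Q) = Im ((CLINT J|P j. iexp (inner h (Vs j \<omega> J))) - complex_of_real (exp (- lrv (symm h h) / 2)))"
        unfolding eq unfolding sin(1) charQ[OF sin(2), symmetric] by (simp add: measure_pmf.integral_cos_sin Q.integral_cos_sin id)
      then show "\<bar>(\<integral>x. F x \<partial>boot_law j \<omega>) - (\<integral>x. F x \<partial>Q)\<bar> \<le> cmod ((CLINT J|P j. iexp (inner h (Vs j \<omega> J))) - complex_of_real (exp (- lrv (symm h h) / 2)))"
        using abs_Im_le_cmod by metis
    qed (use int char_int in auto)
  next
    case (prod i l)
    have Qeq: "(\<integral>x. F x \<partial>Q) = lrv (symm (e i) (e l))" using Q' unfolding prod by (simp add: second_moment_def)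
    have F2: "inner (symm (e i) (e l) x) x = F x" for x unfolding inner_symm prod by (simp add: inner_commute)
    show ?thesis unfolding eq Qeq using boot_quad_tendsto[OF selfadj_symm, of "e i" "e l"] unfolding F2 .
  next
    case sq_norm
    have "(\<integral>x. (norm x)\<^sup>2 \<partial>Q) = lrv (\<lambda>x. x)" using Q' by (simp add: total_moment_def)
    then show ?thesis unfolding eq unfolding sq_norm using boot_quad_tendsto[OF selfadj_ident] by (simp add: power2_norm_eq_inner)
  qed
qed

end

section \<open>Identification of the conditional laws\<close>

text \<open>\<open>Z\<close> is a function of the data and of a choice \<open>R\<close> independent
  of them with finitely many values. Splitting by the value of \<open>R\<close> and using
  independence of each event from the data verifies the defining property of conditional expectation
  for the average over \<open>p\<close> with the data frozen.\<close>

lemma (in prob_space) cond_law_finite_choice: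
  fixes p :: "'b pmf" and g :: "'b \<Rightarrow> 'a \<Rightarrow> 'c::topological_space"
  assumes sub: "subalgebra M F" and fin: "finite (set_pmf p)"
    and R: "\<And>J. J \<in> set_pmf p \<Longrightarrow> {\<omega> \<in> space M. R \<omega> = J} \<in> events"
    and ind: "\<And>J B. J \<in> set_pmf p \<Longrightarrow> B \<in> sets F \<Longrightarrow> prob ({\<omega> \<in> space M. R \<omega> = J} \<inter> B) = pmf p J * prob B"
    and g: "\<And>J. J \<in> set_pmf p \<Longrightarrow> g J \<in> borel_measurable F"
    and Z: "Z \<in> borel_measurable M" "\<And>\<omega>. \<omega> \<in> space M \<Longrightarrow> Z \<omega> = g (R \<omega>) \<omega>"
    and A: "A \<in> sets borel"
  shows "AE \<omega> in M. real_cond_exp M F (indicator (Z -` A \<inter> space M)) \<omega> = measure (distr (measure_pmf p) borel (\<lambda>J. g J \<omega>)) A"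
proof -
  interpret F: finite_measure_subalgebra M F by unfold_locales (rule sub)
  have spF: "space F = space M" and setsF: "sets F \<subseteq> events" using sub by (auto simp: subalgebra_def)
  let ?E = "\<lambda>J. {\<omega> \<in> space M. R \<omega> = J}"
  define h where "h \<omega> = (\<Sum>J\<in>set_pmf p. indicator A (g J \<omega>) * pmf p J)" for \<omega>
  have h: "measure (distr (measure_pmf p) borel (\<lambda>J. g J \<omega>)) A = h \<omega>" for \<omega>
  proof -
    have "measure (distr (measure_pmf p) borel (\<lambda>J. g J \<omega>)) A = measure (measure_pmf p) ((\<lambda>J. g J \<omega>) -` A)"
      using A by (subst measure_distr) auto
    also have "\<dots> = (\<integral>J. indicator ((\<lambda>J. g J \<omega>) -` A) J \<partial>measure_pmf p)" by simp
    also have "\<dots> = (\<integral>J. indicator A (g J \<omega>) \<partial>measure_pmf p)" by (simp add: indicator_def)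
    also have "\<dots> = h \<omega>" unfolding h_def by (rule integral_measure_pmf_real[OF fin])
    finally show ?thesis .
  qed
  have gA: "{\<omega> \<in> space M. g J \<omega> \<in> A} \<in> sets F" if "J \<in> set_pmf p" for J
    using measurable_sets[OF g[OF that] A] unfolding spF vimage_def Int_def by (simp add: conj_commute)
  have meas_h: "h \<in> borel_measurable F"
    unfolding h_def
  proof (intro borel_measurable_sum borel_measurable_times borel_measurable_const)
    fix J assume "J \<in> set_pmf p"
    then show "(\<lambda>\<omega>. indicator A (g J \<omega>)) \<in> borel_measurable F"
      by (intro measurable_compose[OF g] borel_measurable_indicator A)
  qed
  have int_h: "integrable M h"
  proof (rule integrable_const_bound[of _ "\<Sum>J\<in>set_pmf p. pmf p J"])
    have "\<bar>h \<omega>\<bar> \<le> (\<Sum>J\<in>set_pmf p. pmf p J)" for \<omega>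
      unfolding h_def by (rule order_trans[OF sum_abs]) (auto intro!: sum_mono simp: abs_mult indicator_def)
    then show "AE \<omega> in M. norm (h \<omega>) \<le> (\<Sum>J\<in>set_pmf p. pmf p J)" by simp
  qed (rule measurable_from_subalg[OF sub meas_h])
  have ZA: "Z -` A \<inter> space M \<in> events" by (rule measurable_sets[OF Z(1) A])
  \<comment> \<open>Independence from the whole space gives each value its probability; these add up
    to one, so \<open>R\<close> lies in the support almost surely.\<close>
  have "prob (\<Union>J\<in>set_pmf p. ?E J) = (\<Sum>J\<in>set_pmf p. prob (?E J))"
    by (rule finite_measure_finite_Union[OF fin]) (use R in \<open>auto simp: disjoint_family_on_def\<close>)
  also have "\<dots> = (\<Sum>J\<in>set_pmf p. pmf p J)"
  proof (rule sum.cong[OF refl])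
    fix J assume J: "J \<in> set_pmf p"
    have "space M \<in> sets F" using sets.top[of F] by (simp add: spF)
    from ind[OF J this] show "prob (?E J) = pmf p J" by (simp add: Int_absorb2 subset_iff prob_space)
  qed
  also have "\<dots> = 1" by (rule sum_pmf_eq_1[OF fin]) simp
  finally have one: "prob (\<Union>J\<in>set_pmf p. ?E J) = 1" .
  have ae: "AE \<omega> in M. \<omega> \<in> (\<Union>J\<in>set_pmf p. ?E J)"
    by (rule AE_prob_1[OF one])
  show ?thesis
    unfolding h
  proof (rule F.real_cond_exp_charact)
    fix B assume B: "B \<in> sets F"
    have BM: "B \<in> events" using B setsF by blast
    have int: "integrable M (\<lambda>\<omega>. indicator (?E J \<inter> ({\<omega> \<in> space M. g J \<omega> \<in> A} \<inter> B)) \<omega> :: real)" if "J \<in> set_pmf p" for J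
      using R[OF that] gA[OF that] setsF BM by (intro integrable_real_indicator) (auto simp: emeasure_eq_measure)
    have "(\<integral>\<omega>\<in>B. indicator (Z -` A \<inter> space M) \<omega> \<partial>M :: real) = (\<integral>\<omega>. (\<Sum>J\<in>set_pmf p. indicator (?E J \<inter> ({\<omega> \<in> space M. g J \<omega> \<in> A} \<inter> B)) \<omega>) \<partial>M)"
      unfolding set_lebesgue_integral_def
    proof (rule integral_cong_AE)
      show "(\<lambda>\<omega>. indicator B \<omega> *\<^sub>R (indicator (Z -` A \<inter> space M) \<omega> :: real)) \<in> borel_measurable M"
        using BM ZA by (intro borel_measurable_scaleR borel_measurable_indicator)
      show "(\<lambda>\<omega>. (\<Sum>J\<in>set_pmf p. indicator (?E J \<inter> ({\<omega> \<in> space M. g J \<omega> \<in> A} \<inter> B)) \<omega> :: real)) \<in> borel_measurable M"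
        using int by (intro borel_measurable_sum) (auto dest: borel_measurable_integrable)
      show "AE \<omega> in M. indicator B \<omega> *\<^sub>R (indicator (Z -` A \<inter> space M) \<omega> :: real)
          = (\<Sum>J\<in>set_pmf p. indicator (?E J \<inter> ({\<omega> \<in> space M. g J \<omega> \<in> A} \<inter> B)) \<omega> :: real)"
        using ae AE_space
      proof eventually_elim
        case (elim \<omega>)
        then have "R \<omega> \<in> set_pmf p" by auto
        have "(\<Sum>J\<in>set_pmf p. indicator (?E J \<inter> ({\<omega> \<in> space M. g J \<omega> \<in> A} \<inter> B)) \<omega> :: real)
            = (\<Sum>J\<in>set_pmf p. if J = R \<omega> then indicator B \<omega> *\<^sub>R indicator A (g J \<omega>) else 0)"
          using elim(2) by (intro sum.cong refl) (auto simp: indicator_def)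
        also have "\<dots> = indicator B \<omega> *\<^sub>R indicator A (Z \<omega>)"
          using \<open>R \<omega> \<in> set_pmf p\<close> fin Z(2)[OF elim(2)] by simp
        finally show ?case using elim(2) by (simp add: indicator_def)
      qed
    qed
    also have "\<dots> = (\<Sum>J\<in>set_pmf p. prob (?E J \<inter> ({\<omega> \<in> space M. g J \<omega> \<in> A} \<inter> B)))"
    proof (subst Bochner_Integration.integral_sum)
      show "(\<Sum>J\<in>set_pmf p. \<integral>\<omega>. indicator (?E J \<inter> ({\<omega> \<in> space M. g J \<omega> \<in> A} \<inter> B)) \<omega> \<partial>M)
          = (\<Sum>J\<in>set_pmf p. prob (?E J \<inter> ({\<omega> \<in> space M. g J \<omega> \<in> A} \<inter> B)))"
        by (intro sum.cong refl) (simp add: Int_absorb2 subset_iff)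
    qed (rule int)
    also have "\<dots> = (\<Sum>J\<in>set_pmf p. pmf p J * prob ({\<omega> \<in> space M. g J \<omega> \<in> A} \<inter> B))"
      by (intro sum.cong refl ind sets.Int gA B)
    also have "\<dots> = (\<Sum>J\<in>set_pmf p. \<integral>\<omega>. pmf p J * indicator ({\<omega> \<in> space M. g J \<omega> \<in> A} \<inter> B) \<omega> \<partial>M)"
      by (intro sum.cong refl) (simp add: Int_absorb2 subset_iff)
    also have "\<dots> = (\<integral>\<omega>. (\<Sum>J\<in>set_pmf p. pmf p J * indicator ({\<omega> \<in> space M. g J \<omega> \<in> A} \<inter> B) \<omega>) \<partial>M)"
    proof (rule Bochner_Integration.integral_sum[symmetric])
      fix J assume "J \<in> set_pmf p"
      then show "integrable M (\<lambda>\<omega>. pmf p J * indicator ({\<omega> \<in> space M. g J \<omega> \<in> A} \<inter> B) \<omega>)"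
        using gA[of J] setsF BM by (intro integrable_mult_right integrable_real_indicator) (auto simp: emeasure_eq_measure)
    qed
    also have "\<dots> = (\<integral>\<omega>\<in>B. h \<omega> \<partial>M)"
      unfolding set_lebesgue_integral_def
    proof (rule Bochner_Integration.integral_cong[OF refl])
      fix \<omega> assume "\<omega> \<in> space M"
      then show "(\<Sum>J\<in>set_pmf p. pmf p J * indicator ({\<omega> \<in> space M. g J \<omega> \<in> A} \<inter> B) \<omega>) = indicator B \<omega> *\<^sub>R h \<omega>"
        unfolding h_def scaleR_sum_right by (intro sum.cong refl) (auto simp: indicator_def)
    qed
    finally show "(\<integral>\<omega>\<in>B. indicator (Z -` A \<inter> space M) \<omega> \<partial>M) = (\<integral>\<omega>\<in>B. h \<omega> \<partial>M)" .
  next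
    show "integrable M (indicator (Z -` A \<inter> space M) :: 'a \<Rightarrow> real)"
      using ZA by (intro integrable_real_indicator) (auto simp: emeasure_eq_measure)
  qed (fact int_h meas_h)+
qed

lemma borel_countable_generator:
  "\<exists>E :: 'b::second_countable_topology set set. countable E \<and> Int_stable E \<and> UNIV \<in> E \<and> sets borel = sigma_sets UNIV E"
proof -
  obtain B :: "'b set set" where B: "countable B" "topological_basis B" using ex_countable_basis by blast
  define E where "E = Inter ` {S. finite S \<and> S \<subseteq> B}"
  have "open X" if "X \<in> E" for X
  proof -
    obtain S where S: "X = \<Inter>S" "finite S" "S \<subseteq> B" using \<open>X \<in> E\<close> unfolding E_def by blast
    show ?thesis unfolding S(1) by (rule open_Inter[OF S(2)]) (use S(3) topological_basis_open[OF B(2)] in blast)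
  qed
  then have sub: "E \<subseteq> sets borel" by (auto intro: borel_open)
  have BE: "B \<subseteq> E"
  proof
    fix X assume "X \<in> B"
    then show "X \<in> E" unfolding E_def by (intro image_eqI[of _ _ "{X}"]) auto
  qed
  have "sets borel = sigma_sets UNIV B"
    unfolding borel_eq_countable_basis[OF B] by (rule sets_measure_of) simp
  also have "\<dots> \<subseteq> sigma_sets UNIV E" by (rule sigma_sets_mono') (rule BE)
  finally have "sets borel = sigma_sets UNIV E"
    using sets.sigma_sets_subset[OF sub] by auto
  moreover have "Int_stable E"
  proof (rule Int_stableI)
    fix X Y assume "X \<in> E" "Y \<in> E"
    then obtain S T where S: "X = \<Inter>S" "finite S" "S \<subseteq> B" and T: "Y = \<Inter>T" "finite T" "T \<subseteq> B"
      unfolding E_def by blast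
    show "X \<inter> Y \<in> E" unfolding E_def S(1) T(1) by (intro image_eqI[of _ _ "S \<union> T"]) (use S T in auto)
  qed
  moreover have "UNIV \<in> E" unfolding E_def by (intro image_eqI[of _ _ "{}"]) auto
  moreover have "countable E" unfolding E_def by (intro countable_image countable_Collect_finite_subset B(1))
  ultimately show ?thesis by blast
qed

text \<open>The hypothesis has a separate null set for each Borel set. A countable generator closed
  under intersections allows the union of these null sets, and it determines a probability
  measure.\<close>

lemma AE_eq_measureI:
  fixes K H :: "'a \<Rightarrow> 'b::second_countable_topology measure"
  assumes K: "\<And>\<omega>. \<omega> \<in> space M \<Longrightarrow> K \<omega> \<in> space (prob_algebra borel)"
    and H: "\<And>\<omega>. \<omega> \<in> space M \<Longrightarrow> H \<omega> \<in> space (prob_algebra borel)"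
    and eq: "\<And>A. A \<in> sets borel \<Longrightarrow> AE \<omega> in M. measure (K \<omega>) A = measure (H \<omega>) A"
  shows "AE \<omega> in M. K \<omega> = H \<omega>"
proof -
  obtain E :: "'b set set" where E: "countable E" "Int_stable E" "UNIV \<in> E" "sets borel = sigma_sets UNIV E"
    using borel_countable_generator by blast
  have "AE \<omega> in M. \<forall>A\<in>E. measure (K \<omega>) A = measure (H \<omega>) A"
    by (subst AE_ball_countable[OF E(1)]) (use eq E(4) in \<open>auto intro: sigma_sets.Basic\<close>)
  then show ?thesis using AE_space
  proof eventually_elim
    case (elim \<omega>)
    interpret K: prob_space "K \<omega>" using K[OF elim(2)] by (simp add: space_prob_algebra)
    interpret H: prob_space "H \<omega>" using H[OF elim(2)] by (simp add: space_prob_algebra)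
    show ?case
    proof (rule measure_eqI_generator_eq[where \<Omega>=UNIV and E=E and A="\<lambda>_. UNIV"])
      show "emeasure (K \<omega>) X = emeasure (H \<omega>) X" if "X \<in> E" for X
        using elim(1) that by (simp add: K.emeasure_eq_measure H.emeasure_eq_measure)
    qed (use E K[OF elim(2)] H[OF elim(2)] in \<open>auto simp: space_prob_algebra\<close>)
  qed
qed

section \<open>The starting points as an independent finite choice\<close>

lemma start_support: "0 < N \<Longrightarrow> J \<in> set_pmf (start_pmf k N) \<Longrightarrow> J \<in> PiE {1..k} (\<lambda>_. {1..N})"
  unfolding start_pmf_def by (subst (asm) set_Pi_pmf) (auto simp: PiE_dflt_def PiE_def extensional_def)

definition start :: "nat \<Rightarrow> (nat \<Rightarrow> 'a \<Rightarrow> nat) \<Rightarrow> 'a \<Rightarrow> nat \<Rightarrow> nat" where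
  "start k I \<omega> = (\<lambda>i\<in>{1..k}. I i \<omega>)"

text \<open>The bootstrap mean with the starting points frozen at \<open>J\<close>, hence a function
  of the data alone.\<close>

definition resample_mean ::
  "(real \<Rightarrow> real) \<Rightarrow> nat \<Rightarrow> nat \<Rightarrow> (int \<Rightarrow> 'a \<Rightarrow> L2) \<Rightarrow> (nat \<Rightarrow> nat) \<Rightarrow> 'a \<Rightarrow> L2" where
  "resample_mean w n b Y J \<omega> = sample_mean n (tbb_sample w n b (sample Y n \<omega>) J)"

lemma measurable_sample: "sample Y n \<in> measurable (data_algebra M Y n) (PiM {1..n} (\<lambda>_. borel))"
  unfolding data_algebra_def by (rule measurable_vimage_algebra1) (auto simp: sample_def space_PiM)

lemma measurable_sample_component: "(\<lambda>\<omega>. sample Y n \<omega> t) \<in> borel_measurable (data_algebra M Y n)"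
proof (cases "t \<in> {1..n}")
  case True
  from measurable_compose[OF measurable_sample measurable_component_singleton[OF True]] show ?thesis .
next
  \<comment> \<open>Outside \<open>{1..n}\<close> the sample is the constant
    \<open>undefined\<close>, which is measurable as well; so positions need not be checked in
    \<open>measurable_resample_mean\<close>.\<close>
  case False
  then have "sample Y n \<omega> t = undefined" for \<omega> by (simp add: sample_def del: atLeastAtMost_iff)
  then show ?thesis by simp
qed

lemma measurable_resample_mean: "resample_mean w n b Y J \<in> borel_measurable (data_algebra M Y n)"
  unfolding resample_mean_def[abs_def] sample_mean_def tbb_sample_def tbb_block_def
  by (intro borel_measurable_scaleR borel_measurable_const borel_measurable_sum borel_measurable_diff measurable_sample_component)

lemma subalgebra_data:
  assumes "\<And>t. Y t \<in> borel_measurable M"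
  shows "subalgebra M (data_algebra M Y n)"
proof -
  have "sample Y n \<in> measurable M (PiM {1..n} (\<lambda>_. borel))"
    unfolding sample_def[abs_def] by (intro measurable_restrict assms)
  then show ?thesis
    unfolding subalgebra_def data_algebra_def by (auto simp: sets_vimage_algebra2 sample_def space_PiM dest: measurable_sets)
qed

lemma block_index:
  fixes n k b s :: nat
  assumes "n = k * b" "1 \<le> b" "s \<in> {1..n}"
  shows "(s - 1) div b + 1 \<in> {1..k}"
proof -
  have "1 \<le> s" "s \<le> k * b" using assms by auto
  then have "s - 1 < k * b" by linarith
  then have "(s - 1) div b < k" by (simp add: less_mult_imp_div_less)
  then show ?thesis by simp
qed

lemma tbb_mean_eq_resample_mean:
  assumes "n = k * b" "1 \<le> b"
  shows "tbb_mean w n b Y I \<omega> = resample_mean w n b Y (start k I \<omega>) \<omega>"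
  unfolding tbb_mean_def resample_mean_def sample_mean_def tbb_sample_def start_def
  using block_index[OF assms] by (intro arg_cong[where f="\<lambda>x. _ *\<^sub>R x"] sum.cong refl) simp

context prob_space begin

context
  fixes Y :: "int \<Rightarrow> 'a \<Rightarrow> L2" and n b k :: nat and I :: "nat \<Rightarrow> 'a \<Rightarrow> nat"
  assumes ind: "tbb_indices M Y n b k I" and k: "0 < k" and Y: "\<And>t. Y t \<in> borel_measurable M"
begin

lemma measurable_start: "start k I \<in> measurable M (count_space (PiE {1..k} (\<lambda>_. UNIV)))"
proof -
  have "indep_vars (\<lambda>_. count_space UNIV) I {1..k}" using ind by (simp add: tbb_indices_def)
  then have I: "I i \<in> measurable M (count_space UNIV)" if "i \<in> {1..k}" for i
    using that by (auto simp: indep_vars_def)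
  have "start k I \<in> measurable M (PiM {1..k} (\<lambda>_. count_space UNIV))"
    unfolding start_def[abs_def] by (intro measurable_restrict I)
  then show ?thesis by (simp add: count_space_PiM_finite)
qed

lemma start_event: "J \<in> PiE {1..k} (\<lambda>_. UNIV) \<Longrightarrow> {\<omega> \<in> space M. start k I \<omega> = J} \<in> events"
  using measurable_sets[OF measurable_start, of "{J}"] by (simp add: vimage_def Int_def conj_commute)

lemma prob_start:
  assumes J: "J \<in> PiE {1..k} (\<lambda>_. UNIV)"
  shows "prob {\<omega> \<in> space M. start k I \<omega> = J} = pmf (start_pmf k (n - b + 1)) J"
proof -
  have iv: "indep_vars (\<lambda>_. count_space UNIV) I {1..k}"
    and law: "\<And>i. i \<in> {1..k} \<Longrightarrow> distr M (count_space UNIV) (I i) = measure_pmf (pmf_of_set {1..n - b + 1})"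
    using ind by (simp_all add: tbb_indices_def)
  have I: "I i \<in> measurable M (count_space UNIV)" if "i \<in> {1..k}" for i using iv that by (auto simp: indep_vars_def)
  have "{\<omega> \<in> space M. start k I \<omega> = J} = (\<Inter>i\<in>{1..k}. I i -` {J i} \<inter> space M)"
    using k J by (auto simp: start_def PiE_def extensional_def fun_eq_iff)
  also have "prob \<dots> = (\<Prod>i\<in>{1..k}. prob (I i -` {J i} \<inter> space M))"
    by (rule indep_varsD_finite[OF iv]) (use k in auto)
  also have "\<dots> = (\<Prod>i\<in>{1..k}. pmf (pmf_of_set {1..n - b + 1}) (J i))"
  proof (rule prod.cong[OF refl])
    fix i assume i: "i \<in> {1..k}"
    have "prob (I i -` {J i} \<inter> space M) = measure (distr M (count_space UNIV) (I i)) {J i}"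
      using I[OF i] by (subst measure_distr) auto
    also have "\<dots> = pmf (pmf_of_set {1..n - b + 1}) (J i)" unfolding law[OF i] by (simp add: measure_pmf_single)
    finally show "prob (I i -` {J i} \<inter> space M) = pmf (pmf_of_set {1..n - b + 1}) (J i)" .
  qed
  also have "\<dots> = pmf (start_pmf k (n - b + 1)) J"
    using J unfolding start_pmf_def by (subst pmf_Pi) (auto simp: PiE_def extensional_def)
  finally show ?thesis .
qed

lemma prob_start_Int:
  assumes J: "J \<in> PiE {1..k} (\<lambda>_. UNIV)" and B: "B \<in> sets (data_algebra M Y n)"
  shows "prob ({\<omega> \<in> space M. start k I \<omega> = J} \<inter> B) = pmf (start_pmf k (n - b + 1)) J * prob B"
proof -
  let ?V = "vimage_algebra (space M) (start k I) (PiM {1..k} (\<lambda>_. count_space UNIV))"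
  have "start k I -` {J} \<inter> space M \<in> sets ?V"
    by (rule in_vimage_algebra) (use J in \<open>simp add: count_space_PiM_finite\<close>)
  then have "{\<omega> \<in> space M. start k I \<omega> = J} \<in> sets ?V" by (simp add: vimage_def Int_def conj_commute)
  moreover have "indep_set (sets (data_algebra M Y n)) (sets ?V)"
    using ind unfolding tbb_indices_def start_def[abs_def] by blast
  ultimately have "prob (B \<inter> {\<omega> \<in> space M. start k I \<omega> = J}) = prob B * prob {\<omega> \<in> space M. start k I \<omega> = J}"
    using B by (intro indep_setD)
  then show ?thesis unfolding prob_start[OF J] by (simp add: Int_commute mult.commute)
qed

text \<open>Identifies any version of a conditional law with an explicit finite mixture.
  \<open>Z\<close> may depend on the data beyond the block values, as needed for centring by the
  conditional mean.\<close>

lemma cond_law_start: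
  assumes K: "is_cond_law M (data_algebra M Y n) Z K"
    and g: "\<And>J. g J \<in> borel_measurable (data_algebra M Y n)"
    and Z: "\<And>\<omega>. Z \<omega> = g (start k I \<omega>) \<omega>"
  shows "AE \<omega> in M. K \<omega> = distr (measure_pmf (start_pmf k (n - b + 1))) borel (\<lambda>J. g J \<omega>)"
proof (rule AE_eq_measureI)
  let ?p = "start_pmf k (n - b + 1)"
  note sub = subalgebra_data[where n=n, OF Y]
  have sp: "space (data_algebra M Y n) = space M" using sub by (simp add: subalgebra_def)
  show "K \<omega> \<in> space (prob_algebra borel)" if "\<omega> \<in> space M" for \<omega>
    using K that unfolding is_cond_law_def by (auto simp: sp dest: measurable_space)
  show "distr (measure_pmf ?p) borel (\<lambda>J. g J \<omega>) \<in> space (prob_algebra borel)" for \<omega>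
    by (simp add: space_prob_algebra measure_pmf.prob_space_distr)
  have supp: "J \<in> PiE {1..k} (\<lambda>_. UNIV)" if "J \<in> set_pmf ?p" for J using start_support[OF _ that] by (auto simp: PiE_def)
  have Zm: "Z \<in> borel_measurable M"
    unfolding Z[abs_def]
    \<comment> \<open>The starting points take countably many values, so \<open>Z\<close> is
      measurable piece by piece.\<close>
    by (rule measurable_compose_countable'[OF measurable_from_subalg[OF sub g] measurable_start]) (simp add: countable_PiE)
  show "AE \<omega> in M. measure (K \<omega>) A = measure (distr (measure_pmf ?p) borel (\<lambda>J. g J \<omega>)) A" if A: "A \<in> sets borel" for A
  proof -
    have "AE \<omega> in M. measure (K \<omega>) A = real_cond_exp M (data_algebra M Y n) (indicator (Z -` A \<inter> space M)) \<omega>"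
      using K A unfolding is_cond_law_def by blast
    moreover have "AE \<omega> in M. real_cond_exp M (data_algebra M Y n) (indicator (Z -` A \<inter> space M)) \<omega>
        = measure (distr (measure_pmf ?p) borel (\<lambda>J. g J \<omega>)) A"
    proof (rule cond_law_finite_choice[where g=g and R="start k I", OF sub])
      show "finite (set_pmf ?p)" by (rule finite_start_pmf[OF k]) simp
    qed (use start_event prob_start_Int supp g Zm Z A in auto)
    ultimately show ?thesis by eventually_elim simp
  qed
qed

end

end

section \<open>The bootstrap mean as a sum of block values\<close>

lemma sum_over_blocks:
  fixes h :: "nat \<Rightarrow> nat \<Rightarrow> 'c::comm_monoid_add"
  assumes "1 \<le> b"
  shows "(\<Sum>s=1..k * b. h ((s - 1) div b + 1) ((s - 1) mod b + 1)) = (\<Sum>i=1..k. \<Sum>r=1..b. h i r)"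
  unfolding sum.cartesian_product
proof (rule sum.reindex_bij_witness[of _ "\<lambda>(i, r). (i - 1) * b + r" "\<lambda>s. ((s - 1) div b + 1, (s - 1) mod b + 1)"])
  fix s assume s: "s \<in> {1..k * b}"
  show "(case ((s - 1) div b + 1, (s - 1) mod b + 1) of (i, r) \<Rightarrow> (i - 1) * b + r) = s"
    using s div_mult_mod_eq[of "s - 1" b] by simp
  have "(s - 1) mod b < b" using assms by simp
  then show "((s - 1) div b + 1, (s - 1) mod b + 1) \<in> {1..k} \<times> {1..b}"
    using block_index[OF refl assms s] by simp
next
  fix x assume "x \<in> {1..k} \<times> {1..b}"
  then obtain i r where x: "x = (i, r)" and i: "1 \<le> i" "i \<le> k" and r: "1 \<le> r" "r \<le> b" by auto
  obtain q where q: "r = Suc q" using r by (cases r) auto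
  then have "q < b" using r by simp
  then have "((i - 1) * b + q) div b = i - 1" "((i - 1) * b + q) mod b = q" by simp_all
  then show "(((case x of (i, r) \<Rightarrow> (i - 1) * b + r) - 1) div b + 1, ((case x of (i, r) \<Rightarrow> (i - 1) * b + r) - 1) mod b + 1) = x"
    using i unfolding x q by simp
  have "(i - 1) * b + r \<le> (i - 1) * b + b" using r by simp
  also have "\<dots> = i * b" using i by (cases i) auto
  also have "\<dots> \<le> k * b" using i by simp
  finally show "(case x of (i, r) \<Rightarrow> (i - 1) * b + r) \<in> {1..k * b}" unfolding x using r by simp
qed simp

context
  fixes n b k :: nat and w :: "real \<Rightarrow> real" and Y :: "int \<Rightarrow> 'a \<Rightarrow> L2" and \<omega> :: 'a
  assumes n: "n = k * b" and b: "1 \<le> b" and k: "0 < k"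
begin

private abbreviation "N \<equiv> n - b + 1"
private abbreviation "p \<equiv> start_pmf k N"
private definition "v t = blk b (taper_weights w b) (\<lambda>t. Y (int t)) t \<omega>"
text \<open>The effect of centring by the sample mean on one block. It is the same for every
  starting point.\<close>

private definition "c = (\<Sum>r=1..b. taper_weights w b r) *\<^sub>R Y_mean Y n \<omega>"

private lemma bn: "b \<le> n"
  using n k by (cases k) auto

private lemma block_sum:
  assumes t: "t \<in> {1..N}"
  shows "(\<Sum>r=1..b. tbb_block w b (\<lambda>t. sample Y n \<omega> t - sample_mean n (sample Y n \<omega>)) t r) = sqrt (real b) *\<^sub>R (v t - c)"
proof -
  have "(\<Sum>r=1..b. tbb_block w b (\<lambda>t. sample Y n \<omega> t - sample_mean n (sample Y n \<omega>)) t r)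
      = (\<Sum>r=1..b. sqrt (real b) *\<^sub>R (taper_weights w b r *\<^sub>R (Y (int (t - 1 + r)) \<omega> - Y_mean Y n \<omega>)))"
  proof (rule sum.cong[OF refl])
    fix r assume r: "r \<in> {1..b}"
    have "t + r - 1 = t - 1 + r" using t by auto
    moreover have "t - 1 + r \<in> {1..n}" using t r bn by auto
    ultimately show "tbb_block w b (\<lambda>t. sample Y n \<omega> t - sample_mean n (sample Y n \<omega>)) t r
        = sqrt (real b) *\<^sub>R (taper_weights w b r *\<^sub>R (Y (int (t - 1 + r)) \<omega> - Y_mean Y n \<omega>))"
      unfolding tbb_block_def Y_mean_def[symmetric] by (simp add: sample_def taper_weights_def mult.commute del: of_nat_add of_nat_diff)
  qed
  also have "\<dots> = sqrt (real b) *\<^sub>R (v t - c)"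
    unfolding v_def c_def blk_def scaleR_sum_left by (simp only: scaleR_diff_right sum_subtractf scaleR_sum_right)
  finally show ?thesis .
qed

private lemma resample_mean_eq:
  assumes J: "\<And>i. i \<in> {1..k} \<Longrightarrow> J i \<in> {1..N}"
  shows "resample_mean w n b Y J \<omega> = (sqrt (real b) / real n) *\<^sub>R (\<Sum>i=1..k. v (J i) - c)"
proof -
  have "resample_mean w n b Y J \<omega>
      = (1 / real n) *\<^sub>R (\<Sum>i=1..k. \<Sum>r=1..b. tbb_block w b (\<lambda>t. sample Y n \<omega> t - sample_mean n (sample Y n \<omega>)) (J i) r)"
    unfolding resample_mean_def sample_mean_def[of n "tbb_sample w n b (sample Y n \<omega>) J"] tbb_sample_def
    unfolding n by (subst sum_over_blocks[OF b]) simp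
  also have "(\<Sum>i=1..k. \<Sum>r=1..b. tbb_block w b (\<lambda>t. sample Y n \<omega> t - sample_mean n (sample Y n \<omega>)) (J i) r)
      = (\<Sum>i=1..k. sqrt (real b) *\<^sub>R (v (J i) - c))"
    by (intro sum.cong refl block_sum J)
  finally show ?thesis by (simp add: scaleR_sum_right)
qed

text \<open>The constant \<open>c\<close> cancels against the one in the conditional mean, and
  \<open>n = k * b\<close> turns \<open>sqrt n * sqrt b / n\<close> into
  \<open>1 / sqrt k\<close>.\<close>

private lemma resample_mean_centred:
  assumes J: "J \<in> set_pmf p" and E: "E = (\<integral>J. resample_mean w n b Y J \<omega> \<partial>measure_pmf p)"
  shows "sqrt (real n) *\<^sub>R (resample_mean w n b Y J \<omega> - E) = star k N v J"
proof -
  have N: "0 < N" by simp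
  have in_N: "J i \<in> {1..N}" if "J \<in> set_pmf p" "i \<in> {1..k}" for J i
    using start_support[OF N that(1)] that(2) by (rule PiE_mem)
  have "E = (\<integral>J. (sqrt (real b) / real n) *\<^sub>R (\<Sum>i=1..k. v (J i) - c) \<partial>measure_pmf p)"
    unfolding E by (rule integral_cong_AE) (use resample_mean_eq in_N in \<open>auto simp: AE_measure_pmf_iff\<close>)
  also have "\<dots> = (sqrt (real b) / real n) *\<^sub>R (\<Sum>i=1..k. \<integral>J. v (J i) - c \<partial>measure_pmf p)"
    by (subst integral_scaleR_right, subst Bochner_Integration.integral_sum) (rule integrable_start[OF k N], rule refl)
  also have "(\<Sum>i=1..k. \<integral>J. v (J i) - c \<partial>measure_pmf p) = (\<Sum>i=1..k. avg N v - c)"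
  proof (rule sum.cong[OF refl])
    fix i assume "i \<in> {1..k}"
    from integral_start_component[OF k N this, where F="\<lambda>t. v t - c"]
    show "(\<integral>J. v (J i) - c \<partial>measure_pmf p) = avg N v - c" unfolding avg_diff avg_const[OF N] .
  qed
  finally have E': "E = (sqrt (real b) / real n) *\<^sub>R (\<Sum>i=1..k. avg N v - c)" .
  have R: "resample_mean w n b Y J \<omega> = (sqrt (real b) / real n) *\<^sub>R (\<Sum>i=1..k. v (J i) - c)"
    by (rule resample_mean_eq, rule in_N[OF J])
  have "resample_mean w n b Y J \<omega> - E = (sqrt (real b) / real n) *\<^sub>R (\<Sum>i=1..k. v (J i) - avg N v)"
    unfolding R unfolding E' by (simp only: scaleR_diff_right[symmetric] sum_subtractf[symmetric] diff_diff_eq2 diff_add_cancel)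
  moreover have "sqrt (real n) * (sqrt (real b) / real n) = 1 / sqrt (real k)"
    using b k unfolding n by (simp add: real_sqrt_mult field_simps)
  ultimately show ?thesis unfolding star_def by (simp add: scaleR_sum_right)
qed

text \<open>Both claims of the theorem are brought to the single law \<open>Q\<close>: the centred
  and scaled bootstrap mean has law \<open>Q\<close>, and its scaled covariance operator is the
  second moment operator of \<open>Q\<close>.\<close>

lemma resampled_laws:
  assumes K: "K = distr (measure_pmf p) borel (\<lambda>J. resample_mean w n b Y J \<omega>)"
  defines "Q \<equiv> distr (measure_pmf p) borel (star k N (\<lambda>t. blk b (taper_weights w b) (\<lambda>t. Y (int t)) t \<omega>))"
  shows "distr (measure_pmf p) borel (\<lambda>J. sqrt (real n) *\<^sub>R (resample_mean w n b Y J \<omega> - law_mean K)) = Q"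
    and "real n *\<^sub>R op_expectation K (\<lambda>x. tensor (x - law_mean K) (x - law_mean K)) h = op_expectation Q (\<lambda>x. tensor x x) h"
proof -
  have m: "law_mean K = (\<integral>J. resample_mean w n b Y J \<omega> \<partial>measure_pmf p)"
    unfolding law_mean_def K by (rule integral_distr) auto
  note eq = resample_mean_centred[OF _ m]
  show Q: "distr (measure_pmf p) borel (\<lambda>J. sqrt (real n) *\<^sub>R (resample_mean w n b Y J \<omega> - law_mean K)) = Q"
    unfolding Q_def v_def[symmetric, abs_def] by (rule distr_cong_AE) (use eq in \<open>auto simp: AE_measure_pmf_iff\<close>)
  let ?d = "\<lambda>J. resample_mean w n b Y J \<omega> - law_mean K"
  have "op_expectation Q (\<lambda>x. tensor x x) h = (\<integral>J. inner (sqrt (real n) *\<^sub>R ?d J) h *\<^sub>R (sqrt (real n) *\<^sub>R ?d J) \<partial>measure_pmf p)"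
    unfolding op_expectation_def tensor_def Q[symmetric] by (rule integral_distr) auto
  also have "\<dots> = real n *\<^sub>R (\<integral>J. inner (?d J) h *\<^sub>R ?d J \<partial>measure_pmf p)"
  proof -
    have "inner (sqrt (real n) *\<^sub>R x) h *\<^sub>R (sqrt (real n) *\<^sub>R x) = real n *\<^sub>R (inner x h *\<^sub>R x)" for x
      by (simp add: mult_ac)
    then show ?thesis by (simp only:) (rule integral_scaleR_right)
  qed
  also have "(\<integral>J. inner (?d J) h *\<^sub>R ?d J \<partial>measure_pmf p) = op_expectation K (\<lambda>x. tensor (x - law_mean K) (x - law_mean K)) h"
    unfolding op_expectation_def tensor_def
  proof -
    have "(\<lambda>x. inner (x - law_mean K) h *\<^sub>R (x - law_mean K)) \<in> borel_measurable borel" by simp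
    then have "(\<integral>x. inner (x - law_mean K) h *\<^sub>R (x - law_mean K) \<partial>distr (measure_pmf p) borel (\<lambda>J. resample_mean w n b Y J \<omega>))
        = (\<integral>J. inner (?d J) h *\<^sub>R ?d J \<partial>measure_pmf p)"
      by (intro integral_distr) auto
    then show "(\<integral>J. inner (?d J) h *\<^sub>R ?d J \<partial>measure_pmf p) = (\<integral>x. inner (x - law_mean K) h *\<^sub>R (x - law_mean K) \<partial>K)"
      unfolding K[symmetric] by simp
  qed
  finally show "real n *\<^sub>R op_expectation K (\<lambda>x. tensor (x - law_mean K) (x - law_mean K)) h = op_expectation Q (\<lambda>x. tensor x x) h" ..
qed

end

section \<open>From limits of explicit laws to the two claims\<close>

lemma tendsto_0_in_prob_cong_AE:
  assumes M: "prob_space M" and X: "tendsto_0_in_prob M X"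
    and eq: "\<forall>\<^sub>F j in sequentially. AE \<omega> in M. X' j \<omega> = X j \<omega>"
  shows "tendsto_0_in_prob M X'"
  unfolding tendsto_0_in_prob_def
proof (intro allI impI)
  fix \<epsilon> :: real assume "\<epsilon> > 0"
  obtain A where A: "\<And>j. A j \<in> sets M" "\<And>j. {\<omega> \<in> space M. \<bar>X j \<omega>\<bar> > \<epsilon>} \<subseteq> A j" "(\<lambda>j. measure M (A j)) \<longlonglongrightarrow> 0"
    using X \<open>\<epsilon> > 0\<close> unfolding tendsto_0_in_prob_def by meson
  obtain j0 where "\<And>j. j \<ge> j0 \<Longrightarrow> AE \<omega> in M. X' j \<omega> = X j \<omega>" using eq unfolding eventually_sequentially by blast
  then have "\<forall>j. \<exists>Z. j \<ge> j0 \<longrightarrow> Z \<in> null_sets M \<and> {\<omega> \<in> space M. X' j \<omega> \<noteq> X j \<omega>} \<subseteq> Z"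
    by (auto elim!: AE_E2 simp: eventually_ae_filter)
  then obtain Z where Z: "\<And>j. j \<ge> j0 \<Longrightarrow> Z j \<in> null_sets M" "\<And>j. j \<ge> j0 \<Longrightarrow> {\<omega> \<in> space M. X' j \<omega> \<noteq> X j \<omega>} \<subseteq> Z j"
    by metis
  define A' where "A' j = (if j \<ge> j0 then A j \<union> Z j else space M)" for j
  have "A' j \<in> sets M" for j using A(1)[of j] Z(1)[of j] by (auto simp: A'_def)
  moreover have "\<omega> \<in> A' j" if \<omega>: "\<omega> \<in> space M" "\<bar>X' j \<omega>\<bar> > \<epsilon>" for j \<omega>
  proof (cases "j \<ge> j0 \<and> X' j \<omega> = X j \<omega>")
    case True
    then have "\<omega> \<in> A j" using A(2)[of j] \<omega> by auto
    then show ?thesis using \<omega>(1) by (simp add: A'_def)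
  next
    case False
    then show ?thesis using Z(2)[of j] \<omega>(1) by (auto simp: A'_def)
  qed
  moreover have "(\<lambda>j. measure M (A' j)) \<longlonglongrightarrow> 0"
  proof (rule Lim_transform_eventually[OF A(3)])
    show "\<forall>\<^sub>F j in sequentially. measure M (A j) = measure M (A' j)"
      using eventually_ge_at_top[of j0] by eventually_elim (use A(1) Z(1) in \<open>simp add: A'_def measure_Un_null_set\<close>)
  qed
  ultimately show "\<exists>A. (\<forall>j. A j \<in> sets M \<and> {\<omega> \<in> space M. \<bar>X' j \<omega>\<bar> > \<epsilon>} \<subseteq> A j) \<and> (\<lambda>j. measure M (A j)) \<longlonglongrightarrow> 0"
    by (intro exI[of _ A'] conjI allI) auto
qed

context boot_basis begin

lemma S_law_subseq: "is_limit_law Q \<Longrightarrow> filterlim n at_top sequentially \<Longrightarrow> conv_tests (\<lambda>j. S_law (n j)) Q"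
  using S_law_tendsto[of Q] unfolding conv_tests_def by (auto intro: filterlim_compose)

text \<open>Both laws are compared with the common limit \<open>Q\<close> through the triangle
  inequality; \<open>tests_transfer\<close> supplies the reindexing \<open>r\<close>, along which
  the law of the mean still converges.\<close>

theorem boot_law_dist_tendsto:
  assumes d: "metrizes_weak_convergence d" and n: "filterlim n at_top sequentially"
  shows "tendsto_0_in_prob M (\<lambda>j \<omega>. d (boot_law j \<omega>) (S_law (n j)))"
proof -
  obtain Q where Q: "is_limit_law Q" using limit_law_exists ..
  have good: "good_law Q" using Q unfolding is_limit_law_def by blast
  interpret D: Metric_space "space (prob_algebra borel)" d using d by (simp add: metrizes_weak_convergence_def)
  have lim: "(\<lambda>m. d (\<mu> m) Q) \<longlonglongrightarrow> 0" if c: "conv_tests \<mu> Q" for \<mu>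
  proof -
    have "\<forall>m. \<mu> m \<in> space (prob_algebra borel)" using c good_lawD(5) unfolding conv_tests_def by blast
    then show ?thesis
      using d conv_tests_imp_weak_conv[OF c] good_lawD(5)[OF good] unfolding metrizes_weak_convergence_def by blast
  qed
  show ?thesis
  proof (rule tests_transfer[OF prob_space_axioms good good_boot_law boot_law_tests(1)[OF Q] boot_law_tests(2)[OF Q]])
    fix r :: "nat \<Rightarrow> nat" and \<mu> assume r: "filterlim r at_top sequentially" and \<mu>: "conv_tests \<mu> Q"
    have "(\<lambda>m. d (\<mu> m) Q + d (S_law (n (r m))) Q) \<longlonglongrightarrow> 0 + 0"
      by (intro tendsto_add lim \<mu> S_law_subseq[OF Q] filterlim_compose[OF n r])
    then have sum: "(\<lambda>m. d (\<mu> m) Q + d (S_law (n (r m))) Q) \<longlonglongrightarrow> 0" by simp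
    show "(\<lambda>m. d (\<mu> m) (S_law (n (r m)))) \<longlonglongrightarrow> 0"
    proof (rule Lim_null_comparison[OF _ sum], rule always_eventually, rule allI)
      fix m
      have in_space: "\<mu> m \<in> space (prob_algebra borel)" "Q \<in> space (prob_algebra borel)"
        "S_law (n (r m)) \<in> space (prob_algebra borel)"
        using \<mu> good good_S_law good_lawD(5) unfolding conv_tests_def by blast+
      show "norm (d (\<mu> m) (S_law (n (r m)))) \<le> d (\<mu> m) Q + d (S_law (n (r m))) Q"
        using D.triangle[OF in_space] D.commute[of Q "S_law (n (r m))"] D.nonneg[of "\<mu> m" "S_law (n (r m))"] by simp
    qed
  qed
qed

theorem boot_law_hs_tendsto:
  assumes n: "filterlim n at_top sequentially"
  shows "tendsto_0_in_prob M (\<lambda>j \<omega>. hs_norm e (\<lambda>h. op_expectation (boot_law j \<omega>) (\<lambda>x. tensor x x) h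
    - op_expectation (S_law (n j)) (\<lambda>x. tensor x x) h))"
proof -
  obtain Q where Q: "is_limit_law Q" using limit_law_exists ..
  have good: "good_law Q" using Q unfolding is_limit_law_def by blast
  show ?thesis
  proof (rule tests_transfer[OF prob_space_axioms good good_boot_law boot_law_tests(1)[OF Q] boot_law_tests(2)[OF Q],
      where G="\<lambda>j \<mu>. hs_norm e (\<lambda>h. op_expectation \<mu> (\<lambda>x. tensor x x) h - op_expectation (S_law (n j)) (\<lambda>x. tensor x x) h)"])
    fix r :: "nat \<Rightarrow> nat" and \<mu> assume r: "filterlim r at_top sequentially" and \<mu>: "conv_tests \<mu> Q"
    show "(\<lambda>m. hs_norm e (\<lambda>h. op_expectation (\<mu> m) (\<lambda>x. tensor x x) h - op_expectation (S_law (n (r m))) (\<lambda>x. tensor x x) h)) \<longlonglongrightarrow> 0"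
      by (rule hs_norm_tendsto[OF \<mu> S_law_subseq[OF Q filterlim_compose[OF n r]]])
  qed
qed

end

text \<open>With \<open>n = k * b\<close>, the quotient \<open>b\<^sup>2 / n\<close> is
  \<open>b / k\<close>. Since \<open>b < n\<close> forces \<open>k \<ge> 2\<close>, at least half of
  the sample consists of admissible starting points, so \<open>N\<close> may replace
  \<open>n\<close>.\<close>

lemma bandwidth_asymptotics:
  fixes n b k :: "nat \<Rightarrow> nat"
  assumes nkb: "\<And>j. n j = k j * b j" and k: "\<And>j. 0 < k j" and b: "\<And>j. 1 \<le> b j \<and> b j < n j"
    and lim: "(\<lambda>j. 1 / real (b j) + real (b j) / sqrt (real (n j))) \<longlonglongrightarrow> 0"
  shows "filterlim b at_top sequentially" "(\<lambda>j. real (b j) / real (k j)) \<longlonglongrightarrow> 0"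
    "(\<lambda>j. (real (b j))\<^sup>2 / real (n j - b j + 1)) \<longlonglongrightarrow> 0"
proof -
  have "(\<lambda>j. 1 / real (b j)) \<longlonglongrightarrow> 0"
    by (rule Lim_null_comparison[OF _ lim], rule always_eventually) simp
  then have "(\<lambda>j. inverse (real (b j))) \<longlonglongrightarrow> 0" by (simp only: inverse_eq_divide)
  moreover have "\<forall>\<^sub>F j in sequentially. 0 < inverse (real (b j))"
    by (rule always_eventually, rule allI) (use b in \<open>simp add: Suc_le_eq\<close>)
  ultimately have "filterlim (\<lambda>j. inverse (inverse (real (b j)))) at_top sequentially"
    by (rule filterlim_inverse_at_top)
  then show "filterlim b at_top sequentially" by (simp add: filterlim_sequentially_iff_filterlim_real)
  have "(\<lambda>j. real (b j) / sqrt (real (n j))) \<longlonglongrightarrow> 0"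
    by (rule Lim_null_comparison[OF _ lim], rule always_eventually) simp
  from tendsto_power[OF this, of 2] have sq: "(\<lambda>j. (real (b j))\<^sup>2 / real (n j)) \<longlonglongrightarrow> 0"
    by (simp add: power_divide)
  have "(real (b j))\<^sup>2 / real (n j) = real (b j) / real (k j)" for j
    using b[of j] k[of j] unfolding nkb by (simp add: power2_eq_square)
  with sq show "(\<lambda>j. real (b j) / real (k j)) \<longlonglongrightarrow> 0" by simp
  from tendsto_mult_left[OF sq, of 2] have sq2: "(\<lambda>j. 2 * ((real (b j))\<^sup>2 / real (n j))) \<longlonglongrightarrow> 0" by simp
  show "(\<lambda>j. (real (b j))\<^sup>2 / real (n j - b j + 1)) \<longlonglongrightarrow> 0"
  proof (rule Lim_null_comparison[OF _ sq2], rule always_eventually, rule allI)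
    fix j
    have "k j \<noteq> 1" using b[of j] nkb[of j] by auto
    then have "2 * b j \<le> n j" unfolding nkb using k[of j] by (intro mult_right_mono) auto
    then have "n j \<le> 2 * (n j - b j + 1)" by arith
    then have "real (n j) \<le> real (2 * (n j - b j + 1))" by (rule of_nat_mono)
    then have "real (n j) \<le> 2 * real (n j - b j + 1)" by simp
    moreover have "0 < real (n j)" using b[of j] by linarith
    ultimately have "(real (b j))\<^sup>2 / real (n j - b j + 1) \<le> (real (b j))\<^sup>2 / (real (n j) / 2)"
      by (intro divide_left_mono) auto
    then show "norm ((real (b j))\<^sup>2 / real (n j - b j + 1)) \<le> 2 * ((real (b j))\<^sup>2 / real (n j))" by (simp add: mult.commute)
  qed
qed

theorem theorem2p2:
  fixes M :: "'w measure"
    and Y :: "int \<Rightarrow> 'w \<Rightarrow> L2"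
    and f :: "(nat \<Rightarrow> L2) \<Rightarrow> L2"
    and \<delta> :: "int \<Rightarrow> 'w \<Rightarrow> L2"
    and \<delta>' :: "nat \<Rightarrow> int \<Rightarrow> int \<Rightarrow> 'w \<Rightarrow> L2"
    and w :: "real \<Rightarrow> real"
    and n b k :: "nat \<Rightarrow> nat"
    and I :: "nat \<Rightarrow> nat \<Rightarrow> 'w \<Rightarrow> nat"
    and K L :: "nat \<Rightarrow> 'w \<Rightarrow> L2 measure"
    and d :: "L2 measure \<Rightarrow> L2 measure \<Rightarrow> real"
    and e :: "nat \<Rightarrow> L2"
  assumes "prob_space M"
    and "\<And>t. Y t \<in> borel_measurable M"
    and "strictly_stationary M Y"
    and "\<And>t. (\<integral>\<omega>. Y t \<omega> \<partial>M) = 0"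
    and "L2_m_approximable M Y f \<delta> \<delta>'"
    and "\<And>t. (\<lambda>m. real m * approx_error M Y f \<delta> \<delta>' t m) \<longlonglongrightarrow> 0"
    and "tapering_window w"
    and "filterlim n at_top sequentially"
    and "\<And>j. n j = k j * b j"
    and "\<And>j. 0 < k j"
    and "\<And>j. 1 \<le> b j \<and> b j < n j"
    and "(\<lambda>j. 1 / real (b j) + real (b j) / sqrt (real (n j))) \<longlonglongrightarrow> 0"
    and "\<And>j. tbb_indices M Y (n j) (b j) (k j) (I j)"
    and "\<And>j. is_cond_law M (data_algebra M Y (n j)) (tbb_mean w (n j) (b j) Y (I j)) (K j)"
    and "\<And>j. is_cond_law M (data_algebra M Y (n j))
               (\<lambda>\<omega>. sqrt (real (n j)) *\<^sub>R (tbb_mean w (n j) (b j) Y (I j) \<omega> - law_mean (K j \<omega>))) (L j)"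
    and "metrizes_weak_convergence d"
    and "orthonormal_basis e"
  shows "tendsto_0_in_prob M
           (\<lambda>j \<omega>. d (L j \<omega>) (distr M borel (\<lambda>\<omega>'. sqrt (real (n j)) *\<^sub>R Y_mean Y (n j) \<omega>'))) \<and>
         tendsto_0_in_prob M
           (\<lambda>j \<omega>. hs_norm e (\<lambda>h.
              real (n j) *\<^sub>R op_expectation (K j \<omega>)
                (\<lambda>x. tensor (x - law_mean (K j \<omega>)) (x - law_mean (K j \<omega>))) h
              - real (n j) *\<^sub>R op_expectation M
                (\<lambda>\<omega>'. tensor (Y_mean Y (n j) \<omega>') (Y_mean Y (n j) \<omega>')) h))"
proof -
  note M = assms(1) and Ym = assms(2) and n_lim = assms(8) and nkb = assms(9) and k = assms(10) and b = assms(11)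
    and ind = assms(13) and Kc = assms(14) and Lc = assms(15)
  interpret prob_space M by (rule M)
  note approx = assms(5)[unfolded L2_m_approximable_def]
  interpret Sh: shift_process M f \<delta> \<delta>' by unfold_locales (use approx in blast)+
  \<comment> \<open>The representation holds for each time up to a null set. Countably many times
    allow one common null set, and from here on \<open>Sh.X\<close> stands in for
    \<open>Y\<close>.\<close>
  have YX: "AE \<omega> in M. \<forall>t. Y t \<omega> = Sh.X t \<omega>"
    unfolding AE_all_countable Sh.X_def using approx by blast
  have YX': "AE \<omega> in M. Y t \<omega> = Sh.X t \<omega>" for t using YX by eventually_elim simp
  have "integrable M (\<lambda>\<omega>. (norm (Y 0 \<omega>))\<^sup>2)" using approx by blast
  moreover have "integrable M (\<lambda>\<omega>. (norm (Y 0 \<omega>))\<^sup>2) \<longleftrightarrow> integrable M (\<lambda>\<omega>. (norm (Sh.X 0 \<omega>))\<^sup>2)"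
  proof (rule integrable_cong_AE)
    show "AE \<omega> in M. (norm (Y 0 \<omega>))\<^sup>2 = (norm (Sh.X 0 \<omega>))\<^sup>2" using YX'[of 0] by eventually_elim simp
  qed (use Ym[of 0] in measurable)
  ultimately have sq0: "sq_int M (Sh.X 0)" by (simp add: sq_int_def)
  have mean0: "(\<integral>\<omega>. Sh.X 0 \<omega> \<partial>M) = 0"
    unfolding assms(4)[of 0, symmetric] by (rule integral_cong_AE) (use Ym[of 0] YX'[of 0] in auto)
  have err: "approx_error M Y f \<delta> \<delta>' 0 m = Sh.err m" if "1 \<le> m" for m
    unfolding approx_error_def Sh.err_def rms_def
  proof (rule arg_cong[where f=sqrt], rule integral_cong_AE)
    note [measurable] = Ym[of 0] Sh.meas_C[OF that, of 0]
    show "(\<lambda>\<omega>. (norm (Y 0 \<omega> - Sh.C 0 m \<omega>))\<^sup>2) \<in> borel_measurable M" by measurable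
    show "(\<lambda>\<omega>. (norm (Sh.X 0 \<omega> - Sh.C 0 m \<omega>))\<^sup>2) \<in> borel_measurable M" by measurable
    show "AE \<omega> in M. (norm (Y 0 \<omega> - Sh.C 0 m \<omega>))\<^sup>2 = (norm (Sh.X 0 \<omega> - Sh.C 0 m \<omega>))\<^sup>2"
      using YX'[of 0] by eventually_elim simp
  qed
  have "summable (\<lambda>m. approx_error M Y f \<delta> \<delta>' 0 (Suc m))" using approx by blast
  then have sum: "summable (\<lambda>m. Sh.err (Suc m))" by (simp add: err)
  \<comment> \<open>At \<open>m = 0\<close> the two errors are not compared; the factor
    \<open>m\<close> makes both sides zero.\<close>
  have "real m * approx_error M Y f \<delta> \<delta>' 0 m = real m * Sh.err m" for m by (cases m) (simp_all add: err)
  with assms(6)[of 0] have rate: "(\<lambda>m. real m * Sh.err m) \<longlonglongrightarrow> 0" by simp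
  define \<nu> where "\<nu> h = (if h = 0 then rms M (Sh.X 0) else Sh.err h)" for h
  interpret W: weak_dep M "\<lambda>t. Sh.X (int t)" \<nu>
    unfolding \<nu>_def[abs_def] by (rule Sh.weak_dep_shift_process[OF sq0 mean0 sum rate])
  note bw = bandwidth_asymptotics[OF nkb k b assms(12)]
  note ta = taper_weights_asymptotics[OF assms(7) bw(1)]
  \<comment> \<open>For small block sizes the taper may vanish at all sample points; any normalised weights do there.\<close>
  define a where "a j = (if 0 < taper_norm w (b j) then taper_weights w (b j) else (\<lambda>i. if i = 1 then 1 else 0))" for j
  define N where "N j = n j - b j + 1" for j
  have a: "norm_weights (b j) (a j)" for j
  proof (cases "0 < taper_norm w (b j)")
    case False
    have "(\<Sum>i=1..b j. (if i = 1 then 1 else 0 :: real)\<^sup>2) = (\<Sum>i=1..b j. if i = 1 then 1 else 0)" by (intro sum.cong) auto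
    also have "\<dots> = 1" using b[of j] by simp
    finally show ?thesis using False b[of j] by (simp add: a_def norm_weights_def)
  qed (simp add: a_def taper_weights_norm)
  have rough: "(\<lambda>j. roughness (b j) (a j)) \<longlonglongrightarrow> 0"
  proof (rule Lim_transform_eventually[OF ta(2)])
    show "\<forall>\<^sub>F j in sequentially. roughness (b j) (taper_weights w (b j)) = roughness (b j) (a j)"
      using ta(1) by eventually_elim (simp add: a_def)
  qed
  interpret B: boot_basis M "\<lambda>t. Sh.X (int t)" \<nu> a b k N e
    by unfold_locales (use a rough k bw assms(17) in \<open>simp_all add: N_def\<close>)
  \<comment> \<open>\<open>K\<close> is identified before \<open>L\<close>, because \<open>L\<close>
    is centred by the mean of \<open>K\<close>. A positive taper norm, which holds eventually, makes
    the abstract weights \<open>a j\<close> the taper weights.\<close>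
  have laws: "AE \<omega> in M. L j \<omega> = B.boot_law j \<omega> \<and>
      (\<forall>h. real (n j) *\<^sub>R op_expectation (K j \<omega>) (\<lambda>x. tensor (x - law_mean (K j \<omega>)) (x - law_mean (K j \<omega>))) h
        = op_expectation (B.boot_law j \<omega>) (\<lambda>x. tensor x x) h)"
    if pos: "0 < taper_norm w (b j)" for j
  proof -
    let ?p = "measure_pmf (start_pmf (k j) (n j - b j + 1))" and ?R = "resample_mean w (n j) (b j) Y"
    have b1: "1 \<le> b j" using b by blast
    have "AE \<omega> in M. K j \<omega> = distr ?p borel (\<lambda>J. ?R J \<omega>)"
      by (rule cond_law_start[OF ind k Ym Kc]) (rule measurable_resample_mean, rule tbb_mean_eq_resample_mean[OF nkb b1])
    moreover have "AE \<omega> in M. L j \<omega> = distr ?p borel (\<lambda>J. sqrt (real (n j)) *\<^sub>R (?R J \<omega> - law_mean (K j \<omega>)))"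
    proof (rule cond_law_start[OF ind k Ym Lc])
      have "K j \<in> measurable (data_algebra M Y (n j)) (prob_algebra borel)" using Kc[of j] by (simp add: is_cond_law_def)
      then have "(\<lambda>\<omega>. law_mean (K j \<omega>)) \<in> borel_measurable (data_algebra M Y (n j))"
        unfolding law_mean_def by (rule measurable_compose[OF measurable_prob_algebraD]) (rule integral_measurable_subprob_algebra, simp)
      then show "(\<lambda>\<omega>. sqrt (real (n j)) *\<^sub>R (?R J \<omega> - law_mean (K j \<omega>))) \<in> borel_measurable (data_algebra M Y (n j))" for J
        by (intro borel_measurable_scaleR borel_measurable_const borel_measurable_diff measurable_resample_mean)
    qed (simp add: tbb_mean_eq_resample_mean[OF nkb b1])
    ultimately show ?thesis using YX
    proof eventually_elim
      case (elim \<omega>)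
      have "blk (b j) (taper_weights w (b j)) (\<lambda>t. Y (int t)) t \<omega> = B.V j t \<omega>" for t
        using pos elim(3) by (simp add: blk_def a_def)
      then have "B.boot_law j \<omega> = distr ?p borel (star (k j) (n j - b j + 1) (\<lambda>t. blk (b j) (taper_weights w (b j)) (\<lambda>t. Y (int t)) t \<omega>))"
        by (simp add: B.boot_law_def B.Vs_def N_def)
      then show ?case
        using resampled_laws[OF nkb b1 k elim(1)] elim(2) by simp
    qed
  qed
  \<comment> \<open>Only an almost sure identity, since \<open>Y\<close> and \<open>Sh.X\<close> may
    differ on a null set; it is enough for equality of laws.\<close>
  have mean_S: "AE \<omega> in M. sqrt (real (n j)) *\<^sub>R Y_mean Y (n j) \<omega> = W.S (n j) \<omega>" for j
    using YX
  proof eventually_elim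
    case (elim \<omega>)
    have "sqrt (real (n j)) * (1 / real (n j)) = 1 / sqrt (real (n j))" using b[of j] by (simp add: field_simps)
    then show ?case using elim
      by (simp add: Y_mean_def sample_mean_def sample_def W.S_def scaleR_sum_right[symmetric])
  qed
  have Y_mean_meas [measurable]: "Y_mean Y m \<in> borel_measurable M" for m
    unfolding Y_mean_def[abs_def] sample_mean_def
    by (intro borel_measurable_scaleR borel_measurable_const borel_measurable_sum
        measurable_from_subalg[OF subalgebra_data[where n=m, OF Ym] measurable_sample_component])
  have S_meas [measurable]: "W.S m \<in> borel_measurable M" for m by (rule sq_intD(1)[OF W.sq_int_S])
  have S_law: "distr M borel (\<lambda>\<omega>'. sqrt (real (n j)) *\<^sub>R Y_mean Y (n j) \<omega>') = B.S_law (n j)" for j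
    unfolding B.S_law_def by (rule distr_cong_AE) (use mean_S in auto)
  have S_op: "real (n j) *\<^sub>R op_expectation M (\<lambda>\<omega>'. tensor (Y_mean Y (n j) \<omega>') (Y_mean Y (n j) \<omega>')) h
      = op_expectation (B.S_law (n j)) (\<lambda>x. tensor x x) h" for j h
  proof -
    have "op_expectation (B.S_law (n j)) (\<lambda>x. tensor x x) h
        = (\<integral>\<omega>. inner (sqrt (real (n j)) *\<^sub>R Y_mean Y (n j) \<omega>) h *\<^sub>R (sqrt (real (n j)) *\<^sub>R Y_mean Y (n j) \<omega>) \<partial>M)"
      unfolding op_expectation_def tensor_def S_law[symmetric] by (rule integral_distr) auto
    also have "\<dots> = (\<integral>\<omega>. real (n j) *\<^sub>R (inner (Y_mean Y (n j) \<omega>) h *\<^sub>R Y_mean Y (n j) \<omega>) \<partial>M)"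
      by (intro Bochner_Integration.integral_cong refl) (simp add: mult_ac)
    also have "\<dots> = real (n j) *\<^sub>R (\<integral>\<omega>. inner (Y_mean Y (n j) \<omega>) h *\<^sub>R Y_mean Y (n j) \<omega> \<partial>M)"
      by (rule integral_scaleR_right)
    finally show ?thesis unfolding op_expectation_def tensor_def ..
  qed
  show ?thesis
  proof (intro conjI)
    show "tendsto_0_in_prob M (\<lambda>j \<omega>. d (L j \<omega>) (distr M borel (\<lambda>\<omega>'. sqrt (real (n j)) *\<^sub>R Y_mean Y (n j) \<omega>')))"
      unfolding S_law
    proof (rule tendsto_0_in_prob_cong_AE[OF M B.boot_law_dist_tendsto[OF assms(16) n_lim]])
      show "\<forall>\<^sub>F j in sequentially. AE \<omega> in M. d (L j \<omega>) (B.S_law (n j)) = d (B.boot_law j \<omega>) (B.S_law (n j))"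
        using ta(1)
      proof eventually_elim
        case (elim j)
        from laws[OF elim] show ?case by eventually_elim simp
      qed
    qed
    show "tendsto_0_in_prob M (\<lambda>j \<omega>. hs_norm e (\<lambda>h.
        real (n j) *\<^sub>R op_expectation (K j \<omega>) (\<lambda>x. tensor (x - law_mean (K j \<omega>)) (x - law_mean (K j \<omega>))) h
        - real (n j) *\<^sub>R op_expectation M (\<lambda>\<omega>'. tensor (Y_mean Y (n j) \<omega>') (Y_mean Y (n j) \<omega>')) h))"
      unfolding S_op
    proof (rule tendsto_0_in_prob_cong_AE[OF M B.boot_law_hs_tendsto[OF n_lim]])
      show "\<forall>\<^sub>F j in sequentially. AE \<omega> in M. hs_norm e (\<lambda>h.
          real (n j) *\<^sub>R op_expectation (K j \<omega>) (\<lambda>x. tensor (x - law_mean (K j \<omega>)) (x - law_mean (K j \<omega>))) h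
          - op_expectation (B.S_law (n j)) (\<lambda>x. tensor x x) h)
        = hs_norm e (\<lambda>h. op_expectation (B.boot_law j \<omega>) (\<lambda>x. tensor x x) h - op_expectation (B.S_law (n j)) (\<lambda>x. tensor x x) h)"
        using ta(1)
      proof eventually_elim
        case (elim j)
        from laws[OF elim] show ?case by eventually_elim simp
      qed
    qed
  qed
qed

end
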